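(* There is a polynomial-time $\Omega\left(\frac{1}{k_{in}+k_{out}}\right)$-approximation algorithm for weighted stochastic probing when the inner constraint $\mathcal{I}_{in}$ is an intersection of $k_{in}$ matroids and the outer constraint $\mathcal{I}_{out}$ is an intersection of $k_{out}$ matroids on $V$; that is, there is a universal constant $c>0$ such that the algorithm's expected chosen weight is at least $\frac{c}{k_{in}+k_{out}}$ times the optimal expected weight of any adaptive policy. Moreover, there is an $\Omega\left(\frac{1}{(k_{in}+k_{out})^2}\right)$-approximation algorithm when $\mathcal{I}_{in}$ and $\mathcal{I}_{out}$ are arbitrary $k_{in}$-system and $k_{out}$-system constraints.
   Context: Stochastic probing problem: $V$ is a finite universe; each $e\in V$ has a weight $w_e\ge 0$ and a probability $p_e\in[0,1]$, and is active independently of all other elements with probability $p_e$. $\mathcal{I}_{in},\mathcal{I}_{out}\subseteq 2^V$ are downward-closed families (inner and outer packing constraints), accessed via independence oracles. A policy probes elements one at a time, possibly adaptively; if $Q$ is the set probed so far and $S$ the set chosen so far (initially both empty), it may probe $e\in V\setminus Q$ only if $Q\cup\{e\}\in\mathcal{I}_{out}$ and $S\cup\{e\}\in\mathcal{I}_{in}$. After probing, $e$ is added to $Q$, and if $e$ is active it is irrevocably added to $S$. The goal is to maximize $\mathbb{E}[\sum_{e\in S}w_e]$. A $k$-system is a downward-closed $\mathcal{I}\subseteq 2^V$ such that for every $A\subseteq V$, every maximal independent subset of $A$ has size at least $\frac1k$ times the size of a maximum independent subset of $A$. *)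

theory Defs
  imports
    "HOL-Probability.Product_PMF"
    "HOL-Computational_Algebra.Polynomial"
    "HOL-Library.Log_Nat"
begin

section \<open>Packing constraints\<close>

definition downward_closed :: "'a set \<Rightarrow> 'a set set \<Rightarrow> bool" where
  "downward_closed V \<I> \<longleftrightarrow> \<I> \<subseteq> Pow V \<and> (\<forall>A\<in>\<I>. \<forall>B. B \<subseteq> A \<longrightarrow> B \<in> \<I>)"

definition matroid :: "'a set \<Rightarrow> 'a set set \<Rightarrow> bool" where
  "matroid V \<I> \<longleftrightarrow> finite V \<and> downward_closed V \<I> \<and> {} \<in> \<I> \<and>
     (\<forall>A\<in>\<I>. \<forall>B\<in>\<I>. card A < card B \<longrightarrow> (\<exists>e\<in>B - A. insert e A \<in> \<I>))"

definition maximal_indep_subset :: "'a set set \<Rightarrow> 'a set \<Rightarrow> 'a set \<Rightarrow> bool" where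
  "maximal_indep_subset \<I> A B \<longleftrightarrow> B \<in> \<I> \<and> B \<subseteq> A \<and> (\<forall>B'\<in>\<I>. B \<subseteq> B' \<and> B' \<subseteq> A \<longrightarrow> B' = B)"

definition maximum_indep_subset :: "'a set set \<Rightarrow> 'a set \<Rightarrow> 'a set \<Rightarrow> bool" where
  "maximum_indep_subset \<I> A J \<longleftrightarrow> J \<in> \<I> \<and> J \<subseteq> A \<and> (\<forall>J'\<in>\<I>. J' \<subseteq> A \<longrightarrow> card J' \<le> card J)"

definition k_system :: "'a set \<Rightarrow> nat \<Rightarrow> 'a set set \<Rightarrow> bool" where
  "k_system V k \<I> \<longleftrightarrow> finite V \<and> 1 \<le> k \<and> downward_closed V \<I> \<and>
     (\<forall>A\<subseteq>V. \<forall>B J. maximal_indep_subset \<I> A B \<and> maximum_indep_subset \<I> A J \<longrightarrow>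
        real (card B) \<ge> 1 / real k * real (card J))"


section \<open>Stochastic probing\<close>

text \<open>
  The universe is \<open>{..<univ_size I}\<close>. Weights and probabilities are rational so that an instance
  has a bit length. Each side of the constraints is a list of families, each with its own
  independence oracle; the constraint itself is the intersection of the list.
\<close>

record probing =
  univ_size :: nat
  weight :: "nat \<Rightarrow> rat"
  act_prob :: "nat \<Rightarrow> rat"
  inner_fams :: "nat set set list"
  outer_fams :: "nat set set list"

abbreviation ground :: "probing \<Rightarrow> nat set" where
  "ground I \<equiv> {..<univ_size I}"

definition inner_constraint :: "probing \<Rightarrow> nat set set" where
  "inner_constraint I = {A. A \<subseteq> ground I \<and> (\<forall>\<I>\<in>set (inner_fams I). A \<in> \<I>)}"

definition outer_constraint :: "probing \<Rightarrow> nat set set" where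
  "outer_constraint I = {A. A \<subseteq> ground I \<and> (\<forall>\<I>\<in>set (outer_fams I). A \<in> \<I>)}"

definition valid_numbers :: "probing \<Rightarrow> bool" where
  "valid_numbers I \<longleftrightarrow> (\<forall>e\<in>ground I. 0 \<le> weight I e \<and> 0 \<le> act_prob I e \<and> act_prob I e \<le> 1)"

definition reward :: "probing \<Rightarrow> nat set \<Rightarrow> real" where
  "reward I S = (\<Sum>e\<in>S. real_of_rat (weight I e))"

definition activation :: "probing \<Rightarrow> (nat \<Rightarrow> bool) pmf" where
  "activation I = Pi_pmf (ground I) False (\<lambda>e. bernoulli_pmf (real_of_rat (act_prob I e)))"

definition may_probe :: "probing \<Rightarrow> nat set \<Rightarrow> nat set \<Rightarrow> nat \<Rightarrow> bool" where
  "may_probe I Q S e \<longleftrightarrow>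
     e \<in> ground I - Q \<and> insert e Q \<in> outer_constraint I \<and> insert e S \<in> inner_constraint I"

text \<open>
  An adaptive policy is a decision tree; in \<open>Probe_Then e l r\<close> the subtree \<open>l\<close> is followed if \<open>e\<close>
  turns out to be active and \<open>r\<close> otherwise.
\<close>

datatype policy = Stop | Probe_Then nat policy policy

fun feasible_from :: "probing \<Rightarrow> nat set \<Rightarrow> nat set \<Rightarrow> policy \<Rightarrow> bool" where
  "feasible_from I Q S Stop \<longleftrightarrow> True"
| "feasible_from I Q S (Probe_Then e l r) \<longleftrightarrow>
     may_probe I Q S e \<and>
     feasible_from I (insert e Q) (insert e S) l \<and> feasible_from I (insert e Q) S r"

definition feasible :: "probing \<Rightarrow> policy \<Rightarrow> bool" where
  "feasible I \<pi> \<longleftrightarrow> feasible_from I {} {} \<pi>"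

fun chosen_by :: "policy \<Rightarrow> (nat \<Rightarrow> bool) \<Rightarrow> nat set" where
  "chosen_by Stop X = {}"
| "chosen_by (Probe_Then e l r) X = (if X e then insert e (chosen_by l X) else chosen_by r X)"

definition policy_value :: "probing \<Rightarrow> policy \<Rightarrow> real" where
  "policy_value I \<pi> = measure_pmf.expectation (activation I) (\<lambda>X. reward I (chosen_by \<pi> X))"


section \<open>Randomized oracle programs with logarithmic cost\<close>

text \<open>
  Programs work on arrays of rationals, addressed by a name and an index. As in the
  logarithmic-cost RAM, evaluating an expression costs the total bit length of the values of all
  its subexpressions, so that programs of polynomial cost are those running in polynomial time on
  a probabilistic oracle Turing machine. Besides computing, a program can flip a fair coin, query
  the independence oracles, and probe an element.
\<close>

type_synonym memory = "string \<Rightarrow> nat \<Rightarrow> rat"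

definition bits :: "rat \<Rightarrow> nat" where
  "bits r = nat (bitlen \<bar>fst (quotient_of r)\<bar> + bitlen (snd (quotient_of r)))"

definition to_nat_idx :: "rat \<Rightarrow> nat" where
  "to_nat_idx r = nat \<lfloor>r\<rfloor>"

datatype aexp =
    Num rat
  | Elem string aexp
  | Add aexp aexp
  | Sub aexp aexp
  | Mul aexp aexp
  | Quot aexp aexp
  | Floor aexp

fun aval :: "aexp \<Rightarrow> memory \<Rightarrow> rat" where
  "aval (Num r) m = r"
| "aval (Elem x a) m = m x (to_nat_idx (aval a m))"
| "aval (Add a b) m = aval a m + aval b m"
| "aval (Sub a b) m = aval a m - aval b m"
| "aval (Mul a b) m = aval a m * aval b m"
| "aval (Quot a b) m = aval a m / aval b m"
| "aval (Floor a) m = of_int \<lfloor>aval a m\<rfloor>"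

fun acost :: "aexp \<Rightarrow> memory \<Rightarrow> nat" where
  "acost (Num r) m = bits r"
| "acost (Elem x a) m = acost a m + bits (aval (Elem x a) m)"
| "acost (Add a b) m = acost a m + acost b m + bits (aval (Add a b) m)"
| "acost (Sub a b) m = acost a m + acost b m + bits (aval (Sub a b) m)"
| "acost (Mul a b) m = acost a m + acost b m + bits (aval (Mul a b) m)"
| "acost (Quot a b) m = acost a m + acost b m + bits (aval (Quot a b) m)"
| "acost (Floor a) m = acost a m + bits (aval (Floor a) m)"

datatype bexp = Less aexp aexp | Neg bexp | Conj bexp bexp

fun bval :: "bexp \<Rightarrow> memory \<Rightarrow> bool" where
  "bval (Less a b) m \<longleftrightarrow> aval a m < aval b m"
| "bval (Neg b) m \<longleftrightarrow> \<not> bval b m"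
| "bval (Conj b c) m \<longleftrightarrow> bval b m \<and> bval c m"

fun bcost :: "bexp \<Rightarrow> memory \<Rightarrow> nat" where
  "bcost (Less a b) m = 1 + acost a m + acost b m"
| "bcost (Neg b) m = 1 + bcost b m"
| "bcost (Conj b c) m = 1 + bcost b m + bcost c m"

datatype com =
    Skip
  | Assign string aexp aexp         \<comment> \<open>\<open>x[a] := b\<close>\<close>
  | Seq com com
  | If bexp com com
  | While bexp com
  | Flip string                     \<comment> \<open>\<open>x[0] :=\<close> fair coin\<close>
  | Query_Inner string aexp string  \<comment> \<open>\<open>x[0] :=\<close> is the set with indicator \<open>y\<close> in inner family \<open>a\<close>?\<close>
  | Query_Outer string aexp string
  | Probe string aexp               \<comment> \<open>\<open>x[0] :=\<close> is the element \<open>a\<close>, now probed, active?\<close>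

record state =
  mem :: memory
  coins_used :: nat
  probed :: "nat set"
  chosen :: "nat set"

definition store :: "string \<Rightarrow> nat \<Rightarrow> rat \<Rightarrow> state \<Rightarrow> state" where
  "store x i r s = s\<lparr>mem := (mem s)(x := (mem s x)(i := r))\<rparr>"

definition coded_set :: "probing \<Rightarrow> string \<Rightarrow> memory \<Rightarrow> nat set" where
  "coded_set I y m = {e \<in> ground I. m y e \<noteq> 0}"

definition coded_cost :: "probing \<Rightarrow> string \<Rightarrow> memory \<Rightarrow> nat" where
  "coded_cost I y m = (\<Sum>e\<in>ground I. bits (m y e))"

definition oracle_answer :: "nat set set list \<Rightarrow> nat \<Rightarrow> nat set \<Rightarrow> bool" where
  "oracle_answer \<I>s i A \<longleftrightarrow> i < length \<I>s \<and> A \<in> \<I>s ! i"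

text \<open>
  \<open>exec I X \<omega> c s t s'\<close>: on instance \<open>I\<close> with active elements \<open>X\<close> and coin tape \<open>\<omega>\<close>, running \<open>c\<close> from
  \<open>s\<close> ends in \<open>s'\<close> at cost \<open>t\<close>. There is no rule for a forbidden probe, so a run that attempts one
  does not end in any state. The program sees \<open>X\<close> only through \<open>Probe\<close>.
\<close>

inductive exec :: "probing \<Rightarrow> (nat \<Rightarrow> bool) \<Rightarrow> (nat \<Rightarrow> bool) \<Rightarrow> com \<Rightarrow> state \<Rightarrow> nat \<Rightarrow> state \<Rightarrow> bool"
  for I :: probing and X \<omega> :: "nat \<Rightarrow> bool"
where
  Skip: "exec I X \<omega> Skip s 1 s"
| Assign: "exec I X \<omega> (Assign x a b) s (1 + acost a (mem s) + acost b (mem s))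
     (store x (to_nat_idx (aval a (mem s))) (aval b (mem s)) s)"
| Seq: "exec I X \<omega> c s t s' \<Longrightarrow> exec I X \<omega> d s' t' s'' \<Longrightarrow> exec I X \<omega> (Seq c d) s (1 + t + t') s''"
| IfTrue: "bval b (mem s) \<Longrightarrow> exec I X \<omega> c s t s' \<Longrightarrow>
     exec I X \<omega> (If b c d) s (1 + bcost b (mem s) + t) s'"
| IfFalse: "\<not> bval b (mem s) \<Longrightarrow> exec I X \<omega> d s t s' \<Longrightarrow>
     exec I X \<omega> (If b c d) s (1 + bcost b (mem s) + t) s'"
| WhileFalse: "\<not> bval b (mem s) \<Longrightarrow> exec I X \<omega> (While b c) s (1 + bcost b (mem s)) s"
| WhileTrue: "bval b (mem s) \<Longrightarrow> exec I X \<omega> c s t s' \<Longrightarrow> exec I X \<omega> (While b c) s' t' s'' \<Longrightarrow>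
     exec I X \<omega> (While b c) s (1 + bcost b (mem s) + t + t') s''"
| Flip: "exec I X \<omega> (Flip x) s 1
     ((store x 0 (of_bool (\<omega> (coins_used s))) s)\<lparr>coins_used := coins_used s + 1\<rparr>)"
| Query_Inner: "exec I X \<omega> (Query_Inner x a y) s (1 + acost a (mem s) + coded_cost I y (mem s))
     (store x 0 (of_bool (oracle_answer (inner_fams I) (to_nat_idx (aval a (mem s)))
        (coded_set I y (mem s)))) s)"
| Query_Outer: "exec I X \<omega> (Query_Outer x a y) s (1 + acost a (mem s) + coded_cost I y (mem s))
     (store x 0 (of_bool (oracle_answer (outer_fams I) (to_nat_idx (aval a (mem s)))
        (coded_set I y (mem s)))) s)"
| Probe: "e = to_nat_idx (aval a (mem s)) \<Longrightarrow> may_probe I (probed s) (chosen s) e \<Longrightarrow>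
     exec I X \<omega> (Probe x a) s (1 + acost a (mem s))
     ((store x 0 (of_bool (X e)) s)\<lparr>probed := insert e (probed s),
        chosen := (if X e then insert e (chosen s) else chosen s)\<rparr>)"

inductive_cases exec_basicE:
  "exec I X \<omega> Skip s t s'" "exec I X \<omega> (Assign x a b) s t s'" "exec I X \<omega> (Flip x) s t s'"
  "exec I X \<omega> (Query_Inner x a y) s t s'" "exec I X \<omega> (Query_Outer x a y) s t s'"
  "exec I X \<omega> (Probe x a) s t s'"
inductive_cases exec_SeqE: "exec I X \<omega> (Seq c d) s t s'"
inductive_cases exec_IfE: "exec I X \<omega> (If b c d) s t s'"
inductive_cases exec_WhileE: "exec I X \<omega> (While b c) s t s'"

lemma exec_deterministic:
  assumes "exec I X \<omega> c s t s'" and "exec I X \<omega> c s u s''"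
  shows "u = t \<and> s'' = s'"
  using assms
proof (induction arbitrary: u s'' rule: exec.induct)
  case (Seq c s t s' d t' s2)
  from Seq.prems show ?case by (rule exec_SeqE) (metis add_Suc plus_1_eq_Suc Seq.IH)
next
  case (IfTrue b s c t s' d)
  from IfTrue.prems show ?case by (rule exec_IfE) (metis add_Suc plus_1_eq_Suc IfTrue.IH IfTrue.hyps(1))+
next
  case (IfFalse b s d t s' c)
  from IfFalse.prems show ?case by (rule exec_IfE) (metis add_Suc plus_1_eq_Suc IfFalse.IH IfFalse.hyps(1))+
next
  case (WhileFalse b s c)
  from WhileFalse.prems show ?case by (rule exec_WhileE) (metis add_Suc plus_1_eq_Suc WhileFalse.hyps)+
next
  case (WhileTrue b s c t s' t' s2)
  from WhileTrue.prems show ?case by (rule exec_WhileE) (metis add_Suc plus_1_eq_Suc WhileTrue.IH WhileTrue.hyps(1))+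
next
  case Skip
  then show ?case by (rule exec_basicE(1)) simp
next
  case Assign
  then show ?case by (rule exec_basicE(2)) simp
next
  case Flip
  then show ?case by (rule exec_basicE(3)) simp
next
  case Query_Inner
  then show ?case by (rule exec_basicE(4)) simp
next
  case Query_Outer
  then show ?case by (rule exec_basicE(5)) simp
next
  case (Probe e a s x)
  from Probe.prems show ?case by (rule exec_basicE(6)) (simp add: Probe.hyps(1))
qed

section \<open>Polynomial-time approximation algorithms\<close>

text \<open>
  \<open>kin\<close> and \<open>kout\<close> are passed as part of the input. For intersections of matroids they are the
  numbers of inner and outer oracles.
\<close>

definition initial_state :: "nat \<Rightarrow> nat \<Rightarrow> probing \<Rightarrow> state" where
  "initial_state kin kout I =
     \<lparr>mem = (\<lambda>x i.
        if x = ''n'' \<and> i = 0 then of_nat (univ_size I)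
        else if x = ''kin'' \<and> i = 0 then of_nat kin
        else if x = ''kout'' \<and> i = 0 then of_nat kout
        else if x = ''w'' \<and> i < univ_size I then weight I i
        else if x = ''p'' \<and> i < univ_size I then act_prob I i
        else 0),
      coins_used = 0, probed = {}, chosen = {}\<rparr>"

definition input_size :: "nat \<Rightarrow> nat \<Rightarrow> probing \<Rightarrow> nat" where
  "input_size kin kout I =
     univ_size I + length (inner_fams I) + length (outer_fams I) +
     bits (of_nat kin) + bits (of_nat kout) +
     (\<Sum>e\<in>ground I. bits (weight I e) + bits (act_prob I e))"

definition runs_within :: "nat \<Rightarrow> com \<Rightarrow> nat \<Rightarrow> nat \<Rightarrow> probing \<Rightarrow>
    ((nat \<Rightarrow> bool) \<Rightarrow> (nat \<Rightarrow> bool) \<Rightarrow> nat set) \<Rightarrow> bool" where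
  "runs_within T P kin kout I out \<longleftrightarrow>
     (\<forall>X \<omega>. \<exists>t s. exec I X \<omega> P (initial_state kin kout I) t s \<and> t \<le> T \<and> chosen s = out X \<omega>)"

text \<open>A run of cost at most \<open>T\<close> reads at most the first \<open>T\<close> coins.\<close>

definition coin_tape :: "nat \<Rightarrow> (nat \<Rightarrow> bool) pmf" where
  "coin_tape T = Pi_pmf {..<T} False (\<lambda>_. bernoulli_pmf (1/2))"

definition expected_reward :: "nat \<Rightarrow> probing \<Rightarrow> ((nat \<Rightarrow> bool) \<Rightarrow> (nat \<Rightarrow> bool) \<Rightarrow> nat set) \<Rightarrow> real" where
  "expected_reward T I out =
     measure_pmf.expectation (pair_pmf (activation I) (coin_tape T)) (\<lambda>(X, \<omega>). reward I (out X \<omega>))"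

definition poly_time_approximation ::
    "com \<Rightarrow> (nat \<Rightarrow> nat \<Rightarrow> probing \<Rightarrow> bool) \<Rightarrow> (nat \<Rightarrow> nat \<Rightarrow> real) \<Rightarrow> bool" where
  "poly_time_approximation P C \<alpha> \<longleftrightarrow>
     (\<exists>q :: nat poly. \<forall>kin kout I. valid_numbers I \<and> C kin kout I \<longrightarrow>
        (let T = poly q (input_size kin kout I) in
         \<exists>out. runs_within T P kin kout I out \<and>
           (\<forall>\<pi>. feasible I \<pi> \<longrightarrow> expected_reward T I out \<ge> \<alpha> kin kout * policy_value I \<pi>)))"

definition matroid_intersections :: "nat \<Rightarrow> nat \<Rightarrow> probing \<Rightarrow> bool" where
  "matroid_intersections kin kout I \<longleftrightarrow>
     length (inner_fams I) = kin \<and> length (outer_fams I) = kout \<and>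
     (\<forall>\<I>\<in>set (inner_fams I) \<union> set (outer_fams I). matroid (ground I) \<I>)"

text \<open>Here each side has a single oracle, for the constraint itself.\<close>

definition k_systems :: "nat \<Rightarrow> nat \<Rightarrow> probing \<Rightarrow> bool" where
  "k_systems kin kout I \<longleftrightarrow>
     (\<exists>\<I>in \<I>out. inner_fams I = [\<I>in] \<and> outer_fams I = [\<I>out] \<and>
        k_system (ground I) kin \<I>in \<and> k_system (ground I) kout \<I>out)"

end

theory Submission
  imports Defs "HOL-Probability.Hoeffding"
begin

text \<open>
  Let \<open>v e = p e * w e\<close>. The algorithm first plans a set \<open>Q\<close> without probing, and then probes \<open>Q\<close>
  by decreasing weight as long as the inner constraint allows it.

  Planning scans the elements once and maintains the list \<open>A\<close> of all accepted elements and the outer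
  independent set \<open>Q \<subseteq> A\<close>. A scanned \<open>f\<close> is rejected if, in at least half of \<open>M\<close> fresh simulations of the
  activations of \<open>A\<close>, it is blocked, that is, depends in some inner family on the greedy set of the
  simulated active elements. Otherwise \<open>f\<close> is accepted if \<open>v f\<close> exceeds twice the total \<open>v\<close> of the
  elements of \<open>Q\<close> that have to leave \<open>Q\<close> for \<open>f\<close>: for each violated outer family, the exchangeable one of
  least \<open>v\<close>.
  For matroids the scan is by decreasing weight. For \<open>k\<close>-systems it is by decreasing \<open>v\<close>, so that no
  element ever leaves \<open>Q\<close>, and an element can be blocked only by elements of its own weight class,
  in which weights differ by a factor of at most 2.

  The analysis compares with the probabilities \<open>x e\<close> that a policy probes \<open>e\<close>, which satisfy
  \<open>\<Sum>f\<in>B. x f \<le> k * card Z\<close> if \<open>Z\<close> is outer independent and blocks \<open>B\<close>, and similarly for \<open>x f * p f\<close>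
  and the inner families. By a layer-cake argument, the values of the elements rejected for
  either reason are charged to the value of \<open>A\<close>; an element blocked with probability \<open>\<beta>\<close> is rejected
  with probability at most \<open>2 * \<beta>\<close> by Markov's inequality. By Hoeffding's inequality, accepted elements
  with \<open>\<beta> > 3/4\<close> are so rare that they are negligible even against a single element, whose value is
  bounded in terms of \<open>A\<close> by the same charging bound, applied to the policy that probes only this
  element. The other elements of \<open>Q\<close> remain selectable with probability at least 1/4.

  Probabilities are rounded up to powers of 1/2, so that simulating an activation takes boundedly many
  coin flips. As the true activations are a random thinning of the simulated ones, this costs only a
  constant factor.
\<close>

section \<open>Set systems\<close>

text \<open>Rejections are charged to the list \<open>A\<close> of all accepted elements and not to
  \<open>Q\<close>: \<open>A\<close> only grows, so the greedy sets and spans met during the scan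
  are dominated by those of the final \<open>A\<close>, while the factor 2 in the exchange test
  keeps the value of \<open>Q\<close> at least half that of \<open>A\<close>. Blocking is judged by
  \<open>A\<close> as well, since its simulated active part contains whatever the probing phase can
  have chosen before. In a matroid a larger set spans more, so an element that is not blocked in the
  simulation is selectable in reality. For \<open>k\<close>-systems this monotonicity fails: two
  greedy sets are only compared by size, class by class, which costs a second factor of the order of
  \<open>k\<close>. This is the square in the second guarantee. Scanning by decreasing
  \<open>v\<close> avoids exchanges there, but without classes a light element of high probability
  could block a heavy one of low probability. Finally, \<open>kin\<close> and \<open>kout\<close>
  are given in binary, so for \<open>k\<close>-systems the number of simulations must not be
  proportional to them; \<open>min k n\<close> takes the place of \<open>k\<close>.\<close>

definition blocking_bound :: "nat \<Rightarrow> 'a set set \<Rightarrow> bool" where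
  "blocking_bound k \<I> \<longleftrightarrow>
     (\<forall>Z\<in>\<I>. \<forall>B\<in>\<I>. (\<forall>f\<in>B - Z. insert f Z \<notin> \<I>) \<longrightarrow> card B \<le> k * card Z)"

lemma blocking_boundD:
  assumes "blocking_bound k \<I>" "Z \<in> \<I>" "B \<in> \<I>" "\<And>f. f \<in> B \<Longrightarrow> f \<notin> Z \<Longrightarrow> insert f Z \<notin> \<I>"
  shows "card B \<le> k * card Z"
  using assms unfolding blocking_bound_def by blast

lemma downward_closedD: "downward_closed V \<I> \<Longrightarrow> A \<in> \<I> \<Longrightarrow> B \<subseteq> A \<Longrightarrow> B \<in> \<I>"
  unfolding downward_closed_def by blast

text \<open>\<open>Z\<close> is maximal in \<open>Z \<union> B\<close>, because a further element
  would come from \<open>B\<close> and be blocked, and a maximum independent subset of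
  \<open>Z \<union> B\<close> has at least \<open>card B\<close> elements. The analysis uses the
  ratio of a \<open>k\<close>-system in this form; \<open>B\<close> is independent because a policy
  only produces independent sets.\<close>

lemma k_system_blocking_bound:
  assumes "k_system V k \<I>"
  shows "blocking_bound k \<I>"
  unfolding blocking_bound_def
proof (intro ballI impI)
  fix Z B assume Z: "Z \<in> \<I>" and B: "B \<in> \<I>" and bl: "\<forall>f\<in>B - Z. insert f Z \<notin> \<I>"
  from assms have fin: "finite V" and k: "1 \<le> k" and dc: "downward_closed V \<I>"
    and *: "\<And>A B J. A \<subseteq> V \<Longrightarrow> maximal_indep_subset \<I> A B \<Longrightarrow> maximum_indep_subset \<I> A J \<Longrightarrow>
        real (card B) \<ge> 1 / real k * real (card J)"
    unfolding k_system_def by auto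
  have sub: "A \<subseteq> V" if "A \<in> \<I>" for A using dc that unfolding downward_closed_def by blast
  have fin\<I>: "finite \<I>" using dc fin unfolding downward_closed_def by (meson finite_Pow_iff finite_subset)
  let ?A = "Z \<union> B"
  have A: "?A \<subseteq> V" using sub Z B by blast
  have max: "maximal_indep_subset \<I> ?A Z"
    unfolding maximal_indep_subset_def
  proof (intro conjI ballI impI)
    fix B' assume B': "B' \<in> \<I>" and "Z \<subseteq> B' \<and> B' \<subseteq> ?A"
    show "B' = Z"
    proof (rule ccontr)
      assume "B' \<noteq> Z"
      then obtain f where "f \<in> B' - Z" using \<open>Z \<subseteq> B' \<and> B' \<subseteq> ?A\<close> by blast
      moreover then have "insert f Z \<in> \<I>"
        using downward_closedD[OF dc B', of "insert f Z"] \<open>Z \<subseteq> B' \<and> B' \<subseteq> ?A\<close> by blast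
      ultimately show False using bl \<open>Z \<subseteq> B' \<and> B' \<subseteq> ?A\<close> by blast
    qed
  qed (use Z in auto)
  obtain J where J: "J \<in> {J\<in>\<I>. J \<subseteq> ?A}" "\<And>J'. J' \<in> {J\<in>\<I>. J \<subseteq> ?A} \<Longrightarrow> card J' \<le> card J"
  proof -
    let ?S = "{J\<in>\<I>. J \<subseteq> ?A}"
    have "finite (card ` ?S)" "card ` ?S \<noteq> {}" using fin\<I> B by auto
    then have "Max (card ` ?S) \<in> card ` ?S" "\<And>J'. J' \<in> ?S \<Longrightarrow> card J' \<le> Max (card ` ?S)"
      using Max_in by auto
    then show ?thesis using that by (metis (no_types, lifting) imageE)
  qed
  have "maximum_indep_subset \<I> ?A J" using J unfolding maximum_indep_subset_def by blast
  from *[OF A max this] have "real (card J) \<le> real k * real (card Z)"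
    using k by (simp add: field_simps)
  moreover have "card B \<le> card J" using J(2)[of B] B by auto
  ultimately show "card B \<le> k * card Z"
    by (metis le_trans of_nat_le_iff of_nat_mult)
qed

lemma matroid_augment:
  assumes "matroid V \<I>" "A \<in> \<I>" "B \<in> \<I>" "card A \<le> card B"
  obtains C where "A \<subseteq> C" "C \<subseteq> A \<union> B" "C \<in> \<I>" "card C = card B"
proof -
  have "\<exists>C. A \<subseteq> C \<and> C \<subseteq> A \<union> B \<and> C \<in> \<I> \<and> card C = card B" using assms(2-)
  proof (induction "card B - card A" arbitrary: A)
    case 0
    then show ?case by (metis Un_upper1 diff_is_0_eq le_antisym order_refl)
  next
    case (Suc d)
    then have "card A < card B" by simp
    with assms(1) Suc.prems obtain e where e: "e \<in> B - A" "insert e A \<in> \<I>"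
      unfolding matroid_def by blast
    have "insert e A \<subseteq> V" "finite V" using assms(1) e unfolding matroid_def downward_closed_def by auto
    then have "finite A" using finite_subset by auto
    then have c: "card (insert e A) = Suc (card A)" using e by simp
    have "\<exists>C. insert e A \<subseteq> C \<and> C \<subseteq> insert e A \<union> B \<and> C \<in> \<I> \<and> card C = card B"
      using Suc.hyps(1)[of "insert e A"] Suc.hyps(2) Suc.prems e c by auto
    then show ?case using e by blast
  qed
  then show ?thesis using that by blast
qed

lemma matroid_dc: "matroid V \<I> \<Longrightarrow> downward_closed V \<I>" "matroid V \<I> \<Longrightarrow> finite V" "matroid V \<I> \<Longrightarrow> {} \<in> \<I>"
  unfolding matroid_def by auto

lemma matroid_indep_finite: "matroid V \<I> \<Longrightarrow> A \<in> \<I> \<Longrightarrow> finite A"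
  unfolding matroid_def downward_closed_def by (meson PowD finite_subset subset_iff)

lemma matroid_blocking_bound:
  assumes "matroid V \<I>"
  shows "blocking_bound 1 \<I>"
  unfolding blocking_bound_def
proof (intro ballI impI, rule ccontr)
  fix Z B assume Z: "Z \<in> \<I>" and B: "B \<in> \<I>" and bl: "\<forall>f\<in>B - Z. insert f Z \<notin> \<I>"
    and "\<not> card B \<le> 1 * card Z"
  then have "card Z < card B" by simp
  with assms Z B bl show False unfolding matroid_def by blast
qed

text \<open>Monotonicity of spans, with \<open>Z\<close> a basis of \<open>T\<close>. If
  \<open>insert f Z\<close> were independent, \<open>S\<close> could be extended from it to an
  independent set of the same size. That set cannot contain \<open>f\<close>, which depends on
  \<open>S\<close>; without \<open>f\<close> it lies in \<open>T\<close> and is larger than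
  \<open>Z\<close>.\<close>

lemma matroid_span_maximal:
  assumes m: "matroid V \<I>" and Z: "Z \<in> \<I>" "Z \<subseteq> T" "\<And>a. a \<in> T \<Longrightarrow> a \<notin> Z \<Longrightarrow> insert a Z \<notin> \<I>"
    and S: "S \<in> \<I>" "S \<subseteq> T" "insert f S \<notin> \<I>" and f: "f \<notin> Z"
  shows "insert f Z \<notin> \<I>"
proof
  assume fZ: "insert f Z \<in> \<I>"
  have kb: "card B \<le> card Z" if "B \<in> \<I>" "B \<subseteq> T" for B
    using blocking_boundD[OF matroid_blocking_bound[OF m] Z(1) that(1)] Z(3) that(2) by auto
  have "card S \<le> card (insert f Z)" using kb[OF S(1,2)] matroid_indep_finite[OF m Z(1)] f by simp
  from matroid_augment[OF m S(1) fZ this] obtain C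
    where C: "S \<subseteq> C" "C \<subseteq> S \<union> insert f Z" "C \<in> \<I>" "card C = card (insert f Z)" by blast
  show False
  proof (cases "f \<in> C")
    case True
    then show False using downward_closedD[OF matroid_dc(1)[OF m] C(3), of "insert f S"] C(1) S(3) by blast
  next
    case False
    then have "C \<subseteq> T" using C(2) S(2) Z(2) by blast
    then show False using kb[OF C(3)] C(4) matroid_indep_finite[OF m Z(1)] f by simp
  qed
qed

text \<open>The elements of \<open>Q\<close> that can make room for \<open>f\<close> form, together
  with \<open>f\<close>, its fundamental circuit. In terms of independent sets: extending an
  independent \<open>insert f Z\<close> by elements of \<open>Q\<close> to the size of
  \<open>Q\<close> would give \<open>insert f (Q - {e})\<close> for some \<open>e\<close> outside
  \<open>Z\<close>.\<close>

lemma matroid_no_exchange: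
  assumes m: "matroid V \<I>" and Q: "Q \<in> \<I>" "insert f Q \<notin> \<I>" and Z: "Z \<subseteq> Q"
    and no: "\<And>e. e \<in> Q - Z \<Longrightarrow> insert f (Q - {e}) \<notin> \<I>"
  shows "insert f Z \<notin> \<I>"
proof
  assume fZ: "insert f Z \<in> \<I>"
  have f: "f \<notin> Q" using Q by (metis insert_absorb)
  have finQ: "finite Q" and finZ: "finite Z" using matroid_indep_finite[OF m Q(1)] Z finite_subset by auto
  have "Z \<noteq> Q" using fZ Q by auto
  then have "card (insert f Z) \<le> card Q" using Z f finQ finZ
    by (metis Suc_leI card_insert_disjoint psubsetI psubset_card_mono subsetD)
  from matroid_augment[OF m fZ Q(1) this] obtain C
    where C: "insert f Z \<subseteq> C" "C \<subseteq> insert f Z \<union> Q" "C \<in> \<I>" "card C = card Q" by blast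
  have C': "C - {f} \<subseteq> Q" using C Z by auto
  have finC: "finite C" using matroid_indep_finite[OF m C(3)] .
  have "card (C - {f}) = card Q - 1" using C finC by (simp add: card_Diff_singleton_if)
  moreover have "card Q > 0" using \<open>Z \<noteq> Q\<close> Z finQ by (auto simp: card_gt_0_iff)
  moreover have "card (Q - (C - {f})) = card Q - card (C - {f})"
    using C' finC by (intro card_Diff_subset) auto
  ultimately have cd: "card (Q - (C - {f})) = 1" by linarith
  then obtain e where e: "Q - (C - {f}) = {e}" by (auto simp: card_1_singleton_iff)
  then have "e \<in> Q - Z" using C(1) f by auto
  moreover have "insert f (Q - {e}) \<subseteq> C" using C(1) e by blast
  then have "insert f (Q - {e}) \<in> \<I>" using downward_closedD[OF matroid_dc(1)[OF m] C(3)] by blast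
  ultimately show False using no by blast
qed

section \<open>Greedy sets\<close>

text \<open>For a list without repetitions \<open>Z - {e}\<close> is just \<open>Z\<close>. It is
  written this way because the program sets the flag of \<open>e\<close> tentatively and clears it
  after a negative answer of the oracle.\<close>

definition greedy :: "'a set set \<Rightarrow> 'a list \<Rightarrow> 'a set" where
  "greedy \<I> xs = fold (\<lambda>e Z. if insert e Z \<in> \<I> then insert e Z else Z - {e}) xs {}"

lemma greedy_Nil [simp]: "greedy \<I> [] = {}"
  and greedy_snoc: "greedy \<I> (xs @ [x]) = (if insert x (greedy \<I> xs) \<in> \<I> then insert x (greedy \<I> xs) else greedy \<I> xs - {x})"
  by (simp_all add: greedy_def)

lemma greedy_subset: "greedy \<I> xs \<subseteq> set xs"
  by (induction xs rule: rev_induct) (auto simp: greedy_snoc split: if_splits)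

lemma greedy_indep:
  assumes "downward_closed V \<I>" "{} \<in> \<I>"
  shows "greedy \<I> xs \<in> \<I>"
  using assms by (induction xs rule: rev_induct) (auto simp: greedy_snoc intro: downward_closedD)

lemma greedy_append:
  assumes "distinct (xs @ ys)"
  shows "greedy \<I> xs \<subseteq> greedy \<I> (xs @ ys)"
  using assms
proof (induction ys rule: rev_induct)
  case (snoc y ys)
  then have "y \<notin> greedy \<I> xs" using greedy_subset[of \<I> xs] by auto
  with snoc show ?case by (auto simp: greedy_snoc simp flip: append_assoc)
qed simp

text \<open>A rejected \<open>a\<close> was rejected against the smaller set of its time, so by
  downward closure the final set rejects it too.\<close>

lemma greedy_maximal:
  assumes "downward_closed V \<I>" "distinct xs" "a \<in> set xs" "a \<notin> greedy \<I> xs"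
  shows "insert a (greedy \<I> xs) \<notin> \<I>"
proof
  assume ind: "insert a (greedy \<I> xs) \<in> \<I>"
  obtain ys zs where xs: "xs = ys @ a # zs" using assms(3) by (meson split_list)
  have "greedy \<I> (ys @ [a]) \<subseteq> greedy \<I> xs" using greedy_append[of "ys @ [a]" zs] assms(2) xs by simp
  then have "insert a (greedy \<I> ys) \<notin> \<I>" using assms(4) by (auto simp: greedy_snoc split: if_splits)
  moreover have "greedy \<I> ys \<subseteq> greedy \<I> xs" using greedy_append[of ys "a # zs"] assms(2) xs by simp
  ultimately show False using downward_closedD[OF assms(1) ind, of "insert a (greedy \<I> ys)"] by blast
qed

section \<open>A layer-cake inequality\<close>

text \<open>A finite form of integrating the inequality between level sets over \<theta>. The
  induction cuts off the slab below the least positive value of \<open>g\<close>; the hypothesis at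
  that level pays for the slab.\<close>

lemma layer_cake:
  fixes y g :: "'a \<Rightarrow> real" and u :: "'b \<Rightarrow> real" and k :: real
  assumes "finite B" "finite A" "\<And>f. f \<in> B \<Longrightarrow> 0 \<le> g f" "\<And>a. a \<in> A \<Longrightarrow> 0 \<le> u a"
    and "\<And>\<theta>. 0 < \<theta> \<Longrightarrow> (\<Sum>f\<in>{f\<in>B. \<theta> \<le> g f}. y f) \<le> k * card {a\<in>A. \<theta> \<le> u a}" and k: "0 \<le> k"
  shows "(\<Sum>f\<in>B. y f * g f) \<le> k * (\<Sum>a\<in>A. u a)"
  using assms(3-5)
proof (induction "card {f\<in>B. 0 < g f}" arbitrary: g u rule: less_induct)
  case less
  show ?case
  proof (cases "{f\<in>B. 0 < g f} = {}")
    case True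
    then have "g f = 0" if "f \<in> B" for f using that less.prems(1)[of f] by force
    then have "(\<Sum>f\<in>B. y f * g f) = 0" by simp
    then show ?thesis using k less.prems(2) by (simp add: sum_nonneg)
  next
    case False
    define P where "P = {f\<in>B. 0 < g f}"
    have finP: "finite P" "P \<noteq> {}" using assms(1) False unfolding P_def by auto
    define m where "m = Min (g ` P)"
    have "m \<in> g ` P" unfolding m_def using finP by (intro Min_in) auto
    then obtain f0 where f0: "f0 \<in> P" "m = g f0" by auto
    then have m: "m > 0" unfolding P_def by auto
    have mle: "m \<le> g f" if "f \<in> P" for f unfolding m_def using finP that by (intro Min_le) auto
    \<comment> \<open>Both functions are lowered by \<open>m\<close> and truncated at 0. This
      removes \<open>f0\<close> from the support of \<open>g\<close>, and the level sets of the new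
      functions are those of the old ones, shifted by \<open>m\<close>.\<close>
    define g' where "g' f = max (g f - m) 0" for f
    define u' where "u' a = max (u a - m) 0" for a
    have "{f\<in>B. 0 < g' f} \<subseteq> P - {f0}" using f0 m unfolding g'_def P_def by auto
    then have "{f\<in>B. 0 < g' f} \<subset> P" using f0 by blast
    then have lt: "card {f\<in>B. 0 < g' f} < card {f\<in>B. 0 < g f}" using finP psubset_card_mono unfolding P_def by blast
    have IH: "(\<Sum>f\<in>B. y f * g' f) \<le> k * (\<Sum>a\<in>A. u' a)"
    proof (rule less.hyps[OF lt])
      fix \<theta> :: real assume "0 < \<theta>"
      then have "{f\<in>B. \<theta> \<le> g' f} = {f\<in>B. \<theta> + m \<le> g f}" "{a\<in>A. \<theta> \<le> u' a} = {a\<in>A. \<theta> + m \<le> u a}"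
        using m unfolding g'_def u'_def by auto
      then show "(\<Sum>f\<in>{f\<in>B. \<theta> \<le> g' f}. y f) \<le> k * card {a\<in>A. \<theta> \<le> u' a}"
        using less.prems(3)[of "\<theta> + m"] \<open>0 < \<theta>\<close> m by simp
    qed (auto simp: g'_def u'_def)
    have Peq: "{f\<in>B. m \<le> g f} = P" using mle m unfolding P_def by auto
    have "(\<Sum>f\<in>B. y f * g f) = (\<Sum>f\<in>B. y f * g' f + (if m \<le> g f then y f * m else 0))"
    proof (rule sum.cong)
      fix f assume f: "f \<in> B"
      show "y f * g f = y f * g' f + (if m \<le> g f then y f * m else 0)"
      proof (cases "m \<le> g f")
        case True then show ?thesis by (simp add: g'_def algebra_simps)
      next
        case False
        then have "g f = 0" using f mle[of f] less.prems(1)[of f] unfolding P_def by force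
        then show ?thesis using m by (simp add: g'_def)
      qed
    qed simp
    also have "\<dots> = (\<Sum>f\<in>B. y f * g' f) + m * (\<Sum>f\<in>{f\<in>B. m \<le> g f}. y f)"
      using assms(1) by (simp add: sum.distrib sum.If_cases sum_distrib_left mult.commute Int_def)
    \<comment> \<open>The slab has height \<open>m\<close> over all of \<open>P\<close> and is paid
      by the hypothesis at level \<open>m\<close>; on the other side each \<open>a\<close> with
      \<open>m \<le> u a\<close> has exactly \<open>m\<close> cut off.\<close>
    also have "\<dots> \<le> k * (\<Sum>a\<in>A. u' a) + m * (k * card {a\<in>A. m \<le> u a})"
      using IH less.prems(3)[OF m] m by (intro add_mono mult_left_mono) auto
    also have "\<dots> = k * (\<Sum>a\<in>A. u' a + (if m \<le> u a then m else 0))"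
      using assms(2) by (simp add: sum.distrib sum.If_cases Int_def algebra_simps)
    also have "\<dots> \<le> k * (\<Sum>a\<in>A. u a)"
      using k less.prems(2) unfolding u'_def by (intro mult_left_mono sum_mono) auto
    finally show ?thesis .
  qed
qed

section \<open>Policies and their probing probabilities\<close>

fun probed_by :: "policy \<Rightarrow> (nat \<Rightarrow> bool) \<Rightarrow> nat set" where
  "probed_by Stop X = {}"
| "probed_by (Probe_Then e l r) X = insert e (if X e then probed_by l X else probed_by r X)"

lemma chosen_by_eq: "chosen_by \<pi> X = {e\<in>probed_by \<pi> X. X e}"
  by (induction \<pi>) auto

text \<open>The activity of \<open>f\<close> is revealed only by probing \<open>f\<close>, so it
  cannot influence whether \<open>f\<close> is probed. This is the independence behind
  \<open>prob_chosen_by\<close>.\<close>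

lemma mem_probed_by_upd: "f \<in> probed_by \<pi> (X(f := b)) \<longleftrightarrow> f \<in> probed_by \<pi> X"
  by (induction \<pi>) auto

lemma feasible_from_outer:
  assumes "feasible_from I Q S \<pi>" "Q \<in> outer_constraint I"
  shows "Q \<union> probed_by \<pi> X \<in> outer_constraint I"
  using assms
proof (induction \<pi> arbitrary: Q S)
  case (Probe_Then e l r)
  then have "insert e Q \<in> outer_constraint I" by (simp add: may_probe_def)
  then show ?case using Probe_Then.prems Probe_Then.IH(1)[of "insert e Q" "insert e S"] Probe_Then.IH(2)[of "insert e Q" S]
    by (auto simp: insert_commute)
qed simp

lemma feasible_from_inner:
  assumes "feasible_from I Q S \<pi>" "S \<in> inner_constraint I"
  shows "S \<union> chosen_by \<pi> X \<in> inner_constraint I"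
  using assms
proof (induction \<pi> arbitrary: Q S)
  case (Probe_Then e l r)
  then have "insert e S \<in> inner_constraint I" by (simp add: may_probe_def)
  then show ?case using Probe_Then.prems Probe_Then.IH(1)[of "insert e Q" "insert e S"] Probe_Then.IH(2)[of "insert e Q" S]
    by auto
qed simp

definition probe_prob :: "probing \<Rightarrow> policy \<Rightarrow> nat \<Rightarrow> real" where
  "probe_prob I \<pi> e = measure_pmf.prob (activation I) {X. e \<in> probed_by \<pi> X}"

lemma finite_set_activation [simp]: "finite (set_pmf (activation I))"
  unfolding activation_def by (rule finite_subset[OF set_Pi_pmf_subset']) (auto intro: finite_PiE_dflt)

lemma measure_eq_expectation: "measure_pmf.prob M {x. P x} = measure_pmf.expectation M (\<lambda>x. of_bool (P x))"
proof -
  have "measure_pmf.expectation M (\<lambda>x. of_bool (P x) :: real) = measure_pmf.expectation M (indicator {x. P x})"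
    by (intro Bochner_Integration.integral_cong) (auto simp: indicator_def)
  then show ?thesis by simp
qed

text \<open>It is used for two events that do not look at the coordinate of \<open>f\<close>: that a
  policy probes \<open>f\<close>, and that the simulated predecessors of \<open>f\<close> do not
  block it.\<close>

lemma prob_Pi_pmf_indep:
  assumes A: "finite A" "f \<in> A" and H: "\<And>Z b. H (Z(f := b)) \<longleftrightarrow> H Z"
  shows "measure_pmf.prob (Pi_pmf A d q) {Z. G (Z f) \<and> H Z} =
    measure_pmf.prob (q f) {b. G b} * measure_pmf.prob (Pi_pmf A d q) {Z. H Z}"
proof -
  let ?R = "Pi_pmf (A - {f}) d q"
  have eq: "Pi_pmf A d q = map_pmf (\<lambda>(b, Z). Z(f := b)) (pair_pmf (q f) ?R)"
    using Pi_pmf_insert[of "A - {f}" f d q] A by (simp add: insert_absorb)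
  have prod: "measure_pmf.prob (pair_pmf (q f) ?R) (U \<times> {Z. H Z}) = measure_pmf.prob (q f) U * measure_pmf.prob ?R {Z. H Z}" for U
  proof -
    \<comment> \<open>The product rule is for countable sets, so both events are first cut down to
      the supports.\<close>
    have "measure_pmf.prob (pair_pmf (q f) ?R) (U \<times> {Z. H Z}) =
        measure_pmf.prob (pair_pmf (q f) ?R) ((U \<inter> set_pmf (q f)) \<times> ({Z. H Z} \<inter> set_pmf ?R))"
      by (subst measure_Int_set_pmf[symmetric], intro arg_cong[where f = "measure_pmf.prob _"]) auto
    also have "\<dots> = measure_pmf.prob (q f) (U \<inter> set_pmf (q f)) * measure_pmf.prob ?R ({Z. H Z} \<inter> set_pmf ?R)"
      by (intro measure_pmf_prob_product) auto
    finally show ?thesis by (simp add: measure_Int_set_pmf)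
  qed
  have "measure_pmf.prob (Pi_pmf A d q) {Z. G (Z f) \<and> H Z} = measure_pmf.prob (pair_pmf (q f) ?R) ({b. G b} \<times> {Z. H Z})"
    unfolding eq by (simp, intro arg_cong[where f = "measure_pmf.prob _"]) (auto simp: H)
  moreover have "measure_pmf.prob (Pi_pmf A d q) {Z. H Z} = measure_pmf.prob (pair_pmf (q f) ?R) (UNIV \<times> {Z. H Z})"
    unfolding eq by (simp, intro arg_cong[where f = "measure_pmf.prob _"]) (auto simp: H)
  ultimately show ?thesis unfolding prod by simp
qed

lemma prob_chosen_by:
  assumes "valid_numbers I" "f \<in> ground I"
  shows "measure_pmf.prob (activation I) {X. f \<in> chosen_by \<pi> X} = probe_prob I \<pi> f * real_of_rat (act_prob I f)"
proof -
  have "0 \<le> real_of_rat (act_prob I f)" "real_of_rat (act_prob I f) \<le> 1"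
    using assms unfolding valid_numbers_def by auto
  moreover have "{X. f \<in> chosen_by \<pi> X} = {X. X f \<and> f \<in> probed_by \<pi> X}" by (auto simp: chosen_by_eq)
  moreover have "measure_pmf.prob (activation I) {X. X f \<and> f \<in> probed_by \<pi> X} =
      measure_pmf.prob (bernoulli_pmf (real_of_rat (act_prob I f))) {b. b} * measure_pmf.prob (activation I) {X. f \<in> probed_by \<pi> X}"
    unfolding activation_def using assms(2) by (intro prob_Pi_pmf_indep) (auto simp: mem_probed_by_upd)
  moreover have "{b. b} = {True}" by auto
  ultimately show ?thesis by (simp add: probe_prob_def measure_pmf_single)
qed

text \<open>Linearity of expectation turns a bound for every realisation into one for the marginals.
  This is how an adaptive policy enters the relaxation.\<close>

lemma sum_probe_prob_le:
  assumes fin: "finite B" and c: "\<And>X. card (B \<inter> probed_by \<pi> X) \<le> c"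
  shows "(\<Sum>f\<in>B. probe_prob I \<pi> f) \<le> real c"
proof -
  have "(\<Sum>f\<in>B. probe_prob I \<pi> f) = measure_pmf.expectation (activation I) (\<lambda>X. \<Sum>f\<in>B. of_bool (f \<in> probed_by \<pi> X))"
    unfolding probe_prob_def measure_eq_expectation
    by (subst Bochner_Integration.integral_sum) (auto intro: integrable_measure_pmf_finite)
  also have "\<dots> = measure_pmf.expectation (activation I) (\<lambda>X. real (card (B \<inter> probed_by \<pi> X)))"
    using fin by (simp add: Int_def)
  also have "\<dots> \<le> measure_pmf.expectation (activation I) (\<lambda>X. real c)"
    by (intro integral_mono) (auto intro: integrable_measure_pmf_finite c)
  finally show ?thesis by simp
qed

lemma sum_choose_prob_le:
  assumes fin: "finite B" "B \<subseteq> ground I" and v: "valid_numbers I" and c: "\<And>X. card (B \<inter> chosen_by \<pi> X) \<le> c"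
  shows "(\<Sum>f\<in>B. probe_prob I \<pi> f * real_of_rat (act_prob I f)) \<le> real c"
proof -
  have "(\<Sum>f\<in>B. probe_prob I \<pi> f * real_of_rat (act_prob I f)) = measure_pmf.expectation (activation I) (\<lambda>X. \<Sum>f\<in>B. of_bool (f \<in> chosen_by \<pi> X))"
    by (subst Bochner_Integration.integral_sum)
     (use fin v in \<open>auto intro: integrable_measure_pmf_finite simp: prob_chosen_by[symmetric] measure_eq_expectation intro!: sum.cong\<close>)
  also have "\<dots> = measure_pmf.expectation (activation I) (\<lambda>X. real (card (B \<inter> chosen_by \<pi> X)))"
    using fin by (simp add: Int_def)
  also have "\<dots> \<le> measure_pmf.expectation (activation I) (\<lambda>X. real c)"
    by (intro integral_mono) (auto intro: integrable_measure_pmf_finite c)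
  finally show ?thesis by simp
qed

lemma policy_value_eq:
  assumes v: "valid_numbers I" and \<pi>: "feasible I \<pi>"
  shows "policy_value I \<pi> = (\<Sum>e\<in>ground I. probe_prob I \<pi> e * (real_of_rat (act_prob I e) * real_of_rat (weight I e)))"
proof -
  have sub: "probed_by \<pi> X \<subseteq> ground I" for X
  proof -
    have "feasible_from I Q S \<pi> \<Longrightarrow> probed_by \<pi> X \<subseteq> ground I" for Q S
    proof (induction \<pi> arbitrary: Q S)
      case (Probe_Then e l r)
      have "probed_by l X \<subseteq> ground I" by (rule Probe_Then.IH(1)) (use Probe_Then.prems in auto)
      moreover have "probed_by r X \<subseteq> ground I" by (rule Probe_Then.IH(2)) (use Probe_Then.prems in auto)
      ultimately show ?case using Probe_Then.prems by (simp add: may_probe_def)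
    qed simp
    then show ?thesis using \<pi> unfolding feasible_def by blast
  qed
  have "reward I (chosen_by \<pi> X) = (\<Sum>e\<in>ground I. real_of_rat (weight I e) * of_bool (e \<in> chosen_by \<pi> X))" for X
    unfolding reward_def using sub[of X] by (intro sum.mono_neutral_cong_left) (auto simp: chosen_by_eq)
  then have "policy_value I \<pi> = measure_pmf.expectation (activation I) (\<lambda>X. \<Sum>e\<in>ground I. real_of_rat (weight I e) * of_bool (e \<in> chosen_by \<pi> X))"
    unfolding policy_value_def by simp
  also have "\<dots> = (\<Sum>e\<in>ground I. real_of_rat (weight I e) * measure_pmf.expectation (activation I) (\<lambda>X. of_bool (e \<in> chosen_by \<pi> X)))"
    by (subst Bochner_Integration.integral_sum) (auto intro: integrable_measure_pmf_finite)
  also have "\<dots> = (\<Sum>e\<in>ground I. probe_prob I \<pi> e * (real_of_rat (act_prob I e) * real_of_rat (weight I e)))"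
    by (intro sum.cong) (auto simp: measure_eq_expectation[symmetric] prob_chosen_by[OF v])
  finally show ?thesis .
qed

section \<open>Finitely supported expectations\<close>

lemma expectation_bind_finite:
  fixes h :: "'b \<Rightarrow> real"
  assumes "finite (set_pmf M)" "\<And>x. x \<in> set_pmf M \<Longrightarrow> finite (set_pmf (f x))"
  shows "measure_pmf.expectation (bind_pmf M f) h = measure_pmf.expectation M (\<lambda>x. measure_pmf.expectation (f x) h)"
  using assms by (subst pmf_expectation_bind[where A = "set_pmf M"])
    (auto simp: integral_measure_pmf_real[where A = "set_pmf M"] mult.commute)

lemma expectation_mono_finite:
  fixes g h :: "'b \<Rightarrow> real"
  assumes "finite (set_pmf M)" "\<And>x. x \<in> set_pmf M \<Longrightarrow> g x \<le> h x"
  shows "measure_pmf.expectation M g \<le> measure_pmf.expectation M h"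
  using assms by (intro integral_mono_AE) (auto intro: integrable_measure_pmf_finite simp: AE_measure_pmf_iff)

lemma expectation_binomial:
  assumes "p \<in> {0..1}"
  shows "measure_pmf.expectation (binomial_pmf m p) real = m * p"
proof (induction m)
  case (Suc m)
  have p: "0 \<le> p" "p \<le> 1" using assms by auto
  have "measure_pmf.expectation (binomial_pmf m p) (\<lambda>k. 1 + real k) = 1 + m * p"
    using Suc assms by (subst Bochner_Integration.integral_add) auto
  then show ?case using Suc p assms
    by (simp add: binomial_pmf_Suc expectation_bind_finite finite_set_pmf_binomial_pmf map_pmf_def[symmetric] algebra_simps)
qed (use assms in \<open>simp add: binomial_pmf_0\<close>)

lemma prob_binomial_minority_ge:
  assumes p: "p \<in> {0..1}" and m: "0 < m"
  shows "1 - 2 * p \<le> measure_pmf.prob (binomial_pmf m p) {c. 2 * c < m}"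
proof -
  have "1 - 2 * p = measure_pmf.expectation (binomial_pmf m p) (\<lambda>c. 1 - 2 / m * real c)"
    using p m by (subst Bochner_Integration.integral_diff) (auto simp: expectation_binomial)
  \<comment> \<open>Markov's inequality, pointwise: \<open>1 - 2 / m * real c\<close> is at most 1,
    and at most 0 unless \<open>2 * c < m\<close>.\<close>
  also have "\<dots> \<le> measure_pmf.expectation (binomial_pmf m p) (\<lambda>c. of_bool (2 * c < m))"
    using p m by (intro integral_mono) (auto simp: field_simps)
  finally show ?thesis by (simp add: measure_eq_expectation)
qed

text \<open>The mean is at least \<open>3/4 * m\<close>, so a minority deviates from it by at least
  \<open>m / 4\<close>, and Hoeffding's inequality gives \<open>exp (- m / 8)\<close>. The cruder
  \<open>8 / m\<close> suffices, because the number of trials is a large multiple of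
  \<open>n * C\<close> in \<open>lp_le_good\<close>.\<close>

lemma prob_binomial_minority_le:
  assumes pp: "p \<in> {3/4..1}" and m: "0 < m"
  shows "measure_pmf.prob (binomial_pmf m p) {c. 2 * c < m} \<le> 8 / m"
proof -
  interpret binomial_distribution m p by unfold_locales (use pp in auto)
  have "measure_pmf.prob (binomial_pmf m p) {c. 2 * c < m} \<le> measure_pmf.prob (binomial_pmf m p) {c. c \<le> m * p - m / 4}"
  proof (intro measure_pmf.finite_measure_mono subsetI; clarsimp)
    fix c :: nat assume "2 * c < m"
    then have "real c \<le> real m * (3/4) - m / 4" by linarith
    also have "\<dots> \<le> m * p - m / 4" using pp by (intro diff_right_mono mult_left_mono) auto
    finally show "real c \<le> m * p - m / 4" .
  qed
  also have "\<dots> \<le> exp (- 2 * (m / 4)\<^sup>2 / m)" by (rule prob_le) (use m in auto)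
  also have "\<dots> = 1 / exp (m / 8)" using m by (simp add: power2_eq_square exp_minus field_simps)
  also have "\<dots> \<le> 1 / (m / 8)" using m exp_ge_add_one_self[of "m / 8"] by (intro divide_left_mono) (simp_all del: exp_ge_add_one_self, linarith?)
  finally show ?thesis by simp
qed

section \<open>The planning phase\<close>

definition cand :: "(nat \<Rightarrow> bool) \<Rightarrow> (nat \<Rightarrow> 'c) \<Rightarrow> nat \<Rightarrow> nat list \<Rightarrow> nat list" where
  "cand Y r f xs = filter (\<lambda>e. Y e \<and> r e = r f) xs"

definition blocked :: "nat set set list \<Rightarrow> (nat \<Rightarrow> 'c) \<Rightarrow> (nat \<Rightarrow> bool) \<Rightarrow> nat \<Rightarrow> nat list \<Rightarrow> bool" where
  "blocked Fs r Y f xs \<longleftrightarrow> (\<exists>F\<in>set Fs. insert f (greedy F (cand Y r f xs)) \<notin> F)"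

text \<open>The value \<open>n\<close>, which is not an element, means that no exchange is possible.\<close>

definition rival :: "(nat \<Rightarrow> 'b::linordered_field) \<Rightarrow> nat \<Rightarrow> nat set set \<Rightarrow> nat set \<Rightarrow> nat \<Rightarrow> nat" where
  "rival v n F Q f =
     fold (\<lambda>j x. if j \<in> Q \<and> (x < n \<longrightarrow> v j < v x) \<and> insert f (Q - {j}) \<in> F then j else x) [0..<n] n"

text \<open>A set rather than a list: an element that is the rival in several families leaves
  \<open>Q\<close> once and is counted once.\<close>

definition conflicts :: "(nat \<Rightarrow> 'b::linordered_field) \<Rightarrow> nat \<Rightarrow> nat set set list \<Rightarrow> nat set \<Rightarrow> nat \<Rightarrow> nat set" where
  "conflicts v n Os Q f = (\<lambda>F. rival v n F Q f) ` {F \<in> set Os. insert f Q \<notin> F}"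

text \<open>With the factor 2 an exchange gains more than half of \<open>v f\<close>. This keeps the
  value of \<open>Q\<close> at least half of the value of everything ever accepted, see
  \<open>chain_inv\<close>.\<close>

definition admissible :: "(nat \<Rightarrow> 'b::linordered_field) \<Rightarrow> nat \<Rightarrow> nat set set list \<Rightarrow> nat set \<Rightarrow> nat \<Rightarrow> bool" where
  "admissible v n Os Q f \<longleftrightarrow> n \<notin> conflicts v n Os Q f \<and> 2 * sum v (conflicts v n Os Q f) < v f"

definition admit :: "(nat \<Rightarrow> 'b::linordered_field) \<Rightarrow> nat \<Rightarrow> nat set set list \<Rightarrow> nat \<Rightarrow> nat list \<times> nat set \<Rightarrow> nat list \<times> nat set" where
  "admit v n Os f \<sigma> = (if admissible v n Os (snd \<sigma>) f
     then (fst \<sigma> @ [f], insert f (snd \<sigma> - conflicts v n Os (snd \<sigma>) f)) else \<sigma>)"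

lemma rival_cases:
  fixes v :: "nat \<Rightarrow> 'b::linordered_field" and n f :: nat and Q and F
  defines "R \<equiv> {j\<in>Q. j < n \<and> insert f (Q - {j}) \<in> F}"
  shows "R = {} \<and> rival v n F Q f = n \<or> rival v n F Q f \<in> R \<and> (\<forall>j\<in>R. v (rival v n F Q f) \<le> v j)"
proof -
  define x where "x m = fold (\<lambda>j x. if j \<in> Q \<and> (x < n \<longrightarrow> v j < v x) \<and> insert f (Q - {j}) \<in> F then j else x) [0..<m] n" for m
  have "{j\<in>R. j < m} = {} \<and> x m = n \<or> x m \<in> {j\<in>R. j < m} \<and> (\<forall>j\<in>{j\<in>R. j < m}. v (x m) \<le> v j)" if "m \<le> n" for m
    using that
  proof (induction m)
    case (Suc m)
    have x: "x (Suc m) = (if m \<in> Q \<and> (x m < n \<longrightarrow> v m < v (x m)) \<and> insert f (Q - {m}) \<in> F then m else x m)"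
      unfolding x_def by (subst upt_Suc_append) (simp_all only: fold_append comp_apply fold_simps le0)
    have R: "{j\<in>R. j < Suc m} = (if m \<in> Q \<and> insert f (Q - {m}) \<in> F then insert m {j\<in>R. j < m} else {j\<in>R. j < m})"
      using Suc.prems by (auto simp: R_def less_Suc_eq)
    from Suc consider "{j\<in>R. j < m} = {}" "x m = n" | "x m \<in> {j\<in>R. j < m}" "\<forall>j\<in>{j\<in>R. j < m}. v (x m) \<le> v j" by fastforce
    then show ?case
    proof cases
      case 1
      then show ?thesis unfolding R x by auto
    next
      case 2
      then have "x m < n" using Suc.prems by simp
      then show ?thesis unfolding x R using 2 by (auto intro: order.trans less_imp_le)
    qed
  qed (simp add: x_def)
  from this[of n] show ?thesis unfolding x_def rival_def R_def by auto
qed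

section \<open>Blocking probabilities and the random plan\<close>

definition block_prob :: "nat set set list \<Rightarrow> (nat \<Rightarrow> 'c) \<Rightarrow> (nat \<Rightarrow> real) \<Rightarrow> nat \<Rightarrow> nat list \<Rightarrow> real" where
  "block_prob Fs r p f xs =
     measure_pmf.prob (Pi_pmf (set xs) False (\<lambda>e. bernoulli_pmf (p e))) {Y. blocked Fs r Y f xs}"

lemma block_prob_01: "block_prob Fs r p f xs \<in> {0..1}" "0 \<le> block_prob Fs r p f xs" "block_prob Fs r p f xs \<le> 1"
  by (auto simp: block_prob_def)

lemma blocked_cong: "(\<And>e. e \<in> set xs \<Longrightarrow> Y e = Y' e) \<Longrightarrow> blocked Fs r Y f xs = blocked Fs r Y' f xs"
proof -
  assume "\<And>e. e \<in> set xs \<Longrightarrow> Y e = Y' e"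
  then have "cand Y r f xs = cand Y' r f xs" unfolding cand_def by (intro filter_cong) auto
  then show ?thesis unfolding blocked_def by simp
qed

text \<open>Lets all prefixes of an accepted list be tested on one common sample.\<close>

lemma block_prob_eq:
  assumes "finite A" "set xs \<subseteq> A"
  shows "block_prob Fs r p f xs = measure_pmf.prob (Pi_pmf A False (\<lambda>e. bernoulli_pmf (p e))) {Y. blocked Fs r Y f xs}"
proof -
  have "blocked Fs r (\<lambda>x. if x \<in> set xs then Y x else False) f xs = blocked Fs r Y f xs" for Y
    by (rule blocked_cong) simp
  then show ?thesis
    unfolding block_prob_def Pi_pmf_subset[OF assms] by (simp add: vimage_def)
qed

text \<open>Only the number of blocking simulations matters, and it is binomial, so the step draws
  it directly; \<open>dist_hits_tree\<close> relates it to actual simulations. The types of values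
  and classes stay open because the program computes with \<open>rat\<close> and the analysis with
  \<open>real\<close>.\<close>

definition plan_step :: "nat \<Rightarrow> nat \<Rightarrow> nat set set list \<Rightarrow> nat set set list \<Rightarrow> (nat \<Rightarrow> 'c) \<Rightarrow> (nat \<Rightarrow> real) \<Rightarrow>
    (nat \<Rightarrow> 'b::linordered_field) \<Rightarrow> nat \<Rightarrow> nat list \<times> nat set \<Rightarrow> (nat list \<times> nat set) pmf" where
  "plan_step M n Fs Os r p v f \<sigma> =
     (if 0 < v f then map_pmf (\<lambda>c. if 2 * c < M then admit v n Os f \<sigma> else \<sigma>)
        (binomial_pmf M (block_prob Fs r p f (fst \<sigma>))) else return_pmf \<sigma>)"

primrec plan :: "nat \<Rightarrow> nat \<Rightarrow> nat set set list \<Rightarrow> nat set set list \<Rightarrow> (nat \<Rightarrow> 'c) \<Rightarrow> (nat \<Rightarrow> real) \<Rightarrow>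
    (nat \<Rightarrow> 'b::linordered_field) \<Rightarrow> (nat \<Rightarrow> nat) \<Rightarrow> nat \<Rightarrow> (nat list \<times> nat set) pmf" where
  "plan M n Fs Os r p v ord 0 = return_pmf ([], {})"
| "plan M n Fs Os r p v ord (Suc t) = bind_pmf (plan M n Fs Os r p v ord t) (plan_step M n Fs Os r p v (ord t))"

text \<open>\<open>p'\<close> are the rounded probabilities used by the simulations,
  \<open>p\<close> the true ones. \<open>D\<close> bounds the weight of an element relative to the
  earlier ones of its class: it is 1 for matroids, where there is one class and weights decrease,
  and 2 for \<open>k\<close>-systems.\<close>

locale planner =
  fixes M n :: nat and Fs Os :: "nat set set list" and r :: "nat \<Rightarrow> 'c" and p p' w :: "nat \<Rightarrow> real"
    and ord :: "nat \<Rightarrow> nat" and \<kappa> \<kappa>' :: nat and D :: real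
  assumes M: "0 < M"
    and w: "\<And>e. e < n \<Longrightarrow> 0 \<le> w e"
    and p: "\<And>e. e < n \<Longrightarrow> 0 \<le> p e" "\<And>e. e < n \<Longrightarrow> p e \<le> p' e" "\<And>e. e < n \<Longrightarrow> p' e \<le> 2 * p e" "\<And>e. e < n \<Longrightarrow> p' e \<le> 1"
    and ord: "bij_betw ord {..<n} {..<n}"
    and inner: "\<And>F. F \<in> set Fs \<Longrightarrow> downward_closed {..<n} F" "\<And>F. F \<in> set Fs \<Longrightarrow> {} \<in> F" "\<And>F. F \<in> set Fs \<Longrightarrow> blocking_bound \<kappa> F"
    and outer: "\<And>F. F \<in> set Os \<Longrightarrow> downward_closed {..<n} F" "\<And>F. F \<in> set Os \<Longrightarrow> {} \<in> F" "\<And>F. F \<in> set Os \<Longrightarrow> blocking_bound \<kappa>' F"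
    and D: "0 \<le> D" and classes: "\<And>s t. s < t \<Longrightarrow> t < n \<Longrightarrow> r (ord s) = r (ord t) \<Longrightarrow> w (ord t) \<le> D * w (ord s)"
begin

definition v :: "nat \<Rightarrow> real" where "v e = p e * w e"

abbreviation "\<beta> \<equiv> block_prob Fs r p'"
abbreviation "chain \<equiv> plan M n Fs Os r p' v ord"

text \<open>The relaxation: \<open>x\<close> abstracts the probing probabilities of a policy.\<close>

definition lp :: "(nat \<Rightarrow> real) \<Rightarrow> bool" where
  "lp x \<longleftrightarrow> (\<forall>e. 0 \<le> x e \<and> x e \<le> 1) \<and>
     (\<forall>F\<in>set Fs. \<forall>B\<subseteq>{..<n}. \<forall>Z\<in>F. (\<forall>f\<in>B - Z. insert f Z \<notin> F) \<longrightarrow> (\<Sum>f\<in>B. x f * p f) \<le> \<kappa> * card Z) \<and>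
     (\<forall>F\<in>set Os. \<forall>B\<subseteq>{..<n}. \<forall>Z\<in>F. (\<forall>f\<in>B - Z. insert f Z \<notin> F) \<longrightarrow> (\<Sum>f\<in>B. x f) \<le> \<kappa>' * card Z)"

text \<open>Accepted lists grow only at the end, so \<open>pre t\<close> recovers the list at time
  \<open>t\<close> from the final one. All quantities of the accounting thereby become functions of
  the final list.\<close>

definition pre :: "nat \<Rightarrow> nat list \<Rightarrow> nat list" where
  "pre t xs = filter (\<lambda>e. e \<in> ord ` {..<t}) xs"

definition scanned :: "nat \<Rightarrow> nat list \<Rightarrow> bool" where
  "scanned t xs \<longleftrightarrow> (\<exists>P. xs = map ord (filter P [0..<t]))"

lemma v_nonneg: "e < n \<Longrightarrow> 0 \<le> v e"
  unfolding v_def using p w by (intro mult_nonneg_nonneg) auto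

lemma ord_less [simp]: "t < n \<Longrightarrow> ord t < n"
  using ord unfolding bij_betw_def by auto

lemma ord_eq_iff [simp]: "s < n \<Longrightarrow> t < n \<Longrightarrow> ord s = ord t \<longleftrightarrow> s = t"
  using ord unfolding bij_betw_def inj_on_def by auto

lemma sum_ord: "(\<Sum>t<n. h (ord t)) = (\<Sum>e<n. h e)"
  using sum.reindex_bij_betw[OF ord] .

lemma pre_map:
  assumes "s \<le> t" "t \<le> n"
  shows "pre s (map ord (filter P [0..<t])) = map ord (filter P [0..<s])"
proof -
  have "[0..<t] = [0..<s] @ [s..<t]" using upt_add_eq_append[of 0 s "t - s"] assms(1) by simp
  moreover have "filter (\<lambda>e. e \<in> ord ` {..<s}) (map ord (filter P [0..<s])) = map ord (filter P [0..<s])"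
    by (auto simp: filter_id_conv)
  moreover have "filter (\<lambda>e. e \<in> ord ` {..<s}) (map ord (filter P [s..<t])) = []"
    using assms by (auto simp: filter_empty_conv)
  ultimately show ?thesis by (simp add: pre_def)
qed

lemma scanned_pre_same: "scanned t xs \<Longrightarrow> t \<le> n \<Longrightarrow> pre t xs = xs"
  unfolding scanned_def using pre_map by blast

lemma scanned_prefix: "scanned t xs \<Longrightarrow> s \<le> t \<Longrightarrow> t \<le> n \<Longrightarrow> \<exists>ys. xs = pre s xs @ ys"
  unfolding scanned_def using pre_map upt_add_eq_append[of 0 s "t - s"]
  by (metis (no_types, lifting) add_0 filter_append le_add_diff_inverse map_append zero_le)

lemma scanned_distinct: "scanned t xs \<Longrightarrow> t \<le> n \<Longrightarrow> distinct xs"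
  unfolding scanned_def by (auto simp: distinct_map inj_on_def)

lemma scanned_set: "scanned t xs \<Longrightarrow> set xs \<subseteq> ord ` {..<t}"
  unfolding scanned_def by auto

lemma scanned_ground: "scanned t xs \<Longrightarrow> t \<le> n \<Longrightarrow> set xs \<subseteq> {..<n}"
  using scanned_set by fastforce

lemma scanned_Suc: "scanned t xs \<Longrightarrow> scanned (Suc t) xs"
proof -
  assume "scanned t xs"
  then obtain P where "xs = map ord (filter P [0..<t])" unfolding scanned_def by auto
  moreover have "filter (\<lambda>s. P s \<and> s \<noteq> t) [0..<t] = filter P [0..<t]" by (rule filter_cong) auto
  ultimately have "xs = map ord (filter (\<lambda>s. P s \<and> s \<noteq> t) [0..<Suc t])" by simp
  then show ?thesis unfolding scanned_def by blast
qed

lemma scanned_snoc: "scanned t xs \<Longrightarrow> scanned (Suc t) (xs @ [ord t])"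
proof -
  assume "scanned t xs"
  then obtain P where "xs = map ord (filter P [0..<t])" unfolding scanned_def by auto
  moreover have "filter (\<lambda>s. P s \<or> s = t) [0..<t] = filter P [0..<t]" by (rule filter_cong) auto
  ultimately have "xs @ [ord t] = map ord (filter (\<lambda>s. P s \<or> s = t) [0..<Suc t])" by simp
  then show ?thesis unfolding scanned_def by blast
qed

lemma pre_snoc: "s \<le> t \<Longrightarrow> t < n \<Longrightarrow> pre s (xs @ [ord t]) = pre s xs"
  by (auto simp: pre_def)

lemma fst_admit: "fst (admit v n Os f \<sigma>) = (if admissible v n Os (snd \<sigma>) f then fst \<sigma> @ [f] else fst \<sigma>)"
  by (simp add: admit_def)

lemma finite_chain [simp]: "finite (set_pmf (chain t))"
  by (induction t) (auto simp: plan_step_def intro!: finite_set_pmf_binomial_pmf block_prob_01)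

lemma finite_plan_step [simp]: "finite (set_pmf (plan_step M n Fs Os r p' v f \<sigma>))"
  by (auto simp: plan_step_def intro!: finite_set_pmf_binomial_pmf block_prob_01)

lemma plan_stepE:
  assumes "\<sigma>' \<in> set_pmf (plan_step M n Fs Os r p' v f \<sigma>)"
  obtains "\<sigma>' = \<sigma>" | "0 < v f" "admissible v n Os (snd \<sigma>) f" "\<sigma>' = admit v n Os f \<sigma>"
  using assms by (auto simp: plan_step_def admit_def split: if_splits)

lemma scanned_chain:
  assumes "\<sigma> \<in> set_pmf (chain t)"
  shows "scanned t (fst \<sigma>)"
  using assms
proof (induction t arbitrary: \<sigma>)
  case (Suc t)
  then obtain \<sigma>' where s: "\<sigma>' \<in> set_pmf (chain t)" "\<sigma> \<in> set_pmf (plan_step M n Fs Os r p' v (ord t) \<sigma>')" by auto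
  from s(2) show ?case
    by (rule plan_stepE) (use Suc.IH[OF s(1)] in \<open>auto simp: fst_admit intro: scanned_Suc scanned_snoc\<close>)
qed (simp add: scanned_def)

text \<open>By downward closure, removing the rivals of all violated families repairs each of them
  at once.\<close>

lemma conflicts_subset:
  assumes "n \<notin> conflicts v n Os Q f" 
  shows "conflicts v n Os Q f \<subseteq> Q" "conflicts v n Os Q f \<subseteq> {..<n}"
    "\<And>F. F \<in> set Os \<Longrightarrow> insert f Q \<notin> F \<Longrightarrow> insert f (Q - conflicts v n Os Q f) \<in> F"
proof -
  have *: "rival v n F Q f \<in> Q \<inter> {..<n} \<and> insert f (Q - {rival v n F Q f}) \<in> F" if "F \<in> set Os" "insert f Q \<notin> F" for F
    using rival_cases[of Q n f F v] assms that unfolding conflicts_def by fastforce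
  then show "conflicts v n Os Q f \<subseteq> Q" "conflicts v n Os Q f \<subseteq> {..<n}" unfolding conflicts_def by auto
  fix F assume F: "F \<in> set Os" "insert f Q \<notin> F"
  then have "rival v n F Q f \<in> conflicts v n Os Q f" unfolding conflicts_def by auto
  then have "insert f (Q - conflicts v n Os Q f) \<subseteq> insert f (Q - {rival v n F Q f})" by auto
  with *[OF F] show "insert f (Q - conflicts v n Os Q f) \<in> F" by (blast intro: downward_closedD[OF outer(1)[OF F(1)]])
qed

text \<open>For the last part: with \<open>K\<close> the set of leaving elements, accepting
  \<open>f\<close> adds \<open>v f\<close> on the left and \<open>2 * (v f - sum v K)\<close> on the
  right, which is more than \<open>v f\<close> because \<open>2 * sum v K < v f\<close>.\<close>

lemma chain_inv:
  assumes "\<sigma> \<in> set_pmf (chain t)" "t \<le> n"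
  shows "snd \<sigma> \<subseteq> set (fst \<sigma>) \<and> (\<forall>F\<in>set Os. snd \<sigma> \<in> F) \<and> sum v (set (fst \<sigma>)) \<le> 2 * sum v (snd \<sigma>)"
  using assms
proof (induction t arbitrary: \<sigma>)
  case 0
  then show ?case using outer by auto
next
  case (Suc t)
  then obtain \<sigma>' where s: "\<sigma>' \<in> set_pmf (chain t)" "\<sigma> \<in> set_pmf (plan_step M n Fs Os r p' v (ord t) \<sigma>')" by auto
  have IH: "snd \<sigma>' \<subseteq> set (fst \<sigma>')" "\<forall>F\<in>set Os. snd \<sigma>' \<in> F" "sum v (set (fst \<sigma>')) \<le> 2 * sum v (snd \<sigma>')"
    using Suc s(1) by auto
  from s(2) show ?case
  proof (rule plan_stepE)
    assume "\<sigma> = \<sigma>'" then show ?thesis using IH by simp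
  next
    let ?K = "conflicts v n Os (snd \<sigma>') (ord t)"
    assume adm: "admissible v n Os (snd \<sigma>') (ord t)" and "\<sigma> = admit v n Os (ord t) \<sigma>'"
    then have \<sigma>: "\<sigma> = (fst \<sigma>' @ [ord t], insert (ord t) (snd \<sigma>' - ?K))" by (simp add: admit_def)
    have nK: "n \<notin> ?K" and lt: "2 * sum v ?K < v (ord t)" using adm by (auto simp: admissible_def)
    have sc: "scanned t (fst \<sigma>')" using scanned_chain[OF s(1)] .
    have new: "ord t \<notin> set (fst \<sigma>')" using scanned_set[OF sc] Suc.prems by auto
    have fin: "finite (snd \<sigma>')" using IH(1) finite_subset by blast
    have "ord t \<notin> snd \<sigma>' - ?K" using new IH(1) by blast
    then have "sum v (insert (ord t) (snd \<sigma>' - ?K)) = v (ord t) + (sum v (snd \<sigma>') - sum v ?K)"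
      using fin conflicts_subset(1)[OF nK] by (simp add: sum_diff)
    then have "sum v (set (fst \<sigma>)) \<le> 2 * sum v (snd \<sigma>)" using \<sigma> new IH(3) lt by simp
    moreover have "insert (ord t) (snd \<sigma>' - ?K) \<in> F" if F: "F \<in> set Os" for F
    proof (cases "insert (ord t) (snd \<sigma>') \<in> F")
      case True
      then show ?thesis by (rule downward_closedD[OF outer(1)[OF F]]) auto
    next
      case False
      then show ?thesis by (rule conflicts_subset(3)[OF nK F])
    qed
    moreover have "snd \<sigma> \<subseteq> set (fst \<sigma>)" using \<sigma> IH(1) by auto
    ultimately show ?thesis using \<sigma> by simp
  qed
qed

text \<open>The uses of the test: \<open>1 - 2 * \<beta>\<close> in the charging of blocked
  elements, \<open>8 / M\<close> for elements accepted in spite of a high blocking probability, and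
  the case \<open>\<beta> = 1\<close> for elements that are dependent on their own in an inner
  family.\<close>

lemma prob_admit_bounds:
  fixes f :: nat and xs :: "nat list"
  defines "\<alpha> \<equiv> \<lambda>f xs. measure_pmf.prob (binomial_pmf M (\<beta> f xs)) {c. 2 * c < M}"
  shows "1 - 2 * \<beta> f xs \<le> \<alpha> f xs" "3/4 \<le> \<beta> f xs \<Longrightarrow> \<alpha> f xs \<le> 8 / M" "\<beta> f xs = 1 \<Longrightarrow> \<alpha> f xs = 0"
    "0 \<le> \<alpha> f xs" "\<alpha> f xs \<le> 1"
  unfolding \<alpha>_def
    apply (rule prob_binomial_minority_ge[OF block_prob_01(1) M])
   apply (rule prob_binomial_minority_le[OF _ M], use block_prob_01 in auto)[1]
  by (auto simp: measure_pmf_zero_iff M)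

lemma expectation_plan_step:
  fixes h :: "nat list \<times> nat set \<Rightarrow> real"
  shows "measure_pmf.expectation (plan_step M n Fs Os r p' v f \<sigma>) h =
    (if 0 < v f then h \<sigma> + measure_pmf.prob (binomial_pmf M (\<beta> f (fst \<sigma>))) {c. 2 * c < M} * (h (admit v n Os f \<sigma>) - h \<sigma>) else h \<sigma>)"
proof (cases "0 < v f")
  case True
  have "measure_pmf.expectation (plan_step M n Fs Os r p' v f \<sigma>) h =
    measure_pmf.expectation (binomial_pmf M (\<beta> f (fst \<sigma>))) (\<lambda>c. h \<sigma> + of_bool (2 * c < M) * (h (admit v n Os f \<sigma>) - h \<sigma>))"
    unfolding plan_step_def using True by (auto intro!: Bochner_Integration.integral_cong)
  also have "\<dots> = h \<sigma> + measure_pmf.expectation (binomial_pmf M (\<beta> f (fst \<sigma>))) (\<lambda>c. of_bool (2 * c < M)) * (h (admit v n Os f \<sigma>) - h \<sigma>)"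
    by (subst Bochner_Integration.integral_add) (auto simp: integrable_binomial_pmf[OF block_prob_01(1)])
  finally show ?thesis using True by (simp add: measure_eq_expectation)
qed (simp add: plan_step_def)

end

section \<open>Charging rejected elements to the accepted value\<close>

context planner
begin

abbreviation "sample \<equiv> Pi_pmf {..<n} False (\<lambda>e. bernoulli_pmf (p' e))"

lemma finite_sample [simp]: "finite (set_pmf sample)"
  by (rule finite_subset[OF set_Pi_pmf_subset']) auto

lemma prob_sample: "a < n \<Longrightarrow> measure_pmf.expectation sample (\<lambda>Y. of_bool (Y a)) = p' a"
proof -
  assume a: "a < n"
  have "measure_pmf.expectation sample (\<lambda>Y. of_bool (Y a)) = measure_pmf.expectation (map_pmf (\<lambda>Y. Y a) sample) (\<lambda>b. of_bool b :: real)"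
    by simp
  also have "\<dots> = p' a" using a p[of a] by (subst Pi_pmf_component) auto
  finally show ?thesis .
qed

text \<open>For fixed simulated activations the layer cake is applied in each class, with levels of
  weight. A blocked element of weight at least \<theta> is blocked by earlier members of its class,
  whose weights times \<open>D\<close> are at least \<theta>. So the heavy part of one greedy set
  blocks all blocked elements of the level, and \<open>lp\<close> bounds their mass
  \<open>x * p\<close>.\<close>

lemma sum_blocked_by_le:
  assumes x: "lp x" and F: "F \<in> set Fs" and xs: "scanned n xs"
  shows "(\<Sum>s<n. x (ord s) * v (ord s) * of_bool (insert (ord s) (greedy F (cand Y r (ord s) (pre s xs))) \<notin> F))
    \<le> \<kappa> * (\<Sum>a\<in>{a\<in>set xs. Y a}. D * w a)"
proof -
  define blk where "blk s \<longleftrightarrow> insert (ord s) (greedy F (cand Y r (ord s) (pre s xs))) \<notin> F" for s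
  let ?C = "r ` {..<n}"
  have A: "finite {a\<in>set xs. Y a}" "r ` {a\<in>set xs. Y a} \<subseteq> ?C" using scanned_ground[OF xs] by auto
  have dist: "distinct xs" using scanned_distinct[OF xs] by simp
  have per: "(\<Sum>s\<in>{s\<in>{s. s < n \<and> blk s}. r (ord s) = c}. (x (ord s) * p (ord s)) * w (ord s))
      \<le> \<kappa> * (\<Sum>a\<in>{a\<in>{a\<in>set xs. Y a}. r a = c}. D * w a)" for c
  proof (rule layer_cake)
    fix \<theta> :: real assume \<theta>: "0 < \<theta>"
    let ?B = "{s\<in>{s\<in>{s. s < n \<and> blk s}. r (ord s) = c}. \<theta> \<le> w (ord s)}"
    let ?A = "{a\<in>{a\<in>{a\<in>set xs. Y a}. r a = c}. \<theta> \<le> D * w a}"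
    \<comment> \<open>The greedy set of the class on the final list contains the greedy sets of all
      prefixes, so it serves all scanned elements at once.\<close>
    define G where "G = greedy F (filter (\<lambda>e. Y e \<and> r e = c) xs)"
    define Z where "Z = {a\<in>G. \<theta> \<le> D * w a}"
    have G: "G \<in> F" unfolding G_def using inner(1,2)[OF F] by (rule greedy_indep)
    have Z: "Z \<in> F" using downward_closedD[OF inner(1)[OF F] G] unfolding Z_def by auto
    have "Z \<subseteq> ?A" using greedy_subset[of F "filter (\<lambda>e. Y e \<and> r e = c) xs"] unfolding Z_def G_def by auto
    then have cZ: "card Z \<le> card ?A" by (intro card_mono) auto
    have inj: "inj_on ord ?B" by (auto simp: inj_on_def)
    have bl: "insert f Z \<notin> F" if "f \<in> ord ` ?B - Z" for f
    proof
      assume fZ: "insert f Z \<in> F"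
      obtain s where s: "f = ord s" "s < n" "blk s" "r f = c" "\<theta> \<le> w f" using \<open>f \<in> ord ` ?B - Z\<close> by auto
      obtain ys where ys: "xs = pre s xs @ ys" using scanned_prefix[OF xs, of s] s(2) by auto
      have "cand Y r f (pre s xs) @ filter (\<lambda>e. Y e \<and> r e = c) ys = filter (\<lambda>e. Y e \<and> r e = c) xs"
        using s(4) by (subst (2) ys) (simp add: cand_def)
      then have "greedy F (cand Y r f (pre s xs)) \<subseteq> G"
        unfolding G_def using greedy_append[of "cand Y r f (pre s xs)" "filter (\<lambda>e. Y e \<and> r e = c) ys" F] dist
        by (metis distinct_filter)
      moreover have "\<theta> \<le> D * w a" if a: "a \<in> greedy F (cand Y r f (pre s xs))" for a
      proof -
        have "a \<in> set (cand Y r f (pre s xs))" using a greedy_subset[of F "cand Y r f (pre s xs)"] by blast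
        then obtain s' where "s' < s" "a = ord s'" "r a = r f" unfolding cand_def pre_def by auto
        then show ?thesis using classes[of s' s] s by auto
      qed
      ultimately have "insert f (greedy F (cand Y r f (pre s xs))) \<subseteq> insert f Z" unfolding Z_def by blast
      then show False using downward_closedD[OF inner(1)[OF F] fZ] s unfolding blk_def by blast
    qed
    have "(\<Sum>s\<in>?B. x (ord s) * p (ord s)) = (\<Sum>f\<in>ord ` ?B. x f * p f)"
      using inj by (simp add: sum.reindex)
    also have "\<dots> \<le> \<kappa> * card Z"
    proof -
      have "ord ` ?B \<subseteq> {..<n}" by auto
      moreover have "\<forall>f\<in>ord ` ?B - Z. insert f Z \<notin> F" using bl by blast
      ultimately show ?thesis using x F Z unfolding lp_def by blast
    qed
    also have "\<dots> \<le> real \<kappa> * card ?A" using cZ by (simp add: mult_left_mono)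
    finally show "(\<Sum>s\<in>?B. x (ord s) * p (ord s)) \<le> real \<kappa> * card ?A" .
  qed (use w D scanned_ground[OF xs] in \<open>auto intro!: mult_nonneg_nonneg\<close>)
  have "(\<Sum>s<n. x (ord s) * v (ord s) * of_bool (blk s)) = (\<Sum>s\<in>{s. s < n \<and> blk s}. (x (ord s) * p (ord s)) * w (ord s))"
    by (intro sum.mono_neutral_cong_right) (auto simp: v_def)
  also have "\<dots> = (\<Sum>c\<in>?C. \<Sum>s\<in>{s\<in>{s. s < n \<and> blk s}. r (ord s) = c}. (x (ord s) * p (ord s)) * w (ord s))"
    by (rule sum.group[symmetric]) auto
  also have "\<dots> \<le> (\<Sum>c\<in>?C. \<kappa> * (\<Sum>a\<in>{a\<in>{a\<in>set xs. Y a}. r a = c}. D * w a))"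
    by (intro sum_mono per)
  also have "\<dots> = \<kappa> * (\<Sum>a\<in>{a\<in>set xs. Y a}. D * w a)"
    unfolding sum_distrib_left[symmetric] by (subst sum.group) (use A in auto)
  finally show ?thesis unfolding blk_def .
qed

lemma lp_nonneg: "lp x \<Longrightarrow> 0 \<le> x e"
  unfolding lp_def by (drule conjunct1) simp

text \<open>By linearity one sample may serve all times, although the algorithm draws fresh ones.
  The union bound over the families and \<open>sum_blocked_by_le\<close> leave the weights of the
  simulated active elements, with means \<open>p' * w \<le> 2 * v\<close>.\<close>

lemma sum_block_prob_le:
  assumes x: "lp x" and xs: "scanned n xs"
  shows "(\<Sum>s<n. x (ord s) * v (ord s) * \<beta> (ord s) (pre s xs)) \<le> 2 * D * \<kappa> * length Fs * sum v (set xs)"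
proof -
  let ?bl = "\<lambda>Y s F. insert (ord s) (greedy F (cand Y r (ord s) (pre s xs))) \<notin> F"
  have sub: "set (pre s xs) \<subseteq> {..<n}" for s using scanned_ground[OF xs] unfolding pre_def by auto
  have "(\<Sum>s<n. x (ord s) * v (ord s) * \<beta> (ord s) (pre s xs)) =
      (\<Sum>s<n. measure_pmf.expectation sample (\<lambda>Y. x (ord s) * v (ord s) * of_bool (blocked Fs r Y (ord s) (pre s xs))))"
    by (intro sum.cong) (simp_all add: block_prob_eq[OF finite_lessThan sub] measure_eq_expectation)
  also have "\<dots> = measure_pmf.expectation sample (\<lambda>Y. \<Sum>s<n. x (ord s) * v (ord s) * of_bool (blocked Fs r Y (ord s) (pre s xs)))"
    by (rule Bochner_Integration.integral_sum[symmetric]) (auto intro: integrable_measure_pmf_finite)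
  also have "\<dots> \<le> measure_pmf.expectation sample (\<lambda>Y. \<Sum>F\<in>set Fs. \<Sum>s<n. x (ord s) * v (ord s) * of_bool (?bl Y s F))"
  proof (rule expectation_mono_finite)
    fix Y
    have "x (ord s) * v (ord s) * of_bool (blocked Fs r Y (ord s) (pre s xs)) \<le>
        (\<Sum>F\<in>set Fs. x (ord s) * v (ord s) * of_bool (?bl Y s F))" if "s < n" for s
    proof (cases "blocked Fs r Y (ord s) (pre s xs)")
      case True
      then obtain F where F: "F \<in> set Fs" "?bl Y s F" unfolding blocked_def by auto
      then have "x (ord s) * v (ord s) * of_bool (?bl Y s F) \<le> (\<Sum>F\<in>set Fs. x (ord s) * v (ord s) * of_bool (?bl Y s F))"
        using lp_nonneg[OF x] v_nonneg that by (intro member_le_sum) auto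
      then show ?thesis using F True by simp
    next
      case False
      then show ?thesis using lp_nonneg[OF x] v_nonneg that by (auto intro: sum_nonneg)
    qed
    then have "(\<Sum>s<n. x (ord s) * v (ord s) * of_bool (blocked Fs r Y (ord s) (pre s xs))) \<le>
        (\<Sum>s<n. \<Sum>F\<in>set Fs. x (ord s) * v (ord s) * of_bool (?bl Y s F))" by (intro sum_mono) auto
    then show "(\<Sum>s<n. x (ord s) * v (ord s) * of_bool (blocked Fs r Y (ord s) (pre s xs))) \<le>
        (\<Sum>F\<in>set Fs. \<Sum>s<n. x (ord s) * v (ord s) * of_bool (?bl Y s F))" by (subst sum.swap)
  qed simp
  also have "\<dots> \<le> measure_pmf.expectation sample (\<lambda>Y. \<Sum>F\<in>set Fs. \<kappa> * (\<Sum>a\<in>{a\<in>set xs. Y a}. D * w a))"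
    by (intro expectation_mono_finite sum_mono sum_blocked_by_le x xs) simp_all
  also have "\<dots> = measure_pmf.expectation sample (\<lambda>Y. card (set Fs) * \<kappa> * (\<Sum>a\<in>set xs. D * w a * of_bool (Y a)))"
    by (intro Bochner_Integration.integral_cong) (simp_all add: sum.inter_filter[symmetric] of_bool_def if_distrib cong: if_cong)
  also have "\<dots> = card (set Fs) * \<kappa> * (\<Sum>a\<in>set xs. D * w a * measure_pmf.expectation sample (\<lambda>Y. of_bool (Y a)))"
    by (subst Bochner_Integration.integral_mult_right_zero, subst Bochner_Integration.integral_sum)
      (auto intro: integrable_measure_pmf_finite)
  also have "\<dots> = card (set Fs) * \<kappa> * (\<Sum>a\<in>set xs. D * w a * p' a)"
    using scanned_ground[OF xs] by (simp add: prob_sample subset_iff)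
  also have "\<dots> \<le> length Fs * \<kappa> * (\<Sum>a\<in>set xs. D * 2 * v a)"
  proof (rule mult_mono, goal_cases)
    case 2
    show ?case
    proof (rule sum_mono)
    fix a assume "a \<in> set xs"
    then have a: "a < n" using scanned_ground[OF xs] by auto
    have "w a * p' a \<le> w a * (2 * p a)" using w p a by (intro mult_left_mono) auto
    then show "D * w a * p' a \<le> D * 2 * v a" using D mult_left_mono[of "w a * p' a" "w a * (2 * p a)" D] by (simp add: v_def mult_ac)
    qed
  next
    case 4
    show "0 \<le> (\<Sum>a\<in>set xs. D * w a * p' a)"
    proof (intro sum_nonneg mult_nonneg_nonneg)
      fix a assume "a \<in> set xs"
      then have a: "a < n" using scanned_ground[OF xs] by auto
      show "0 \<le> p' a" using p(1,2)[OF a] by linarith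
      show "0 \<le> w a" using w a .
    qed (rule D)
  qed (auto intro!: mult_right_mono simp: card_length)
  also have "\<dots> = 2 * D * \<kappa> * length Fs * sum v (set xs)"
    by (simp add: sum_distrib_left sum_distrib_right mult_ac)
  finally show ?thesis .
qed

text \<open>\<open>oc xs f\<close> is what may be charged for refusing \<open>f\<close> on account
  of the outer constraint while \<open>xs\<close> is accepted. It is a function of the accepted list
  so that, through \<open>pre\<close>, it can be evaluated on the final one. Matroids and
  \<open>k\<close>-systems supply different functions.\<close>

definition charge :: "(nat \<Rightarrow> real) \<Rightarrow> (nat list \<Rightarrow> nat \<Rightarrow> real) \<Rightarrow> real \<Rightarrow> bool" where
  "charge x oc Co \<longleftrightarrow> (\<forall>xs f. f < n \<longrightarrow> 0 \<le> oc xs f) \<and>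
     (\<forall>t<n. \<forall>\<sigma>\<in>set_pmf (chain t). 0 < v (ord t) \<longrightarrow> \<not> admissible v n Os (snd \<sigma>) (ord t) \<longrightarrow>
        x (ord t) * v (ord t) \<le> oc (fst \<sigma>) (ord t)) \<and>
     (\<forall>\<sigma>\<in>set_pmf (chain n). (\<Sum>t<n. oc (pre t (fst \<sigma>)) (ord t)) \<le> Co * sum v (set (fst \<sigma>)))"

text \<open>A potential argument: each step raises the expected potential by at least
  \<open>x f * v f\<close>. If \<open>f\<close> is not admissible, \<open>oc\<close> pays. If it is,
  it is accepted with probability at least \<open>1 - 2 * \<beta>\<close>, and the term with
  \<open>2 * \<beta>\<close>, which is added in any case, pays for the rest.\<close>

lemma accounting:
  assumes x: "lp x" and oc: "charge x oc Co" and "t \<le> n"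
  defines "term \<equiv> \<lambda>xs s. x (ord s) * v (ord s) * (2 * \<beta> (ord s) (pre s xs) + of_bool (ord s \<in> set xs)) + oc (pre s xs) (ord s)"
  shows "(\<Sum>s<t. x (ord s) * v (ord s)) \<le> measure_pmf.expectation (chain t) (\<lambda>\<sigma>. \<Sum>s<t. term (fst \<sigma>) s)"
  using \<open>t \<le> n\<close>
proof (induction t)
  case (Suc t)
  let ?f = "ord t" and ?\<Psi> = "\<lambda>t \<sigma>. \<Sum>s<t. term (fst \<sigma>) s"
  have step: "?\<Psi> t \<sigma> + x ?f * v ?f \<le> measure_pmf.expectation (plan_step M n Fs Os r p' v ?f \<sigma>) (?\<Psi> (Suc t))"
    if \<sigma>: "\<sigma> \<in> set_pmf (chain t)" for \<sigma>
  proof -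
    have sc: "scanned t (fst \<sigma>)" using scanned_chain[OF \<sigma>] .
    have new: "?f \<notin> set (fst \<sigma>)" using scanned_set[OF sc] Suc.prems by auto
    have pre: "pre t (fst \<sigma>) = fst \<sigma>" using scanned_pre_same[OF sc] Suc.prems by simp
    have h: "?\<Psi> (Suc t) \<sigma> = ?\<Psi> t \<sigma> + (x ?f * v ?f * (2 * \<beta> ?f (fst \<sigma>)) + oc (fst \<sigma>) ?f)"
      using new by (simp add: term_def pre)
    \<comment> \<open>Acceptance is seen only by the indicator of \<open>ord t\<close>; all other
      contributions are determined by the list before the new element.\<close>
    have adm: "?\<Psi> (Suc t) (admit v n Os ?f \<sigma>) - ?\<Psi> (Suc t) \<sigma> = x ?f * v ?f" if "admissible v n Os (snd \<sigma>) ?f"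
    proof -
      have "term (fst \<sigma> @ [?f]) s = term (fst \<sigma>) s" if "s < t" for s
        using that Suc.prems by (simp add: term_def pre_snoc)
      then have "?\<Psi> t (admit v n Os ?f \<sigma>) = ?\<Psi> t \<sigma>" using that by (simp add: fst_admit)
      moreover have "term (fst (admit v n Os ?f \<sigma>)) t = x ?f * v ?f * (2 * \<beta> ?f (fst \<sigma>)) + oc (fst \<sigma>) ?f + x ?f * v ?f"
        using that Suc.prems by (simp add: fst_admit term_def pre_snoc pre algebra_simps)
      ultimately show ?thesis using h by simp
    qed
    have ocn: "0 \<le> oc (fst \<sigma>) ?f" using oc Suc.prems unfolding charge_def by simp
    have xv: "0 \<le> x ?f * v ?f" using lp_nonneg[OF x] v_nonneg Suc.prems by simp
    have b: "0 \<le> \<beta> ?f (fst \<sigma>)" using block_prob_01 by auto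
    show ?thesis
    proof (cases "0 < v ?f \<and> admissible v n Os (snd \<sigma>) ?f")
      case True
      let ?\<alpha> = "measure_pmf.prob (binomial_pmf M (\<beta> ?f (fst \<sigma>))) {c. 2 * c < M}"
      have "x ?f * v ?f * 1 \<le> x ?f * v ?f * (2 * \<beta> ?f (fst \<sigma>) + ?\<alpha>)"
        using prob_admit_bounds(1)[of ?f "fst \<sigma>"] xv by (intro mult_left_mono) auto
      then show ?thesis unfolding expectation_plan_step using True h adm ocn by (simp add: algebra_simps)
    next
      case False
      have eq: "measure_pmf.expectation (plan_step M n Fs Os r p' v ?f \<sigma>) (?\<Psi> (Suc t)) = ?\<Psi> (Suc t) \<sigma>"
        unfolding expectation_plan_step using False by (auto simp: admit_def)
      have "x ?f * v ?f \<le> oc (fst \<sigma>) ?f"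
      proof (cases "0 < v ?f")
        case True
        then show ?thesis using False oc \<sigma> Suc.prems unfolding charge_def by auto
      next
        case False
        then have "v ?f = 0" using v_nonneg[of ?f] Suc.prems by simp
        then show ?thesis using ocn by simp
      qed
      moreover have "0 \<le> x ?f * v ?f * (2 * \<beta> ?f (fst \<sigma>))" using xv b by simp
      ultimately show ?thesis unfolding eq h by linarith
    qed
  qed
  have "(\<Sum>s<Suc t. x (ord s) * v (ord s)) \<le> measure_pmf.expectation (chain t) (?\<Psi> t) + x ?f * v ?f"
    using Suc by simp
  also have "\<dots> = measure_pmf.expectation (chain t) (\<lambda>\<sigma>. ?\<Psi> t \<sigma> + x ?f * v ?f)"
    by (subst Bochner_Integration.integral_add) (auto intro: integrable_measure_pmf_finite)
  also have "\<dots> \<le> measure_pmf.expectation (chain t) (\<lambda>\<sigma>. measure_pmf.expectation (plan_step M n Fs Os r p' v ?f \<sigma>) (?\<Psi> (Suc t)))"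
    by (rule expectation_mono_finite) (use step in auto)
  also have "\<dots> = measure_pmf.expectation (chain (Suc t)) (?\<Psi> (Suc t))"
    by (simp add: expectation_bind_finite)
  finally show ?case .
qed simp

abbreviation "accepted_value \<equiv> measure_pmf.expectation (chain n) (\<lambda>\<sigma>. sum v (set (fst \<sigma>)))"

lemma lp_le_accepted_value:
  assumes x: "lp x" and oc: "charge x oc Co"
  shows "(\<Sum>e<n. x e * v e) \<le> (4 * D * \<kappa> * length Fs + Co + 1) * accepted_value"
proof -
  have "(\<Sum>e<n. x e * v e) = (\<Sum>s<n. x (ord s) * v (ord s))" by (rule sum_ord[symmetric])
  also have "\<dots> \<le> measure_pmf.expectation (chain n) (\<lambda>\<sigma>. \<Sum>s<n. x (ord s) * v (ord s) *
      (2 * \<beta> (ord s) (pre s (fst \<sigma>)) + of_bool (ord s \<in> set (fst \<sigma>))) + oc (pre s (fst \<sigma>)) (ord s))"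
    by (rule accounting[OF x oc]) simp
  also have "\<dots> \<le> measure_pmf.expectation (chain n) (\<lambda>\<sigma>. (4 * D * \<kappa> * length Fs + Co + 1) * sum v (set (fst \<sigma>)))"
  proof (rule expectation_mono_finite)
    fix \<sigma> assume \<sigma>: "\<sigma> \<in> set_pmf (chain n)"
    then have sc: "scanned n (fst \<sigma>)" by (rule scanned_chain)
    have g: "set (fst \<sigma>) \<subseteq> {..<n}" using scanned_ground[OF sc] by simp
    have "(\<Sum>s<n. x (ord s) * v (ord s) * of_bool (ord s \<in> set (fst \<sigma>))) = (\<Sum>e<n. x e * v e * of_bool (e \<in> set (fst \<sigma>)))"
      by (rule sum_ord)
    also have "\<dots> = (\<Sum>e\<in>set (fst \<sigma>). x e * v e)"
      using g by (intro sum.mono_neutral_cong_right) auto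
    also have "\<dots> \<le> sum v (set (fst \<sigma>))"
      using x g v_nonneg unfolding lp_def by (intro sum_mono mult_left_le_one_le) auto
    finally have 1: "(\<Sum>s<n. x (ord s) * v (ord s) * of_bool (ord s \<in> set (fst \<sigma>))) \<le> sum v (set (fst \<sigma>))" .
    have 2: "(\<Sum>s<n. oc (pre s (fst \<sigma>)) (ord s)) \<le> Co * sum v (set (fst \<sigma>))"
      using oc \<sigma> unfolding charge_def by simp
    have 3: "(\<Sum>s<n. x (ord s) * v (ord s) * \<beta> (ord s) (pre s (fst \<sigma>))) \<le> 2 * D * \<kappa> * length Fs * sum v (set (fst \<sigma>))"
      by (rule sum_block_prob_le[OF x sc])
    have "(\<Sum>s<n. x (ord s) * v (ord s) *
      (2 * \<beta> (ord s) (pre s (fst \<sigma>)) + of_bool (ord s \<in> set (fst \<sigma>))) + oc (pre s (fst \<sigma>)) (ord s)) =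
      2 * (\<Sum>s<n. x (ord s) * v (ord s) * \<beta> (ord s) (pre s (fst \<sigma>))) +
      (\<Sum>s<n. x (ord s) * v (ord s) * of_bool (ord s \<in> set (fst \<sigma>))) + (\<Sum>s<n. oc (pre s (fst \<sigma>)) (ord s))"
      by (simp add: sum.distrib sum_distrib_left algebra_simps)
    also have "\<dots> \<le> 2 * (2 * D * \<kappa> * length Fs * sum v (set (fst \<sigma>))) + sum v (set (fst \<sigma>)) + Co * sum v (set (fst \<sigma>))"
      using 1 2 3 by linarith
    also have "\<dots> = (4 * D * \<kappa> * length Fs + Co + 1) * sum v (set (fst \<sigma>))" by (simp add: algebra_simps)
    finally show "(\<Sum>s<n. x (ord s) * v (ord s) *
      (2 * \<beta> (ord s) (pre s (fst \<sigma>)) + of_bool (ord s \<in> set (fst \<sigma>))) + oc (pre s (fst \<sigma>)) (ord s)) \<le>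
      (4 * D * \<kappa> * length Fs + Co + 1) * sum v (set (fst \<sigma>))" .
  qed simp
  also have "\<dots> = (4 * D * \<kappa> * length Fs + Co + 1) * accepted_value" by simp
  finally show ?thesis .
qed

section \<open>Accepted elements with a high blocking probability\<close>

definition single_feasible :: "nat \<Rightarrow> bool" where
  "single_feasible f \<longleftrightarrow> (\<forall>F\<in>set Fs \<union> set Os. {f} \<in> F)"

definition bad :: "nat \<Rightarrow> nat list \<Rightarrow> real" where
  "bad t xs = (\<Sum>s<t. v (ord s) * of_bool (ord s \<in> set xs \<and> 3/4 < \<beta> (ord s) (pre s xs)))"

lemma admissible_single: "admissible v n Os Q f \<Longrightarrow> F \<in> set Os \<Longrightarrow> {f} \<in> F"
proof -
  assume a: "admissible v n Os Q f" and F: "F \<in> set Os"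
  have "\<exists>A. insert f A \<in> F" using conflicts_subset(3)[of Q f F] a F unfolding admissible_def by metis
  then obtain A where "insert f A \<in> F" ..
  then show ?thesis by (rule downward_closedD[OF outer(1)[OF F]]) simp
qed

lemma block_prob_infeasible: "F \<in> set Fs \<Longrightarrow> {f} \<notin> F \<Longrightarrow> \<beta> f xs = 1"
proof -
  assume F: "F \<in> set Fs" "{f} \<notin> F"
  then have "insert f Z \<notin> F" for Z using downward_closedD[OF inner(1)[OF F(1)], of "insert f Z" "{f}"] by auto
  then have "{Y. blocked Fs r Y f xs} = UNIV" unfolding blocked_def using F(1) by auto
  then show ?thesis unfolding block_prob_def by simp
qed

text \<open>Only elements that are feasible alone can contribute: the others are blocked with
  certainty or never admissible. The restriction matters because these values are later compared
  with policies that probe a single element.\<close>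

lemma expectation_bad_le:
  assumes "t \<le> n"
  shows "measure_pmf.expectation (chain t) (\<lambda>\<sigma>. bad t (fst \<sigma>)) \<le> 8 / M * (\<Sum>s<t. v (ord s) * of_bool (single_feasible (ord s)))"
  using assms
proof (induction t)
  case (Suc t)
  let ?f = "ord t" and ?b = "\<lambda>t \<sigma>. bad t (fst \<sigma>)"
  let ?c = "8 / M * (v ?f * of_bool (single_feasible ?f))"
  have vf: "0 \<le> v ?f" using v_nonneg Suc.prems by simp
  then have c0: "0 \<le> ?c" using M by simp
  have step: "measure_pmf.expectation (plan_step M n Fs Os r p' v ?f \<sigma>) (?b (Suc t)) \<le> ?b t \<sigma> + ?c"
    if \<sigma>: "\<sigma> \<in> set_pmf (chain t)" for \<sigma>
  proof -
    have sc: "scanned t (fst \<sigma>)" using scanned_chain[OF \<sigma>] .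
    have new: "?f \<notin> set (fst \<sigma>)" using scanned_set[OF sc] Suc.prems by auto
    have pre: "pre t (fst \<sigma>) = fst \<sigma>" using scanned_pre_same[OF sc] Suc.prems by simp
    have h: "?b (Suc t) \<sigma> = ?b t \<sigma>" using new by (simp add: bad_def)
    show ?thesis
    proof (cases "0 < v ?f \<and> admissible v n Os (snd \<sigma>) ?f")
      case True
      let ?\<alpha> = "measure_pmf.prob (binomial_pmf M (\<beta> ?f (fst \<sigma>))) {c. 2 * c < M}"
      have "(\<Sum>s<t. v (ord s) * of_bool (ord s \<in> set (fst \<sigma> @ [?f]) \<and> 3/4 < \<beta> (ord s) (pre s (fst \<sigma> @ [?f])))) = bad t (fst \<sigma>)"
        unfolding bad_def using Suc.prems by (intro sum.cong) (auto simp: pre_snoc)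
      then have adm: "?b (Suc t) (admit v n Os ?f \<sigma>) = ?b t \<sigma> + v ?f * of_bool (3/4 < \<beta> ?f (fst \<sigma>))"
        using True Suc.prems by (simp add: fst_admit bad_def pre_snoc pre)
      have "?\<alpha> * (v ?f * of_bool (3/4 < \<beta> ?f (fst \<sigma>))) \<le> ?c"
      proof (cases "3/4 < \<beta> ?f (fst \<sigma>)")
        case b: True
        show ?thesis
        proof (cases "single_feasible ?f")
          case True
          then show ?thesis using b prob_admit_bounds(2)[of ?f "fst \<sigma>"] vf mult_right_mono[of ?\<alpha> "8 / M" "v ?f"] by simp
        next
          case False
          then obtain F where "F \<in> set Fs" "{?f} \<notin> F"
            using admissible_single True unfolding single_feasible_def by blast
          then have "?\<alpha> = 0" by (intro prob_admit_bounds(3) block_prob_infeasible)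
          then show ?thesis using c0 by simp
        qed
      qed (use c0 in simp)
      then show ?thesis unfolding expectation_plan_step using True h adm by simp
    next
      case False
      then have "measure_pmf.expectation (plan_step M n Fs Os r p' v ?f \<sigma>) (?b (Suc t)) = ?b (Suc t) \<sigma>"
        unfolding expectation_plan_step by (auto simp: admit_def)
      then show ?thesis using h c0 by simp
    qed
  qed
  have "measure_pmf.expectation (chain (Suc t)) (?b (Suc t)) =
      measure_pmf.expectation (chain t) (\<lambda>\<sigma>. measure_pmf.expectation (plan_step M n Fs Os r p' v ?f \<sigma>) (?b (Suc t)))"
    by (simp add: expectation_bind_finite)
  also have "\<dots> \<le> measure_pmf.expectation (chain t) (\<lambda>\<sigma>. ?b t \<sigma> + ?c)"
    by (rule expectation_mono_finite) (use step in auto)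
  also have "\<dots> = measure_pmf.expectation (chain t) (?b t) + ?c"
    by (subst Bochner_Integration.integral_add) (auto intro: integrable_measure_pmf_finite)
  also have "\<dots> \<le> 8 / M * (\<Sum>s<t. v (ord s) * of_bool (single_feasible (ord s))) + ?c"
    using Suc by simp
  finally show ?case by (simp add: distrib_left)
qed (simp add: bad_def)

lemma blocking_bound_pos:
  assumes "blocking_bound k F" "{f} \<in> F"
  shows "1 \<le> k"
  using blocking_boundD[OF assms(1) assms(2) assms(2)] by auto

text \<open>The policy that probes only \<open>f\<close>. A set \<open>Z\<close> that blocks
  \<open>f\<close> is not empty, since \<open>{f}\<close> is independent, and
  \<open>1 \<le> k\<close> follows from the blocking bound for \<open>Z = B = {f}\<close>.\<close>

lemma lp_single:
  assumes "f < n" "single_feasible f"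
  shows "lp (\<lambda>e. of_bool (e = f))"
proof -
  have aux: "(\<Sum>g\<in>B. of_bool (g = f) * q g) \<le> k * card Z"
    if F: "downward_closed {..<n} F" "{f} \<in> F" "blocking_bound k F" and B: "B \<subseteq> {..<n}" and Z: "Z \<in> F"
      and bl: "\<forall>f\<in>B - Z. insert f Z \<notin> F" and q: "q f \<le> 1" for F B Z and k :: nat and q :: "nat \<Rightarrow> real"
  proof -
    have fin: "finite B" using B finite_subset by auto
    have "finite Z" using F(1) Z unfolding downward_closed_def by (meson PowD finite_lessThan finite_subset subsetD)
    have "(\<Sum>g\<in>B. of_bool (g = f) * q g) = (if f \<in> B then q f else 0)"
      using fin by (simp add: of_bool_def if_distrib[of "\<lambda>x. x * _"] sum.delta cong: if_cong)
    also have "\<dots> \<le> k * card Z"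
    proof (cases "f \<in> B")
      case True
      then have "Z \<noteq> {}" using bl F(2) by auto
      then have "1 \<le> k * card Z" using blocking_bound_pos[OF F(3,2)] \<open>finite Z\<close>
        by (simp add: Suc_le_eq card_gt_0_iff)
      then have "1 \<le> real k * real (card Z)" by (metis of_nat_1 of_nat_le_iff of_nat_mult)
      then show ?thesis using True q by auto
    qed simp
    finally show ?thesis .
  qed
  show ?thesis
    unfolding lp_def
  proof (intro conjI ballI allI impI)
    fix F B Z assume F: "F \<in> set Fs" "B \<subseteq> {..<n}" "Z \<in> F" "\<forall>f\<in>B - Z. insert f Z \<notin> F"
    show "(\<Sum>g\<in>B. of_bool (g = f) * p g) \<le> \<kappa> * card Z"
      using assms F p[of f] inner[OF F(1)] unfolding single_feasible_def by (intro aux) auto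
  next
    fix F B Z assume F: "F \<in> set Os" "B \<subseteq> {..<n}" "Z \<in> F" "\<forall>f\<in>B - Z. insert f Z \<notin> F"
    show "(\<Sum>g\<in>B. of_bool (g = f)) \<le> real (\<kappa>' * card Z)"
      using assms F outer[OF F(1)] aux[of F \<kappa>' B Z "\<lambda>_. 1"] unfolding single_feasible_def by simp
  qed auto
qed

text \<open>The expected weight collected from \<open>Q\<close> if every active element that is not
  blocked by its simulated predecessors were selected; see
  \<open>expectation_useful\<close>.\<close>

definition good :: "nat list \<times> nat set \<Rightarrow> real" where
  "good \<sigma> = (\<Sum>t<n. v (ord t) * of_bool (ord t \<in> snd \<sigma>) * (1 - \<beta> (ord t) (pre t (fst \<sigma>))))"

text \<open>The constant 16: half of the accepted value is in \<open>Q\<close>, a quarter of it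
  survives for elements with \<open>\<beta> \<le> 3/4\<close>, and the bad elements cost at most
  half of the resulting eighth.\<close>

theorem lp_le_good:
  fixes C Co :: real
  assumes x: "lp x" and oc: "\<And>x. lp x \<Longrightarrow> \<exists>oc. charge x oc Co"
    and Co: "0 \<le> Co" and C: "4 * D * \<kappa> * length Fs + Co + 1 \<le> C" and big: "32 * n * C \<le> M"
  shows "(\<Sum>e<n. x e * v e) \<le> 16 * C * measure_pmf.expectation (chain n) good"
proof -
  let ?V = accepted_value
  have V: "0 \<le> ?V"
  proof (intro integral_nonneg_AE, unfold AE_measure_pmf_iff, intro ballI sum_nonneg)
    fix \<sigma> e assume "\<sigma> \<in> set_pmf (chain n)" "e \<in> set (fst \<sigma>)"
    then show "0 \<le> v e" using scanned_ground[OF scanned_chain] v_nonneg[of e] by blast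
  qed
  have main: "(\<Sum>e<n. y e * v e) \<le> C * ?V" if y: "lp y" for y
  proof -
    obtain oc' where "charge y oc' Co" using oc[OF y] by blast
    from lp_le_accepted_value[OF y this] show ?thesis using mult_right_mono[OF C V] by linarith
  qed
  have sf: "v f * of_bool (single_feasible f) \<le> C * ?V" if f: "f < n" for f
  proof (cases "single_feasible f")
    case True
    have "(\<Sum>e<n. of_bool (e = f) * v e) = v f" using f
      by (simp add: of_bool_def if_distrib[of "\<lambda>x. x * _"] sum.delta cong: if_cong)
    then show ?thesis using main[OF lp_single[OF f True]] True by simp
  next
    case False
    have "lp (\<lambda>_. 0)" unfolding lp_def by auto
    from main[OF this] False show ?thesis by simp
  qed
  have "measure_pmf.expectation (chain n) (\<lambda>\<sigma>. bad n (fst \<sigma>)) \<le> 8 / M * (\<Sum>s<n. v (ord s) * of_bool (single_feasible (ord s)))"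
    by (rule expectation_bad_le) simp
  also have "\<dots> \<le> 8 / M * (\<Sum>s<n. C * ?V)" using sf by (intro mult_left_mono sum_mono) auto
  also have "\<dots> = (8 * n * C) / M * ?V" by simp
  \<comment> \<open>The origin of \<open>32 * n * C\<close> as a lower bound for the trials: each of
    the \<open>n\<close> elements is worth at most \<open>C * ?V\<close> and is accepted wrongly
    with probability at most \<open>8 / M\<close>.\<close>
  also have "\<dots> \<le> 1 / 4 * ?V" using big M V by (intro mult_right_mono) (auto simp: field_simps)
  finally have bad: "measure_pmf.expectation (chain n) (\<lambda>\<sigma>. bad n (fst \<sigma>)) \<le> ?V / 4" by simp
  have "?V / 8 - ?V / 4 / 4 \<le> ?V / 8 - measure_pmf.expectation (chain n) (\<lambda>\<sigma>. bad n (fst \<sigma>)) / 4"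
    using bad by simp
  also have "\<dots> = measure_pmf.expectation (chain n) (\<lambda>\<sigma>. sum v (set (fst \<sigma>)) / 8 - bad n (fst \<sigma>) / 4)"
    by (subst Bochner_Integration.integral_diff) (auto intro: integrable_measure_pmf_finite)
  also have "\<dots> \<le> measure_pmf.expectation (chain n) good"
  proof (rule expectation_mono_finite)
    fix \<sigma> assume \<sigma>: "\<sigma> \<in> set_pmf (chain n)"
    have sc: "scanned n (fst \<sigma>)" using scanned_chain[OF \<sigma>] .
    have inv: "snd \<sigma> \<subseteq> set (fst \<sigma>)" "sum v (set (fst \<sigma>)) \<le> 2 * sum v (snd \<sigma>)" using chain_inv[OF \<sigma>] by auto
    have g: "snd \<sigma> \<subseteq> {..<n}" using inv(1) scanned_ground[OF sc] by blast
    have "sum v (set (fst \<sigma>)) / 8 - bad n (fst \<sigma>) / 4 \<le> (sum v (snd \<sigma>) - bad n (fst \<sigma>)) / 4"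
      using inv(2) by simp
    also have "sum v (snd \<sigma>) = (\<Sum>e<n. v e * of_bool (e \<in> snd \<sigma>))"
      using g by (intro sum.mono_neutral_cong_left) auto
    also have "\<dots> = (\<Sum>t<n. v (ord t) * of_bool (ord t \<in> snd \<sigma>))" by (rule sum_ord[symmetric])
    also have "(\<dots> - bad n (fst \<sigma>)) / 4 = (\<Sum>t<n. (v (ord t) * of_bool (ord t \<in> snd \<sigma>) -
        v (ord t) * of_bool (ord t \<in> set (fst \<sigma>) \<and> 3/4 < \<beta> (ord t) (pre t (fst \<sigma>)))) / 4)"
      unfolding bad_def by (simp add: sum_subtractf sum_divide_distrib[symmetric])
    also have "\<dots> \<le> good \<sigma>"
      unfolding good_def
    proof (rule sum_mono)
      fix t assume t: "t \<in> {..<n}"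
      let ?b = "\<beta> (ord t) (pre t (fst \<sigma>))"
      have vt: "0 \<le> v (ord t)" using v_nonneg t by simp
      have b: "?b \<le> 1" using block_prob_01 by auto
      show "(v (ord t) * of_bool (ord t \<in> snd \<sigma>) - v (ord t) * of_bool (ord t \<in> set (fst \<sigma>) \<and> 3/4 < ?b)) / 4
          \<le> v (ord t) * of_bool (ord t \<in> snd \<sigma>) * (1 - ?b)"
      proof (cases "ord t \<in> snd \<sigma> \<and> ?b \<le> 3/4")
        case True
        then show ?thesis using vt mult_left_mono[of "1/4" "1 - ?b" "v (ord t)"] by simp
      next
        case False
        then have "(v (ord t) * of_bool (ord t \<in> snd \<sigma>) - v (ord t) * of_bool (ord t \<in> set (fst \<sigma>) \<and> 3/4 < ?b)) / 4 \<le> 0"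
          using inv(1) vt by auto
        also have "0 \<le> v (ord t) * of_bool (ord t \<in> snd \<sigma>) * (1 - ?b)" using vt b by simp
        finally show ?thesis .
      qed
    qed
    finally show "sum v (set (fst \<sigma>)) / 8 - bad n (fst \<sigma>) / 4 \<le> good \<sigma>" .
  qed simp
  finally have "?V \<le> 16 * measure_pmf.expectation (chain n) good" by simp
  moreover have "0 \<le> C" using C Co D by (simp add: order.trans[rotated])
  ultimately have "C * ?V \<le> C * (16 * measure_pmf.expectation (chain n) good)" by (intro mult_left_mono)
  then show ?thesis using main[OF x] by simp
qed

end

section \<open>The probing phase\<close>

definition finish :: "nat set set list \<Rightarrow> nat set \<Rightarrow> (nat \<Rightarrow> bool) \<Rightarrow> nat list \<Rightarrow> nat set" where
  "finish Fs Q X es =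
     fold (\<lambda>e S. if e \<in> Q \<and> (\<forall>F\<in>set Fs. insert e S \<in> F) \<and> X e then insert e S else S - {e}) es {}"

lemma finish_Nil [simp]: "finish Fs Q X [] = {}"
  and finish_snoc: "finish Fs Q X (es @ [e]) = (if e \<in> Q \<and> (\<forall>F\<in>set Fs. insert e (finish Fs Q X es) \<in> F) \<and> X e
    then insert e (finish Fs Q X es) else finish Fs Q X es - {e})"
  by (simp_all add: finish_def)

lemma finish_subset: "finish Fs Q X es \<subseteq> {e\<in>Q. X e} \<inter> set es"
  by (induction es rule: rev_induct) (auto simp: finish_snoc split: if_splits)

lemma finish_single:
  assumes "distinct es"
  shows "finish [F] Q X es = greedy F (filter (\<lambda>e. e \<in> Q \<and> X e) es)"
  using assms
proof (induction es rule: rev_induct)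
  case (snoc e es)
  then have "e \<notin> finish [F] Q X es" using finish_subset[of "[F]" Q X es] by auto
  with snoc show ?case by (auto simp: finish_snoc greedy_snoc)
qed simp

text \<open>All elements other than the largest one \<open>b\<close> are at most
  \<open>b / 2\<close>, so by induction they sum to at most \<open>b\<close>.\<close>

lemma sum_geometric_le:
  fixes C :: "real set"
  assumes "finite C" "\<And>a b. a \<in> C \<Longrightarrow> b \<in> C \<Longrightarrow> a < b \<Longrightarrow> 2 * a \<le> b" "\<And>c. c \<in> C \<Longrightarrow> c \<le> \<theta>" "0 \<le> \<theta>" "\<And>c. c \<in> C \<Longrightarrow> 0 \<le> c"
  shows "\<Sum>C \<le> 2 * \<theta>"
  using assms
proof (induction C arbitrary: \<theta> rule: finite_linorder_max_induct)
  case (insert b A)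
  have "\<Sum>A \<le> 2 * (b / 2)"
  proof (rule insert.IH)
    fix c assume "c \<in> A"
    then show "c \<le> b / 2" using insert.hyps(2) insert.prems(1)[of c b] by auto
  qed (use insert.prems in auto)
  moreover have "b \<le> \<theta>" using insert.prems by auto
  moreover have "b \<notin> A" using insert.hyps(2) by auto
  ultimately show ?case using insert.hyps(1) by simp
qed simp

lemma bernoulli_conj:
  assumes "0 \<le> a" "a \<le> 1" "0 \<le> b" "b \<le> 1"
  shows "map_pmf (\<lambda>(x, y). x \<and> y) (pair_pmf (bernoulli_pmf a) (bernoulli_pmf b)) = bernoulli_pmf (a * b)"
proof -
  have ab: "0 \<le> a * b" "a * b \<le> 1" using assms by (auto intro: mult_le_one)
  have "pmf (map_pmf (\<lambda>(x, y). x \<and> y) (pair_pmf (bernoulli_pmf a) (bernoulli_pmf b))) True = a * b"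
  proof -
    have "(\<lambda>(x, y). x \<and> y) -` {True} = {(True, True)}" by auto
    then show ?thesis using assms by (simp add: pmf_map measure_pmf_single pmf_pair)
  qed
  then show ?thesis using ab
    by (intro pmf_eqI) (metis (full_types) pmf_False_conv_True pmf_bernoulli_True)
qed

context planner
begin

text \<open>The default 0 is consistent: \<open>p' e = 0\<close> forces
  \<open>p e = 0\<close>.\<close>

definition keep_prob :: "nat \<Rightarrow> real" where
  "keep_prob e = (if p' e = 0 then 0 else p e / p' e)"

text \<open>Couples the simulated activations (first components) with the real ones (conjunctions).\<close>

definition joint :: "(nat \<Rightarrow> bool \<times> bool) pmf" where
  "joint = Pi_pmf {..<n} (False, False) (\<lambda>e. pair_pmf (bernoulli_pmf (p' e)) (bernoulli_pmf (keep_prob e)))"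

abbreviation "actual \<equiv> Pi_pmf {..<n} False (\<lambda>e. bernoulli_pmf (p e))"

lemma finite_joint [simp]: "finite (set_pmf joint)"
  unfolding joint_def by (rule finite_subset[OF set_Pi_pmf_subset']) auto

lemma finite_actual [simp]: "finite (set_pmf actual)"
  by (rule finite_subset[OF set_Pi_pmf_subset']) auto

lemma keep_prob: "e < n \<Longrightarrow> 0 \<le> keep_prob e" "e < n \<Longrightarrow> keep_prob e \<le> 1" "e < n \<Longrightarrow> p' e * keep_prob e = p e" "e < n \<Longrightarrow> 0 \<le> p' e"
  using p[of e] by (auto simp: keep_prob_def divide_le_eq_1)

lemma map_joint_fst: "map_pmf (\<lambda>Z. fst \<circ> Z) joint = sample"
  unfolding joint_def
  by (subst Pi_pmf_map[symmetric, where dflt' = False]) (auto simp: map_fst_pair_pmf)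

lemma map_joint_conj: "map_pmf (\<lambda>Z e. fst (Z e) \<and> snd (Z e)) joint = actual"
proof -
  have "map_pmf (\<lambda>Z e. fst (Z e) \<and> snd (Z e)) joint = map_pmf (\<lambda>Z. (\<lambda>(a, b). a \<and> b) \<circ> Z) joint"
    by (simp add: comp_def case_prod_beta)
  also have "\<dots> = Pi_pmf {..<n} False (\<lambda>e. map_pmf (\<lambda>(a, b). a \<and> b) (pair_pmf (bernoulli_pmf (p' e)) (bernoulli_pmf (keep_prob e))))"
    unfolding joint_def by (rule Pi_pmf_map[symmetric]) auto
  also have "\<dots> = actual"
    using keep_prob p by (intro Pi_pmf_cong) (auto simp: bernoulli_conj)
  finally show ?thesis .
qed

text \<open>Activity is real, blocking is simulated. Under the coupling every really active element
  is also simulated active, so the simulated blockers include all really active accepted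
  predecessors.\<close>

definition useful :: "nat list \<times> nat set \<Rightarrow> (nat \<Rightarrow> bool \<times> bool) \<Rightarrow> nat \<Rightarrow> bool" where
  "useful \<sigma> Z t \<longleftrightarrow> ord t \<in> snd \<sigma> \<and> (fst (Z (ord t)) \<and> snd (Z (ord t))) \<and> \<not> blocked Fs r (fst \<circ> Z) (ord t) (pre t (fst \<sigma>))"

text \<open>Whether \<open>f\<close> is really active depends on its own coordinate, whether it is
  blocked only on those of its accepted predecessors; hence the product
  \<open>p f * (1 - \<beta>)\<close>.\<close>

lemma expectation_useful:
  assumes xs: "scanned n (fst \<sigma>)"
  shows "measure_pmf.expectation joint (\<lambda>Z. \<Sum>t<n. w (ord t) * of_bool (useful \<sigma> Z t)) = good \<sigma>"
proof -
  have "measure_pmf.expectation joint (\<lambda>Z. of_bool (useful \<sigma> Z t)) = p (ord t) * of_bool (ord t \<in> snd \<sigma>) * (1 - \<beta> (ord t) (pre t (fst \<sigma>)))"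
    if t: "t < n" for t
  proof (cases "ord t \<in> snd \<sigma>")
    case True
    let ?f = "ord t" and ?ys = "pre t (fst \<sigma>)"
    have ys: "set ?ys \<subseteq> {..<n}" using scanned_ground[OF xs] unfolding pre_def by auto
    have f: "?f \<notin> set ?ys" using t by (auto simp: pre_def)
    have "blocked Fs r (fst \<circ> Z(?f := b)) ?f ?ys = blocked Fs r (fst \<circ> Z) ?f ?ys" for Z and b :: "bool \<times> bool"
      using f by (intro blocked_cong) auto
    then have "measure_pmf.prob joint {Z. (case Z ?f of (a, b) \<Rightarrow> a \<and> b) \<and> \<not> blocked Fs r (fst \<circ> Z) ?f ?ys} =
      measure_pmf.prob (pair_pmf (bernoulli_pmf (p' ?f)) (bernoulli_pmf (keep_prob ?f))) {z. case z of (a, b) \<Rightarrow> a \<and> b} *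
      measure_pmf.prob joint {Z. \<not> blocked Fs r (fst \<circ> Z) ?f ?ys}"
      unfolding joint_def using t by (intro prob_Pi_pmf_indep) auto
    also have "measure_pmf.prob (pair_pmf (bernoulli_pmf (p' ?f)) (bernoulli_pmf (keep_prob ?f))) {z. case z of (a, b) \<Rightarrow> a \<and> b} = p ?f"
    proof -
      have "measure_pmf.prob (map_pmf (\<lambda>(x, y). x \<and> y) (pair_pmf (bernoulli_pmf (p' ?f)) (bernoulli_pmf (keep_prob ?f)))) {True} = p ?f"
        using keep_prob[of ?f] p[of ?f] t by (subst bernoulli_conj) (auto simp: measure_pmf_single)
      then show ?thesis by (simp add: vimage_def case_prod_beta)
    qed
    also have "measure_pmf.prob joint {Z. \<not> blocked Fs r (fst \<circ> Z) ?f ?ys} = measure_pmf.prob (map_pmf (\<lambda>Z. fst \<circ> Z) joint) (- {Y. blocked Fs r Y ?f ?ys})"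
      by (simp add: vimage_def Compl_eq)
    also have "\<dots> = 1 - \<beta> ?f ?ys"
      unfolding map_joint_fst block_prob_eq[OF finite_lessThan ys] by (subst measure_pmf.prob_compl[symmetric]) (auto simp: Compl_eq_Diff_UNIV)
    finally show ?thesis using True by (simp add: measure_eq_expectation useful_def case_prod_beta comp_def)
  qed (simp add: useful_def)
  then show ?thesis
    unfolding good_def
    by (subst Bochner_Integration.integral_sum) (auto intro!: integrable_measure_pmf_finite sum.cong simp: v_def)
qed

abbreviation reward_of :: "nat list \<Rightarrow> nat set \<Rightarrow> real" where
  "reward_of es Q \<equiv> measure_pmf.expectation actual (\<lambda>X. sum w (finish Fs Q X es))"

text \<open>\<open>G\<close> is the loss between unblocked and chosen elements: 1 for matroids and
  \<open>4 * \<kappa>\<close> for \<open>k\<close>-systems.\<close>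

lemma good_le_reward:
  assumes xs: "scanned n (fst \<sigma>)"
    and G: "\<And>Z. (\<Sum>t\<in>{t. t < n \<and> useful \<sigma> Z t}. w (ord t)) \<le> G * sum w (finish Fs (snd \<sigma>) (\<lambda>e. fst (Z e) \<and> snd (Z e)) es)"
  shows "good \<sigma> \<le> G * reward_of es (snd \<sigma>)"
proof -
  have "good \<sigma> = measure_pmf.expectation joint (\<lambda>Z. \<Sum>t<n. w (ord t) * of_bool (useful \<sigma> Z t))"
    by (rule expectation_useful[OF xs, symmetric])
  also have "\<dots> \<le> measure_pmf.expectation joint (\<lambda>Z. G * sum w (finish Fs (snd \<sigma>) (\<lambda>e. fst (Z e) \<and> snd (Z e)) es))"
  proof (rule expectation_mono_finite)
    fix Z
    have "(\<Sum>t<n. w (ord t) * of_bool (useful \<sigma> Z t)) = (\<Sum>t\<in>{t. t < n \<and> useful \<sigma> Z t}. w (ord t))"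
      by (intro sum.mono_neutral_cong_right) auto
    then show "(\<Sum>t<n. w (ord t) * of_bool (useful \<sigma> Z t)) \<le> G * sum w (finish Fs (snd \<sigma>) (\<lambda>e. fst (Z e) \<and> snd (Z e)) es)"
      using G by simp
  qed simp
  also have "\<dots> = G * measure_pmf.expectation (map_pmf (\<lambda>Z e. fst (Z e) \<and> snd (Z e)) joint) (\<lambda>X. sum w (finish Fs (snd \<sigma>) X es))"
    by simp
  finally show ?thesis unfolding map_joint_conj .
qed

lemma lp_le_reward:
  fixes C Co G :: real
  assumes x: "lp x" and oc: "\<And>x. lp x \<Longrightarrow> \<exists>oc. charge x oc Co"
    and Co: "0 \<le> Co" and C: "4 * D * \<kappa> * length Fs + Co + 1 \<le> C" and big: "32 * n * C \<le> M"
    and G: "\<And>\<sigma> Z. \<sigma> \<in> set_pmf (chain n) \<Longrightarrow>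
      (\<Sum>t\<in>{t. t < n \<and> useful \<sigma> Z t}. w (ord t)) \<le> G * sum w (finish Fs (snd \<sigma>) (\<lambda>e. fst (Z e) \<and> snd (Z e)) es)"
  shows "(\<Sum>e<n. x e * v e) \<le> 16 * C * G * measure_pmf.expectation (chain n) (\<lambda>\<sigma>. reward_of es (snd \<sigma>))"
proof -
  have C0: "0 \<le> C" using C Co D by (simp add: order.trans[rotated])
  have "(\<Sum>e<n. x e * v e) \<le> 16 * C * measure_pmf.expectation (chain n) good"
    by (rule lp_le_good[OF x oc Co C big])
  also have "\<dots> \<le> 16 * C * measure_pmf.expectation (chain n) (\<lambda>\<sigma>. G * reward_of es (snd \<sigma>))"
    using C0 by (intro mult_left_mono expectation_mono_finite good_le_reward G scanned_chain) auto
  finally show ?thesis by (simp add: mult_ac)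
qed

end

section \<open>Matroid constraints\<close>

locale matroid_planner = planner +
  assumes mi: "\<And>F. F \<in> set Fs \<Longrightarrow> matroid {..<n} F" and mo: "\<And>F. F \<in> set Os \<Longrightarrow> matroid {..<n} F"
    and one_class: "\<And>e f. r e = r f"
begin

text \<open>The elements chosen before \<open>f\<close> belong to \<open>Q\<close>, hence to the
  accepted list, and are simulated active. If they spanned \<open>f\<close> in some family, so would
  the greedy set of the simulated active predecessors, which is a basis of these, and
  \<open>f\<close> would be blocked.\<close>

lemma useful_finish:
  assumes \<sigma>: "\<sigma> \<in> set_pmf (chain n)" and t: "t < n" and u: "useful \<sigma> Z t"
  shows "ord t \<in> finish Fs (snd \<sigma>) (\<lambda>e. fst (Z e) \<and> snd (Z e)) (map ord [0..<n])"
proof -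
  let ?S = "\<lambda>t. finish Fs (snd \<sigma>) (\<lambda>e. fst (Z e) \<and> snd (Z e)) (map ord [0..<t])"
  have sc: "scanned n (fst \<sigma>)" using scanned_chain[OF \<sigma>] .
  have ind: "?S s \<in> F" if "F \<in> set Fs" for s F
    using that inner(2)[OF that] by (induction s) (auto simp: finish_snoc intro: downward_closedD[OF inner(1)])
  have new: "ord s \<notin> ?S s" if "s < n" for s
  proof
    assume "ord s \<in> ?S s"
    then have "ord s \<in> ord ` {..<s}"
      using finish_subset[of Fs "snd \<sigma>" "\<lambda>e. fst (Z e) \<and> snd (Z e)" "map ord [0..<s]"] by auto
    then show False using that by auto
  qed
  have "ord t \<in> ?S (Suc t)"
  proof -
    have "insert (ord t) (?S t) \<in> F" if F: "F \<in> set Fs" for F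
    proof (rule ccontr)
      let ?Z = "greedy F (cand (fst \<circ> Z) r (ord t) (pre t (fst \<sigma>)))" and ?T = "set (cand (fst \<circ> Z) r (ord t) (pre t (fst \<sigma>)))"
      assume no: "insert (ord t) (?S t) \<notin> F"
      have d: "distinct (cand (fst \<circ> Z) r (ord t) (pre t (fst \<sigma>)))"
        using scanned_distinct[OF sc] unfolding cand_def pre_def by simp
      have ST: "?S t \<subseteq> ?T"
      proof
        fix e assume "e \<in> ?S t"
        then have "e \<in> snd \<sigma>" "fst (Z e)" "e \<in> ord ` {..<t}"
          using finish_subset[of Fs "snd \<sigma>" "\<lambda>e. fst (Z e) \<and> snd (Z e)" "map ord [0..<t]"] by auto
        then show "e \<in> ?T" using chain_inv[OF \<sigma>] one_class[of e "ord t"] by (auto simp: cand_def pre_def)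
      qed
      have "ord t \<notin> ?Z" using greedy_subset[of F "cand (fst \<circ> Z) r (ord t) (pre t (fst \<sigma>))"] t
        by (auto simp: cand_def pre_def)
      then have "insert (ord t) ?Z \<notin> F"
        using matroid_span_maximal[OF mi[OF F] greedy_indep[OF inner(1,2)[OF F]] greedy_subset
            greedy_maximal[OF inner(1)[OF F] d] ind[OF F] ST no] by blast
      then show False using u F unfolding useful_def blocked_def by blast
    qed
    then show ?thesis using u by (simp add: finish_snoc useful_def)
  qed
  \<comment> \<open>Once chosen, an element stays: the removal in \<open>finish\<close> only
    concerns the element just scanned, which is new.\<close>
  moreover have "?S (Suc t) \<subseteq> ?S s" if "Suc t \<le> s" "s \<le> n" for s
    using that
  proof (induction s rule: dec_induct)
    case (step s)
    have "?S s \<subseteq> ?S (Suc s)"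
      unfolding upt_Suc_append[OF zero_le] map_append list.map finish_snoc using new[of s] step.prems by auto
    then show ?case using step by (meson Suc_leD order_trans)
  qed simp
  ultimately show ?thesis using t by (meson Suc_leI order_refl subsetD)
qed

text \<open>The bottleneck value of \<open>f\<close>: the highest value \<open>v a\<close> in
  \<open>xs\<close> such that the elements of \<open>xs\<close> worth at least \<open>v a\<close>
  span \<open>f\<close>, and 0 if there is none. It refers to the accepted list, which only grows,
  and not to \<open>Q\<close>.\<close>

definition span_weight :: "nat set set \<Rightarrow> nat list \<Rightarrow> nat \<Rightarrow> real" where
  "span_weight F xs f =
     Max (insert 0 (v ` {a\<in>set xs. \<exists>Z\<in>F. Z \<subseteq> {b\<in>set xs. v a \<le> v b} \<and> insert f Z \<notin> F}))"

lemma span_weight_nonneg: "0 \<le> span_weight F xs f"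
  unfolding span_weight_def by (intro Max_ge) auto

lemma span_weight_ge:
  "a \<in> set xs \<Longrightarrow> Z \<in> F \<Longrightarrow> Z \<subseteq> {b\<in>set xs. v a \<le> v b} \<Longrightarrow> insert f Z \<notin> F \<Longrightarrow> v a \<le> span_weight F xs f"
  unfolding span_weight_def by (intro Max_ge) auto

lemma span_weightE:
  assumes "0 < \<theta>" "\<theta> \<le> span_weight F xs f"
  obtains Z where "Z \<in> F" "Z \<subseteq> {b\<in>set xs. \<theta> \<le> v b}" "insert f Z \<notin> F"
proof -
  let ?A = "{a\<in>set xs. \<exists>Z\<in>F. Z \<subseteq> {b\<in>set xs. v a \<le> v b} \<and> insert f Z \<notin> F}"
  have "span_weight F xs f \<in> insert 0 (v ` ?A)" unfolding span_weight_def by (intro Max_in) auto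
  then obtain a where "a \<in> ?A" "span_weight F xs f = v a" using assms by auto
  then show ?thesis using that assms by force
qed

text \<open>An inadmissible \<open>f\<close> without impossible exchanges is worth at most twice the
  sum of its rivals. A rival is the cheapest element of the fundamental circuit of \<open>f\<close>
  in \<open>Q\<close>, so it is worth at most the bottleneck value. For the total, a maximal
  independent set of the accepted elements above a level blocks every \<open>f\<close> whose
  bottleneck value reaches this level, and \<open>lp\<close> bounds their mass.\<close>

lemma outer_charge:
  assumes x: "lp x"
  shows "charge x (\<lambda>xs f. \<Sum>F\<in>set Os. x f * (2 * span_weight F xs f)) (2 * \<kappa>' * length Os)"
  unfolding charge_def
proof (intro conjI allI ballI impI)
  fix xs f
  show "0 \<le> (\<Sum>F\<in>set Os. x f * (2 * span_weight F xs f))"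
    using lp_nonneg[OF x] span_weight_nonneg by (intro sum_nonneg) simp
next
  fix t \<sigma> assume t: "t < n" and \<sigma>: "\<sigma> \<in> set_pmf (chain t)" and na: "\<not> admissible v n Os (snd \<sigma>) (ord t)"
  let ?f = "ord t" and ?Q = "snd \<sigma>"
  have inv: "?Q \<subseteq> set (fst \<sigma>)" "\<And>F. F \<in> set Os \<Longrightarrow> ?Q \<in> F" using chain_inv[OF \<sigma>] t by auto
  have Qn: "?Q \<subseteq> {..<n}" using inv(1) scanned_ground[OF scanned_chain[OF \<sigma>]] t by auto
  have rival: "rival v n F ?Q ?f = n \<and> {?f} \<notin> F \<or>
      rival v n F ?Q ?f \<in> ?Q \<and> v (rival v n F ?Q ?f) \<le> span_weight F (fst \<sigma>) ?f"
    if F: "F \<in> set Os" "insert ?f ?Q \<notin> F" for F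
  proof -
    let ?R = "{j\<in>?Q. j < n \<and> insert ?f (?Q - {j}) \<in> F}"
    consider "?R = {}" "rival v n F ?Q ?f = n" | "rival v n F ?Q ?f \<in> ?R" "\<forall>j\<in>?R. v (rival v n F ?Q ?f) \<le> v j"
      using rival_cases[of ?Q n ?f F v] by blast
    then show ?thesis
    proof cases
      case 1
      have "insert ?f {} \<notin> F"
      proof (rule matroid_no_exchange[OF mo[OF F(1)] inv(2)[OF F(1)] F(2)])
        fix e assume "e \<in> ?Q - {}"
        then have "e \<in> ?Q" "e < n" using Qn by auto
        then show "insert ?f (?Q - {e}) \<notin> F" using 1(1) by blast
      qed simp
      then show ?thesis using 1 by simp
    next
      case 2
      \<comment> \<open>\<open>?Z\<close> contains the whole circuit except \<open>f\<close>: a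
        cheaper element of \<open>Q\<close> is not exchangeable, because the rival has the least
        value.\<close>
      let ?Z = "{b\<in>?Q. v (rival v n F ?Q ?f) \<le> v b}"
      have "insert ?f ?Z \<notin> F"
      proof (rule matroid_no_exchange[OF mo[OF F(1)] inv(2)[OF F(1)] F(2)])
        fix e assume "e \<in> ?Q - ?Z"
        then have "e \<in> ?Q" "e < n" "\<not> v (rival v n F ?Q ?f) \<le> v e" using Qn by auto
        then show "insert ?f (?Q - {e}) \<notin> F" using 2(2) by blast
      qed simp
      moreover have "?Z \<in> F" by (rule downward_closedD[OF outer(1)[OF F(1)] inv(2)[OF F(1)]]) auto
      ultimately show ?thesis using 2(1) inv(1) by (auto intro!: span_weight_ge[where Z = ?Z])
    qed
  qed
  show "x ?f * v ?f \<le> (\<Sum>F\<in>set Os. x ?f * (2 * span_weight F (fst \<sigma>) ?f))"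
  proof (cases "n \<in> conflicts v n Os ?Q ?f")
    case True
    then obtain F where F: "F \<in> set Os" "insert ?f ?Q \<notin> F" "rival v n F ?Q ?f = n" unfolding conflicts_def by auto
    then have "{?f} \<notin> F" using rival[OF F(1,2)] Qn by auto
    then have "\<forall>f\<in>{?f} - {}. insert f {} \<notin> F" by simp
    moreover have "\<forall>B\<subseteq>{..<n}. \<forall>Z\<in>F. (\<forall>f\<in>B - Z. insert f Z \<notin> F) \<longrightarrow> (\<Sum>f\<in>B. x f) \<le> \<kappa>' * card Z"
      using x F(1) unfolding lp_def by simp
    moreover have "{?f} \<subseteq> {..<n}" using t by simp
    ultimately have "(\<Sum>f\<in>{?f}. x f) \<le> \<kappa>' * card ({} :: nat set)"
      using outer(2)[OF F(1)] by metis
    \<comment> \<open>If no exchange helps, \<open>f\<close> is dependent on its own; then the empty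
      set blocks it and \<open>lp\<close> leaves it no mass.\<close>
    then have "x ?f = 0" using lp_nonneg[OF x, of ?f] by simp
    then show ?thesis by simp
  next
    case False
    let ?Fs = "{F \<in> set Os. insert ?f ?Q \<notin> F}"
    have "v ?f \<le> 2 * sum v (conflicts v n Os ?Q ?f)" using na False unfolding admissible_def by simp
    also have "sum v (conflicts v n Os ?Q ?f) \<le> (\<Sum>F\<in>?Fs. v (rival v n F ?Q ?f))"
      unfolding conflicts_def
    proof (rule sum_image_le[of ?Fs v "\<lambda>F. rival v n F ?Q ?f", unfolded comp_def])
      fix F assume "F \<in> ?Fs"
      then have "rival v n F ?Q ?f \<in> conflicts v n Os ?Q ?f" unfolding conflicts_def by auto
      then show "0 \<le> v (rival v n F ?Q ?f)" using conflicts_subset(2)[OF False] v_nonneg by auto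
    qed simp
    also have "\<dots> \<le> (\<Sum>F\<in>?Fs. span_weight F (fst \<sigma>) ?f)"
    proof (rule sum_mono)
      fix F assume F: "F \<in> ?Fs"
      then have "rival v n F ?Q ?f \<in> conflicts v n Os ?Q ?f" unfolding conflicts_def by auto
      then show "v (rival v n F ?Q ?f) \<le> span_weight F (fst \<sigma>) ?f" using rival[of F] F False by auto
    qed
    also have "\<dots> \<le> (\<Sum>F\<in>set Os. span_weight F (fst \<sigma>) ?f)"
      by (intro sum_mono2 span_weight_nonneg) auto
    finally have "v ?f \<le> 2 * (\<Sum>F\<in>set Os. span_weight F (fst \<sigma>) ?f)" by simp
    then have "x ?f * v ?f \<le> x ?f * (2 * (\<Sum>F\<in>set Os. span_weight F (fst \<sigma>) ?f))"
      using lp_nonneg[OF x] by (rule mult_left_mono)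
    then show ?thesis by (simp add: sum_distrib_left)
  qed
next
  fix \<sigma> assume "\<sigma> \<in> set_pmf (chain n)"
  define xs where "xs = fst \<sigma>"
  have xs: "scanned n xs" unfolding xs_def using \<open>\<sigma> \<in> set_pmf (chain n)\<close> by (rule scanned_chain)
  have per: "(\<Sum>t\<in>{..<n}. x (ord t) * span_weight F (pre t xs) (ord t)) \<le> \<kappa>' * (\<Sum>a\<in>set xs. v a)" if F: "F \<in> set Os" for F
  proof (rule layer_cake)
    fix \<theta> :: real assume \<theta>: "0 < \<theta>"
    let ?B = "{t\<in>{..<n}. \<theta> \<le> span_weight F (pre t xs) (ord t)}" and ?T = "{a\<in>set xs. \<theta> \<le> v a}"
    define Z where "Z = greedy F (filter (\<lambda>a. \<theta> \<le> v a) xs)"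
    have Z: "Z \<in> F" "Z \<subseteq> ?T" unfolding Z_def using greedy_indep[OF outer(1,2)[OF F]] greedy_subset by fastforce+
    have max: "insert a Z \<notin> F" if "a \<in> ?T" "a \<notin> Z" for a
      using that greedy_maximal[OF outer(1)[OF F], of "filter (\<lambda>a. \<theta> \<le> v a) xs"] scanned_distinct[OF xs] unfolding Z_def by auto
    have "insert f Z \<notin> F" if f: "f \<in> ord ` ?B - Z" for f
    proof -
      obtain t where t: "t < n" "f = ord t" "\<theta> \<le> span_weight F (pre t xs) f" using f by auto
      obtain S where S: "S \<in> F" "S \<subseteq> {b\<in>set (pre t xs). \<theta> \<le> v b}" "insert f S \<notin> F"
        using span_weightE[OF \<theta> t(3)] .
      have "S \<subseteq> ?T" using S(2) unfolding pre_def by auto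
      then show ?thesis using f by (intro matroid_span_maximal[OF mo[OF F] Z max S(1) _ S(3)]) auto
    qed
    then have "(\<Sum>f\<in>ord ` ?B. x f) \<le> \<kappa>' * card Z"
    proof -
      have sub: "ord ` ?B \<subseteq> {..<n}" by auto
      assume "\<And>f. f \<in> ord ` ?B - Z \<Longrightarrow> insert f Z \<notin> F"
      then have "\<forall>f\<in>ord ` ?B - Z. insert f Z \<notin> F" by blast
      then show ?thesis using x F Z(1) sub unfolding lp_def by simp
    qed
    moreover have "card Z \<le> card ?T" using Z(2) by (intro card_mono) auto
    moreover have "inj_on ord ?B" by (auto simp: inj_on_def)
    ultimately show "(\<Sum>t\<in>?B. x (ord t)) \<le> real \<kappa>' * real (card ?T)"
      by (simp add: sum.reindex) (meson mult_left_mono of_nat_0_le_iff of_nat_mono order_trans)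
  qed (use span_weight_nonneg v_nonneg scanned_ground[OF xs] in auto)
  have v0: "0 \<le> sum v (set xs)" using scanned_ground[OF xs] v_nonneg by (intro sum_nonneg) auto
  have "(\<Sum>t<n. \<Sum>F\<in>set Os. x (ord t) * (2 * span_weight F (pre t xs) (ord t))) =
      2 * (\<Sum>F\<in>set Os. \<Sum>t\<in>{..<n}. x (ord t) * span_weight F (pre t xs) (ord t))"
    by (subst sum.swap) (simp add: sum_distrib_left mult_ac)
  also have "\<dots> \<le> 2 * (\<Sum>F\<in>set Os. \<kappa>' * (\<Sum>a\<in>set xs. v a))" by (intro mult_left_mono sum_mono per) auto
  also have "\<dots> = 2 * \<kappa>' * card (set Os) * sum v (set xs)" by simp
  also have "\<dots> \<le> 2 * \<kappa>' * length Os * sum v (set xs)"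
    using v0 card_length[of Os] by (intro mult_right_mono) (auto intro: mult_left_mono)
  finally show "(\<Sum>t<n. \<Sum>F\<in>set Os. x (ord t) * (2 * span_weight F (pre t (fst \<sigma>)) (ord t))) \<le> 2 * \<kappa>' * length Os * sum v (set (fst \<sigma>))"
    unfolding xs_def .
qed

theorem matroid_guarantee:
  fixes C :: real
  assumes x: "lp x" and C: "4 * D * \<kappa> * length Fs + 2 * \<kappa>' * length Os + 1 \<le> C" and big: "32 * n * C \<le> M"
  shows "(\<Sum>e<n. x e * v e) \<le> 16 * C * measure_pmf.expectation (chain n) (\<lambda>\<sigma>. reward_of (map ord [0..<n]) (snd \<sigma>))"
proof -
  have "(\<Sum>e<n. x e * v e) \<le> 16 * C * 1 * measure_pmf.expectation (chain n) (\<lambda>\<sigma>. reward_of (map ord [0..<n]) (snd \<sigma>))"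
  proof (rule lp_le_reward[OF x _ _ _ big])
    fix \<sigma> Z assume \<sigma>: "\<sigma> \<in> set_pmf (chain n)"
    let ?S = "finish Fs (snd \<sigma>) (\<lambda>e. fst (Z e) \<and> snd (Z e)) (map ord [0..<n])"
    have S: "?S \<subseteq> {..<n}" using finish_subset[of Fs "snd \<sigma>" _ "map ord [0..<n]"] by fastforce
    have "(\<Sum>t\<in>{t. t < n \<and> useful \<sigma> Z t}. w (ord t)) = sum w (ord ` {t. t < n \<and> useful \<sigma> Z t})"
      by (subst sum.reindex) (auto simp: inj_on_def)
    also have "\<dots> \<le> sum w ?S"
      using S w useful_finish[OF \<sigma>] by (intro sum_mono2) (auto intro: finite_subset)
    finally show "(\<Sum>t\<in>{t. t < n \<and> useful \<sigma> Z t}. w (ord t)) \<le> 1 * sum w ?S" by simp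
  qed (use outer_charge C in auto)
  then show ?thesis by simp
qed

end

section \<open>Constraints that are \<open>k\<close>-systems\<close>

text \<open>Two orders: planning follows \<open>ord\<close> by decreasing value \<open>v\<close>,
  probing follows \<open>es\<close> by decreasing weight. \<open>r e\<close> is the weight of the
  leader of the class of \<open>e\<close>, and distinct classes differ by a factor of at least
  2.\<close>

locale system_planner = planner M n "[Fi]" "[Fo]" r p p' w ord \<kappa> \<kappa>' 2
  for M n Fi Fo and r :: "nat \<Rightarrow> real" and p p' w ord \<kappa> \<kappa>' +
  fixes es :: "nat list"
  assumes desc: "\<And>s t. s < t \<Longrightarrow> t < n \<Longrightarrow> p (ord t) * w (ord t) \<le> p (ord s) * w (ord s)"
    and es: "distinct es" "set es = {..<n}" "sorted_wrt (\<lambda>e f. w f \<le> w e) es"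
    and r: "\<And>e. e < n \<Longrightarrow> w e \<le> r e" "\<And>e. e < n \<Longrightarrow> r e \<le> 2 * w e"
      "\<And>e f. e < n \<Longrightarrow> f < n \<Longrightarrow> r e < r f \<Longrightarrow> 2 * r e \<le> r f"
begin

lemma v_desc: "s < t \<Longrightarrow> t < n \<Longrightarrow> v (ord t) \<le> v (ord s)"
  using desc unfolding v_def .

text \<open>The elements of \<open>Q\<close> were scanned earlier and are worth at least
  \<open>v f\<close>, so a nonempty set of conflicts would fail the exchange test.\<close>

lemma snd_chain:
  assumes "\<sigma> \<in> set_pmf (chain t)" "t \<le> n"
  shows "snd \<sigma> = set (fst \<sigma>)"
  using assms
proof (induction t arbitrary: \<sigma>)
  case (Suc t)
  then obtain \<sigma>' where s: "\<sigma>' \<in> set_pmf (chain t)" "\<sigma> \<in> set_pmf (plan_step M n [Fi] [Fo] r p' v (ord t) \<sigma>')" by auto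
  have IH: "snd \<sigma>' = set (fst \<sigma>')" using Suc s(1) by simp
  from s(2) show ?case
  proof (rule plan_stepE)
    assume "\<sigma> = \<sigma>'" then show ?thesis using IH by simp
  next
    let ?K = "conflicts v n [Fo] (snd \<sigma>') (ord t)"
    assume v: "0 < v (ord t)" and adm: "admissible v n [Fo] (snd \<sigma>') (ord t)" and \<sigma>: "\<sigma> = admit v n [Fo] (ord t) \<sigma>'"
    have nK: "n \<notin> ?K" and lt: "2 * sum v ?K < v (ord t)" using adm by (auto simp: admissible_def)
    have "?K = {}"
    proof (rule ccontr)
      assume "?K \<noteq> {}"
      then obtain e where e: "e \<in> ?K" by auto
      have sub: "?K \<subseteq> {..<n}" using conflicts_subset(2)[OF nK] .
      have "e \<in> set (fst \<sigma>')" using e conflicts_subset(1)[OF nK] IH by auto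
      then obtain s where "e = ord s" "s < t" using scanned_set[OF scanned_chain[OF s(1)]] by auto
      then have "v (ord t) \<le> v e" using v_desc Suc.prems by simp
      also have "v e \<le> sum v ?K" using e sub v_nonneg by (intro member_le_sum) (auto intro: finite_subset)
      finally show False using lt v by linarith
    qed
    then show ?thesis using \<sigma> adm IH by (simp add: admit_def)
  qed
qed simp

text \<open>The whole accepted list is outer independent. If \<open>f\<close> is worth at least
  \<theta>, so is every accepted predecessor; hence the part of the list above \<theta> blocks every
  rejected \<open>f\<close> of this level.\<close>

lemma outer_charge:
  assumes x: "lp x"
  shows "charge x (\<lambda>xs f. x f * v f * of_bool (insert f (set xs) \<notin> Fo)) \<kappa>'"
  unfolding charge_def
proof (intro conjI allI ballI impI)
  fix xs f assume "f < n"
  then show "0 \<le> x f * v f * of_bool (insert f (set xs) \<notin> Fo)" using lp_nonneg[OF x] v_nonneg by simp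
next
  fix t \<sigma> assume t: "t < n" and \<sigma>: "\<sigma> \<in> set_pmf (chain t)" and v: "0 < v (ord t)" and na: "\<not> admissible v n [Fo] (snd \<sigma>) (ord t)"
  have "insert (ord t) (set (fst \<sigma>)) \<notin> Fo"
  proof
    assume "insert (ord t) (set (fst \<sigma>)) \<in> Fo"
    then have "conflicts v n [Fo] (snd \<sigma>) (ord t) = {}" using snd_chain[OF \<sigma>] t unfolding conflicts_def by simp
    then show False using na v unfolding admissible_def by simp
  qed
  then show "x (ord t) * v (ord t) \<le> x (ord t) * v (ord t) * of_bool (insert (ord t) (set (fst \<sigma>)) \<notin> Fo)" by simp
next
  fix \<sigma> assume \<sigma>: "\<sigma> \<in> set_pmf (chain n)"
  define xs where "xs = fst \<sigma>"
  have xs: "scanned n xs" unfolding xs_def using \<sigma> by (rule scanned_chain)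
  have xsF: "set xs \<in> Fo" using chain_inv[OF \<sigma>] snd_chain[OF \<sigma>] unfolding xs_def by simp
  have dc: "downward_closed {..<n} Fo" using outer(1) by simp
  let ?N = "{t. t < n \<and> insert (ord t) (set (pre t xs)) \<notin> Fo}"
  have "(\<Sum>t\<in>?N. x (ord t) * v (ord t)) \<le> \<kappa>' * (\<Sum>a\<in>set xs. v a)"
  proof (rule layer_cake)
    fix \<theta> :: real
    let ?B = "{t\<in>?N. \<theta> \<le> v (ord t)}" and ?T = "{a\<in>set xs. \<theta> \<le> v a}"
    have T: "?T \<in> Fo" by (rule downward_closedD[OF dc xsF]) auto
    have "insert f ?T \<notin> Fo" if "f \<in> ord ` ?B - ?T" for f
    proof
      assume ins: "insert f ?T \<in> Fo"
      obtain t where t: "t < n" "insert f (set (pre t xs)) \<notin> Fo" "f = ord t" "\<theta> \<le> v f" using \<open>f \<in> ord ` ?B - ?T\<close> by auto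
      have "set (pre t xs) \<subseteq> ?T" using t v_desc[of _ t] by (auto simp: pre_def intro: order.trans)
      then show False using downward_closedD[OF dc ins, of "insert f (set (pre t xs))"] t(2) by blast
    qed
    then have "\<forall>f\<in>ord ` ?B - ?T. insert f ?T \<notin> Fo" by blast
    moreover have "ord ` ?B \<subseteq> {..<n}" by auto
    ultimately have "(\<Sum>f\<in>ord ` ?B. x f) \<le> \<kappa>' * card ?T" using x T unfolding lp_def by simp
    moreover have "inj_on ord ?B" by (auto simp: inj_on_def)
    ultimately show "(\<Sum>t\<in>?B. x (ord t)) \<le> real \<kappa>' * real (card ?T)" by (simp add: sum.reindex)
  qed (use v_nonneg scanned_ground[OF xs] in auto)
  moreover have "(\<Sum>t<n. x (ord t) * v (ord t) * of_bool (insert (ord t) (set (pre t xs)) \<notin> Fo)) = (\<Sum>t\<in>?N. x (ord t) * v (ord t))"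
    by (intro sum.mono_neutral_cong_right) auto
  ultimately show "(\<Sum>t<n. x (ord t) * v (ord t) * of_bool (insert (ord t) (set (pre t (fst \<sigma>))) \<notin> Fo)) \<le> \<kappa>' * sum v (set (fst \<sigma>))"
    unfolding xs_def by simp
qed

text \<open>Two greedy runs are compared. The useful elements of a class lie in the simulated greedy
  set of the class, so they form an independent set. A useful element that is not chosen was refused
  because of chosen elements of at least its weight, which is at least \<open>c / 2\<close>. So the
  chosen elements of at least that weight block the useful ones.\<close>

lemma card_useful_class_le:
  fixes Z :: "nat \<Rightarrow> bool \<times> bool"
  assumes \<sigma>: "\<sigma> \<in> set_pmf (chain n)"
  defines "S \<equiv> finish [Fi] (snd \<sigma>) (\<lambda>e. fst (Z e) \<and> snd (Z e)) es"
  shows "card {t. t < n \<and> useful \<sigma> Z t \<and> r (ord t) = c} \<le> \<kappa> * card {s\<in>S. c \<le> 2 * w s}"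
proof -
  let ?X = "\<lambda>e. fst (Z e) \<and> snd (Z e)"
  let ?U = "ord ` {t. t < n \<and> useful \<sigma> Z t \<and> r (ord t) = c}" and ?S = "{s\<in>S. c \<le> 2 * w s}"
  have dc: "downward_closed {..<n} Fi" and emp: "{} \<in> Fi" and kb: "blocking_bound \<kappa> Fi" using inner by auto
  have sc: "scanned n (fst \<sigma>)" using scanned_chain[OF \<sigma>] .
  have d: "distinct (fst \<sigma>)" using scanned_distinct[OF sc] by simp
  define L where "L = filter (\<lambda>e. e \<in> snd \<sigma> \<and> ?X e) es"
  have S: "S = greedy Fi L" unfolding S_def L_def by (rule finish_single[OF es(1)])
  have "?S \<in> Fi" using greedy_indep[OF dc emp, of L] unfolding S by (rule downward_closedD[OF dc]) auto
  moreover have "?U \<subseteq> greedy Fi (filter (\<lambda>e. (fst \<circ> Z) e \<and> r e = c) (fst \<sigma>))"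
  proof clarify
    fix t assume t: "t < n" and u: "useful \<sigma> Z t" and c: "c = r (ord t)"
    have mem: "ord t \<in> set (fst \<sigma>)" using u chain_inv[OF \<sigma>] unfolding useful_def by auto
    obtain ys where ys: "fst \<sigma> = pre t (fst \<sigma>) @ ord t # ys"
    proof -
      obtain P where P: "fst \<sigma> = map ord (filter P [0..<n])" using sc unfolding scanned_def by blast
      have "P t" using mem P t by auto
      moreover have "[0..<n] = [0..<t] @ t # [Suc t..<n]" using t
        by (metis less_imp_add_positive upt_add_eq_append upt_conv_Cons zero_le less_or_eq_imp_le add_0)
      ultimately have "fst \<sigma> = map ord (filter P [0..<t]) @ ord t # map ord (filter P [Suc t..<n])"
        using P by simp
      moreover have "pre t (fst \<sigma>) = map ord (filter P [0..<t])" unfolding P using pre_map[of t n P] t by simp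
      ultimately show ?thesis using that by metis
    qed
    have "insert (ord t) (greedy Fi (cand (fst \<circ> Z) r (ord t) (pre t (fst \<sigma>)))) \<in> Fi"
      using u unfolding useful_def blocked_def by simp
    then have "ord t \<in> greedy Fi (cand (fst \<circ> Z) r (ord t) (pre t (fst \<sigma>)) @ [ord t])" by (simp add: greedy_snoc)
    also have "\<dots> \<subseteq> greedy Fi ((cand (fst \<circ> Z) r (ord t) (pre t (fst \<sigma>)) @ [ord t]) @ filter (\<lambda>e. (fst \<circ> Z) e \<and> r e = c) ys)"
    proof (rule greedy_append)
      have "distinct (pre t (fst \<sigma>) @ ord t # ys)" using d ys by simp
      then show "distinct ((cand (fst \<circ> Z) r (ord t) (pre t (fst \<sigma>)) @ [ord t]) @ filter (\<lambda>e. (fst \<circ> Z) e \<and> r e = c) ys)"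
        unfolding cand_def by auto
    qed
    also have "(cand (fst \<circ> Z) r (ord t) (pre t (fst \<sigma>)) @ [ord t]) @ filter (\<lambda>e. (fst \<circ> Z) e \<and> r e = c) ys =
        filter (\<lambda>e. (fst \<circ> Z) e \<and> r e = c) (fst \<sigma>)"
      using u by (subst (2) ys) (auto simp: cand_def c useful_def)
    finally show "ord t \<in> greedy Fi (filter (\<lambda>e. (fst \<circ> Z) e \<and> r e = r (ord t)) (fst \<sigma>))" unfolding c .
  qed
  then have "?U \<in> Fi" using downward_closedD[OF dc greedy_indep[OF dc emp]] by blast
  moreover have "insert f ?S \<notin> Fi" if f: "f \<in> ?U" "f \<notin> ?S" for f
  proof
    assume ins: "insert f ?S \<in> Fi"
    obtain t where t: "t < n" "useful \<sigma> Z t" "f = ord t" "r f = c" using f by auto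
    have "c \<le> 2 * w f" using r(2)[of f] t by auto
    then have fS: "f \<notin> S" using f(2) by auto
    have fes: "f \<in> set es" using es t by auto
    then obtain ys zs where yz: "es = ys @ f # zs" by (meson split_list)
    let ?P = "\<lambda>e. e \<in> snd \<sigma> \<and> ?X e"
    have Pf: "?P f" using t unfolding useful_def by simp
    have L: "L = (filter ?P ys @ [f]) @ filter ?P zs" unfolding L_def yz using Pf by simp
    have dL: "distinct L" unfolding L_def using es by simp
    have "greedy Fi (filter ?P ys @ [f]) \<subseteq> S" unfolding S L using dL L by (intro greedy_append) simp
    \<comment> \<open>\<open>f\<close> is active and in \<open>Q\<close>, so it can be missing from
      \<open>S\<close> only for lack of independence.\<close>
    then have "insert f (greedy Fi (filter ?P ys)) \<notin> Fi" using fS by (auto simp: greedy_snoc split: if_splits)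
    moreover have "greedy Fi (filter ?P ys) \<subseteq> ?S"
    proof
      fix a assume a: "a \<in> greedy Fi (filter ?P ys)"
      have "greedy Fi (filter ?P ys) \<subseteq> S"
        unfolding S L append_assoc using dL L by (intro greedy_append) simp
      moreover have "a \<in> set ys" using a greedy_subset[of Fi "filter ?P ys"] by auto
      then have "w f \<le> w a" using es(3) unfolding yz by (simp add: sorted_wrt_append)
      ultimately show "a \<in> ?S" using a \<open>c \<le> 2 * w f\<close> by auto
    qed
    ultimately show False using downward_closedD[OF dc ins, of "insert f (greedy Fi (filter ?P ys))"] by blast
  qed
  ultimately have "card ?U \<le> \<kappa> * card ?S" by (intro blocking_boundD[OF kb]) auto
  moreover have "card ?U = card {t. t < n \<and> useful \<sigma> Z t \<and> r (ord t) = c}"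
    by (rule card_image) (auto simp: inj_on_def)
  ultimately show ?thesis by simp
qed

text \<open>A chosen \<open>s\<close> is charged only by class values
  \<open>c \<le> 2 * w s\<close>. These grow at least geometrically, with sum at most
  \<open>4 * w s\<close>, so the number of classes does not enter.\<close>

lemma sum_useful_le:
  assumes \<sigma>: "\<sigma> \<in> set_pmf (chain n)"
  shows "(\<Sum>t\<in>{t. t < n \<and> useful \<sigma> Z t}. w (ord t)) \<le> 4 * \<kappa> * sum w (finish [Fi] (snd \<sigma>) (\<lambda>e. fst (Z e) \<and> snd (Z e)) es)"
proof -
  define S where "S = finish [Fi] (snd \<sigma>) (\<lambda>e. fst (Z e) \<and> snd (Z e)) es"
  have Sn: "S \<subseteq> {..<n}" unfolding S_def using finish_subset[of "[Fi]" "snd \<sigma>" _ es] es by auto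
  then have fS: "finite S" using finite_subset by auto
  let ?U = "{t. t < n \<and> useful \<sigma> Z t}" and ?C = "r ` {..<n}"
  have r0: "0 \<le> c" if "c \<in> ?C" for c using that r(1) w by force
  have "(\<Sum>t\<in>?U. w (ord t)) \<le> (\<Sum>t\<in>?U. r (ord t))" using r(1) by (intro sum_mono) auto
  also have "\<dots> = (\<Sum>c\<in>?C. \<Sum>t\<in>{t\<in>?U. r (ord t) = c}. r (ord t))"
    by (rule sum.group[symmetric]) auto
  also have "\<dots> = (\<Sum>c\<in>?C. c * card {t. t < n \<and> useful \<sigma> Z t \<and> r (ord t) = c})"
    by (intro sum.cong) (simp_all add: conj_ac)
  also have "\<dots> \<le> (\<Sum>c\<in>?C. c * (\<kappa> * card {s\<in>S. c \<le> 2 * w s}))"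
  proof (intro sum_mono mult_left_mono)
    fix c
    show "real (card {t. t < n \<and> useful \<sigma> Z t \<and> r (ord t) = c}) \<le> real (\<kappa> * card {s\<in>S. c \<le> 2 * w s})"
      using card_useful_class_le[OF \<sigma>, of Z c] unfolding S_def of_nat_le_iff .
  qed (rule r0)
  also have "\<dots> = \<kappa> * (\<Sum>c\<in>?C. \<Sum>s\<in>S. c * of_bool (c \<le> 2 * w s))"
    using fS by (simp add: sum_distrib_left mult_ac Int_def)
  also have "\<dots> = \<kappa> * (\<Sum>s\<in>S. \<Sum>c\<in>?C. c * of_bool (c \<le> 2 * w s))"
    by (subst sum.swap) simp
  also have "\<dots> \<le> \<kappa> * (\<Sum>s\<in>S. 2 * (2 * w s))"
  proof (intro mult_left_mono sum_mono)
    fix s assume "s \<in> S"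
    then have s: "0 \<le> w s" using Sn w by auto
    have "(\<Sum>c\<in>?C. c * of_bool (c \<le> 2 * w s)) = \<Sum>{c\<in>?C. c \<le> 2 * w s}"
      by (intro sum.mono_neutral_cong_right) auto
    also have "\<dots> \<le> 2 * (2 * w s)"
      using s r0 r(3) by (intro sum_geometric_le) auto
    finally show "(\<Sum>c\<in>?C. c * of_bool (c \<le> 2 * w s)) \<le> 2 * (2 * w s)" .
  qed simp
  also have "\<dots> = 4 * \<kappa> * sum w S" by (simp add: sum_distrib_left[symmetric])
  finally show ?thesis unfolding S_def .
qed

theorem system_guarantee:
  fixes C :: real
  assumes x: "lp x" and C: "8 * \<kappa> + \<kappa>' + 1 \<le> C" and big: "32 * n * C \<le> M"
  shows "(\<Sum>e<n. x e * v e) \<le> 16 * C * (4 * \<kappa>) * measure_pmf.expectation (chain n) (\<lambda>\<sigma>. reward_of es (snd \<sigma>))"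
  by (rule lp_le_reward[OF x _ _ _ big]) (use outer_charge sum_useful_le C in auto)

end

section \<open>Coin trees\<close>

text \<open>The number of coins read depends on their outcomes, so a random procedure is a tree.
  \<open>toss\<close> runs it on a tape, as the program does, and also returns the position of the
  next unread coin; \<open>tree_pmf\<close> is its distribution.\<close>

datatype 'a tree = Ret 'a | Coin "bool \<Rightarrow> 'a tree"

primrec toss :: "'a tree \<Rightarrow> (nat \<Rightarrow> bool) \<Rightarrow> nat \<Rightarrow> 'a \<times> nat" where
  "toss (Ret a) \<omega> i = (a, i)"
| "toss (Coin f) \<omega> i = toss (f (\<omega> i)) \<omega> (Suc i)"

primrec tree_pmf :: "'a tree \<Rightarrow> 'a pmf" where
  "tree_pmf (Ret a) = return_pmf a"
| "tree_pmf (Coin f) = bind_pmf (bernoulli_pmf (1/2)) (\<lambda>b. tree_pmf (f b))"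

primrec tbind :: "'a tree \<Rightarrow> ('a \<Rightarrow> 'b tree) \<Rightarrow> 'b tree" where
  "tbind (Ret a) g = g a"
| "tbind (Coin f) g = Coin (\<lambda>b. tbind (f b) g)"

lemma toss_tbind: "toss (tbind t g) \<omega> i = (case toss t \<omega> i of (a, j) \<Rightarrow> toss (g a) \<omega> j)"
  by (induction t arbitrary: i) auto

lemma dist_tbind: "tree_pmf (tbind t g) = bind_pmf (tree_pmf t) (\<lambda>a. tree_pmf (g a))"
  by (induction t) (auto simp: bind_return_pmf bind_assoc_pmf)

lemma toss_cong: "(\<And>j. i \<le> j \<Longrightarrow> \<omega> j = \<omega>' j) \<Longrightarrow> toss t \<omega> i = toss t \<omega>' i"
  by (induction t arbitrary: i) auto

lemma toss_mono: "i \<le> snd (toss t \<omega> i)"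
proof (induction t arbitrary: i)
  case (Coin f)
  then show ?case using Suc_leD by (metis rangeI toss.simps(2))
qed simp

text \<open>Induction over the tree: the first coin is independent of the rest of the tape, and the
  subtrees read only the rest. The bound on the positions guarantees that the finite tape
  suffices.\<close>

lemma map_toss_Pi_pmf:
  assumes "i \<le> T" "\<And>\<omega>. snd (toss t \<omega> i) \<le> T"
  shows "map_pmf (\<lambda>\<omega>. fst (toss t \<omega> i)) (Pi_pmf {i..<T} False (\<lambda>_. bernoulli_pmf (1/2))) = tree_pmf t"
  using assms
proof (induction t arbitrary: i)
  case (Coin f)
  let ?P = "Pi_pmf {Suc i..<T} False (\<lambda>_. bernoulli_pmf (1/2))"
  have "snd (toss (f True) (\<lambda>_. True) (Suc i)) \<le> T" using Coin.prems(2)[of "\<lambda>_. True"] by simp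
  then have i: "Suc i \<le> T" using toss_mono[of "Suc i" "f True" "\<lambda>_. True"] by simp
  have upd: "toss (f b) (fun_upd \<omega> i c) (Suc i) = toss (f b) \<omega> (Suc i)" for b c \<omega>
    by (rule toss_cong) auto
  have IH: "map_pmf (\<lambda>\<omega>. fst (toss (f b) \<omega> (Suc i))) ?P = tree_pmf (f b)" for b
  proof (rule Coin.IH[OF _ i])
    fix \<omega>
    show "snd (toss (f b) \<omega> (Suc i)) \<le> T" using Coin.prems(2)[of "fun_upd \<omega> i b"]
      by (simp only: toss.simps fun_upd_same upd)
  qed simp
  have "{i..<T} = insert i {Suc i..<T}" using i by auto
  then have "Pi_pmf {i..<T} False (\<lambda>_. bernoulli_pmf (1/2)) =
      do {b \<leftarrow> bernoulli_pmf (1/2); \<omega> \<leftarrow> ?P; return_pmf (fun_upd \<omega> i b)}"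
    by (simp add: Pi_pmf_insert')
  then have "map_pmf (\<lambda>\<omega>. fst (toss (Coin f) \<omega> i)) (Pi_pmf {i..<T} False (\<lambda>_. bernoulli_pmf (1/2))) =
      do {b \<leftarrow> bernoulli_pmf (1/2); map_pmf (\<lambda>\<omega>. fst (toss (f b) \<omega> (Suc i))) ?P}"
    by (simp add: map_bind_pmf upd map_pmf_def bind_assoc_pmf bind_return_pmf)
  then show ?case by (simp add: IH)
qed (simp add: map_pmf_const)

lemma map_toss_coin_tape:
  assumes "\<And>\<omega>. snd (toss t \<omega> 0) \<le> T"
  shows "map_pmf (\<lambda>\<omega>. fst (toss t \<omega> 0)) (coin_tape T) = tree_pmf t"
  using map_toss_Pi_pmf[of 0 T t] assms unfolding coin_tape_def by (simp add: atLeast0LessThan)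

section \<open>Sizes of rational numbers\<close>

text \<open>The fraction need not be reduced, so sums and products can be bounded without
  normalising. By \<open>small_bits\<close> reduction only helps; numerator and denominator together
  give the factor 2 there.\<close>

definition small :: "nat \<Rightarrow> rat \<Rightarrow> bool" where
  "small k r \<longleftrightarrow> (\<exists>a b. r = of_int a / of_int b \<and> 0 < b \<and> \<bar>a\<bar> < 2 ^ k \<and> b < 2 ^ k)"

lemma small_mono: "small k r \<Longrightarrow> k \<le> l \<Longrightarrow> small l r"
proof -
  assume "small k r" "k \<le> l"
  then obtain a b where ab: "r = of_int a / of_int b" "0 < b" "\<bar>a\<bar> < 2 ^ k" "b < 2 ^ k" unfolding small_def by auto
  have "(2::int) ^ k \<le> 2 ^ l" using \<open>k \<le> l\<close> by (intro power_increasing) auto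
  then have "\<bar>a\<bar> < 2 ^ l" "b < 2 ^ l" using ab by linarith+
  then show ?thesis unfolding small_def using ab by blast
qed

lemma bitlen_less: "bitlen x \<le> int k \<Longrightarrow> x < 2 ^ k"
proof -
  assume a: "bitlen x \<le> int k"
  have "x < 2 ^ nat (bitlen x)"
  proof (cases "0 < x")
    case True
    then show ?thesis using bitlen_bounds[of x] by simp
  next
    case False
    then show ?thesis by (simp add: le_less_trans[of x 0])
  qed
  also have "\<dots> \<le> 2 ^ k" using a by (intro power_increasing) auto
  finally show ?thesis .
qed

lemma less_bitlen: "0 \<le> x \<Longrightarrow> x < 2 ^ k \<Longrightarrow> bitlen x \<le> int k"
proof -
  assume a: "0 \<le> x" "x < 2 ^ k"
  show ?thesis
  proof (cases "x = 0")
    case False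
    then have "2 ^ nat (bitlen x - 1) \<le> x" using a bitlen_bounds[of x] by simp
    then have "(2::int) ^ nat (bitlen x - 1) < 2 ^ k" using a by linarith
    then have "nat (bitlen x - 1) < k" by simp
    then show ?thesis by linarith
  qed (simp add: bitlen_def floorlog_def)
qed

lemma bits_small: "bits r \<le> k \<Longrightarrow> small k r"
proof -
  assume k: "bits r \<le> k"
  obtain a b where ab: "quotient_of r = (a, b)" by fastforce
  have nn: "0 \<le> bitlen \<bar>a\<bar>" "0 \<le> bitlen b" by (auto simp: bitlen_nonneg)
  then have "bitlen \<bar>a\<bar> \<le> int k" "bitlen b \<le> int k" using k ab unfolding bits_def by auto
  moreover have "0 < b" using quotient_of_denom_pos[OF ab] .
  moreover have "r = of_int a / of_int b" using quotient_of_div[OF ab] .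
  ultimately show ?thesis unfolding small_def using bitlen_less by blast
qed

lemma small_bits: "small k r \<Longrightarrow> bits r \<le> 2 * k"
proof -
  assume "small k r"
  then obtain a b where ab: "r = of_int a / of_int b" "0 < b" "\<bar>a\<bar> < 2 ^ k" "b < 2 ^ k" unfolding small_def by auto
  have r: "r = Fract a b" using ab by (simp add: Fract_of_int_quotient)
  let ?g = "gcd a b"
  have g: "?g > 0" using ab by (simp add: gcd_pos_int)
  have q: "quotient_of r = (a div ?g, b div ?g)" unfolding r quotient_of_Fract using ab by (simp add: normalize_def Let_def)
  have le: "k \<le> g * k" if "0 \<le> k" "0 < g" for k g :: int using mult_right_mono[of 1 g k] that by simp
  have a: "a = ?g * (a div ?g)" and b: "b = ?g * (b div ?g)" by simp_all
  have "\<bar>a div ?g\<bar> \<le> \<bar>a\<bar>"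
  proof -
    have "\<bar>a\<bar> = ?g * \<bar>a div ?g\<bar>" using a g by (metis abs_mult abs_of_pos)
    then show ?thesis using le[of "\<bar>a div ?g\<bar>" ?g] g by simp
  qed
  moreover have "0 \<le> b div ?g" using g ab by (simp add: pos_imp_zdiv_nonneg_iff)
  moreover then have "b div ?g \<le> b" using le[of "b div ?g" ?g] g b by simp
  ultimately have "bitlen \<bar>a div ?g\<bar> \<le> int k" "bitlen (b div ?g) \<le> int k" using ab by (auto intro!: less_bitlen)
  then show ?thesis unfolding bits_def q by simp
qed

lemma small_add: "small j r \<Longrightarrow> small k s \<Longrightarrow> small (j + k + 1) (r + s)"
proof -
  assume "small j r" "small k s"
  then obtain a b c d where *: "r = of_int a / of_int b" "0 < b" "\<bar>a\<bar> < 2 ^ j" "b < 2 ^ j"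
    "s = of_int c / of_int d" "0 < d" "\<bar>c\<bar> < 2 ^ k" "d < 2 ^ k" unfolding small_def by auto
  have "\<bar>a * d\<bar> < 2 ^ j * 2 ^ k" "\<bar>c * b\<bar> < 2 ^ k * 2 ^ j" "b * d < 2 ^ j * 2 ^ k"
    using * by (auto simp: abs_mult intro!: mult_strict_mono)
  then have "\<bar>a * d + c * b\<bar> < 2 ^ (j + k + 1)" "b * d < 2 ^ (j + k + 1)" using abs_triangle_ineq[of "a * d" "c * b"] by (auto simp: power_add mult.commute)
  moreover have "r + s = of_int (a * d + c * b) / of_int (b * d)" using * by (simp add: add_frac_eq)
  moreover have "0 < b * d" using * by simp
  ultimately show ?thesis unfolding small_def by blast
qed

lemma small_minus: "small k s \<Longrightarrow> small k (- s)"
proof -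
  assume "small k s"
  then obtain c d where "s = of_int c / of_int d" "0 < d" "\<bar>c\<bar> < 2 ^ k" "d < 2 ^ k" unfolding small_def by auto
  then show ?thesis unfolding small_def by (intro exI[of _ "- c"] exI[of _ d]) auto
qed

lemma small_diff: "small j r \<Longrightarrow> small k s \<Longrightarrow> small (j + k + 1) (r - s)"
  using small_add[of j r k "- s"] small_minus[of k s] by simp

lemma small_mult: "small j r \<Longrightarrow> small k s \<Longrightarrow> small (j + k) (r * s)"
proof -
  assume "small j r" "small k s"
  then obtain a b c d where *: "r = of_int a / of_int b" "0 < b" "\<bar>a\<bar> < 2 ^ j" "b < 2 ^ j"
    "s = of_int c / of_int d" "0 < d" "\<bar>c\<bar> < 2 ^ k" "d < 2 ^ k" unfolding small_def by auto
  have "\<bar>a * c\<bar> < 2 ^ (j + k)" "b * d < 2 ^ (j + k)"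
    using * by (auto simp: abs_mult power_add intro!: mult_strict_mono)
  moreover have "r * s = of_int (a * c) / of_int (b * d)" "0 < b * d" using * by auto
  ultimately show ?thesis unfolding small_def by blast
qed

lemma small_of_bool: "small 2 (of_bool b)"
  unfolding small_def by (rule exI[of _ "of_bool b"], rule exI[of _ 1]) auto

section \<open>Programs with bounded loops\<close>

abbreviation "inputs \<equiv> {''n'', ''kin'', ''kout'', ''w'', ''p''}"

text \<open>Divisions and floors are excluded: \<open>asize\<close> and \<open>atime\<close> bound
  the size and cost of plain expressions only, and their value 0 elsewhere is a dummy.\<close>

fun plain :: "aexp \<Rightarrow> bool" where
  "plain (Num r) = True"
| "plain (Elem x a) = plain a"
| "plain (Add a b) = (plain a \<and> plain b)"
| "plain (Sub a b) = (plain a \<and> plain b)"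
| "plain (Mul a b) = (plain a \<and> plain b)"
| "plain (Quot a b) = False"
| "plain (Floor a) = False"

fun plain_b :: "bexp \<Rightarrow> bool" where
  "plain_b (Less a b) = (plain a \<and> plain b)"
| "plain_b (Neg b) = plain_b b"
| "plain_b (Conj b c) = (plain_b b \<and> plain_b c)"

fun asize :: "nat \<Rightarrow> aexp \<Rightarrow> nat" where
  "asize V (Num r) = bits r"
| "asize V (Elem x a) = V"
| "asize V (Add a b) = asize V a + asize V b + 1"
| "asize V (Sub a b) = asize V a + asize V b + 1"
| "asize V (Mul a b) = asize V a + asize V b"
| "asize V _ = 0"

fun atime :: "nat \<Rightarrow> aexp \<Rightarrow> nat" where
  "atime V (Num r) = bits r"
| "atime V (Elem x a) = atime V a + 2 * V"
| "atime V (Add a b) = atime V a + atime V b + 2 * (asize V a + asize V b + 1)"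
| "atime V (Sub a b) = atime V a + atime V b + 2 * (asize V a + asize V b + 1)"
| "atime V (Mul a b) = atime V a + atime V b + 2 * (asize V a + asize V b)"
| "atime V _ = 0"

fun btime :: "nat \<Rightarrow> bexp \<Rightarrow> nat" where
  "btime V (Less a b) = 1 + atime V a + atime V b"
| "btime V (Neg b) = 1 + btime V b"
| "btime V (Conj b c) = 1 + btime V b + btime V c"

lemma small_aval: "plain a \<Longrightarrow> (\<And>x i. small V (m x i)) \<Longrightarrow> small (asize V a) (aval a m)"
  by (induction a) (auto intro: bits_small small_add small_diff small_mult simp del: One_nat_def add_Suc_right)

lemma acost_le: "plain a \<Longrightarrow> (\<And>x i. small V (m x i)) \<Longrightarrow> acost a m \<le> atime V a"
proof (induction a)
  case (Add a b)
  then show ?case using small_bits[OF small_aval[of "Add a b" V m]] by simp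
next
  case (Sub a b)
  then show ?case using small_bits[OF small_aval[of "Sub a b" V m]] by simp
next
  case (Mul a b)
  then show ?case using small_bits[OF small_aval[of "Mul a b" V m]] by simp
qed (auto intro!: add_mono small_bits)

lemma bcost_le: "plain_b b \<Longrightarrow> (\<And>x i. small V (m x i)) \<Longrightarrow> bcost b m \<le> btime V b"
  by (induction b) (auto intro!: add_mono acost_le)

text \<open>
  Read-only expressions use only the input arrays. A dynamic expression adds or multiplies read-only
  values to at most one mutable value, so that every assignment increases sizes only additively.
\<close>

fun read_only :: "aexp \<Rightarrow> bool" where
  "read_only (Num r) = True"
| "read_only (Elem x a) = (x \<in> inputs)"
| "read_only (Add a b) = (read_only a \<and> read_only b)"
| "read_only (Mul a b) = (read_only a \<and> read_only b)"
| "read_only _ = False"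

fun dynamic :: "aexp \<Rightarrow> bool" where
  "dynamic (Num r) = True"
| "dynamic (Elem x a) = True"
| "dynamic (Add a b) = (dynamic a \<and> read_only b)"
| "dynamic (Mul a b) = (dynamic a \<and> read_only b)"
| "dynamic _ = False"

fun rise :: "nat \<Rightarrow> aexp \<Rightarrow> nat" where
  "rise B (Num r) = bits r"
| "rise B (Elem x a) = 0"
| "rise B (Add a b) = rise B a + asize B b + 1"
| "rise B (Mul a b) = rise B a + asize B b"
| "rise B _ = 0"

lemma small_read_only:
  "read_only a \<Longrightarrow> (\<And>x i. x \<in> inputs \<Longrightarrow> small B (m x i)) \<Longrightarrow> small (asize B a) (aval a m)"
  by (induction a) (auto intro: bits_small small_add small_mult simp del: One_nat_def add_Suc_right)

lemma small_dynamic: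
  assumes "dynamic a" "\<And>x i. small W (m x i)" "\<And>x i. x \<in> inputs \<Longrightarrow> small B (m x i)"
  shows "small (W + rise B a) (aval a m)"
  using assms(1)
proof (induction a)
  case (Add a b)
  then have "small (W + rise B a + asize B b + 1) (aval a m + aval b m)"
    using small_read_only[of b B m] assms(3) by (intro small_add) auto
  then show ?case by (simp add: add.assoc)
next
  case (Mul a b)
  then have "small (W + rise B a + asize B b) (aval a m * aval b m)"
    using small_read_only[of b B m] assms(3) by (intro small_mult) auto
  then show ?case by (simp add: add.assoc)
qed (use assms(2) in \<open>auto intro: bits_small small_mono\<close>)

fun safe :: "com \<Rightarrow> bool" where
  "safe Skip = True"
| "safe (Assign x a b) = (x \<notin> inputs \<and> plain a \<and> plain b \<and> dynamic b)"
| "safe (Seq c d) = (safe c \<and> safe d)"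
| "safe (If b c d) = (plain_b b \<and> safe c \<and> safe d)"
| "safe (While b c) = (plain_b b \<and> safe c)"
| "safe (Flip x) = (x \<notin> inputs)"
| "safe (Query_Inner x a y) = (x \<notin> inputs \<and> plain a)"
| "safe (Query_Outer x a y) = (x \<notin> inputs \<and> plain a)"
| "safe (Probe x a) = (x \<notin> inputs \<and> plain a)"

text \<open>The growth of sizes and the time, if every loop makes at most \<open>N\<close> iterations.\<close>

fun growth :: "nat \<Rightarrow> nat \<Rightarrow> com \<Rightarrow> nat" where
  "growth N B (Assign x a b) = rise B b"
| "growth N B (Seq c d) = growth N B c + growth N B d"
| "growth N B (If b c d) = growth N B c + growth N B d"
| "growth N B (While b c) = N * growth N B c"
| "growth N B _ = 0"

fun time :: "nat \<Rightarrow> nat \<Rightarrow> com \<Rightarrow> nat" where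
  "time N V Skip = 1"
| "time N V (Assign x a b) = 1 + atime V a + atime V b"
| "time N V (Seq c d) = 1 + time N V c + time N V d"
| "time N V (If b c d) = 1 + btime V b + time N V c + time N V d"
| "time N V (While b c) = (N + 1) * (1 + btime V b + time N V c)"
| "time N V (Flip x) = 1"
| "time N V (Query_Inner x a y) = 1 + atime V a + N * (2 * V)"
| "time N V (Query_Outer x a y) = 1 + atime V a + N * (2 * V)"
| "time N V (Probe x a) = 1 + atime V a"

text \<open>After \<open>k\<close> iterations the guard must have become false, so the precondition
  of a loop includes its termination within the bound.\<close>

primrec iterate :: "nat \<Rightarrow> (state \<Rightarrow> bool) \<Rightarrow> ((state \<Rightarrow> bool) \<Rightarrow> state \<Rightarrow> bool) \<Rightarrow> (state \<Rightarrow> bool) \<Rightarrow> state \<Rightarrow> bool" where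
  "iterate 0 b f Q s = (\<not> b s \<and> Q s)"
| "iterate (Suc k) b f Q s = (if b s then f (iterate k b f Q) s else Q s)"

locale machine =
  fixes I :: probing and X \<omega> :: "nat \<Rightarrow> bool" and N :: nat
begin

text \<open>Weakest precondition for runs in which every loop makes at most \<open>N\<close> iterations.\<close>

primrec wp :: "com \<Rightarrow> (state \<Rightarrow> bool) \<Rightarrow> state \<Rightarrow> bool" where
  "wp Skip Q s = Q s"
| "wp (Assign x a b) Q s = Q (store x (to_nat_idx (aval a (mem s))) (aval b (mem s)) s)"
| "wp (Seq c d) Q s = wp c (wp d Q) s"
| "wp (If b c d) Q s = (if bval b (mem s) then wp c Q s else wp d Q s)"
| "wp (While b c) Q s = iterate N (\<lambda>s. bval b (mem s)) (wp c) Q s"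
| "wp (Flip x) Q s = Q ((store x 0 (of_bool (\<omega> (coins_used s))) s)\<lparr>coins_used := coins_used s + 1\<rparr>)"
| "wp (Query_Inner x a y) Q s = Q (store x 0 (of_bool (oracle_answer (inner_fams I) (to_nat_idx (aval a (mem s)))
        (coded_set I y (mem s)))) s)"
| "wp (Query_Outer x a y) Q s = Q (store x 0 (of_bool (oracle_answer (outer_fams I) (to_nat_idx (aval a (mem s)))
        (coded_set I y (mem s)))) s)"
| "wp (Probe x a) Q s = (let e = to_nat_idx (aval a (mem s)) in may_probe I (probed s) (chosen s) e \<and>
     Q ((store x 0 (of_bool (X e)) s)\<lparr>probed := insert e (probed s),
        chosen := (if X e then insert e (chosen s) else chosen s)\<rparr>))"

lemma iterate_mono:
  assumes "\<And>Q Q' s. f Q s \<Longrightarrow> (\<And>s. Q s \<Longrightarrow> Q' s) \<Longrightarrow> f Q' s"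
  shows "iterate k b f Q s \<Longrightarrow> (\<And>s. Q s \<Longrightarrow> Q' s) \<Longrightarrow> iterate k b f Q' s"
proof (induction k arbitrary: s)
  case (Suc k)
  then show ?case using assms[of "iterate k b f Q" s "iterate k b f Q'"] by (auto split: if_splits)
qed auto

lemma wp_mono: "wp c Q s \<Longrightarrow> (\<And>s. Q s \<Longrightarrow> Q' s) \<Longrightarrow> wp c Q' s"
proof (induction c arbitrary: Q Q' s)
  case (Seq c d)
  have "wp c (wp d Q') s"
    by (rule Seq.IH(1)[of "wp d Q"]) (use Seq.prems Seq.IH(2)[of Q _ Q'] in auto)
  then show ?case by simp
next
  case (While b c)
  show ?case
    unfolding wp.simps
    by (rule iterate_mono[OF While.IH While.prems(1)[unfolded wp.simps] While.prems(2)])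
qed (auto simp: Let_def split: if_splits)

lemma coded_cost_le:
  assumes "\<And>x i. small V (mem s x i)" "univ_size I \<le> N"
  shows "coded_cost I y (mem s) \<le> N * (2 * V)"
proof -
  have "coded_cost I y (mem s) \<le> (\<Sum>e\<in>ground I. 2 * V)"
    unfolding coded_cost_def by (intro sum_mono small_bits assms)
  also have "\<dots> = univ_size I * (2 * V)" by simp
  also have "\<dots> \<le> N * (2 * V)" using assms(2) by (rule mult_right_mono) simp
  finally show ?thesis .
qed

lemma small_store:
  assumes "\<And>x i. small W (mem s x i)" "small W' r" "W \<le> W'"
  shows "small W' (mem (store x i r s) y j)"
  using assms by (auto simp: store_def intro: small_mono)

text \<open>\<open>W\<close> bounds the sizes before the command and grows along the run,
  \<open>V\<close> bounds them throughout and yields the costs, and \<open>B\<close> bounds the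
  inputs, which never change. As growth is measured in terms of \<open>B\<close>, every iteration of
  a loop adds the same amount. \<open>2 \<le> W\<close> covers the answers of coins, oracles and
  probes.\<close>

lemma wp_exec:
  assumes "wp c Q s" "\<And>x i. small W (mem s x i)" "\<And>x i. x \<in> inputs \<Longrightarrow> small B (mem s x i)"
    "safe c" "W + growth N B c \<le> V" "2 \<le> W" "univ_size I \<le> N"
  shows "\<exists>t s'. exec I X \<omega> c s t s' \<and> t \<le> time N V c \<and> Q s' \<and>
    (\<forall>x i. small (W + growth N B c) (mem s' x i)) \<and> (\<forall>x\<in>inputs. mem s' x = mem s x)"
  using assms
proof (induction c arbitrary: Q s W)
  case Skip
  then show ?case using exec.Skip[of I X \<omega> s] by (intro exI[of _ 1] exI[of _ s]) auto
next
  case (Assign x a b)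
  have V: "small V (mem s x i)" for x i using Assign.prems(2,5) small_mono by (metis add_leD1)
  have "small (W + rise B b) (aval b (mem s))" using Assign.prems by (intro small_dynamic) auto
  then have "\<forall>y i. small (W + rise B b) (mem (store x (to_nat_idx (aval a (mem s))) (aval b (mem s)) s) y i)"
    using small_store[OF Assign.prems(2)] by simp
  moreover have "1 + acost a (mem s) + acost b (mem s) \<le> time N V (Assign x a b)"
    using Assign.prems V by (auto intro!: add_mono acost_le)
  moreover have "\<forall>y\<in>inputs. mem (store x (to_nat_idx (aval a (mem s))) (aval b (mem s)) s) y = mem s y"
    using Assign.prems(4) by (auto simp: store_def)
  ultimately show ?case using exec.Assign[of I X \<omega> x a b s] Assign.prems(1) by (metis growth.simps(1) wp.simps(2))
next
  case (Seq c d)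
  from Seq.prems Seq.IH(1)[of "wp d Q" s W] obtain t s' where 1: "exec I X \<omega> c s t s'" "t \<le> time N V c" "wp d Q s'"
    "\<And>x i. small (W + growth N B c) (mem s' x i)" "\<And>x. x \<in> inputs \<Longrightarrow> mem s' x = mem s x" by auto
  have "\<exists>t s2. exec I X \<omega> d s' t s2 \<and> t \<le> time N V d \<and> Q s2 \<and>
    (\<forall>x i. small (W + growth N B c + growth N B d) (mem s2 x i)) \<and> (\<forall>x\<in>inputs. mem s2 x = mem s' x)"
    by (rule Seq.IH(2)) (use 1 Seq.prems in auto)
  then obtain t' s2 where 2: "exec I X \<omega> d s' t' s2" "t' \<le> time N V d" "Q s2"
    "\<forall>x i. small (W + growth N B c + growth N B d) (mem s2 x i)" "\<forall>x\<in>inputs. mem s2 x = mem s' x" by blast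
  show ?case using exec.Seq[OF 1(1) 2(1)] 1 2 by (intro exI[of _ "1 + t + t'"] exI[of _ s2]) (auto simp: add.assoc)
next
  case (If b c d)
  have V: "small V (mem s x i)" for x i using If.prems(2,5) small_mono by (metis add_leD1)
  have bc: "bcost b (mem s) \<le> btime V b" using If.prems V by (intro bcost_le) auto
  show ?case
  proof (cases "bval b (mem s)")
    case True
    have "\<exists>t s2. exec I X \<omega> c s t s2 \<and> t \<le> time N V c \<and> Q s2 \<and>
      (\<forall>x i. small (W + growth N B c) (mem s2 x i)) \<and> (\<forall>x\<in>inputs. mem s2 x = mem s x)"
      by (rule If.IH(1)) (use True If.prems in auto)
    then obtain t s2 where 2: "exec I X \<omega> c s t s2" "t \<le> time N V c" "Q s2"
      "\<forall>x i. small (W + growth N B c) (mem s2 x i)" "\<forall>x\<in>inputs. mem s2 x = mem s x" by blast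
    have "small (W + growth N B (If b c d)) (mem s2 x i)" for x i
      by (rule small_mono[OF 2(4)[rule_format]]) simp
    then show ?thesis using exec.IfTrue[OF True 2(1), of d] 2(2,3,5) bc
      by (intro exI[of _ "1 + bcost b (mem s) + t"] exI[of _ s2]) simp
  next
    case False
    have "\<exists>t s2. exec I X \<omega> d s t s2 \<and> t \<le> time N V d \<and> Q s2 \<and>
      (\<forall>x i. small (W + growth N B d) (mem s2 x i)) \<and> (\<forall>x\<in>inputs. mem s2 x = mem s x)"
      by (rule If.IH(2)) (use False If.prems in auto)
    then obtain t s2 where 2: "exec I X \<omega> d s t s2" "t \<le> time N V d" "Q s2"
      "\<forall>x i. small (W + growth N B d) (mem s2 x i)" "\<forall>x\<in>inputs. mem s2 x = mem s x" by blast
    have "small (W + growth N B (If b c d)) (mem s2 x i)" for x i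
      by (rule small_mono[OF 2(4)[rule_format]]) simp
    then show ?thesis using exec.IfFalse[OF False 2(1), of c] 2(2,3,5) bc
      by (intro exI[of _ "1 + bcost b (mem s) + t"] exI[of _ s2]) simp
  qed
next
  case (While b c)
  let ?g = "growth N B c" and ?T = "1 + btime V b + time N V c"
  have safe: "plain_b b" "safe c" using While.prems(4) by auto
  \<comment> \<open>While the remaining number \<open>k\<close> of iterations goes down, the initial
    size \<open>W\<close> goes up, so that \<open>W + k * ?g \<le> V\<close> is preserved.\<close>
  have loop: "\<exists>t s'. exec I X \<omega> (While b c) s t s' \<and> t \<le> (k + 1) * ?T \<and> Q s' \<and>
      (\<forall>x i. small (W + k * ?g) (mem s' x i)) \<and> (\<forall>x\<in>inputs. mem s' x = mem s x)"
    if "iterate k (\<lambda>s. bval b (mem s)) (wp c) Q s" "\<And>x i. small W (mem s x i)" "\<And>x i. x \<in> inputs \<Longrightarrow> small B (mem s x i)"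
      "W + k * ?g \<le> V" "2 \<le> W" for k s W
    using that
  proof (induction k arbitrary: s W)
    case 0
    have "small V (mem s x i)" for x i using 0(2,4) small_mono by (metis add_leD1)
    then have "bcost b (mem s) \<le> btime V b" using safe by (intro bcost_le) auto
    then show ?case using exec.WhileFalse[of b s I X \<omega> c] 0 by (intro exI[of _ "1 + bcost b (mem s)"] exI[of _ s]) auto
  next
    case (Suc k)
    have "small V (mem s x i)" for x i using Suc.prems(2,4) small_mono by (metis add_leD1)
    then have bc: "bcost b (mem s) \<le> btime V b" using safe by (intro bcost_le) auto
    show ?case
    proof (cases "bval b (mem s)")
      case True
      have "\<exists>t s2. exec I X \<omega> c s t s2 \<and> t \<le> time N V c \<and> iterate k (\<lambda>s. bval b (mem s)) (wp c) Q s2 \<and>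
        (\<forall>x i. small (W + ?g) (mem s2 x i)) \<and> (\<forall>x\<in>inputs. mem s2 x = mem s x)"
        by (rule While.IH) (use True Suc.prems safe While.prems(7) in auto)
      then obtain t s2 where 2: "exec I X \<omega> c s t s2" "t \<le> time N V c" "iterate k (\<lambda>s. bval b (mem s)) (wp c) Q s2"
        "\<And>x i. small (W + ?g) (mem s2 x i)" "\<And>x. x \<in> inputs \<Longrightarrow> mem s2 x = mem s x" by blast
      have "\<exists>t s'. exec I X \<omega> (While b c) s2 t s' \<and> t \<le> (k + 1) * ?T \<and> Q s' \<and>
        (\<forall>x i. small (W + ?g + k * ?g) (mem s' x i)) \<and> (\<forall>x\<in>inputs. mem s' x = mem s2 x)"
        by (rule Suc.IH) (use 2 Suc.prems in auto)
      then obtain t' s3 where 3: "exec I X \<omega> (While b c) s2 t' s3" "t' \<le> (k + 1) * ?T" "Q s3"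
        "\<forall>x i. small (W + ?g + k * ?g) (mem s3 x i)" "\<forall>x\<in>inputs. mem s3 x = mem s2 x" by blast
      define T where "T = ?T"
      have "(Suc k + 1) * T = T + (k + 1) * T" by simp
      moreover have "t' \<le> (k + 1) * T" "1 + bcost b (mem s) + t \<le> T" using 2(2) 3(2) bc unfolding T_def by auto
      ultimately have "1 + bcost b (mem s) + t + t' \<le> (Suc k + 1) * T" by linarith
      then show ?thesis using exec.WhileTrue[OF True 2(1) 3(1)] 2(5) 3(3-5) unfolding T_def
        by (intro exI[of _ "1 + bcost b (mem s) + t + t'"] exI[of _ s3]) (simp add: add.assoc)
    next
      case False
      then have "Q s" using Suc.prems(1) by simp
      moreover have "small (W + Suc k * ?g) (mem s x i)" for x i by (rule small_mono[OF Suc.prems(2)]) simp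
      moreover have "1 + bcost b (mem s) \<le> (Suc k + 1) * ?T" using bc by simp
      ultimately show ?thesis using exec.WhileFalse[OF False, of I X \<omega> c]
        by (intro exI[of _ "1 + bcost b (mem s)"] exI[of _ s]) simp
    qed
  qed
  have "\<exists>t s'. exec I X \<omega> (While b c) s t s' \<and> t \<le> (N + 1) * ?T \<and> Q s' \<and>
      (\<forall>x i. small (W + N * ?g) (mem s' x i)) \<and> (\<forall>x\<in>inputs. mem s' x = mem s x)"
    by (rule loop) (use While.prems in auto)
  then show ?case by simp
next
  case (Flip x)
  have "small W (mem (store x 0 (of_bool (\<omega> (coins_used s))) s) y i)" for y i
    using small_store[OF Flip.prems(2) small_mono[OF small_of_bool Flip.prems(6)]] by simp
  then show ?case using exec.Flip[of I X \<omega> x s] Flip.prems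
    by (intro exI[of _ 1] exI[of _ "(store x 0 (of_bool (\<omega> (coins_used s))) s)\<lparr>coins_used := coins_used s + 1\<rparr>"])
       (auto simp: store_def)
next
  case (Query_Inner x a y)
  have V: "small V (mem s x i)" for x i using Query_Inner.prems(2,5) small_mono by (metis add_leD1)
  let ?s = "store x 0 (of_bool (oracle_answer (inner_fams I) (to_nat_idx (aval a (mem s))) (coded_set I y (mem s)))) s"
  have "\<forall>y i. small W (mem ?s y i)"
    using small_store[OF Query_Inner.prems(2) small_mono[OF small_of_bool Query_Inner.prems(6)]] by simp
  moreover have "1 + acost a (mem s) + coded_cost I y (mem s) \<le> time N V (Query_Inner x a y)"
    using acost_le[of a V "mem s"] coded_cost_le[of V s y] V Query_Inner.prems by simp
  moreover have "\<forall>y\<in>inputs. mem ?s y = mem s y" using Query_Inner.prems(4) by (auto simp: store_def)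
  ultimately show ?case using exec.Query_Inner[of I X \<omega> x a y s] Query_Inner.prems(1)
    by (intro exI[of _ "1 + acost a (mem s) + coded_cost I y (mem s)"] exI[of _ ?s]) simp
next
  case (Query_Outer x a y)
  have V: "small V (mem s x i)" for x i using Query_Outer.prems(2,5) small_mono by (metis add_leD1)
  let ?s = "store x 0 (of_bool (oracle_answer (outer_fams I) (to_nat_idx (aval a (mem s))) (coded_set I y (mem s)))) s"
  have "\<forall>y i. small W (mem ?s y i)"
    using small_store[OF Query_Outer.prems(2) small_mono[OF small_of_bool Query_Outer.prems(6)]] by simp
  moreover have "1 + acost a (mem s) + coded_cost I y (mem s) \<le> time N V (Query_Outer x a y)"
    using acost_le[of a V "mem s"] coded_cost_le[of V s y] V Query_Outer.prems by simp
  moreover have "\<forall>y\<in>inputs. mem ?s y = mem s y" using Query_Outer.prems(4) by (auto simp: store_def)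
  ultimately show ?case using exec.Query_Outer[of I X \<omega> x a y s] Query_Outer.prems(1)
    by (intro exI[of _ "1 + acost a (mem s) + coded_cost I y (mem s)"] exI[of _ ?s]) simp
next
  case (Probe x a)
  have V: "small V (mem s x i)" for x i using Probe.prems(2,5) small_mono by (metis add_leD1)
  define e where "e = to_nat_idx (aval a (mem s))"
  let ?s = "(store x 0 (of_bool (X e)) s)\<lparr>probed := insert e (probed s), chosen := (if X e then insert e (chosen s) else chosen s)\<rparr>"
  have "\<forall>y i. small W (mem (store x 0 (of_bool (X e)) s) y i)"
    using small_store[OF Probe.prems(2) small_mono[OF small_of_bool Probe.prems(6)]] by simp
  moreover have "1 + acost a (mem s) \<le> time N V (Probe x a)" using acost_le[of a V "mem s"] V Probe.prems by simp
  moreover have "\<forall>y\<in>inputs. mem ?s y = mem s y" using Probe.prems(4) by (auto simp: store_def)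
  moreover have "may_probe I (probed s) (chosen s) e" "Q ?s" using Probe.prems(1) by (auto simp: e_def Let_def)
  ultimately show ?case using exec.Probe[OF e_def, of I X \<omega> x]
    by (intro exI[of _ "1 + acost a (mem s)"] exI[of _ ?s]) simp
qed

end

text \<open>Consequently a tape as long as the cost bound contains every coin that is read.\<close>

lemma coins_used_le_cost: "exec I X \<omega> c s t s' \<Longrightarrow> coins_used s' \<le> coins_used s + t"
  by (induction rule: exec.induct) (auto simp: store_def)

section \<open>Polynomial bounds\<close>

definition polynomial :: "(nat \<Rightarrow> nat) \<Rightarrow> bool" where
  "polynomial f \<longleftrightarrow> (\<exists>q :: nat poly. \<forall>s. f s = poly q s)"

lemma polynomial_const [intro]: "polynomial (\<lambda>_. k)"
  unfolding polynomial_def by (intro exI[of _ "[:k:]"]) simp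

lemma polynomial_id [intro]: "polynomial (\<lambda>s. s)"
  unfolding polynomial_def by (intro exI[of _ "[:0, 1:]"]) simp

lemma polynomial_add [intro]: "polynomial f \<Longrightarrow> polynomial g \<Longrightarrow> polynomial (\<lambda>s. f s + g s)"
  unfolding polynomial_def by (metis poly_add)

lemma polynomial_mult [intro]: "polynomial f \<Longrightarrow> polynomial g \<Longrightarrow> polynomial (\<lambda>s. f s * g s)"
  unfolding polynomial_def by (metis poly_mult)

lemma polynomial_Suc [intro]: "polynomial f \<Longrightarrow> polynomial (\<lambda>s. Suc (f s))"
  using polynomial_add[OF polynomial_const[of 1]] by simp

lemma polynomial_asize: "polynomial V \<Longrightarrow> polynomial (\<lambda>s. asize (V s) a)"
  by (induction a) auto

lemma polynomial_atime: "polynomial V \<Longrightarrow> polynomial (\<lambda>s. atime (V s) a)"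
  by (induction a) (auto intro!: polynomial_add polynomial_mult polynomial_Suc polynomial_asize)

lemma polynomial_btime: "polynomial V \<Longrightarrow> polynomial (\<lambda>s. btime (V s) b)"
  by (induction b) (auto intro!: polynomial_add polynomial_Suc polynomial_atime)

lemma polynomial_rise: "polynomial B \<Longrightarrow> polynomial (\<lambda>s. rise (B s) a)"
  by (induction a) (auto intro!: polynomial_add polynomial_Suc polynomial_asize)

lemma polynomial_growth: "polynomial N \<Longrightarrow> polynomial B \<Longrightarrow> polynomial (\<lambda>s. growth (N s) (B s) c)"
  by (induction c) (auto intro!: polynomial_add polynomial_mult polynomial_rise)

lemma polynomial_time: "polynomial N \<Longrightarrow> polynomial V \<Longrightarrow> polynomial (\<lambda>s. time (N s) (V s) c)"
  by (induction c) (auto intro!: polynomial_add polynomial_mult polynomial_Suc polynomial_atime polynomial_btime)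

section \<open>The program\<close>

abbreviation "var x \<equiv> Elem x (Num 0)"
abbreviation "assign_var x e \<equiv> Assign x (Num 0) e"
abbreviation "flag x a \<equiv> Less (Num 0) (Elem x a)"

definition for_loop :: "string \<Rightarrow> aexp \<Rightarrow> com \<Rightarrow> com" where
  "for_loop x hi c = Seq (assign_var x (Num 0))
     (While (Less (var x) hi) (Seq c (assign_var x (Add (var x) (Num 1)))))"

definition clear :: "string \<Rightarrow> aexp \<Rightarrow> com" where
  "clear y hi = for_loop ''j'' hi (Assign y (var ''j'') (Num 0))"

definition weight_exp :: "aexp \<Rightarrow> aexp" where
  "weight_exp i = Elem ''w'' i"

definition value_exp :: "aexp \<Rightarrow> aexp" where
  "value_exp i = Mul (Elem ''p'' i) (Elem ''w'' i)"

definition pick_com :: "(aexp \<Rightarrow> aexp) \<Rightarrow> com" where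
  "pick_com key = Seq (assign_var ''b'' (var ''n'')) (for_loop ''e'' (var ''n'')
     (If (Conj (Neg (flag ''d'' (var ''e'')))
          (Neg (Conj (Less (var ''b'') (var ''n'')) (Neg (Less (key (var ''b'')) (key (var ''e'')))))))
       (assign_var ''b'' (var ''e'')) Skip))"

definition classes_com :: com where
  "classes_com = Seq (for_loop ''t'' (var ''n'') (Seq (pick_com weight_exp)
     (Seq (If (Neg (Conj (Less (Num 0) (var ''t'')) (Neg (Less (Mul (Num 2) (Elem ''w'' (var ''b''))) (var ''x'')))))
            (assign_var ''x'' (Elem ''w'' (var ''b''))) Skip)
     (Seq (Assign ''r'' (var ''b'') (var ''x'')) (Assign ''d'' (var ''b'') (Num 1))))))
     (clear ''d'' (var ''n''))"

text \<open>\<open>l\<close> is doubled as long as it is at most 1/2, with one coin per doubling,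
  and the element is simulated active if no coin shows a tail. This rounds the probability up to a
  power of 1/2 without computing that power.\<close>

definition draw_com :: com where
  "draw_com = for_loop ''j'' (var ''m'') (let e = Elem ''a'' (var ''j'') in
     Seq (Assign ''y'' e (Num 1)) (Seq (assign_var ''l'' (Elem ''p'' e))
     (While (Neg (Less (Num 1) (Add (var ''l'') (var ''l''))))
       (Seq (Flip ''g'') (Seq (If (flag ''g'' (Num 0)) Skip (Assign ''y'' e (Num 0)))
         (assign_var ''l'' (Mul (var ''l'') (Num 2))))))))"

definition test_com :: "aexp \<Rightarrow> com" where
  "test_com ein = Seq (assign_var ''x'' (Num 0)) (for_loop ''i'' ein
     (Seq (clear ''z'' (var ''n''))
     (Seq (for_loop ''j'' (var ''m'') (let e = Elem ''a'' (var ''j'') in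
        If (Conj (flag ''y'' e) (Conj (Neg (Less (Elem ''r'' e) (Elem ''r'' (var ''b''))))
              (Neg (Less (Elem ''r'' (var ''b'')) (Elem ''r'' e)))))
          (Seq (Assign ''z'' e (Num 1)) (Seq (Query_Inner ''g'' (var ''i'') ''z'')
            (If (flag ''g'' (Num 0)) Skip (Assign ''z'' e (Num 0))))) Skip))
     (Seq (Assign ''z'' (var ''b'') (Num 1)) (Seq (Query_Inner ''g'' (var ''i'') ''z'')
       (If (flag ''g'' (Num 0)) Skip (assign_var ''x'' (Num 1))))))))"

definition trials_exp :: "aexp \<Rightarrow> aexp \<Rightarrow> aexp" where
  "trials_exp ein eout = Mul (Mul (Num 128) (var ''n''))
     (Add (Add ein eout) (Add (Mul (Num 3) (var ''n'')) (Num 1)))"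

definition hits_com :: "aexp \<Rightarrow> aexp \<Rightarrow> com" where
  "hits_com ein eout = Seq (assign_var ''c'' (Num 0)) (for_loop ''h'' (trials_exp ein eout)
     (Seq draw_com (Seq (test_com ein)
       (If (flag ''x'' (Num 0)) (assign_var ''c'' (Add (var ''c'') (Num 1))) Skip))))"

definition rival_com :: com where
  "rival_com = Seq (assign_var ''x'' (var ''n'')) (for_loop ''j'' (var ''n'')
     (If (Conj (flag ''q'' (var ''j'')) (Neg (Conj (Less (var ''x'') (var ''n''))
            (Neg (Less (value_exp (var ''j'')) (value_exp (var ''x'')))))))
       (Seq (Assign ''u'' (var ''j'') (Num 0)) (Seq (Query_Outer ''g'' (var ''i'') ''u'')
         (Seq (Assign ''u'' (var ''j'') (Num 1))
           (If (flag ''g'' (Num 0)) (assign_var ''x'' (var ''j'')) Skip)))) Skip))"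

text \<open>\<open>k\<close> is cleared up to index \<open>n\<close> inclusive, because index
  \<open>n\<close> records that no exchange is possible.\<close>

definition conflicts_com :: "aexp \<Rightarrow> com" where
  "conflicts_com eout = Seq (clear ''k'' (Add (var ''n'') (Num 1))) (for_loop ''i'' eout
     (Seq (for_loop ''j'' (var ''n'') (Assign ''u'' (var ''j'') (Elem ''q'' (var ''j''))))
     (Seq (Assign ''u'' (var ''b'') (Num 1)) (Seq (Query_Outer ''g'' (var ''i'') ''u'')
       (If (flag ''g'' (Num 0)) Skip (Seq rival_com (Assign ''k'' (var ''x'') (Num 1))))))))"

definition exchange_com :: com where
  "exchange_com = Seq (assign_var ''v'' (Num 0))
     (Seq (for_loop ''j'' (var ''n'') (If (flag ''k'' (var ''j''))
        (assign_var ''v'' (Add (var ''v'') (value_exp (var ''j'')))) Skip))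
     (If (Conj (Neg (flag ''k'' (var ''n''))) (Less (Mul (Num 2) (var ''v'')) (value_exp (var ''b''))))
       (Seq (Assign ''a'' (var ''m'') (var ''b'')) (Seq (assign_var ''m'' (Add (var ''m'') (Num 1)))
       (Seq (for_loop ''j'' (var ''n'') (If (flag ''k'' (var ''j'')) (Assign ''q'' (var ''j'') (Num 0)) Skip))
         (Assign ''q'' (var ''b'') (Num 1))))) Skip))"

text \<open>Elements of value 0 are skipped. Accepted elements then have positive probability, which
  makes the doubling loop of \<open>draw_com\<close> terminate.\<close>

definition plan_com :: "(aexp \<Rightarrow> aexp) \<Rightarrow> aexp \<Rightarrow> aexp \<Rightarrow> com" where
  "plan_com key ein eout = for_loop ''t'' (var ''n'') (Seq (pick_com key)
     (Seq (Assign ''d'' (var ''b'') (Num 1))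
     (If (Less (Num 0) (value_exp (var ''b'')))
       (Seq (hits_com ein eout) (If (Less (Mul (Num 2) (var ''c'')) (trials_exp ein eout))
          (Seq (conflicts_com eout) exchange_com) Skip)) Skip)))"

definition finish_com :: "aexp \<Rightarrow> com" where
  "finish_com ein = for_loop ''t'' (var ''n'') (Seq (pick_com weight_exp)
     (Seq (Assign ''d'' (var ''b'') (Num 1))
     (If (flag ''q'' (var ''b''))
       (Seq (Assign ''s'' (var ''b'') (Num 1)) (Seq (assign_var ''x'' (Num 1))
       (Seq (for_loop ''i'' ein (Seq (Query_Inner ''g'' (var ''i'') ''s'') (If (flag ''g'' (Num 0)) Skip (assign_var ''x'' (Num 0)))))
         (If (flag ''x'' (Num 0)) (Seq (Probe ''g'' (var ''b'')) (Assign ''s'' (var ''b'') (var ''g''))) (Assign ''s'' (var ''b'') (Num 0))))))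
       Skip)))"

definition program :: "com \<Rightarrow> (aexp \<Rightarrow> aexp) \<Rightarrow> aexp \<Rightarrow> aexp \<Rightarrow> com" where
  "program pre key ein eout = Seq pre (Seq (plan_com key ein eout)
     (Seq (clear ''d'' (var ''n'')) (finish_com ein)))"

lemmas program_defs = for_loop_def clear_def weight_exp_def value_exp_def pick_com_def classes_com_def draw_com_def
  test_com_def trials_exp_def hits_com_def rival_com_def conflicts_com_def exchange_com_def plan_com_def finish_com_def program_def

section \<open>Reasoning about loops\<close>

lemma to_nat_idx_of_nat [simp]: "to_nat_idx (of_nat k) = k" "to_nat_idx 0 = 0" "to_nat_idx 1 = 1"
  "to_nat_idx (1 + of_nat k) = Suc k" "to_nat_idx (of_nat k + 1) = Suc k" "to_nat_idx (numeral w) = numeral w"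
  unfolding to_nat_idx_def by (simp_all add: nat_add_distrib)

lemma mem_store [simp]: "mem (store x i r s) y = (if y = x then fun_upd (mem s x) i r else mem s y)"
  "coins_used (store x i r s) = coins_used s" "probed (store x i r s) = probed s" "chosen (store x i r s) = chosen s"
  by (simp_all add: store_def)

section \<open>Arrays as sets, frames, and the order of selection\<close>

definition ind :: "nat set \<Rightarrow> nat \<Rightarrow> rat" where
  "ind S e = of_bool (e \<in> S)"

lemma ind_upd [simp]: "fun_upd (ind S) e 1 = ind (insert e S)" "fun_upd (ind S) e 0 = ind (S - {e})"
  by (auto simp: ind_def fun_eq_iff)

lemma ind_pos [simp]: "0 < ind S e \<longleftrightarrow> e \<in> S" "ind S e \<noteq> 0 \<longleftrightarrow> e \<in> S" "ind S e = 0 \<longleftrightarrow> e \<notin> S"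
  by (auto simp: ind_def)

lemma ind_of_bool: "fun_upd (ind S) e (of_bool b) = ind (if b then insert e S else S - {e})"
  by (cases b) auto

definition frame :: "string set \<Rightarrow> state \<Rightarrow> state \<Rightarrow> bool" where
  "frame U s s' \<longleftrightarrow> (\<forall>x. x \<notin> U \<longrightarrow> mem s' x = mem s x) \<and> probed s' = probed s \<and> chosen s' = chosen s"

lemma frame_mem: "frame U s s' \<Longrightarrow> x \<notin> U \<Longrightarrow> mem s' x = mem s x"
  and frame_probed: "frame U s s' \<Longrightarrow> probed s' = probed s"
  and frame_chosen: "frame U s s' \<Longrightarrow> chosen s' = chosen s"
  by (auto simp: frame_def)

lemma frame_refl [simp]: "frame U s s"
  by (simp add: frame_def)

lemma frame_store: "x \<in> U \<Longrightarrow> frame U s s' \<Longrightarrow> frame U s (store x i r s')"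
  by (auto simp: frame_def)

lemma frame_coins: "frame U s s' \<Longrightarrow> frame U s (s'\<lparr>coins_used := k\<rparr>)"
  by (auto simp: frame_def)

lemma frame_trans: "frame U s s' \<Longrightarrow> frame U' s' s'' \<Longrightarrow> U' \<subseteq> U \<Longrightarrow> frame U s s''"
  unfolding frame_def by (metis subsetD)

text \<open>The condition repeats the guard of \<open>pick_com\<close>; among equal keys the smaller
  index wins. The start value \<open>n\<close> is not an element.\<close>

definition best :: "(nat \<Rightarrow> rat) \<Rightarrow> nat \<Rightarrow> nat set \<Rightarrow> nat" where
  "best \<kappa> n D = fold (\<lambda>e b. if e \<notin> D \<and> \<not> (b < n \<and> \<not> \<kappa> b < \<kappa> e) then e else b) [0..<n] n"

primrec picked :: "(nat \<Rightarrow> rat) \<Rightarrow> nat \<Rightarrow> nat \<Rightarrow> nat set" where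
  "picked \<kappa> n 0 = {}"
| "picked \<kappa> n (Suc t) = insert (best \<kappa> n (picked \<kappa> n t)) (picked \<kappa> n t)"

definition ranked :: "(nat \<Rightarrow> rat) \<Rightarrow> nat \<Rightarrow> nat \<Rightarrow> nat" where
  "ranked \<kappa> n t = best \<kappa> n (picked \<kappa> n t)"

text \<open>
  Scanning by decreasing weight, a new class starts at an element that weighs less than half of the
  leader of the current class. The first component is the current leader, the second one maps every
  scanned element to the weight of the leader of its class.
\<close>

primrec leaders :: "(nat \<Rightarrow> rat) \<Rightarrow> nat \<Rightarrow> nat \<Rightarrow> rat \<times> (nat \<Rightarrow> rat)" where
  "leaders w n 0 = (0, \<lambda>_. 0)"
| "leaders w n (Suc t) = (let e = ranked w n t; c = (if \<not> (0 < t \<and> \<not> 2 * w e < fst (leaders w n t)) then w e else fst (leaders w n t))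
     in (c, fun_upd (snd (leaders w n t)) e c))"

lemma best_cases:
  assumes "\<exists>e<n. e \<notin> D"
  shows "best \<kappa> n D < n" "best \<kappa> n D \<notin> D" "\<And>e. e < n \<Longrightarrow> e \<notin> D \<Longrightarrow> \<kappa> e \<le> \<kappa> (best \<kappa> n D)"
proof -
  define x where "x m = fold (\<lambda>e b. if e \<notin> D \<and> \<not> (b < n \<and> \<not> \<kappa> b < \<kappa> e) then e else b) [0..<m] n" for m
  have "(\<forall>e<m. e \<in> D) \<and> x m = n \<or> x m < m \<and> x m \<notin> D \<and> (\<forall>e<m. e \<notin> D \<longrightarrow> \<kappa> e \<le> \<kappa> (x m))" if "m \<le> n" for m
    using that
  proof (induction m)
    case (Suc m)
    have x: "x (Suc m) = (if m \<notin> D \<and> \<not> (x m < n \<and> \<not> \<kappa> (x m) < \<kappa> m) then m else x m)"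
      unfolding x_def by (subst upt_Suc_append) (simp_all only: fold_append comp_apply fold_simps le0)
    from Suc consider "\<forall>e<m. e \<in> D" "x m = n" | "x m < m" "x m \<notin> D" "\<forall>e<m. e \<notin> D \<longrightarrow> \<kappa> e \<le> \<kappa> (x m)" by fastforce
    then show ?case
    proof cases
      case 1
      then show ?thesis unfolding x by (auto simp: less_Suc_eq)
    next
      case 2
      then have "x m < n" using Suc.prems by simp
      then show ?thesis unfolding x using 2 by (auto simp: less_Suc_eq intro: order.trans less_imp_le)
    qed
  qed (simp add: x_def)
  from this[of n] show "best \<kappa> n D < n" "best \<kappa> n D \<notin> D" "\<And>e. e < n \<Longrightarrow> e \<notin> D \<Longrightarrow> \<kappa> e \<le> \<kappa> (best \<kappa> n D)"
    using assms unfolding x_def best_def by auto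
qed

lemma picked_eq: "picked \<kappa> n t = ranked \<kappa> n ` {..<t}"
  by (induction t) (auto simp: ranked_def lessThan_Suc)

text \<open>At most \<open>t\<close> elements have been picked before step \<open>t\<close>, so for
  \<open>t < n\<close> the selection never falls back on the value \<open>n\<close>.\<close>

lemma rank_props:
  assumes "t < n"
  shows "ranked \<kappa> n t < n" "ranked \<kappa> n t \<notin> picked \<kappa> n t" "\<And>e. e < n \<Longrightarrow> e \<notin> picked \<kappa> n t \<Longrightarrow> \<kappa> e \<le> \<kappa> (ranked \<kappa> n t)"
proof -
  have "card (picked \<kappa> n t) \<le> t" unfolding picked_eq using card_image_le[of "{..<t}"] by simp
  then have "\<not> {..<n} \<subseteq> picked \<kappa> n t"
    using assms card_mono[of "picked \<kappa> n t" "{..<n}"] by (auto simp: picked_eq)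
  then have "\<exists>e<n. e \<notin> picked \<kappa> n t" by auto
  from best_cases[OF this, where \<kappa> = \<kappa>] show "ranked \<kappa> n t < n" "ranked \<kappa> n t \<notin> picked \<kappa> n t"
    "\<And>e. e < n \<Longrightarrow> e \<notin> picked \<kappa> n t \<Longrightarrow> \<kappa> e \<le> \<kappa> (ranked \<kappa> n t)" unfolding ranked_def by auto
qed

lemma bij_rank: "bij_betw (ranked \<kappa> n) {..<n} {..<n}"
proof -
  have "inj_on (ranked \<kappa> n) {..<n}"
  proof (rule linorder_inj_onI)
    fix s t assume "s < t" "s \<in> {..<n}" "t \<in> {..<n}"
    then have "ranked \<kappa> n s \<in> picked \<kappa> n t" "ranked \<kappa> n t \<notin> picked \<kappa> n t"
      using rank_props(2)[where t = t and n = n and \<kappa> = \<kappa>] by (auto simp: picked_eq)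
    then show "ranked \<kappa> n s \<noteq> ranked \<kappa> n t" by metis
  qed auto
  moreover have "ranked \<kappa> n ` {..<n} \<subseteq> {..<n}" using rank_props(1) by auto
  ultimately show ?thesis by (simp add: bij_betw_def endo_inj_surj)
qed

lemma rank_desc:
  assumes "s < t" "t < n"
  shows "\<kappa> (ranked \<kappa> n t) \<le> \<kappa> (ranked \<kappa> n s)"
proof (rule rank_props(3))
  show "ranked \<kappa> n t \<notin> picked \<kappa> n s"
    using bij_rank[of \<kappa> n] assms unfolding picked_eq bij_betw_def inj_on_def by force
qed (use assms rank_props(1) in auto)

lemma picked_subset: "t \<le> n \<Longrightarrow> picked \<kappa> n t \<subseteq> {..<n}"
  using rank_props(1) by (auto simp: picked_eq)

text \<open>The weight \<open>c\<close> of the current leader is the smallest class value so far and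
  every other one is at least \<open>2 * c\<close>, since a new leader weighs less than half of the
  previous one.\<close>

lemma leaders_props:
  assumes "\<And>e. e < n \<Longrightarrow> 0 \<le> w e" "t \<le> n"
  defines "r \<equiv> snd (leaders w n t)" and "c \<equiv> fst (leaders w n t)"
  shows "(0 < t \<longrightarrow> w (ranked w n (t - 1)) \<le> c \<and> c \<le> 2 * w (ranked w n (t - 1))) \<and>
    (\<forall>e\<in>picked w n t. w e \<le> r e \<and> r e \<le> 2 * w e \<and> c \<le> r e \<and> (r e = c \<or> 2 * c \<le> r e)) \<and>
    (\<forall>e\<in>picked w n t. \<forall>f\<in>picked w n t. r e < r f \<longrightarrow> 2 * r e \<le> r f)"
  unfolding r_def c_def using assms(2)
proof (induction t)
  case (Suc t)
  let ?e = "ranked w n t" and ?c = "fst (leaders w n t)" and ?r = "snd (leaders w n t)"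
  define c' where "c' = (if \<not> (0 < t \<and> \<not> 2 * w ?e < ?c) then w ?e else ?c)"
  have L: "fst (leaders w n (Suc t)) = c'" "snd (leaders w n (Suc t)) = fun_upd ?r ?e c'"
    by (simp_all add: c'_def Let_def)
  have new: "?e \<notin> picked w n t" and en: "?e < n" using rank_props(1,2)[where t = t and n = n and \<kappa> = w] Suc.prems by auto
  have we: "0 \<le> w ?e" using assms(1) en .
  have pk: "picked w n (Suc t) = insert ?e (picked w n t)" by (simp add: ranked_def)
  from Suc have IH1: "0 < t \<Longrightarrow> w (ranked w n (t - 1)) \<le> ?c" "0 < t \<Longrightarrow> ?c \<le> 2 * w (ranked w n (t - 1))"
    and IH2: "\<And>e. e \<in> picked w n t \<Longrightarrow> w e \<le> ?r e \<and> ?r e \<le> 2 * w e \<and> ?c \<le> ?r e \<and> (?r e = ?c \<or> 2 * ?c \<le> ?r e)"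
    and IH3: "\<And>e f. e \<in> picked w n t \<Longrightarrow> f \<in> picked w n t \<Longrightarrow> ?r e < ?r f \<Longrightarrow> 2 * ?r e \<le> ?r f" by auto
  have prev: "0 < t \<Longrightarrow> w ?e \<le> w (ranked w n (t - 1))" using rank_desc[of "t - 1" t n w] Suc.prems by auto
  \<comment> \<open>If no new class starts, \<open>2 * w ?e\<close> is at least the leader's weight,
    which is at least the weight of the previous element.\<close>
  have c': "w ?e \<le> c'" "c' \<le> 2 * w ?e" using IH1(1) prev we unfolding c'_def by (auto intro: order.trans)
  have t0: "0 < t" if "e \<in> picked w n t" for e using that by (cases t) auto
  have rel: "c' \<le> ?r e \<and> (?r e = c' \<or> 2 * c' \<le> ?r e)" if e: "e \<in> picked w n t" for e
  proof (cases "2 * w ?e < ?c")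
    case True
    then have "c' = w ?e" unfolding c'_def by simp
    then show ?thesis using IH2[OF e] True we by auto
  next
    case False
    then have "c' = ?c" using t0[OF e] unfolding c'_def by simp
    then show ?thesis using IH2[OF e] by simp
  qed
  have eq: "fun_upd ?r ?e c' e = ?r e" if "e \<in> picked w n t" for e using that new by auto
  have "r' e \<le> 2 * w e" "w e \<le> r' e" "c' \<le> r' e" "r' e = c' \<or> 2 * c' \<le> r' e"
    if "e \<in> insert ?e (picked w n t)" "r' = fun_upd ?r ?e c'" for e r'
    using that c' IH2[of e] rel[of e] by (cases "e = ?e"; auto)+
  moreover have "2 * r' e \<le> r' f" if "e \<in> insert ?e (picked w n t)" "f \<in> insert ?e (picked w n t)" "r' e < r' f" "r' = fun_upd ?r ?e c'" for e f r'
    using that IH3[of e f] rel[of e] rel[of f] by (cases "e = ?e"; cases "f = ?e"; auto)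
  ultimately show ?case unfolding L pk using c' by auto
qed simp

context machine
begin

text \<open>The bound \<open>hi\<close> is evaluated anew in each iteration, so the invariant has to
  guarantee its value. As the invariant is insensitive to the loop variable, the value of that
  variable is supplied separately.\<close>

lemma wp_for:
  assumes init: "Inv 0 s" and hi: "\<And>k s. Inv k s \<Longrightarrow> aval hi (mem s) = of_nat m"
    and stable: "\<And>k s r. Inv k s \<Longrightarrow> Inv k (store x 0 r s)"
    and step: "\<And>k s. k < m \<Longrightarrow> Inv k s \<Longrightarrow> mem s x 0 = of_nat k \<Longrightarrow> wp c (\<lambda>s'. mem s' x 0 = of_nat k \<and> Inv (Suc k) s') s"
    and fin: "\<And>s. Inv m s \<Longrightarrow> Q s" and m: "m \<le> N"
  shows "wp (for_loop x hi c) Q s"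
proof -
  let ?b = "\<lambda>s. bval (Less (var x) hi) (mem s)" and ?c = "Seq c (assign_var x (Add (var x) (Num 1)))"
  have "iterate j ?b (wp ?c) Q s" if "Inv k s" "mem s x 0 = of_nat k" "k \<le> m" "m \<le> j + k" for j k s
    using that
  proof (induction j arbitrary: k s)
    case 0
    then show ?case using hi[OF 0(1)] fin by (simp add: to_nat_idx_of_nat)
  next
    case (Suc j)
    show ?case
    proof (cases "k < m")
      case True
      have "wp c (\<lambda>s'. mem s' x 0 = of_nat k \<and> Inv (Suc k) s') s" using step[OF True Suc.prems(1,2)] .
      then have "wp ?c (iterate j ?b (wp ?c) Q) s"
        unfolding wp.simps
      proof (rule wp_mono, goal_cases)
        case (1 s')
        have st: "store x (to_nat_idx (aval (Num 0) (mem s'))) (aval (Add (var x) (Num 1)) (mem s')) s' = store x 0 (of_nat (Suc k)) s'"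
          using 1 by (simp add: add.commute)
        have "iterate j ?b (wp ?c) Q (store x 0 (of_nat (Suc k)) s')"
          by (rule Suc.IH[of "Suc k"]) (use 1 stable True Suc.prems in auto)
        then show ?case unfolding st wp.simps .
      qed
      moreover have "?b s" using hi[OF Suc.prems(1)] Suc.prems(2) True by simp
      ultimately show ?thesis unfolding iterate.simps by (simp only: if_True)
    next
      case False
      then have "k = m" using Suc.prems by simp
      then show ?thesis using hi[OF Suc.prems(1)] Suc.prems(1,2) fin by simp
    qed
  qed
  from this[of 0 "store x 0 0 s" N] show ?thesis
    unfolding for_loop_def using stable[OF init] m by simp
qed

lemma wp_clear:
  assumes "mem s y = ind S" "S \<subseteq> {..<h}" "\<And>s'. frame {y, ''j''} s s' \<Longrightarrow> aval hi (mem s') = of_nat h" "h \<le> N" "y \<noteq> ''j''"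
    and Q: "\<And>s'. frame {y, ''j''} s s' \<Longrightarrow> coins_used s' = coins_used s \<Longrightarrow> mem s' y = ind {} \<Longrightarrow> Q s'"
  shows "wp (clear y hi) Q s"
  unfolding clear_def
proof (rule wp_for[where m = h and Inv = "\<lambda>k s'. frame {y, ''j''} s s' \<and> coins_used s' = coins_used s \<and> mem s' y = ind (S - {..<k})"])
  fix k s' assume "k < h" and inv: "frame {y, ''j''} s s' \<and> coins_used s' = coins_used s \<and> mem s' y = ind (S - {..<k})" "mem s' ''j'' 0 = of_nat k"
  have "S - {..<k} - {k} = S - {..<Suc k}" by auto
  then show "wp (Assign y (var ''j'') (Num 0)) (\<lambda>s'. mem s' ''j'' 0 = of_nat k \<and> frame {y, ''j''} s s' \<and> coins_used s' = coins_used s \<and> mem s' y = ind (S - {..<Suc k})) s'"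
    using inv assms(5) by (auto intro: frame_store)
next
  fix s' assume "frame {y, ''j''} s s' \<and> coins_used s' = coins_used s \<and> mem s' y = ind (S - {..<h})"
  moreover have "S - {..<h} = {}" using assms(2) by auto
  ultimately show "Q s'" using Q by simp
qed (use assms in \<open>auto intro: frame_store\<close>)

end

definition input_weight :: "probing \<Rightarrow> nat \<Rightarrow> rat" where
  "input_weight I e = (if e < univ_size I then weight I e else 0)"

definition input_prob :: "probing \<Rightarrow> nat \<Rightarrow> rat" where
  "input_prob I e = (if e < univ_size I then act_prob I e else 0)"

definition input_value :: "probing \<Rightarrow> nat \<Rightarrow> rat" where
  "input_value I e = input_prob I e * input_weight I e"

text \<open>\<open>128 = 32 * 4\<close>: the analysis needs \<open>32 * n * C\<close> trials, and
  \<open>C\<close> is at most 4 times the last factor. For matroids \<open>C\<close> is linear in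
  the numbers of families, for \<open>k\<close>-systems in the two parameters cut off at
  \<open>n\<close>, whence the summand \<open>3 * n\<close>.\<close>

definition trials :: "probing \<Rightarrow> nat" where
  "trials I = 128 * univ_size I * (length (inner_fams I) + length (outer_fams I) + 3 * univ_size I + 1)"

text \<open>The two programs differ in their preprocessing, in the expressions \<open>ein\<close>
  and \<open>eout\<close> for the numbers of oracles and in the key of the scan. The expressions are
  interpreted on the inputs, which no command changes.\<close>

locale probing_machine = machine I X \<omega> N for I X \<omega> N +
  fixes kin kout :: nat and ein eout :: aexp and key :: "aexp \<Rightarrow> aexp" and kv :: "nat \<Rightarrow> rat"
  assumes n_le: "Suc (univ_size I) \<le> N" and ni_le: "length (inner_fams I) \<le> N" and no_le: "length (outer_fams I) \<le> N"
    and M_le: "128 * univ_size I * (length (inner_fams I) + length (outer_fams I) + 3 * univ_size I + 1) \<le> N"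
    and ein: "\<And>m. (\<And>x. x \<in> inputs \<Longrightarrow> m x = mem (initial_state kin kout I) x) \<Longrightarrow> aval ein m = of_nat (length (inner_fams I))"
    and eout: "\<And>m. (\<And>x. x \<in> inputs \<Longrightarrow> m x = mem (initial_state kin kout I) x) \<Longrightarrow> aval eout m = of_nat (length (outer_fams I))"
    and key: "\<And>m i. (\<And>x. x \<in> inputs \<Longrightarrow> m x = mem (initial_state kin kout I) x) \<Longrightarrow> aval (key i) m = kv (to_nat_idx (aval i m))"
begin

definition "n = univ_size I"
definition "Fs = inner_fams I"
definition "Os = outer_fams I"

abbreviation "M \<equiv> trials I"
abbreviation "wv \<equiv> input_weight I"
abbreviation "pv \<equiv> input_prob I"
abbreviation "vv \<equiv> input_value I"

lemma M_def: "M = 128 * n * (length Fs + length Os + 3 * n + 1)"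
  and wv_def: "wv e = (if e < n then weight I e else 0)"
  and pv_def: "pv e = (if e < n then act_prob I e else 0)"
  and vv_def: "vv e = pv e * wv e"
  by (simp_all add: trials_def input_weight_def input_prob_def input_value_def n_def Fs_def Os_def)

definition inp :: "state \<Rightarrow> bool" where
  "inp s \<longleftrightarrow> (\<forall>x\<in>inputs. mem s x = mem (initial_state kin kout I) x)"

lemma inp_simps:
  assumes "inp s"
  shows "mem s ''n'' 0 = of_nat n" "mem s ''w'' = wv" "mem s ''p'' = pv"
    "aval ein (mem s) = of_nat (length Fs)" "aval eout (mem s) = of_nat (length Os)"
    "aval (trials_exp ein eout) (mem s) = of_nat M" "aval (weight_exp i) (mem s) = wv (to_nat_idx (aval i (mem s)))"
    "aval (key i) (mem s) = kv (to_nat_idx (aval i (mem s)))" "aval (value_exp i) (mem s) = vv (to_nat_idx (aval i (mem s)))"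
proof -
  have *: "mem s x = mem (initial_state kin kout I) x" if "x \<in> inputs" for x using assms that unfolding inp_def by blast
  show n: "mem s ''n'' 0 = of_nat n" using *[of "''n''"] by (simp add: initial_state_def n_def)
  show w: "mem s ''w'' = wv" using *[of "''w''"] by (auto simp: initial_state_def n_def wv_def fun_eq_iff)
  show p: "mem s ''p'' = pv" using *[of "''p''"] by (auto simp: initial_state_def n_def pv_def fun_eq_iff)
  show i: "aval ein (mem s) = of_nat (length Fs)" unfolding Fs_def by (rule ein) (rule *)
  show o: "aval eout (mem s) = of_nat (length Os)" unfolding Os_def by (rule eout) (rule *)
  show "aval (trials_exp ein eout) (mem s) = of_nat M" by (simp add: trials_exp_def n i o M_def algebra_simps)
  show "aval (weight_exp i) (mem s) = wv (to_nat_idx (aval i (mem s)))" by (simp add: weight_exp_def w)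
  show "aval (value_exp i) (mem s) = vv (to_nat_idx (aval i (mem s)))" by (simp add: value_exp_def w p vv_def)
  show "aval (key i) (mem s) = kv (to_nat_idx (aval i (mem s)))" by (rule key) (rule *)
qed

lemma inp_frame: "inp s \<Longrightarrow> frame U s s' \<Longrightarrow> U \<inter> inputs = {} \<Longrightarrow> inp s'"
  unfolding inp_def frame_def by (metis disjoint_iff)

lemma bounds: "n \<le> N" "Suc n \<le> N" "length Fs \<le> N" "length Os \<le> N" "M \<le> N"
  using n_le ni_le no_le M_le unfolding n_def Fs_def Os_def M_def by auto

lemma wp_pick:
  assumes inp: "inp s" and d: "mem s ''d'' = ind D"
    and key': "\<And>s i. inp s \<Longrightarrow> aval (key' i) (mem s) = kv' (to_nat_idx (aval i (mem s)))"
    and Q: "\<And>s'. frame {''b'', ''e''} s s' \<Longrightarrow> coins_used s' = coins_used s \<Longrightarrow> mem s' ''b'' 0 = of_nat (best kv' n D) \<Longrightarrow> Q s'"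
  shows "wp (pick_com key') Q s"
proof -
  define x where "x m = fold (\<lambda>e b. if e \<notin> D \<and> \<not> (b < n \<and> \<not> kv' b < kv' e) then e else b) [0..<m] n" for m
  have x: "x (Suc m) = (if m \<notin> D \<and> \<not> (x m < n \<and> \<not> kv' (x m) < kv' m) then m else x m)" for m
    unfolding x_def by (subst upt_Suc_append) (simp_all only: fold_append comp_apply fold_simps le0)
  let ?s = "store ''b'' 0 (of_nat n) s"
  let ?Inv = "\<lambda>k s'. frame {''b'', ''e''} s s' \<and> coins_used s' = coins_used s \<and> mem s' ''b'' 0 = of_nat (x k)"
  have "wp (for_loop ''e'' (var ''n'')
     (If (Conj (Neg (flag ''d'' (var ''e'')))
          (Neg (Conj (Less (var ''b'') (var ''n'')) (Neg (Less (key' (var ''b'')) (key' (var ''e'')))))))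
       (assign_var ''b'' (var ''e'')) Skip)) Q ?s"
  proof (rule wp_for[where m = n and Inv = ?Inv])
    fix k s' assume "k < n" and inv: "?Inv k s'" and k: "mem s' ''e'' 0 = of_nat k"
    then have fr: "frame {''b'', ''e''} s s'" by simp
    have inp': "inp s'" using inp_frame[OF inp fr] by simp
    have d': "mem s' ''d'' = ind D" using d frame_mem[OF fr, of "''d''"] by simp
    show "wp (If (Conj (Neg (flag ''d'' (var ''e'')))
          (Neg (Conj (Less (var ''b'') (var ''n'')) (Neg (Less (key' (var ''b'')) (key' (var ''e'')))))))
       (assign_var ''b'' (var ''e'')) Skip) (\<lambda>s'. mem s' ''e'' 0 = of_nat k \<and> ?Inv (Suc k) s') s'"
      using inv k by (auto simp: d' inp_simps[OF inp'] key'[OF inp'] x intro: frame_store)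
  next
    fix k s' assume "?Inv k s'"
    then have "inp s'" using inp_frame[OF inp, of "{''b'', ''e''}" s'] by simp
    then show "aval (var ''n'') (mem s') = of_nat n" by (simp add: inp_simps)
  next
    fix s' assume "?Inv n s'"
    then show "Q s'" using Q unfolding best_def x_def by simp
  qed (use bounds in \<open>auto simp: x_def intro: frame_store\<close>)
  then show ?thesis unfolding pick_com_def by (simp add: inp_simps[OF inp])
qed

abbreviation "class_of \<equiv> snd (leaders wv n n)"

lemma wp_classes:
  assumes inp: "inp s" and d: "mem s ''d'' = ind {}" and r: "mem s ''r'' = (\<lambda>_. 0)" and x: "mem s ''x'' 0 = 0"
    and Q: "\<And>s'. frame {''b'', ''e'', ''t'', ''x'', ''r'', ''d'', ''j''} s s' \<Longrightarrow> coins_used s' = coins_used s \<Longrightarrow>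
      mem s' ''d'' = ind {} \<Longrightarrow> mem s' ''r'' = class_of \<Longrightarrow> Q s'"
  shows "wp classes_com Q s"
proof -
  let ?U = "{''b'', ''e'', ''t'', ''x'', ''r'', ''d'', ''j''}"
  let ?Inv = "\<lambda>k s'. frame ?U s s' \<and> coins_used s' = coins_used s \<and> mem s' ''d'' = ind (picked wv n k) \<and>
     mem s' ''x'' 0 = fst (leaders wv n k) \<and> mem s' ''r'' = snd (leaders wv n k)"
  show ?thesis
    unfolding classes_com_def wp.simps(3)[where c = "for_loop _ _ _"]
  proof (rule wp_for[where m = n and Inv = ?Inv])
    fix k s' assume k: "k < n" "mem s' ''t'' 0 = of_nat k" and inv: "?Inv k s'"
    then have fr: "frame ?U s s'" by simp
    have inp': "inp s'" using inp_frame[OF inp fr] by simp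
    show "wp (Seq (pick_com weight_exp)
     (Seq (If (Neg (Conj (Less (Num 0) (var ''t'')) (Neg (Less (Mul (Num 2) (Elem ''w'' (var ''b''))) (var ''x'')))))
            (assign_var ''x'' (Elem ''w'' (var ''b''))) Skip)
     (Seq (Assign ''r'' (var ''b'') (var ''x'')) (Assign ''d'' (var ''b'') (Num 1)))))
      (\<lambda>s'. mem s' ''t'' 0 = of_nat k \<and> ?Inv (Suc k) s') s'"
      unfolding wp.simps(3)[where c = "pick_com _"]
    proof (rule wp_pick[OF inp', where kv' = wv and D = "picked wv n k"])
      fix s2 assume fr2: "frame {''b'', ''e''} s' s2" and c2: "coins_used s2 = coins_used s'"
        and b: "mem s2 ''b'' 0 = of_nat (best wv n (picked wv n k))"
      have fr3: "frame ?U s s2" by (rule frame_trans[OF fr fr2]) simp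
      have inp2: "inp s2" using inp_frame[OF inp fr3] by simp
      have m: "mem s2 ''t'' = mem s' ''t''" "mem s2 ''x'' = mem s' ''x''" "mem s2 ''r'' = mem s' ''r''" "mem s2 ''d'' = mem s' ''d''"
        using fr2 by (auto simp: frame_mem)
      show "wp (Seq (If (Neg (Conj (Less (Num 0) (var ''t'')) (Neg (Less (Mul (Num 2) (Elem ''w'' (var ''b''))) (var ''x'')))))
            (assign_var ''x'' (Elem ''w'' (var ''b''))) Skip)
        (Seq (Assign ''r'' (var ''b'') (var ''x'')) (Assign ''d'' (var ''b'') (Num 1))))
        (\<lambda>s'. mem s' ''t'' 0 = of_nat k \<and> ?Inv (Suc k) s') s2"
        using inv k c2 fr3 by (auto simp: inp_simps[OF inp2] b m ranked_def Let_def intro!: frame_store)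
    qed (use inv inp_simps(7) in auto)
  next
    fix k s' assume "?Inv k s'"
    then have "inp s'" using inp_frame[OF inp, of ?U s'] by simp
    then show "aval (var ''n'') (mem s') = of_nat n" by (simp add: inp_simps)
  next
    fix s' assume inv: "?Inv n s'"
    then have fr: "frame ?U s s'" by simp
    show "wp (clear ''d'' (var ''n'')) Q s'"
    proof (rule wp_clear[where S = "picked wv n n" and h = n])
      fix s2 assume "frame {''d'', ''j''} s' s2"
      then have "frame ?U s s2" by (rule frame_trans[OF fr]) simp
      then show "aval (var ''n'') (mem s2) = of_nat n" using inp_frame[OF inp, of ?U s2] by (simp add: inp_simps)
    next
      fix s2 assume fr2: "frame {''d'', ''j''} s' s2" and "coins_used s2 = coins_used s'" "mem s2 ''d'' = ind {}"
      moreover have "frame ?U s s2" by (rule frame_trans[OF fr fr2]) simp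
      moreover have "mem s2 ''r'' = mem s' ''r''" using fr2 by (auto simp: frame_mem)
      ultimately show "Q s2" using inv by (intro Q) auto
    qed (use inv picked_subset bounds in auto)
  qed (use bounds d r x in \<open>auto intro!: frame_store\<close>)
qed

end

section \<open>Sampling by coin flips\<close>

text \<open>For \<open>0 < q \<le> 1\<close> the power \<open>1 / 2 ^ doublings q\<close> lies
  between \<open>q\<close> and \<open>2 * q\<close>; it is the rounded probability.\<close>

definition doublings :: "rat \<Rightarrow> nat" where
  "doublings q = (LEAST k. 1 < 2 * (2 ^ k * q))"

lemma doublings:
  assumes "0 < q"
  shows "1 < 2 * (2 ^ doublings q * q)" "k < doublings q \<Longrightarrow> 2 * (2 ^ k * q) \<le> 1"
proof -
  obtain m :: nat where "1 / q < of_nat m" using reals_Archimedean2 by blast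
  also have "of_nat m \<le> (2 ^ m :: rat)" using of_nat_less_two_power[of m] by (rule less_imp_le)
  finally have "1 < 2 ^ m * q" using assms by (simp add: divide_less_eq)
  then have "1 < 2 * (2 ^ m * q)" by simp
  then show "1 < 2 * (2 ^ doublings q * q)" unfolding doublings_def by (rule LeastI)
  show "2 * (2 ^ k * q) \<le> 1" if "k < doublings q"
    using not_less_Least[of k "\<lambda>k. 1 < 2 * (2 ^ k * q)"] that unfolding doublings_def by simp
qed

text \<open>All \<open>k\<close> coins are read even after a tail, as in the program, so that the
  positions on the tape agree.\<close>

primrec heads :: "nat \<Rightarrow> bool tree" where
  "heads 0 = Ret True"
| "heads (Suc k) = tbind (heads k) (\<lambda>a. Coin (\<lambda>b. Ret (a \<and> b)))"

lemma toss_heads: "toss (heads k) \<omega> i = ((\<forall>j<k. \<omega> (i + j)), i + k)"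
  by (induction k) (auto simp: toss_tbind less_Suc_eq)

lemma dist_heads: "tree_pmf (heads k) = bernoulli_pmf (1 / 2 ^ k)"
proof (induction k)
  case 0
  have "bernoulli_pmf 1 = return_pmf True"
    by (intro pmf_eqI) (auto simp: pmf_return indicator_def split: bool.split)
  then show ?case by simp
next
  case (Suc k)
  have "tree_pmf (heads (Suc k)) = map_pmf (\<lambda>(x, y). x \<and> y) (pair_pmf (bernoulli_pmf (1 / 2 ^ k)) (bernoulli_pmf (1 / 2)))"
    by (simp add: dist_tbind Suc map_pmf_def pair_pmf_def bind_assoc_pmf bind_return_pmf)
  also have "\<dots> = bernoulli_pmf (1 / 2 ^ k * (1 / 2))" by (rule bernoulli_conj) auto
  finally show ?case by (simp add: mult.commute)
qed

definition sample_tree :: "(nat \<Rightarrow> nat) \<Rightarrow> nat list \<Rightarrow> (nat \<Rightarrow> bool) tree" where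
  "sample_tree J xs = foldl (\<lambda>T e. tbind T (\<lambda>Y. tbind (heads (J e)) (\<lambda>b. Ret (fun_upd Y e b)))) (Ret (\<lambda>_. False)) xs"

lemma sample_tree_Nil [simp]: "sample_tree J [] = Ret (\<lambda>_. False)"
  and sample_tree_snoc: "sample_tree J (xs @ [e]) =
    tbind (sample_tree J xs) (\<lambda>Y. tbind (heads (J e)) (\<lambda>b. Ret (fun_upd Y e b)))"
  by (simp_all add: sample_tree_def)

lemma dist_sample_tree:
  "distinct xs \<Longrightarrow> tree_pmf (sample_tree J xs) = Pi_pmf (set xs) False (\<lambda>e. bernoulli_pmf (1 / 2 ^ J e))"
proof (induction xs rule: rev_induct)
  case (snoc e xs)
  then have "tree_pmf (sample_tree J (xs @ [e])) =
      do {Y \<leftarrow> Pi_pmf (set xs) False (\<lambda>e. bernoulli_pmf (1 / 2 ^ J e)); b \<leftarrow> bernoulli_pmf (1 / 2 ^ J e); return_pmf (fun_upd Y e b)}"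
    by (simp add: sample_tree_snoc dist_tbind dist_heads)
  also have "\<dots> = do {b \<leftarrow> bernoulli_pmf (1 / 2 ^ J e); Y \<leftarrow> Pi_pmf (set xs) False (\<lambda>e. bernoulli_pmf (1 / 2 ^ J e)); return_pmf (fun_upd Y e b)}"
    by (rule bind_commute_pmf)
  also have "\<dots> = Pi_pmf (set (xs @ [e])) False (\<lambda>e. bernoulli_pmf (1 / 2 ^ J e))"
    using snoc.prems by (simp add: Pi_pmf_insert')
  finally show ?case .
qed simp

primrec hits_tree :: "(nat \<Rightarrow> nat) \<Rightarrow> nat set set list \<Rightarrow> (nat \<Rightarrow> rat) \<Rightarrow> nat \<Rightarrow> nat list \<Rightarrow> nat \<Rightarrow> nat tree" where
  "hits_tree J Fs r f xs 0 = Ret 0"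
| "hits_tree J Fs r f xs (Suc k) = tbind (hits_tree J Fs r f xs k) (\<lambda>c.
     tbind (sample_tree J xs) (\<lambda>Y. Ret (if blocked Fs r Y f xs then Suc c else c)))"

text \<open>Each round draws a fresh sample, so the rounds are independent trials with success
  probability \<open>block_prob\<close>.\<close>

lemma dist_hits_tree:
  assumes "distinct xs"
  shows "tree_pmf (hits_tree J Fs r f xs k) = binomial_pmf k (block_prob Fs r (\<lambda>e. 1 / 2 ^ J e) f xs)"
proof (induction k)
  case 0
  then show ?case by (simp add: binomial_pmf_0[OF block_prob_01(1)])
next
  case (Suc k)
  let ?P = "Pi_pmf (set xs) False (\<lambda>e. bernoulli_pmf (1 / 2 ^ J e))" and ?\<beta> = "block_prob Fs r (\<lambda>e. 1 / 2 ^ J e) f xs"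
  have *: "map_pmf (\<lambda>Y. blocked Fs r Y f xs) ?P = bernoulli_pmf ?\<beta>"
  proof (rule pmf_eqI)
    have T: "pmf (map_pmf (\<lambda>Y. blocked Fs r Y f xs) ?P) True = ?\<beta>"
      unfolding block_prob_def by (simp add: pmf_map vimage_def)
    fix b
    show "pmf (map_pmf (\<lambda>Y. blocked Fs r Y f xs) ?P) b = pmf (bernoulli_pmf ?\<beta>) b"
      using T block_prob_01(2,3)[of Fs r _ f xs] by (cases b) (simp_all add: pmf_False_conv_True)
  qed
  have "tree_pmf (hits_tree J Fs r f xs (Suc k)) =
    do {c \<leftarrow> binomial_pmf k ?\<beta>; b \<leftarrow> map_pmf (\<lambda>Y. blocked Fs r Y f xs) ?P; return_pmf ((if b then 1 else 0) + c)}"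
    by (simp add: dist_tbind Suc dist_sample_tree[OF assms] bind_map_pmf)
       (intro bind_pmf_cong; simp)
  also have "\<dots> = do {b \<leftarrow> bernoulli_pmf ?\<beta>; c \<leftarrow> binomial_pmf k ?\<beta>; return_pmf ((if b then 1 else 0) + c)}"
    unfolding * by (rule bind_commute_pmf)
  also have "\<dots> = binomial_pmf (Suc k) ?\<beta>" by (rule binomial_pmf_Suc[symmetric, OF block_prob_01(1)])
  finally show ?case .
qed

definition step_tree :: "(nat \<Rightarrow> nat) \<Rightarrow> nat \<Rightarrow> nat \<Rightarrow> nat set set list \<Rightarrow> nat set set list \<Rightarrow> (nat \<Rightarrow> rat) \<Rightarrow>
    (nat \<Rightarrow> rat) \<Rightarrow> nat \<Rightarrow> nat list \<times> nat set \<Rightarrow> (nat list \<times> nat set) tree" where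
  "step_tree J M n Fs Os r v f \<sigma> = (if 0 < v f then tbind (hits_tree J Fs r f (fst \<sigma>) M)
     (\<lambda>c. Ret (if 2 * c < M then admit v n Os f \<sigma> else \<sigma>)) else Ret \<sigma>)"

primrec plan_tree :: "(nat \<Rightarrow> nat) \<Rightarrow> nat \<Rightarrow> nat \<Rightarrow> nat set set list \<Rightarrow> nat set set list \<Rightarrow> (nat \<Rightarrow> rat) \<Rightarrow>
    (nat \<Rightarrow> rat) \<Rightarrow> (nat \<Rightarrow> nat) \<Rightarrow> nat \<Rightarrow> (nat list \<times> nat set) tree" where
  "plan_tree J M n Fs Os r v ord 0 = Ret ([], {})"
| "plan_tree J M n Fs Os r v ord (Suc t) = tbind (plan_tree J M n Fs Os r v ord t) (step_tree J M n Fs Os r v (ord t))"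

definition state_ok :: "(nat \<Rightarrow> rat) \<Rightarrow> nat set \<Rightarrow> nat list \<times> nat set \<Rightarrow> bool" where
  "state_ok v D \<sigma> \<longleftrightarrow> distinct (fst \<sigma>) \<and> set (fst \<sigma>) \<subseteq> D \<and> snd \<sigma> \<subseteq> set (fst \<sigma>) \<and> (\<forall>e\<in>set (fst \<sigma>). 0 < v e)"

lemma state_ok_admit:
  "state_ok v D \<sigma> \<Longrightarrow> f \<notin> D \<Longrightarrow> 0 < v f \<Longrightarrow> state_ok v (insert f D) (admit v n Os f \<sigma>)"
  unfolding state_ok_def admit_def by auto

lemma state_ok_mono: "state_ok v D \<sigma> \<Longrightarrow> state_ok v (insert f D) \<sigma>"
  unfolding state_ok_def by auto

text \<open>The two kinds of probabilities need to agree only on elements of positive value, since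
  no other element enters the accepted list; therefore \<open>state_ok\<close> is proved
  along.\<close>

lemma dist_plan_tree:
  assumes "inj_on ord {..<t}" and p: "\<And>e. 0 < v e \<Longrightarrow> p e = 1 / 2 ^ J e"
  shows "tree_pmf (plan_tree J M n Fs Os r v ord t) = plan M n Fs Os r p v ord t \<and>
    (\<forall>\<sigma>\<in>set_pmf (plan M n Fs Os r p v ord t). state_ok v (ord ` {..<t}) \<sigma>)"
  using assms(1)
proof (induction t)
  case (Suc t)
  let ?P = "plan M n Fs Os r p v ord t"
  have inj: "inj_on ord {..<t}" using Suc.prems by (rule inj_on_subset) auto
  have new: "ord t \<notin> ord ` {..<t}"
  proof
    assume "ord t \<in> ord ` {..<t}"
    then obtain s where "s < t" "ord t = ord s" by auto
    then show False using inj_onD[OF Suc.prems, of t s] by simp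
  qed
  have IH: "tree_pmf (plan_tree J M n Fs Os r v ord t) = ?P" "\<And>\<sigma>. \<sigma> \<in> set_pmf ?P \<Longrightarrow> state_ok v (ord ` {..<t}) \<sigma>"
    using Suc.IH[OF inj] by auto
  have "tree_pmf (plan_tree J M n Fs Os r v ord (Suc t)) = bind_pmf ?P (\<lambda>\<sigma>. tree_pmf (step_tree J M n Fs Os r v (ord t) \<sigma>))"
    by (simp add: dist_tbind IH(1))
  also have "\<dots> = bind_pmf ?P (plan_step M n Fs Os r p v (ord t))"
  proof (rule bind_pmf_cong[OF refl])
    fix \<sigma> assume "\<sigma> \<in> set_pmf ?P"
    then have d: "distinct (fst \<sigma>)" and "\<forall>e\<in>set (fst \<sigma>). 0 < v e" using IH(2) unfolding state_ok_def by blast+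
    then have "block_prob Fs r (\<lambda>e. 1 / 2 ^ J e) (ord t) (fst \<sigma>) = block_prob Fs r p (ord t) (fst \<sigma>)"
      unfolding block_prob_def using p by (intro arg_cong[where f = "\<lambda>P. measure_pmf.prob P _"] Pi_pmf_cong) auto
    then show "tree_pmf (step_tree J M n Fs Os r v (ord t) \<sigma>) = plan_step M n Fs Os r p v (ord t) \<sigma>"
      using d by (simp add: step_tree_def plan_step_def dist_tbind dist_hits_tree map_pmf_def)
  qed
  moreover have "state_ok v (ord ` {..<Suc t}) \<sigma>'"
    if "\<sigma> \<in> set_pmf ?P" "\<sigma>' \<in> set_pmf (plan_step M n Fs Os r p v (ord t) \<sigma>)" for \<sigma> \<sigma>'
    using that(2) IH(2)[OF that(1)] state_ok_admit[of v "ord ` {..<t}" \<sigma> "ord t" n Os] new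
      state_ok_mono[of v "ord ` {..<t}" \<sigma> "ord t"]
    by (auto simp: plan_step_def lessThan_Suc split: if_splits)
  ultimately show ?case by auto
qed (simp add: state_ok_def)

section \<open>Correctness of the sampling loops\<close>

context machine
begin

lemma wp_seqI: "wp c (wp d Q) s \<Longrightarrow> wp (Seq c d) Q s"
  by simp

lemma wp_assignI: "Q (store x (to_nat_idx (aval a (mem s))) (aval b (mem s)) s) \<Longrightarrow> wp (Assign x a b) Q s"
  by simp

lemma wp_ifI: "(bval b (mem s) \<Longrightarrow> wp c Q s) \<Longrightarrow> (\<not> bval b (mem s) \<Longrightarrow> wp d Q s) \<Longrightarrow> wp (If b c d) Q s"
  by simp

lemma wp_while:
  assumes "Inv 0 s" and step: "\<And>k s. k < m \<Longrightarrow> Inv k s \<Longrightarrow> bval b (mem s) \<and> wp c (Inv (Suc k)) s"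
    and fin: "\<And>s. Inv m s \<Longrightarrow> \<not> bval b (mem s) \<and> Q s" and m: "m \<le> N"
  shows "wp (While b c) Q s"
proof -
  have "iterate j (\<lambda>s. bval b (mem s)) (wp c) Q s" if "Inv k s" "k \<le> m" "m \<le> j + k" for j k s
    using that
  proof (induction j arbitrary: k s)
    case 0
    then show ?case using fin by simp
  next
    case (Suc j)
    show ?case
    proof (cases "k < m")
      case True
      then have "wp c (iterate j (\<lambda>s. bval b (mem s)) (wp c) Q) s"
        by (intro wp_mono[OF conjunct2[OF step[OF True Suc.prems(1)]]]) (use Suc in auto)
      then show ?thesis using step[OF True Suc.prems(1)] by simp
    next
      case False
      then show ?thesis using fin Suc.prems by simp
    qed
  qed
  from this[OF assms(1)] m show ?thesis by simp
qed

end

locale probing_sampler = probing_machine +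
  assumes valid: "valid_numbers I"
    and doublings_le: "\<And>e. e < univ_size I \<Longrightarrow> 0 < act_prob I e \<Longrightarrow> doublings (act_prob I e) \<le> N"
begin

definition acc :: "state \<Rightarrow> nat list \<Rightarrow> bool" where
  "acc s xs \<longleftrightarrow> mem s ''m'' 0 = of_nat (length xs) \<and> (\<forall>j<length xs. mem s ''a'' j = of_nat (xs ! j))"

definition J :: "nat \<Rightarrow> nat" where "J e = doublings (pv e)"

text \<open>For scratch arrays: the set left over from the previous use is irrelevant, but it must
  lie in the universe for \<open>wp_clear\<close> and for overwriting it cell by cell.\<close>

definition holds_set :: "string \<Rightarrow> state \<Rightarrow> bool" where
  "holds_set y s \<longleftrightarrow> (\<exists>S\<subseteq>{..<n}. mem s y = ind S)"

lemma acc_frame: "acc s xs \<Longrightarrow> frame U s s' \<Longrightarrow> ''m'' \<notin> U \<Longrightarrow> ''a'' \<notin> U \<Longrightarrow> acc s' xs"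
  unfolding acc_def by (simp add: frame_mem)

lemma wp_draw:
  assumes inp: "inp s" and acc: "acc s xs" and xs: "set xs \<subseteq> {..<n}" "\<And>e. e \<in> set xs \<Longrightarrow> 0 < pv e" and len: "length xs \<le> N"
    and Q: "\<And>s' Y. frame {''j'', ''y'', ''l'', ''g''} s s' \<Longrightarrow> toss (sample_tree J xs) \<omega> (coins_used s) = (Y, coins_used s') \<Longrightarrow>
      (\<And>e. e \<in> set xs \<Longrightarrow> mem s' ''y'' e = of_bool (Y e)) \<Longrightarrow> Q s'"
  shows "wp draw_com Q s"
proof -
  let ?U = "{''j'', ''y'', ''l'', ''g''}"
  define Inv where "Inv k s' \<longleftrightarrow> frame ?U s s' \<and> (\<exists>Y. toss (sample_tree J (take k xs)) \<omega> (coins_used s) = (Y, coins_used s') \<and>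
      (\<forall>e\<in>set (take k xs). mem s' ''y'' e = of_bool (Y e)))" for k s'
  show ?thesis
    unfolding draw_com_def Let_def
  proof (rule wp_for[where m = "length xs" and Inv = Inv])
    fix k s' assume k: "k < length xs" "mem s' ''j'' 0 = of_nat k" and inv: "Inv k s'"
    then obtain Y where fr: "frame ?U s s'" and Y: "toss (sample_tree J (take k xs)) \<omega> (coins_used s) = (Y, coins_used s')"
      "\<And>e. e \<in> set (take k xs) \<Longrightarrow> mem s' ''y'' e = of_bool (Y e)" unfolding Inv_def by blast
    define e where "e = xs ! k"
    have e: "e < n" "0 < pv e" using xs k unfolding e_def by (meson nth_mem lessThan_iff subsetD)+
    have Je: "J e \<le> N" using doublings_le[of e] e unfolding J_def pv_def n_def by (auto split: if_splits)
    define c0 where "c0 = coins_used s'"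
    have a: "mem s' ''a'' k = of_nat e" using acc_frame[OF acc fr] k unfolding acc_def e_def by simp
    have inp': "inp s'" using inp_frame[OF inp fr] by simp
    \<comment> \<open>By minimality of \<open>doublings\<close> the guard fails after exactly
      \<open>J e\<close> iterations; until then the flag of \<open>e\<close> records whether all
      coins so far were heads.\<close>
    define L where "L i s2 \<longleftrightarrow> frame ?U s s2 \<and> mem s2 ''j'' 0 = of_nat k \<and> coins_used s2 = c0 + i \<and>
      mem s2 ''y'' = fun_upd (mem s' ''y'') e (of_bool (\<forall>j<i. \<omega> (c0 + j))) \<and> mem s2 ''l'' 0 = 2 ^ i * pv e" for i s2
    let ?e = "Elem ''a'' (var ''j'')"
    let ?s = "store ''l'' 0 (pv e) (store ''y'' e 1 s')"
    have "wp (While (Neg (Less (Num 1) (Add (var ''l'') (var ''l''))))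
       (Seq (Flip ''g'') (Seq (If (flag ''g'' (Num 0)) Skip (Assign ''y'' ?e (Num 0)))
         (assign_var ''l'' (Mul (var ''l'') (Num 2)))))) (\<lambda>s'. mem s' ''j'' 0 = of_nat k \<and> Inv (Suc k) s') ?s"
    proof (rule wp_while[where m = "J e" and Inv = L])
      show "L 0 ?s" using fr k unfolding L_def c0_def by (auto intro!: frame_store)
    next
      fix i s2 assume i: "i < J e" and l: "L i s2"
      have dbl: "2 * (2 ^ i * pv e) \<le> 1" "2 * (pv e * 2 ^ i) \<le> 1"
        using doublings(2)[OF e(2), of i] i unfolding J_def by (simp_all add: mult.commute)
      have a2: "mem s2 ''a'' k = of_nat e"
        using l acc_frame[OF acc, of ?U s2] k unfolding L_def acc_def e_def by simp
      show "bval (Neg (Less (Num 1) (Add (var ''l'') (var ''l'')))) (mem s2) \<and>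
        wp (Seq (Flip ''g'') (Seq (If (flag ''g'' (Num 0)) Skip (Assign ''y'' ?e (Num 0)))
         (assign_var ''l'' (Mul (var ''l'') (Num 2))))) (L (Suc i)) s2"
        using l a2 dbl i k unfolding L_def J_def
        by (auto simp: less_Suc_eq fun_eq_iff intro!: frame_store frame_coins)
    next
      fix s2 assume l: "L (J e) s2"
      have tk: "take (Suc k) xs = take k xs @ [e]" using k unfolding e_def by (simp add: take_Suc_conv_app_nth)
      have "toss (sample_tree J (take (Suc k) xs)) \<omega> (coins_used s) = (fun_upd Y e (\<forall>j<J e. \<omega> (c0 + j)), coins_used s2)"
        using l Y(1) unfolding tk sample_tree_snoc L_def c0_def by (simp add: toss_tbind toss_heads)
      moreover have "mem s2 ''y'' a = of_bool (fun_upd Y e (\<forall>j<J e. \<omega> (c0 + j)) a)" if "a \<in> set (take (Suc k) xs)" for a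
        using that l Y(2)[of a] unfolding tk L_def by auto
      ultimately have "Inv (Suc k) s2" unfolding Inv_def using l unfolding L_def by blast
      then show "\<not> bval (Neg (Less (Num 1) (Add (var ''l'') (var ''l'')))) (mem s2) \<and> mem s2 ''j'' 0 = of_nat k \<and> Inv (Suc k) s2"
        using l doublings(1)[OF e(2)] unfolding L_def J_def by (simp add: mult.commute)
    qed (rule Je)
    then show "wp (Seq (Assign ''y'' ?e (Num 1)) (Seq (assign_var ''l'' (Elem ''p'' ?e))
       (While (Neg (Less (Num 1) (Add (var ''l'') (var ''l''))))
       (Seq (Flip ''g'') (Seq (If (flag ''g'' (Num 0)) Skip (Assign ''y'' ?e (Num 0)))
         (assign_var ''l'' (Mul (var ''l'') (Num 2)))))))) (\<lambda>s'. mem s' ''j'' 0 = of_nat k \<and> Inv (Suc k) s') s'"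
      using a k by (intro wp_seqI wp_assignI) (simp add: inp_simps[OF inp'] del: wp.simps(5))
  next
    fix k s' assume "Inv k s'"
    then show "aval (var ''m'') (mem s') = of_nat (length xs)"
      using acc_frame[OF acc, of ?U s'] unfolding Inv_def acc_def by simp
  next
    fix k s' r assume "Inv k s'"
    then show "Inv k (store ''j'' 0 r s')" unfolding Inv_def by (auto intro!: frame_store)
  next
    fix s' assume "Inv (length xs) s'"
    then show "Q s'" using Q[of s'] unfolding Inv_def by auto
  qed (use len in \<open>auto simp: Inv_def\<close>)
qed

lemma cand_take_Suc:
  assumes "k < length xs"
  shows "cand Y r f (take (Suc k) xs) = (if Y (xs ! k) \<and> r (xs ! k) = r f then cand Y r f (take k xs) @ [xs ! k] else cand Y r f (take k xs))"
  using assms by (simp add: cand_def take_Suc_conv_app_nth)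

lemma cand_subset: "set xs \<subseteq> A \<Longrightarrow> set (cand Y r f xs) \<subseteq> A"
  by (auto simp: cand_def)

lemma wp_test:
  assumes inp: "inp s" and acc: "acc s xs" and xs: "set xs \<subseteq> {..<n}" and len: "length xs \<le> N"
    and y: "\<And>e. e \<in> set xs \<Longrightarrow> mem s ''y'' e = of_bool (Y e)" and r: "mem s ''r'' = r"
    and b: "mem s ''b'' 0 = of_nat f" and f: "f < n" and z: "holds_set ''z'' s"
    and Q: "\<And>s'. frame {''x'', ''i'', ''j'', ''z'', ''g''} s s' \<Longrightarrow> coins_used s' = coins_used s \<Longrightarrow>
      mem s' ''x'' 0 = of_bool (blocked Fs r Y f xs) \<Longrightarrow> holds_set ''z'' s' \<Longrightarrow> Q s'"
  shows "wp (test_com ein) Q s"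
proof -
  let ?near = "(Conj (flag ''y'' (Elem ''a'' (var ''j''))) (Conj (Neg (Less (Elem ''r'' (Elem ''a'' (var ''j''))) (Elem ''r'' (var ''b'')))) (Neg (Less (Elem ''r'' (var ''b'')) (Elem ''r'' (Elem ''a'' (var ''j'')))))))"
  let ?add = "(Seq (Assign ''z'' (Elem ''a'' (var ''j'')) (Num 1)) (Seq (Query_Inner ''g'' (var ''i'') ''z'') (If (flag ''g'' (Num 0)) Skip (Assign ''z'' (Elem ''a'' (var ''j'')) (Num 0)))))"
  let ?decide = "(Seq (Assign ''z'' (var ''b'') (Num 1)) (Seq (Query_Inner ''g'' (var ''i'') ''z'') (If (flag ''g'' (Num 0)) Skip (assign_var ''x'' (Num 1)))))"
  let ?U = "{''x'', ''i'', ''j'', ''z'', ''g''}"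
  let ?bl = "\<lambda>F. insert f (greedy F (cand Y r f xs)) \<notin> F"
  define Inv where "Inv k s' \<longleftrightarrow> frame ?U s s' \<and> coins_used s' = coins_used s \<and>
     mem s' ''x'' 0 = of_bool (\<exists>i<k. ?bl (Fs ! i)) \<and> holds_set ''z'' s'" for k s'
  have "wp (for_loop ''i'' ein
     (Seq (clear ''z'' (var ''n''))
     (Seq (for_loop ''j'' (var ''m'') (let e = Elem ''a'' (var ''j'') in
        If (Conj (flag ''y'' e) (Conj (Neg (Less (Elem ''r'' e) (Elem ''r'' (var ''b''))))
              (Neg (Less (Elem ''r'' (var ''b'')) (Elem ''r'' e)))))
          (Seq (Assign ''z'' e (Num 1)) (Seq (Query_Inner ''g'' (var ''i'') ''z'')
            (If (flag ''g'' (Num 0)) Skip (Assign ''z'' e (Num 0))))) Skip))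
     ?decide))) Q (store ''x'' 0 0 s)"
    unfolding Let_def
  proof (rule wp_for[where m = "length Fs" and Inv = Inv])
    fix i s' assume i: "i < length Fs" "mem s' ''i'' 0 = of_nat i" and inv: "Inv i s'"
    then have fr: "frame ?U s s'" unfolding Inv_def by simp
    let ?F = "Fs ! i"
    define G where "G k = greedy ?F (cand Y r f (take k xs))" for k
    have Gn: "G k \<subseteq> {..<n}" for k
      unfolding G_def using greedy_subset cand_subset[of "take k xs" "{..<n}" Y r f] xs set_take_subset[of k xs] by (meson order_trans)
    define L where "L k s2 \<longleftrightarrow> frame ?U s s2 \<and> coins_used s2 = coins_used s \<and> mem s2 ''i'' 0 = of_nat i \<and>
      mem s2 ''x'' 0 = of_bool (\<exists>i'<i. ?bl (Fs ! i')) \<and> mem s2 ''z'' = ind (G k)" for k s2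
    have query: "oracle_answer (inner_fams I) i (coded_set I ''z'' m) \<longleftrightarrow> S \<in> ?F" if "m ''z'' = ind S" "S \<subseteq> {..<n}" for m S
    proof -
      have "coded_set I ''z'' m = S" using that unfolding coded_set_def n_def by auto
      then show ?thesis using i(1) unfolding oracle_answer_def Fs_def by simp
    qed
    obtain S where S: "S \<subseteq> {..<n}" "mem s' ''z'' = ind S" using inv unfolding Inv_def holds_set_def by auto
    show "wp (Seq (clear ''z'' (var ''n''))
     (Seq (for_loop ''j'' (var ''m'') (
        If ?near
          ?add Skip))
     ?decide)) (\<lambda>s'. mem s' ''i'' 0 = of_nat i \<and> Inv (Suc i) s') s'"
    proof (intro wp_seqI, rule wp_clear[OF S(2,1)], rule_tac [4] wp_seqI)
      fix s2 assume "frame {''z'', ''j''} s' s2"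
      then have "frame ?U s s2" by (rule frame_trans[OF fr]) simp
      then show "aval (var ''n'') (mem s2) = of_nat n" using inp_frame[OF inp, of ?U s2] by (simp add: inp_simps)
    next
      fix s2 assume fr2: "frame {''z'', ''j''} s' s2" and c2: "coins_used s2 = coins_used s'" and z2: "mem s2 ''z'' = ind {}"
      have fr3: "frame ?U s s2" by (rule frame_trans[OF fr fr2]) simp
      show "wp (for_loop ''j'' (var ''m'') (
        If ?near
          ?add Skip))
        (wp ?decide (\<lambda>s'. mem s' ''i'' 0 = of_nat i \<and> Inv (Suc i) s')) s2"
      proof (rule wp_for[where m = "length xs" and Inv = L])
        show "L 0 s2" unfolding L_def using fr3 c2 z2 inv i fr2 unfolding Inv_def G_def by (simp add: cand_def frame_mem[OF fr2])
      next
        fix k s3 assume k: "k < length xs" "mem s3 ''j'' 0 = of_nat k" and l: "L k s3"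
        have fr4: "frame ?U s s3" using l unfolding L_def by simp
        have a: "mem s3 ''a'' k = of_nat (xs ! k)" using acc_frame[OF acc fr4] k unfolding acc_def by simp
        have m: "mem s3 ''y'' (xs ! k) = of_bool (Y (xs ! k))" "mem s3 ''r'' = r" "mem s3 ''b'' 0 = of_nat f"
          using y[of "xs ! k"] r b k by (simp_all add: frame_mem[OF fr4])
        have ins: "insert (xs ! k) (G k) \<subseteq> {..<n}" using Gn xs k by (meson insert_subsetI nth_mem subsetD)
        have G: "G (Suc k) = (if Y (xs ! k) \<and> r (xs ! k) = r f then
            (if insert (xs ! k) (G k) \<in> ?F then insert (xs ! k) (G k) else G k - {xs ! k}) else G k)"
          unfolding G_def cand_take_Suc[OF k(1)] by (simp add: greedy_snoc)
        let ?s4 = "store ''z'' (xs ! k) 1 s3"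
        have q: "oracle_answer (inner_fams I) i (coded_set I ''z'' (mem ?s4)) \<longleftrightarrow> insert (xs ! k) (G k) \<in> ?F"
          using l by (intro query ins) (simp add: L_def)
        show "wp (If ?near
          ?add Skip) (\<lambda>s'. mem s' ''j'' 0 = of_nat k \<and> L (Suc k) s') s3"
        proof (rule wp_ifI)
          assume "bval ?near (mem s3)"
          then have "Y (xs ! k) \<and> r (xs ! k) = r f" using k a m by (auto split: if_splits)
          then have G': "G (Suc k) = (if insert (xs ! k) (G k) \<in> ?F then insert (xs ! k) (G k) else G k - {xs ! k})"
            unfolding G by simp
          show "wp ?add (\<lambda>s'. mem s' ''j'' 0 = of_nat k \<and> L (Suc k) s') s3"
            using l k a q[simplified] i unfolding L_def G' by (auto intro!: frame_store)
        next
          assume "\<not> bval ?near (mem s3)"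
          then have "\<not> (Y (xs ! k) \<and> r (xs ! k) = r f)" using k a m by (auto split: if_splits)
          then have "G (Suc k) = G k" unfolding G by (simp only: if_False)
          then show "wp Skip (\<lambda>s'. mem s' ''j'' 0 = of_nat k \<and> L (Suc k) s') s3" using l k unfolding L_def by simp
        qed
      next
        fix k s3 assume l: "L k s3"
        then show "aval (var ''m'') (mem s3) = of_nat (length xs)"
          using acc_frame[OF acc, of ?U s3] unfolding L_def acc_def by simp
      next
        fix k s3 r assume "L k s3"
        then show "L k (store ''j'' 0 r s3)" unfolding L_def by (auto intro!: frame_store)
      next
        fix s3 assume l: "L (length xs) s3"
        have fr4: "frame ?U s s3" using l unfolding L_def by simp
        have G: "G (length xs) = greedy ?F (cand Y r f xs)" unfolding G_def by simp
        have ins: "insert f (G (length xs)) \<subseteq> {..<n}" using Gn f by auto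
        let ?s4 = "store ''z'' f 1 s3"
        have q: "oracle_answer (inner_fams I) i (coded_set I ''z'' (mem ?s4)) \<longleftrightarrow> insert f (G (length xs)) \<in> ?F"
          using l by (intro query ins) (simp add: L_def)
        show "wp ?decide (\<lambda>s'. mem s' ''i'' 0 = of_nat i \<and> Inv (Suc i) s') s3"
          using l q[simplified] i ins b frame_mem[OF fr4, of "''b''"] unfolding L_def Inv_def holds_set_def G
          by (auto intro!: frame_store exI[of _ "insert f (greedy ?F (cand Y r f xs))"] simp: less_Suc_eq)
      qed (use len in auto)
    qed (use bounds in auto)
  next
    show "Inv 0 (store ''x'' 0 0 s)" unfolding Inv_def using z unfolding holds_set_def by (auto intro!: frame_store)
  next
    fix k s' assume "Inv k s'"
    then show "aval ein (mem s') = of_nat (length Fs)"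
      using inp_frame[OF inp, of ?U s'] unfolding Inv_def by (simp add: inp_simps)
  next
    fix k s' r assume "Inv k s'"
    then show "Inv k (store ''i'' 0 r s')" unfolding Inv_def holds_set_def by (auto intro!: frame_store)
  next
    fix s' assume "Inv (length Fs) s'"
    moreover have "(\<exists>i<length Fs. ?bl (Fs ! i)) \<longleftrightarrow> blocked Fs r Y f xs"
      unfolding blocked_def by (metis in_set_conv_nth)
    ultimately show "Q s'" using Q unfolding Inv_def by simp
  qed (rule bounds)
  then show ?thesis unfolding test_com_def by simp
qed

lemma wp_hits:
  assumes inp: "inp s" and acc: "acc s xs" and xs: "set xs \<subseteq> {..<n}" "\<And>e. e \<in> set xs \<Longrightarrow> 0 < pv e" and len: "length xs \<le> N"
    and r: "mem s ''r'' = r" and b: "mem s ''b'' 0 = of_nat f" and f: "f < n" and z: "holds_set ''z'' s"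
    and Q: "\<And>s' c. frame {''c'', ''h'', ''j'', ''y'', ''l'', ''g'', ''x'', ''i'', ''z''} s s' \<Longrightarrow>
      toss (hits_tree J Fs r f xs M) \<omega> (coins_used s) = (c, coins_used s') \<Longrightarrow> mem s' ''c'' 0 = of_nat c \<Longrightarrow> holds_set ''z'' s' \<Longrightarrow> Q s'"
  shows "wp (hits_com ein eout) Q s"
proof -
  let ?U = "{''c'', ''h'', ''j'', ''y'', ''l'', ''g'', ''x'', ''i'', ''z''}"
  define Inv where "Inv k s' \<longleftrightarrow> frame ?U s s' \<and> holds_set ''z'' s' \<and>
     (\<exists>c. toss (hits_tree J Fs r f xs k) \<omega> (coins_used s) = (c, coins_used s') \<and> mem s' ''c'' 0 = of_nat c)" for k s'
  show ?thesis
    unfolding hits_com_def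
  proof (intro wp_seqI wp_assignI, rule wp_for[where m = M and Inv = Inv])
    show "Inv 0 (store ''c'' (to_nat_idx (aval (Num 0) (mem s))) (aval (Num 0) (mem s)) s)"
      unfolding Inv_def using z unfolding holds_set_def by (auto intro!: frame_store)
  next
    fix k s' assume k: "mem s' ''h'' 0 = of_nat k" and inv: "Inv k s'"
    then obtain c where fr: "frame ?U s s'" and z': "holds_set ''z'' s'"
      and c: "toss (hits_tree J Fs r f xs k) \<omega> (coins_used s) = (c, coins_used s')" "mem s' ''c'' 0 = of_nat c" unfolding Inv_def by auto
    have inp': "inp s'" using inp_frame[OF inp fr] by simp
    have acc': "acc s' xs" using acc_frame[OF acc fr] by simp
    show "wp (Seq draw_com (Seq (test_com ein) (If (flag ''x'' (Num 0)) (assign_var ''c'' (Add (var ''c'') (Num 1))) Skip)))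
      (\<lambda>s'. mem s' ''h'' 0 = of_nat k \<and> Inv (Suc k) s') s'"
    proof (intro wp_seqI, rule wp_draw[OF inp' acc' xs len], assumption, rule wp_seqI)
      fix s2 Y assume fr2: "frame {''j'', ''y'', ''l'', ''g''} s' s2" and Y: "toss (sample_tree J xs) \<omega> (coins_used s') = (Y, coins_used s2)"
        "\<And>e. e \<in> set xs \<Longrightarrow> mem s2 ''y'' e = of_bool (Y e)"
      have fr3: "frame ?U s s2" by (rule frame_trans[OF fr fr2]) simp
      show "wp (test_com ein) (wp (If (flag ''x'' (Num 0)) (assign_var ''c'' (Add (var ''c'') (Num 1))) Skip)
        (\<lambda>s'. mem s' ''h'' 0 = of_nat k \<and> Inv (Suc k) s')) s2"
      proof (rule wp_test[where Y = Y and f = f and r = r])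
        fix s3 assume fr4: "frame {''x'', ''i'', ''j'', ''z'', ''g''} s2 s3" and c3: "coins_used s3 = coins_used s2"
          and x: "mem s3 ''x'' 0 = of_bool (blocked Fs r Y f xs)" and z3: "holds_set ''z'' s3"
        have fr5: "frame ?U s s3" by (rule frame_trans[OF fr3 fr4]) simp
        have cc: "mem s3 ''c'' 0 = of_nat c" "mem s3 ''h'' 0 = of_nat k"
          using c(2) k by (simp_all add: frame_mem[OF fr4] frame_mem[OF fr2])
        have "toss (hits_tree J Fs r f xs (Suc k)) \<omega> (coins_used s) = (if blocked Fs r Y f xs then Suc c else c, coins_used s3)"
          using c(1) Y(1) c3 by (simp add: toss_tbind)
        then show "wp (If (flag ''x'' (Num 0)) (assign_var ''c'' (Add (var ''c'') (Num 1))) Skip)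
          (\<lambda>s'. mem s' ''h'' 0 = of_nat k \<and> Inv (Suc k) s') s3"
          unfolding Inv_def using x z3 fr5 cc unfolding holds_set_def by (auto intro!: frame_store simp del: hits_tree.simps)
      next
        show "holds_set ''z'' s2" using z' unfolding holds_set_def by (simp add: frame_mem[OF fr2])
      qed (use inp_frame[OF inp fr3] acc_frame[OF acc fr3] xs len Y(2) r b f frame_mem[OF fr3] in auto)
    qed
  next
    fix k s' assume "Inv k s'"
    then show "aval (trials_exp ein eout) (mem s') = of_nat M"
      using inp_frame[OF inp, of ?U s'] unfolding Inv_def by (simp add: inp_simps)
  next
    fix k s' r assume "Inv k s'"
    then show "Inv k (store ''h'' 0 r s')" unfolding Inv_def holds_set_def by (auto intro!: frame_store)
  next
    fix s' assume "Inv M s'"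
    then show "Q s'" using Q unfolding Inv_def by blast
  qed (rule bounds)
qed

end

text \<open>A tape is an arbitrary function, but each outcome has positive probability. So facts
  about the support hold in every single run.\<close>

lemma toss_in_tree_pmf: "fst (toss t \<omega> i) \<in> set_pmf (tree_pmf t)"
proof (induction t arbitrary: i)
  case (Coin f)
  have "fst (toss (f (\<omega> i)) \<omega> (Suc i)) \<in> set_pmf (tree_pmf (f (\<omega> i)))" by (rule Coin) simp
  then show ?case by (simp, intro exI[of _ "\<omega> i"])
qed simp

section \<open>Correctness of the program\<close>

context probing_sampler
begin

lemma vv_pos: "0 < vv e \<Longrightarrow> 0 < pv e \<and> e < n"
proof -
  assume v: "0 < vv e"
  then have e: "e < n" unfolding vv_def wv_def by (auto split: if_splits)
  then have "0 \<le> pv e" using valid unfolding valid_numbers_def pv_def n_def by auto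
  moreover have "pv e \<noteq> 0" using v unfolding vv_def by auto
  ultimately show ?thesis using e by simp
qed

lemma query_inner: "i < length Fs \<Longrightarrow> m y = ind S \<Longrightarrow> S \<subseteq> {..<n} \<Longrightarrow> oracle_answer (inner_fams I) i (coded_set I y m) \<longleftrightarrow> S \<in> Fs ! i"
  unfolding oracle_answer_def Fs_def coded_set_def n_def by (simp add: Collect_conj_eq Int_absorb1 lessThan_def)

lemma query_outer: "i < length Os \<Longrightarrow> m y = ind S \<Longrightarrow> S \<subseteq> {..<n} \<Longrightarrow> oracle_answer (outer_fams I) i (coded_set I y m) \<longleftrightarrow> S \<in> Os ! i"
  unfolding oracle_answer_def Os_def coded_set_def n_def by (simp add: Collect_conj_eq Int_absorb1 lessThan_def)

lemma wp_rival:
  assumes inp: "inp s" and u: "mem s ''u'' = ind (insert f Q)" and q: "mem s ''q'' = ind Q"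
    and f: "f < n" "f \<notin> Q" and Qn: "Q \<subseteq> {..<n}" and i: "mem s ''i'' 0 = of_nat i" "i < length Os"
    and post: "\<And>s'. frame {''x'', ''j'', ''u'', ''g''} s s' \<Longrightarrow> coins_used s' = coins_used s \<Longrightarrow>
      mem s' ''x'' 0 = of_nat (rival vv n (Os ! i) Q f) \<Longrightarrow> mem s' ''u'' = ind (insert f Q) \<Longrightarrow> R s'"
  shows "wp rival_com R s"
proof -
  let ?U = "{''x'', ''j'', ''u'', ''g''}" and ?F = "Os ! i"
  define x where "x m = fold (\<lambda>j x. if j \<in> Q \<and> (x < n \<longrightarrow> vv j < vv x) \<and> insert f (Q - {j}) \<in> ?F then j else x) [0..<m] n" for m
  have x: "x (Suc m) = (if m \<in> Q \<and> (x m < n \<longrightarrow> vv m < vv (x m)) \<and> insert f (Q - {m}) \<in> ?F then m else x m)" for m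
    unfolding x_def by (subst upt_Suc_append) (simp_all only: fold_append comp_apply fold_simps le0)
  define Inv where "Inv k s' \<longleftrightarrow> frame ?U s s' \<and> coins_used s' = coins_used s \<and> mem s' ''x'' 0 = of_nat (x k) \<and>
    mem s' ''u'' = ind (insert f Q)" for k s'
  show ?thesis
    unfolding rival_com_def
  proof (intro wp_seqI wp_assignI, rule wp_for[where m = n and Inv = Inv])
    show "Inv 0 (store ''x'' (to_nat_idx (aval (Num 0) (mem s))) (aval (var ''n'') (mem s)) s)"
      unfolding Inv_def using u by (auto intro!: frame_store simp: x_def inp_simps[OF inp])
  next
    fix k s' assume k: "k < n" "mem s' ''j'' 0 = of_nat k" and inv: "Inv k s'"
    then have fr: "frame ?U s s'" unfolding Inv_def by simp
    have inp': "inp s'" using inp_frame[OF inp fr] by simp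
    have m: "mem s' ''q'' = ind Q" "mem s' ''i'' 0 = of_nat i" using q i by (simp_all add: frame_mem[OF fr])
    let ?b = "Conj (flag ''q'' (var ''j'')) (Neg (Conj (Less (var ''x'') (var ''n''))
            (Neg (Less (value_exp (var ''j'')) (value_exp (var ''x''))))))"
    have b: "bval ?b (mem s') \<longleftrightarrow> k \<in> Q \<and> (x k < n \<longrightarrow> vv k < vv (x k))"
      using inv k m unfolding Inv_def by (auto simp: inp_simps[OF inp'])
    show "wp (If ?b
       (Seq (Assign ''u'' (var ''j'') (Num 0)) (Seq (Query_Outer ''g'' (var ''i'') ''u'')
         (Seq (Assign ''u'' (var ''j'') (Num 1))
           (If (flag ''g'' (Num 0)) (assign_var ''x'' (var ''j'')) Skip)))) Skip) (\<lambda>s'. mem s' ''j'' 0 = of_nat k \<and> Inv (Suc k) s') s'"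
    proof (rule wp_ifI)
      assume "bval ?b (mem s')"
      then have kQ: "k \<in> Q" "x k < n \<longrightarrow> vv k < vv (x k)" using b by auto
      \<comment> \<open>Between iterations \<open>u\<close> represents \<open>insert f Q\<close>.
        Taking out \<open>k\<close> for one query leaves \<open>f\<close> in place, because
        \<open>f\<close> is not in \<open>Q\<close>.\<close>
      then have eq: "insert f Q - {k} = insert f (Q - {k})" "insert k (insert f (Q - {k})) = insert f Q" using f by auto
      have xS: "x (Suc k) = (if insert f (Q - {k}) \<in> ?F then k else x k)" using kQ x by simp
      have "oracle_answer (outer_fams I) i (coded_set I ''u'' (mem (store ''u'' k 0 s'))) \<longleftrightarrow> insert f (Q - {k}) \<in> ?F"
        using inv f Qn unfolding Inv_def by (intro query_outer i(2)) (auto simp: eq(1))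
      then show "wp (Seq (Assign ''u'' (var ''j'') (Num 0)) (Seq (Query_Outer ''g'' (var ''i'') ''u'')
         (Seq (Assign ''u'' (var ''j'') (Num 1))
           (If (flag ''g'' (Num 0)) (assign_var ''x'' (var ''j'')) Skip)))) (\<lambda>s'. mem s' ''j'' 0 = of_nat k \<and> Inv (Suc k) s') s'"
        using inv k m i unfolding Inv_def xS by (auto simp: eq intro!: frame_store)
    next
      assume "\<not> bval ?b (mem s')"
      then have "x (Suc k) = x k" using b x by auto
      then show "wp Skip (\<lambda>s'. mem s' ''j'' 0 = of_nat k \<and> Inv (Suc k) s') s'" using inv k unfolding Inv_def by simp
    qed
  next
    fix k s' assume "Inv k s'"
    then show "aval (var ''n'') (mem s') = of_nat n" using inp_frame[OF inp, of ?U s'] unfolding Inv_def by (simp add: inp_simps)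
  next
    fix k s' r assume "Inv k s'"
    then show "Inv k (store ''j'' 0 r s')" unfolding Inv_def by (auto intro!: frame_store)
  next
    fix s' assume "Inv n s'"
    then show "R s'" using post unfolding Inv_def x_def rival_def by simp
  qed (rule bounds)
qed

lemma rival_le: "rival vv n F Q f \<le> n"
  using rival_cases[of Q n f F vv] by auto

lemma conflicts_le: "conflicts vv n Os Q f \<subseteq> {..<Suc n}"
  using rival_le by (auto simp: conflicts_def less_Suc_eq_le)

lemma wp_conflicts:
  assumes inp: "inp s" and q: "mem s ''q'' = ind Q" and b: "mem s ''b'' 0 = of_nat f"
    and f: "f < n" "f \<notin> Q" and Qn: "Q \<subseteq> {..<n}" and k: "mem s ''k'' = ind K" "K \<subseteq> {..<Suc n}" and u: "holds_set ''u'' s"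
    and post: "\<And>s'. frame {''k'', ''j'', ''i'', ''u'', ''g'', ''x''} s s' \<Longrightarrow> coins_used s' = coins_used s \<Longrightarrow>
      mem s' ''k'' = ind (conflicts vv n Os Q f) \<Longrightarrow> holds_set ''u'' s' \<Longrightarrow> R s'"
  shows "wp (conflicts_com eout) R s"
proof -
  let ?U = "{''k'', ''j'', ''i'', ''u'', ''g'', ''x''}"
  define C where "C m = (\<lambda>i. rival vv n (Os ! i) Q f) ` {i. i < m \<and> insert f Q \<notin> Os ! i}" for m
  have C: "C (Suc m) = (if insert f Q \<in> Os ! m then C m else insert (rival vv n (Os ! m) Q f) (C m))" for m
    unfolding C_def by (auto simp: less_Suc_eq)
  define Inv where "Inv m s' \<longleftrightarrow> frame ?U s s' \<and> coins_used s' = coins_used s \<and> mem s' ''k'' = ind (C m) \<and> holds_set ''u'' s'" for m s'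
  let ?body = "Seq (for_loop ''j'' (var ''n'') (Assign ''u'' (var ''j'') (Elem ''q'' (var ''j''))))
     (Seq (Assign ''u'' (var ''b'') (Num 1)) (Seq (Query_Outer ''g'' (var ''i'') ''u'')
       (If (flag ''g'' (Num 0)) Skip (Seq rival_com (Assign ''k'' (var ''x'') (Num 1))))))"
  have loop: "wp (for_loop ''i'' eout ?body) R s1"
    if fr1: "frame {''k'', ''j''} s s1" and c1: "coins_used s1 = coins_used s" and k1: "mem s1 ''k'' = ind {}" for s1
  proof (rule wp_for[where m = "length Os" and Inv = Inv])
    show "Inv 0 s1" unfolding Inv_def
      using frame_trans[OF frame_refl[of ?U s] fr1] c1 k1 u by (auto simp: C_def holds_set_def frame_mem[OF fr1])
  next
    fix m s' assume m: "m < length Os" "mem s' ''i'' 0 = of_nat m" and inv: "Inv m s'"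
    then have fr: "frame ?U s s'" unfolding Inv_def by simp
    obtain S where S: "S \<subseteq> {..<n}" "mem s' ''u'' = ind S" using inv unfolding Inv_def holds_set_def by auto
    define L where "L j s2 \<longleftrightarrow> frame ?U s s2 \<and> coins_used s2 = coins_used s \<and> mem s2 ''k'' = ind (C m) \<and> mem s2 ''i'' 0 = of_nat m \<and>
      mem s2 ''u'' = ind (S - {..<j} \<union> Q \<inter> {..<j})" for j s2
    show "wp ?body (\<lambda>s'. mem s' ''i'' 0 = of_nat m \<and> Inv (Suc m) s') s'"
    proof (rule wp_seqI, rule wp_for[where m = n and Inv = L])
      show "L 0 s'" using inv m S unfolding L_def Inv_def by simp
    next
      fix j s2 assume j: "j < n" "mem s2 ''j'' 0 = of_nat j" and l: "L j s2"
      have "mem s2 ''q'' = ind Q" using l q unfolding L_def by (auto simp: frame_mem)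
      moreover have "fun_upd (ind (S - {..<j} \<union> Q \<inter> {..<j})) j (ind Q j) = ind (S - {..<Suc j} \<union> Q \<inter> {..<Suc j})"
        by (auto simp: ind_def fun_eq_iff less_Suc_eq)
      ultimately show "wp (Assign ''u'' (var ''j'') (Elem ''q'' (var ''j''))) (\<lambda>s'. mem s' ''j'' 0 = of_nat j \<and> L (Suc j) s') s2"
        using l j unfolding L_def by (auto intro!: frame_store)
    next
      fix j s2 assume "L j s2"
      then show "aval (var ''n'') (mem s2) = of_nat n" using inp_frame[OF inp, of ?U s2] unfolding L_def by (simp add: inp_simps)
    next
      fix j s2 r assume "L j s2"
      then show "L j (store ''j'' 0 r s2)" unfolding L_def by (auto intro!: frame_store)
    next
      fix s2 assume l: "L n s2"
      have "S - {..<n} \<union> Q \<inter> {..<n} = Q" using S Qn by auto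
      then have l': "frame ?U s s2" "coins_used s2 = coins_used s" "mem s2 ''k'' = ind (C m)" "mem s2 ''i'' 0 = of_nat m" "mem s2 ''u'' = ind Q"
        using l unfolding L_def by auto
      have b2: "mem s2 ''b'' 0 = of_nat f" using b by (simp add: frame_mem[OF l'(1)])
      define s3 where "s3 = store ''g'' 0 (of_bool (insert f Q \<in> Os ! m)) (store ''u'' f 1 s2)"
      have fr3: "frame ?U s s3" unfolding s3_def using l' by (auto intro!: frame_store)
      have m3: "mem s3 ''k'' = ind (C m)" "mem s3 ''i'' 0 = of_nat m" "mem s3 ''u'' = ind (insert f Q)" "coins_used s3 = coins_used s"
        "mem s3 ''g'' 0 = of_bool (insert f Q \<in> Os ! m)"
        using l' unfolding s3_def by auto
      have fQ: "insert f Q \<subseteq> {..<n}" using f Qn by auto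
      have u3: "holds_set ''u'' s3" unfolding holds_set_def using m3(3) fQ by blast
      have "wp (If (flag ''g'' (Num 0)) Skip (Seq rival_com (Assign ''k'' (var ''x'') (Num 1)))) (\<lambda>s'. mem s' ''i'' 0 = of_nat m \<and> Inv (Suc m) s') s3"
      proof (rule wp_ifI)
        assume "bval (flag ''g'' (Num 0)) (mem s3)"
        then have "insert f Q \<in> Os ! m" using m3 by (auto split: if_splits)
        then show "wp Skip (\<lambda>s'. mem s' ''i'' 0 = of_nat m \<and> Inv (Suc m) s') s3"
          using fr3 m3 u3 unfolding Inv_def C by auto
      next
        assume "\<not> bval (flag ''g'' (Num 0)) (mem s3)"
        then have no: "insert f Q \<notin> Os ! m" using m3 by auto
        show "wp (Seq rival_com (Assign ''k'' (var ''x'') (Num 1))) (\<lambda>s'. mem s' ''i'' 0 = of_nat m \<and> Inv (Suc m) s') s3"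
        proof (rule wp_seqI, rule wp_rival[where f = f and Q = Q and i = m])
          fix s4 assume fr4: "frame {''x'', ''j'', ''u'', ''g''} s3 s4" and c4: "coins_used s4 = coins_used s3"
            and x4: "mem s4 ''x'' 0 = of_nat (rival vv n (Os ! m) Q f)" and u4: "mem s4 ''u'' = ind (insert f Q)"
          have fr5: "frame ?U s s4" by (rule frame_trans[OF fr3 fr4]) simp
          show "wp (Assign ''k'' (var ''x'') (Num 1)) (\<lambda>s'. mem s' ''i'' 0 = of_nat m \<and> Inv (Suc m) s') s4"
            using fr5 c4 x4 u4 m3 no fQ unfolding Inv_def C holds_set_def
            by (auto simp: frame_mem[OF fr4] intro!: frame_store exI[of _ "insert f Q"])
        qed (use inp_frame[OF inp fr3] m3 q f Qn m frame_mem[OF fr3] in auto)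
      qed
      moreover have "oracle_answer (outer_fams I) m (coded_set I ''u'' (mem (store ''u'' f 1 s2))) \<longleftrightarrow> insert f Q \<in> Os ! m"
        using l' by (intro query_outer m(1) fQ) simp
      ultimately show "wp (Seq (Assign ''u'' (var ''b'') (Num 1)) (Seq (Query_Outer ''g'' (var ''i'') ''u'')
       (If (flag ''g'' (Num 0)) Skip (Seq rival_com (Assign ''k'' (var ''x'') (Num 1)))))) (\<lambda>s'. mem s' ''i'' 0 = of_nat m \<and> Inv (Suc m) s') s2"
        using b2 l'(4) unfolding s3_def by (intro wp_seqI wp_assignI) (simp del: wp.simps(3,4))
    qed (rule bounds)
  next
    fix k s' assume "Inv k s'"
    then show "aval eout (mem s') = of_nat (length Os)" using inp_frame[OF inp, of ?U s'] unfolding Inv_def by (simp add: inp_simps)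
  next
    fix k s' r assume "Inv k s'"
    then show "Inv k (store ''i'' 0 r s')" unfolding Inv_def holds_set_def by (auto intro!: frame_store)
  next
    fix s' assume inv: "Inv (length Os) s'"
    have "C (length Os) = conflicts vv n Os Q f"
      unfolding C_def conflicts_def by (auto simp: in_set_conv_nth image_iff)
    then show "R s'" using post inv unfolding Inv_def by simp
  qed (rule bounds)
  show ?thesis
    unfolding conflicts_com_def
  proof (rule wp_seqI, rule wp_clear[OF k])
    fix s' assume "frame {''k'', ''j''} s s'"
    then show "aval (Add (var ''n'') (Num 1)) (mem s') = of_nat (Suc n)"
      using inp_frame[OF inp, of "{''k'', ''j''}" s'] by (simp add: inp_simps)
  qed (use bounds loop in auto)
qed

lemma wp_exchange:
  assumes inp: "inp s" and acc: "acc s xs" and q: "mem s ''q'' = ind Q" and k: "mem s ''k'' = ind (conflicts vv n Os Q f)"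
    and b: "mem s ''b'' 0 = of_nat f"
    and post: "\<And>s'. frame {''v'', ''j'', ''a'', ''m'', ''q''} s s' \<Longrightarrow> coins_used s' = coins_used s \<Longrightarrow>
      acc s' (fst (admit vv n Os f (xs, Q))) \<Longrightarrow> mem s' ''q'' = ind (snd (admit vv n Os f (xs, Q))) \<Longrightarrow> R s'"
  shows "wp exchange_com R s"
proof -
  let ?gain = "(Conj (Neg (flag ''k'' (var ''n''))) (Less (Mul (Num 2) (var ''v'')) (value_exp (var ''b''))))"
  let ?swap = "(Seq (Assign ''a'' (var ''m'') (var ''b'')) (Seq (assign_var ''m'' (Add (var ''m'') (Num 1))) (Seq (for_loop ''j'' (var ''n'') (If (flag ''k'' (var ''j'')) (Assign ''q'' (var ''j'') (Num 0)) Skip)) (Assign ''q'' (var ''b'') (Num 1)))))"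
  let ?U = "{''v'', ''j'', ''a'', ''m'', ''q''}" and ?K = "conflicts vv n Os Q f"
  define Inv where "Inv m s' \<longleftrightarrow> frame {''v'', ''j''} s s' \<and> coins_used s' = coins_used s \<and> mem s' ''v'' 0 = sum vv (?K \<inter> {..<m})" for m s'
  let ?rest = "If ?gain
       ?swap Skip"
  show ?thesis
    unfolding exchange_com_def
  proof (intro wp_seqI wp_assignI, rule wp_for[where m = n and Inv = Inv])
    show "Inv 0 (store ''v'' (to_nat_idx (aval (Num 0) (mem s))) (aval (Num 0) (mem s)) s)"
      unfolding Inv_def by (auto intro!: frame_store)
  next
    fix m s' assume m: "m < n" "mem s' ''j'' 0 = of_nat m" and inv: "Inv m s'"
    then have fr: "frame {''v'', ''j''} s s'" unfolding Inv_def by simp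
    have inp': "inp s'" using inp_frame[OF inp fr] by simp
    have k': "mem s' ''k'' = ind ?K" using k by (simp add: frame_mem[OF fr])
    have "?K \<inter> {..<Suc m} = (if m \<in> ?K then insert m (?K \<inter> {..<m}) else ?K \<inter> {..<m})" by (auto simp: less_Suc_eq)
    then have "sum vv (?K \<inter> {..<Suc m}) = sum vv (?K \<inter> {..<m}) + (if m \<in> ?K then vv m else 0)" by (simp add: add.commute)
    then show "wp (If (flag ''k'' (var ''j'')) (assign_var ''v'' (Add (var ''v'') (value_exp (var ''j'')))) Skip)
      (\<lambda>s'. mem s' ''j'' 0 = of_nat m \<and> Inv (Suc m) s') s'"
      using inv m k' unfolding Inv_def by (auto simp: inp_simps[OF inp'] intro!: frame_store)
  next
    fix k s' assume "Inv k s'"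
    then show "aval (var ''n'') (mem s') = of_nat n" using inp_frame[OF inp, of "{''v'', ''j''}" s'] unfolding Inv_def by (simp add: inp_simps)
  next
    fix k s' r assume "Inv k s'"
    then show "Inv k (store ''j'' 0 r s')" unfolding Inv_def by (auto intro!: frame_store)
  next
    fix s' assume inv: "Inv n s'"
    then have fr: "frame {''v'', ''j''} s s'" unfolding Inv_def by simp
    have frU: "frame ?U s s'" by (rule frame_trans[OF frame_refl fr]) simp
    have inp': "inp s'" using inp_frame[OF inp fr] by simp
    have m': "mem s' ''k'' = ind ?K" "mem s' ''b'' 0 = of_nat f" "mem s' ''q'' = ind Q" "acc s' xs"
      using k b q acc_frame[OF acc fr] by (simp_all add: frame_mem[OF fr])
    have "bval ?gain (mem s') \<longleftrightarrow>
        n \<notin> ?K \<and> 2 * sum vv (?K \<inter> {..<n}) < vv f"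
      using inv m' unfolding Inv_def by (simp add: inp_simps[OF inp'])
    also have "\<dots> \<longleftrightarrow> admissible vv n Os Q f"
    proof (cases "n \<in> ?K")
      case False
      then have "?K \<inter> {..<n} = ?K" using conflicts_le[of Q f] by (auto simp: less_Suc_eq)
      then show ?thesis unfolding admissible_def by simp
    qed (simp add: admissible_def)
    finally have cond: "bval ?gain (mem s') \<longleftrightarrow>
        admissible vv n Os Q f" .
    show "wp ?rest R s'"
    proof (rule wp_ifI)
      assume "bval ?gain (mem s')"
      then have adm: "admissible vv n Os Q f" using cond by simp
      have nK: "n \<notin> ?K" using adm unfolding admissible_def by simp
      then have Kn: "?K \<inter> {..<n} = ?K" using conflicts_le[of Q f] by (auto simp: less_Suc_eq)
      define L where "L m s2 \<longleftrightarrow> frame ?U s s2 \<and> coins_used s2 = coins_used s \<and> acc s2 (xs @ [f]) \<and> mem s2 ''q'' = ind (Q - ?K \<inter> {..<m})" for m s2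
      let ?s = "store ''m'' 0 (of_nat (Suc (length xs))) (store ''a'' (length xs) (of_nat f) s')"
      have "L 0 ?s" unfolding L_def using frU m' inv unfolding Inv_def acc_def
        by (auto intro!: frame_store simp: nth_append less_Suc_eq)
      then have "wp (for_loop ''j'' (var ''n'') (If (flag ''k'' (var ''j'')) (Assign ''q'' (var ''j'') (Num 0)) Skip))
        (wp (Assign ''q'' (var ''b'') (Num 1)) R) ?s"
      proof (rule wp_for[where m = n and Inv = L])
        fix j s2 assume j: "mem s2 ''j'' 0 = of_nat j" and l: "L j s2"
        then have k2: "mem s2 ''k'' = ind ?K" using k frame_mem[of ?U s s2 "''k''"] unfolding L_def by simp
        have "Q - ?K \<inter> {..<Suc j} = (if j \<in> ?K then Q - ?K \<inter> {..<j} - {j} else Q - ?K \<inter> {..<j})" by (auto simp: less_Suc_eq)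
        then show "wp (If (flag ''k'' (var ''j'')) (Assign ''q'' (var ''j'') (Num 0)) Skip) (\<lambda>s'. mem s' ''j'' 0 = of_nat j \<and> L (Suc j) s') s2"
          using l j k2 unfolding L_def acc_def by (auto intro!: frame_store)
      next
        fix k s2 assume "L k s2"
        then show "aval (var ''n'') (mem s2) = of_nat n" using inp_frame[OF inp, of ?U s2] unfolding L_def by (simp add: inp_simps)
      next
        fix k s2 r assume "L k s2"
        then show "L k (store ''j'' 0 r s2)" unfolding L_def acc_def by (auto intro!: frame_store)
      next
        fix s2 assume l: "L n s2"
        then have b2: "mem s2 ''b'' 0 = of_nat f" using b frame_mem[of ?U s s2 "''b''"] unfolding L_def by simp
        have "R (store ''q'' f 1 s2)"
          using l adm Kn unfolding L_def acc_def by (intro post) (auto intro!: frame_store simp: admit_def acc_def)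
        then show "wp (Assign ''q'' (var ''b'') (Num 1)) R s2" using b2 by simp
      qed (rule bounds)
      then show "wp ?swap R s'"
        using m' unfolding acc_def by (intro wp_seqI wp_assignI) (simp add: add.commute del: wp.simps)
    next
      assume "\<not> bval ?gain (mem s')"
      then have "\<not> admissible vv n Os Q f" using cond by blast
      then show "wp Skip R s'" using post[OF frU] inv m' unfolding Inv_def by (simp add: admit_def)
    qed
  qed (rule bounds)
qed

definition rep :: "state \<Rightarrow> nat list \<times> nat set \<Rightarrow> bool" where
  "rep s \<sigma> \<longleftrightarrow> acc s (fst \<sigma>) \<and> mem s ''q'' = ind (snd \<sigma>) \<and> holds_set ''z'' s \<and> holds_set ''u'' s \<and>
     (\<exists>K\<subseteq>{..<Suc n}. mem s ''k'' = ind K)"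

lemma rep_frame: "rep s \<sigma> \<Longrightarrow> frame U s s' \<Longrightarrow> U \<inter> {''a'', ''m'', ''q'', ''z'', ''u'', ''k''} = {} \<Longrightarrow> rep s' \<sigma>"
  unfolding rep_def holds_set_def acc_def by (auto simp: frame_mem)

lemma wp_step:
  assumes inp: "inp s" and rep: "rep s \<sigma>" and ok: "state_ok vv D \<sigma>" and f: "f \<notin> D" "f < n"
    and b: "mem s ''b'' 0 = of_nat f" and r: "mem s ''r'' = r"
    and post: "\<And>s' \<sigma>'. frame {''c'', ''h'', ''j'', ''y'', ''l'', ''g'', ''x'', ''i'', ''z'', ''k'', ''u'', ''v'', ''a'', ''m'', ''q''} s s' \<Longrightarrow>
      toss (step_tree J M n Fs Os r vv f \<sigma>) \<omega> (coins_used s) = (\<sigma>', coins_used s') \<Longrightarrow> rep s' \<sigma>' \<Longrightarrow> R s'"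
  shows "wp (If (Less (Num 0) (value_exp (var ''b'')))
       (Seq (hits_com ein eout) (If (Less (Mul (Num 2) (var ''c'')) (trials_exp ein eout))
          (Seq (conflicts_com eout) exchange_com) Skip)) Skip) R s"
proof (rule wp_ifI)
  let ?few = "Less (Mul (Num 2) (var ''c'')) (trials_exp ein eout)"
  let ?U = "{''c'', ''h'', ''j'', ''y'', ''l'', ''g'', ''x'', ''i'', ''z'', ''k'', ''u'', ''v'', ''a'', ''m'', ''q''}"
  let ?xs = "fst \<sigma>" and ?Q = "snd \<sigma>"
  assume "bval (Less (Num 0) (value_exp (var ''b''))) (mem s)"
  then have v: "0 < vv f" using b by (simp add: inp_simps[OF inp])
  have acc: "acc s ?xs" and q: "mem s ''q'' = ind ?Q" and z: "holds_set ''z'' s" and u: "holds_set ''u'' s" using rep unfolding rep_def by auto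
  obtain K where K: "mem s ''k'' = ind K" "K \<subseteq> {..<Suc n}" using rep unfolding rep_def by auto
  have xs: "set ?xs \<subseteq> {..<n}" "\<And>e. e \<in> set ?xs \<Longrightarrow> 0 < pv e" using ok vv_pos unfolding state_ok_def by auto
  have Q: "?Q \<subseteq> {..<n}" "f \<notin> ?Q" using ok f xs unfolding state_ok_def by auto
  have "length ?xs \<le> n" using ok xs card_mono[of "{..<n}" "set ?xs"] unfolding state_ok_def by (simp add: distinct_card)
  then have len: "length ?xs \<le> N" using bounds(1) by simp
  show "wp (Seq (hits_com ein eout) (If ?few
          (Seq (conflicts_com eout) exchange_com) Skip)) R s"
  proof (rule wp_seqI, rule wp_hits[OF inp acc xs len r b f(2) z], assumption)
    fix s2 c assume fr2: "frame {''c'', ''h'', ''j'', ''y'', ''l'', ''g'', ''x'', ''i'', ''z''} s s2"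
      and c: "toss (hits_tree J Fs r f ?xs M) \<omega> (coins_used s) = (c, coins_used s2)" "mem s2 ''c'' 0 = of_nat c" and z2: "holds_set ''z'' s2"
    have frU: "frame ?U s s2" by (rule frame_trans[OF frame_refl fr2]) simp
    have inp2: "inp s2" using inp_frame[OF inp fr2] by simp
    have m2: "acc s2 ?xs" "mem s2 ''q'' = ind ?Q" "mem s2 ''b'' 0 = of_nat f" "mem s2 ''k'' = ind K" "holds_set ''u'' s2"
      using acc_frame[OF acc fr2] q b K u by (simp_all add: frame_mem[OF fr2] holds_set_def)
    have step: "toss (step_tree J M n Fs Os r vv f \<sigma>) \<omega> (coins_used s) = (if 2 * c < M then admit vv n Os f \<sigma> else \<sigma>, coins_used s2)"
      using v c(1) by (simp add: step_tree_def toss_tbind)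
    have cond: "bval ?few (mem s2) \<longleftrightarrow> 2 * c < M"
    proof -
      have "bval ?few (mem s2) \<longleftrightarrow> (of_nat (2 * c) :: rat) < of_nat M"
        using c(2) by (simp add: inp_simps[OF inp2])
      then show ?thesis unfolding of_nat_less_iff .
    qed
    show "wp (If ?few (Seq (conflicts_com eout) exchange_com) Skip) R s2"
    proof (rule wp_ifI)
      assume "bval ?few (mem s2)"
      then have lt: "2 * c < M" using cond by simp
      show "wp (Seq (conflicts_com eout) exchange_com) R s2"
      proof (rule wp_seqI, rule wp_conflicts[OF inp2 m2(2,3) f(2) Q(2,1) m2(4) K(2) m2(5)])
        fix s3 assume fr3: "frame {''k'', ''j'', ''i'', ''u'', ''g'', ''x''} s2 s3" and c3: "coins_used s3 = coins_used s2"
          and k3: "mem s3 ''k'' = ind (conflicts vv n Os ?Q f)" and u3: "holds_set ''u'' s3"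
        have frU3: "frame ?U s s3" by (rule frame_trans[OF frU fr3]) simp
        have inp3: "inp s3" using inp_frame[OF inp2 fr3] by simp
        have m3: "acc s3 ?xs" "mem s3 ''q'' = ind ?Q" "mem s3 ''b'' 0 = of_nat f" "holds_set ''z'' s3"
          using acc_frame[OF m2(1) fr3] m2 z2 by (simp_all add: frame_mem[OF fr3] holds_set_def)
        show "wp exchange_com R s3"
        proof (rule wp_exchange[OF inp3 m3(1,2) k3 m3(3)])
          fix s4 assume fr4: "frame {''v'', ''j'', ''a'', ''m'', ''q''} s3 s4" and c4: "coins_used s4 = coins_used s3"
            and a4: "acc s4 (fst (admit vv n Os f (?xs, ?Q)))" "mem s4 ''q'' = ind (snd (admit vv n Os f (?xs, ?Q)))"
          have frU4: "frame ?U s s4" by (rule frame_trans[OF frU3 fr4]) simp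
          have "rep s4 (admit vv n Os f \<sigma>)"
            using a4 k3 u3 m3(4) conflicts_le unfolding rep_def holds_set_def by (auto simp: frame_mem[OF fr4])
          then show "R s4" using post[OF frU4] step lt c3 c4 by simp
        qed
      qed
    next
      assume "\<not> bval ?few (mem s2)"
      then have lt: "\<not> 2 * c < M" using cond by simp
      have "rep s2 \<sigma>" using m2 K z2 unfolding rep_def by auto
      then show "wp Skip R s2" using post[OF frU] step lt by simp
    qed
  qed
next
  assume "\<not> bval (Less (Num 0) (value_exp (var ''b''))) (mem s)"
  then have v: "\<not> 0 < vv f" using b by (simp add: inp_simps[OF inp])
  then show "wp Skip R s" using post[OF frame_refl _ rep] by (simp add: step_tree_def)
qed

abbreviation "tree r \<equiv> plan_tree J M n Fs Os r vv (ranked kv n)"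

lemma state_ok_tree:
  assumes "t \<le> n"
  shows "state_ok vv (picked kv n t) (fst (toss (tree r t) \<omega> i))"
proof -
  have "inj_on (ranked kv n) {..<t}" using bij_rank[of kv n] assms unfolding bij_betw_def by (auto intro: inj_on_subset)
  from dist_plan_tree[OF this, of vv "\<lambda>e. 1 / 2 ^ J e" J M n Fs Os r] toss_in_tree_pmf[of "tree r t" \<omega> i] show ?thesis
    unfolding picked_eq by auto
qed

lemma wp_plan:
  assumes inp: "inp s" and rep: "rep s ([], {})" and d: "mem s ''d'' = ind {}" and r: "mem s ''r'' = r"
    and post: "\<And>s' \<sigma>. frame {''t'', ''b'', ''e'', ''d'', ''c'', ''h'', ''j'', ''y'', ''l'', ''g'', ''x'', ''i'', ''z'', ''k'', ''u'', ''v'', ''a'', ''m'', ''q''} s s' \<Longrightarrow>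
      toss (tree r n) \<omega> (coins_used s) = (\<sigma>, coins_used s') \<Longrightarrow> rep s' \<sigma> \<Longrightarrow> mem s' ''d'' = ind (picked kv n n) \<Longrightarrow> R s'"
  shows "wp (plan_com key ein eout) R s"
proof -
  let ?step = "If (Less (Num 0) (value_exp (var ''b''))) (Seq (hits_com ein eout) (If (Less (Mul (Num 2) (var ''c'')) (trials_exp ein eout)) (Seq (conflicts_com eout) exchange_com) Skip)) Skip"
  let ?U = "{''t'', ''b'', ''e'', ''d'', ''c'', ''h'', ''j'', ''y'', ''l'', ''g'', ''x'', ''i'', ''z'', ''k'', ''u'', ''v'', ''a'', ''m'', ''q''}"
  define Inv where "Inv t s' \<longleftrightarrow> frame ?U s s' \<and> mem s' ''d'' = ind (picked kv n t) \<and>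
    (\<exists>\<sigma>. toss (tree r t) \<omega> (coins_used s) = (\<sigma>, coins_used s') \<and> rep s' \<sigma>)" for t s'
  show ?thesis
    unfolding plan_com_def
  proof (rule wp_for[where m = n and Inv = Inv])
    show "Inv 0 s" unfolding Inv_def using d rep by simp
  next
    fix t s' assume t: "t < n" "mem s' ''t'' 0 = of_nat t" and inv: "Inv t s'"
    then obtain \<sigma> where fr: "frame ?U s s'" and d': "mem s' ''d'' = ind (picked kv n t)"
      and \<sigma>: "toss (tree r t) \<omega> (coins_used s) = (\<sigma>, coins_used s')" "rep s' \<sigma>" unfolding Inv_def by auto
    have inp': "inp s'" using inp_frame[OF inp fr] by simp
    let ?f = "ranked kv n t"
    have f: "?f < n" "?f \<notin> picked kv n t" using rank_props(1,2)[where t = t and n = n and \<kappa> = kv] t by auto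
    have ok: "state_ok vv (picked kv n t) \<sigma>" using state_ok_tree[of t r "coins_used s"] \<sigma>(1) t by simp
    show "wp (Seq (pick_com key) (Seq (Assign ''d'' (var ''b'') (Num 1))
     (?step))) (\<lambda>s'. mem s' ''t'' 0 = of_nat t \<and> Inv (Suc t) s') s'"
    proof (rule wp_seqI, rule wp_pick[OF inp' d', where kv' = kv])
      fix s2 assume fr2: "frame {''b'', ''e''} s' s2" and c2: "coins_used s2 = coins_used s'"
        and b2: "mem s2 ''b'' 0 = of_nat (best kv n (picked kv n t))"
      define s3 where "s3 = store ''d'' ?f 1 s2"
      have fr3: "frame {''b'', ''e'', ''d''} s' s3" unfolding s3_def
        by (rule frame_store) (use frame_trans[OF frame_refl fr2, of "{''b'', ''e'', ''d''}"] in auto)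
      have frU3: "frame ?U s s3" by (rule frame_trans[OF fr fr3]) simp
      have m3: "mem s3 ''b'' 0 = of_nat ?f" "mem s3 ''d'' = ind (picked kv n (Suc t))" "coins_used s3 = coins_used s'" "mem s3 ''r'' = r" "mem s3 ''t'' 0 = of_nat t"
        using b2 c2 d' r t unfolding s3_def by (simp_all add: ranked_def frame_mem[OF fr2] frame_mem[OF fr])
      have "wp (?step) (\<lambda>s'. mem s' ''t'' 0 = of_nat t \<and> Inv (Suc t) s') s3"
      proof (rule wp_step[OF inp_frame[OF inp frU3] rep_frame[OF \<sigma>(2) fr3] ok f(2,1) m3(1,4)])
        fix s4 \<sigma>' assume fr4: "frame {''c'', ''h'', ''j'', ''y'', ''l'', ''g'', ''x'', ''i'', ''z'', ''k'', ''u'', ''v'', ''a'', ''m'', ''q''} s3 s4"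
          and st: "toss (step_tree J M n Fs Os r vv ?f \<sigma>) \<omega> (coins_used s3) = (\<sigma>', coins_used s4)" and rep4: "rep s4 \<sigma>'"
        have "frame ?U s s4" by (rule frame_trans[OF frU3 fr4]) simp
        moreover have "toss (tree r (Suc t)) \<omega> (coins_used s) = (\<sigma>', coins_used s4)"
          using \<sigma>(1) st m3 by (simp add: toss_tbind)
        ultimately show "mem s4 ''t'' 0 = of_nat t \<and> Inv (Suc t) s4"
          unfolding Inv_def using m3 rep4 by (auto simp: frame_mem[OF fr4] simp del: plan_tree.simps picked.simps)
      qed auto
      then show "wp (Seq (Assign ''d'' (var ''b'') (Num 1)) (?step)) (\<lambda>s'. mem s' ''t'' 0 = of_nat t \<and> Inv (Suc t) s') s2"
        using b2 unfolding s3_def ranked_def by (intro wp_seqI wp_assignI) (simp del: wp.simps)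
    qed (rule inp_simps(8))
  next
    fix k s' assume "Inv k s'"
    then show "aval (var ''n'') (mem s') = of_nat n" using inp_frame[OF inp, of ?U s'] unfolding Inv_def by (simp add: inp_simps)
  next
    fix k s' r assume "Inv k s'"
    then have "rep (store ''t'' 0 r s') \<sigma> \<longleftrightarrow> rep s' \<sigma>" for \<sigma> unfolding rep_def acc_def holds_set_def by simp
    then show "Inv k (store ''t'' 0 r s')" using \<open>Inv k s'\<close> unfolding Inv_def by (auto intro!: frame_store)
  next
    fix s' assume "Inv n s'"
    then show "R s'" using post unfolding Inv_def by blast
  qed (rule bounds)
qed

text \<open>Every probe is legal: the outer constraint holds because the probed elements stay inside
  the outer independent \<open>Q\<close>, the inner one because it was queried. The case
  \<open>Q = {}\<close> is exempted from outer independence since the family of a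
  \<open>k\<close>-system may be empty.\<close>

lemma wp_finish:
  assumes inp: "inp s" and d: "mem s ''d'' = ind {}" and s: "mem s ''s'' = ind {}" and q: "mem s ''q'' = ind Q"
    and pr: "probed s = {}" "chosen s = {}" and Qn: "Q \<subseteq> {..<n}" and Qo: "\<And>F. Q \<noteq> {} \<Longrightarrow> F \<in> set Os \<Longrightarrow> Q \<in> F"
    and dc: "\<And>F. F \<in> set Os \<Longrightarrow> downward_closed {..<n} F"
    and post: "\<And>s'. coins_used s' = coins_used s \<Longrightarrow> chosen s' = finish Fs Q X (map (ranked wv n) [0..<n]) \<Longrightarrow> R s'"
  shows "wp (finish_com ein) R s"
proof -
  let ?U = "{''t'', ''b'', ''e'', ''d'', ''s'', ''x'', ''i'', ''g''}"
  define S where "S t = finish Fs Q X (map (ranked wv n) [0..<t])" for t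
  have Ssub: "S t \<subseteq> Q" for t unfolding S_def using finish_subset by blast
  have Spick: "S t \<subseteq> picked wv n t" for t unfolding S_def picked_eq using finish_subset[of Fs Q X "map (ranked wv n) [0..<t]"] by auto
  \<comment> \<open>\<open>frame\<close> also fixes the probed and chosen sets, so the frame
    condition starts from \<open>s\<close> with these two fields updated.\<close>
  define Inv where "Inv t s' \<longleftrightarrow> frame ?U (s\<lparr>probed := probed s', chosen := chosen s'\<rparr>) s' \<and> coins_used s' = coins_used s \<and>
    mem s' ''d'' = ind (picked wv n t) \<and> mem s' ''s'' = ind (S t) \<and> chosen s' = S t \<and> probed s' \<subseteq> Q \<inter> picked wv n t" for t s'
  have inp_frame': "inp s'" if "frame ?U (s\<lparr>probed := P, chosen := C\<rparr>) s'" for s' P C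
  proof (rule inp_frame[OF _ that])
    show "inp (s\<lparr>probed := P, chosen := C\<rparr>)" using inp unfolding inp_def by simp
  qed simp
  show ?thesis
    unfolding finish_com_def
  proof (rule wp_for[where m = n and Inv = Inv])
    show "Inv 0 s" unfolding Inv_def frame_def using d s pr by (simp add: S_def)
  next
    fix t s' assume t: "t < n" "mem s' ''t'' 0 = of_nat t" and inv: "Inv t s'"
    let ?base = "s\<lparr>probed := probed s', chosen := chosen s'\<rparr>"
    have fr: "frame ?U ?base s'" and d': "mem s' ''d'' = ind (picked wv n t)" and s': "mem s' ''s'' = ind (S t)"
      and ch: "chosen s' = S t" and prb: "probed s' \<subseteq> Q \<inter> picked wv n t" and co: "coins_used s' = coins_used s" using inv unfolding Inv_def by auto
    have inp': "inp s'" using inp_frame'[OF fr] .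
    let ?f = "ranked wv n t"
    have f: "?f < n" "?f \<notin> picked wv n t" using rank_props(1,2)[where t = t and n = n and \<kappa> = wv] t by auto
    have fS: "?f \<notin> S t" using f Spick by blast
    have SS: "S (Suc t) = (if ?f \<in> Q \<and> (\<forall>F\<in>set Fs. insert ?f (S t) \<in> F) \<and> X ?f then insert ?f (S t) else S t)"
      unfolding S_def using fS[unfolded S_def] by (auto simp: finish_snoc)
    let ?inner = "for_loop ''i'' ein (Seq (Query_Inner ''g'' (var ''i'') ''s'') (If (flag ''g'' (Num 0)) Skip (assign_var ''x'' (Num 0))))"
    let ?probe = "If (flag ''x'' (Num 0)) (Seq (Probe ''g'' (var ''b'')) (Assign ''s'' (var ''b'') (var ''g''))) (Assign ''s'' (var ''b'') (Num 0))"
    let ?R = "\<lambda>s'. mem s' ''t'' 0 = of_nat t \<and> Inv (Suc t) s'"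
    show "wp (Seq (pick_com weight_exp) (Seq (Assign ''d'' (var ''b'') (Num 1))
     (If (flag ''q'' (var ''b'')) (Seq (Assign ''s'' (var ''b'') (Num 1)) (Seq (assign_var ''x'' (Num 1)) (Seq ?inner ?probe))) Skip))) ?R s'"
    proof (rule wp_seqI, rule wp_pick[OF inp' d', where kv' = wv])
      fix s2 assume fr2: "frame {''b'', ''e''} s' s2" and c2: "coins_used s2 = coins_used s'"
        and b2: "mem s2 ''b'' 0 = of_nat (best wv n (picked wv n t))"
      define s3 where "s3 = store ''d'' ?f 1 s2"
      have fr3: "frame {''b'', ''e'', ''d''} s' s3" unfolding s3_def
        by (rule frame_store) (use frame_trans[OF frame_refl fr2, of "{''b'', ''e'', ''d''}"] in auto)
      have frU3: "frame ?U ?base s3" by (rule frame_trans[OF fr fr3]) simp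
      have m3: "mem s3 ''b'' 0 = of_nat ?f" "mem s3 ''d'' = ind (picked wv n (Suc t))" "coins_used s3 = coins_used s" "mem s3 ''t'' 0 = of_nat t"
        "mem s3 ''s'' = ind (S t)" "mem s3 ''q'' = ind Q" "chosen s3 = S t" "probed s3 = probed s'"
        using b2 c2 d' t s' co ch q frame_probed[OF fr2] frame_chosen[OF fr2] unfolding s3_def
        by (simp_all add: ranked_def frame_mem[OF fr2] frame_mem[OF fr])
      have "wp (If (flag ''q'' (var ''b'')) (Seq (Assign ''s'' (var ''b'') (Num 1)) (Seq (assign_var ''x'' (Num 1)) (Seq ?inner ?probe))) Skip) ?R s3"
      proof (rule wp_ifI)
        assume "bval (flag ''q'' (var ''b'')) (mem s3)"
        then have fQ: "?f \<in> Q" using m3 by simp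
        let ?s4 = "store ''x'' 0 1 (store ''s'' ?f 1 s3)"
        define L where "L m s5 \<longleftrightarrow> frame ?U ?base s5 \<and> coins_used s5 = coins_used s \<and> mem s5 ''b'' 0 = of_nat ?f \<and> mem s5 ''t'' 0 = of_nat t \<and>
          mem s5 ''d'' = ind (picked wv n (Suc t)) \<and> mem s5 ''s'' = ind (insert ?f (S t)) \<and> chosen s5 = S t \<and> probed s5 = probed s' \<and>
          mem s5 ''x'' 0 = of_bool (\<forall>i<m. insert ?f (S t) \<in> Fs ! i)" for m s5
        have ins: "insert ?f (S t) \<subseteq> {..<n}" using f Ssub[of t] Qn by auto
        have "L 0 ?s4" unfolding L_def using frU3 m3 by (auto intro!: frame_store)
        then have "wp ?inner (wp ?probe ?R) ?s4"
        proof (rule wp_for[where m = "length Fs" and Inv = L])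
          fix i s5 assume i: "i < length Fs" "mem s5 ''i'' 0 = of_nat i" and l: "L i s5"
          have "oracle_answer (inner_fams I) i (coded_set I ''s'' (mem s5)) \<longleftrightarrow> insert ?f (S t) \<in> Fs ! i"
            using l by (intro query_inner i(1) ins) (simp add: L_def)
          then show "wp (Seq (Query_Inner ''g'' (var ''i'') ''s'') (If (flag ''g'' (Num 0)) Skip (assign_var ''x'' (Num 0))))
            (\<lambda>s'. mem s' ''i'' 0 = of_nat i \<and> L (Suc i) s') s5"
            using l i unfolding L_def by (auto intro!: frame_store simp: less_Suc_eq simp del: picked.simps)
        next
          fix k s5 assume "L k s5"
          then show "aval ein (mem s5) = of_nat (length Fs)" using inp_frame'[of "chosen s'" "probed s'" s5] unfolding L_def by (simp add: inp_simps)
        next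
          fix k s5 r assume "L k s5"
          then show "L k (store ''i'' 0 r s5)" unfolding L_def by (auto intro!: frame_store simp del: picked.simps)
        next
          fix s5 assume l: "L (length Fs) s5"
          have all: "(\<forall>i<length Fs. insert ?f (S t) \<in> Fs ! i) \<longleftrightarrow> (\<forall>F\<in>set Fs. insert ?f (S t) \<in> F)" by (metis in_set_conv_nth)
          have base: "frame ?U (s\<lparr>probed := P, chosen := C\<rparr>) (s5'\<lparr>probed := P, chosen := C\<rparr>)"
            if "frame ?U ?base s5'" for s5' P C using that unfolding frame_def by simp
          have pk: "picked wv n (Suc t) = insert ?f (picked wv n t)" by (simp add: ranked_def)
          show "wp ?probe ?R s5"
          proof (rule wp_ifI)
            assume "bval (flag ''x'' (Num 0)) (mem s5)"
            then have ok: "\<forall>F\<in>set Fs. insert ?f (S t) \<in> F" using l all unfolding L_def by (auto split: if_splits)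
            have "insert ?f (probed s') \<in> F" if "F \<in> set Os" for F
              using downward_closedD[OF dc[OF that] Qo[OF _ that], of "insert ?f (probed s')"] fQ prb by blast
            moreover have "insert ?f (probed s') \<subseteq> {..<n}" using f prb Qn by auto
            ultimately have may: "may_probe I (probed s5) (chosen s5) ?f"
              using l ok ins f prb unfolding may_probe_def outer_constraint_def inner_constraint_def L_def Fs_def Os_def n_def by auto
            have SX: "S (Suc t) = (if X ?f then insert ?f (S t) else S t)" unfolding SS using fQ ok by simp
            let ?P = "insert ?f (probed s')"
            let ?s6 = "store ''s'' ?f (of_bool (X ?f)) (store ''g'' 0 (of_bool (X ?f)) s5\<lparr>probed := ?P, chosen := S (Suc t)\<rparr>)"
            have eq: "insert ?f (S t) - {?f} = S t" using fS by simp
            have fr6: "frame ?U (s\<lparr>probed := ?P, chosen := S (Suc t)\<rparr>) ?s6"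
              using l unfolding L_def by (intro frame_store base) auto
            have "?R ?s6"
              unfolding Inv_def using l fr6 prb fQ eq unfolding L_def SX pk by (auto simp: ind_of_bool)
            then show "wp (Seq (Probe ''g'' (var ''b'')) (Assign ''s'' (var ''b'') (var ''g''))) ?R s5"
              using l may unfolding L_def SX by (simp add: Let_def split: if_splits)
          next
            assume "\<not> bval (flag ''x'' (Num 0)) (mem s5)"
            then have "\<not> (\<forall>F\<in>set Fs. insert ?f (S t) \<in> F)" using l all unfolding L_def by auto
            then have SX: "S (Suc t) = S t" unfolding SS by auto
            have "insert ?f (S t) - {?f} = S t" using fS by simp
            then show "wp (Assign ''s'' (var ''b'') (Num 0)) ?R s5"
              using l prb ch unfolding L_def Inv_def SX pk by (auto intro!: frame_store)
          qed
        qed (rule bounds)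
        then show "wp (Seq (Assign ''s'' (var ''b'') (Num 1)) (Seq (assign_var ''x'' (Num 1)) (Seq ?inner ?probe))) ?R s3"
          using m3 by (intro wp_seqI wp_assignI) (simp del: wp.simps)
      next
        assume "\<not> bval (flag ''q'' (var ''b'')) (mem s3)"
        then have "S (Suc t) = S t" using m3 unfolding SS by simp
        then show "wp Skip ?R s3" using frU3 m3 prb ch unfolding Inv_def by auto
      qed
      then show "wp (Seq (Assign ''d'' (var ''b'') (Num 1))
       (If (flag ''q'' (var ''b'')) (Seq (Assign ''s'' (var ''b'') (Num 1)) (Seq (assign_var ''x'' (Num 1)) (Seq ?inner ?probe))) Skip)) ?R s2"
        using b2 unfolding s3_def ranked_def by (intro wp_seqI wp_assignI) (simp del: wp.simps)
    qed (rule inp_simps(7))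
  next
    fix k s' assume "Inv k s'"
    then have "inp s'" unfolding Inv_def by (elim conjE) (rule inp_frame')
    then show "aval (var ''n'') (mem s') = of_nat n" by (simp add: inp_simps)
  next
    fix k s' r assume "Inv k s'"
    then show "Inv k (store ''t'' 0 r s')" unfolding Inv_def by (auto intro!: frame_store)
  next
    fix s' assume "Inv n s'"
    then show "R s'" using post unfolding Inv_def S_def by blast
  qed (rule bounds)
qed

theorem wp_program:
  assumes pre: "pre = Skip \<and> r = (\<lambda>_. 0) \<or> pre = classes_com \<and> r = class_of"
    and out: "\<And>\<sigma> F. \<sigma> \<in> set_pmf (tree_pmf (tree r n)) \<Longrightarrow> snd \<sigma> \<noteq> {} \<Longrightarrow> F \<in> set Os \<Longrightarrow> snd \<sigma> \<in> F"
    and dc: "\<And>F. F \<in> set Os \<Longrightarrow> downward_closed {..<n} F"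
  shows "wp (program pre key ein eout) (\<lambda>s'. coins_used s' = snd (toss (tree r n) \<omega> 0) \<and>
    chosen s' = finish Fs (snd (fst (toss (tree r n) \<omega> 0))) X (map (ranked wv n) [0..<n])) (initial_state kin kout I)"
proof -
  let ?s = "initial_state kin kout I" and ?R = "\<lambda>s'. coins_used s' = snd (toss (tree r n) \<omega> 0) \<and>
    chosen s' = finish Fs (snd (fst (toss (tree r n) \<omega> 0))) X (map (ranked wv n) [0..<n])"
  have zero: "mem ?s x = (\<lambda>_. 0)" if "x \<notin> inputs" for x using that by (auto simp: initial_state_def fun_eq_iff)
  have ind0: "ind {} = (\<lambda>_. 0)" by (auto simp: ind_def fun_eq_iff)
  have init: "inp ?s" "probed ?s = {}" "chosen ?s = {}" "coins_used ?s = 0" by (simp_all add: inp_def, simp_all add: initial_state_def)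
  have main: "wp (Seq (plan_com key ein eout) (Seq (clear ''d'' (var ''n'')) (finish_com ein))) ?R s1"
    if fr: "frame {''b'', ''e'', ''t'', ''x'', ''r'', ''d'', ''j''} ?s s1" and c: "coins_used s1 = 0" and d: "mem s1 ''d'' = ind {}" and r: "mem s1 ''r'' = r" for s1
  proof (rule wp_seqI, rule wp_plan)
    show "inp s1" using inp_frame[OF init(1) fr] by simp
    show "rep s1 ([], {})" unfolding rep_def acc_def holds_set_def by (auto simp: frame_mem[OF fr] zero ind0[symmetric])
    show "mem s1 ''d'' = ind {}" by (rule d)
    show "mem s1 ''r'' = r" by (rule r)
    fix s2 \<sigma> assume fr2: "frame {''t'', ''b'', ''e'', ''d'', ''c'', ''h'', ''j'', ''y'', ''l'', ''g'', ''x'', ''i'', ''z'', ''k'', ''u'', ''v'', ''a'', ''m'', ''q''} s1 s2"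
      and \<sigma>: "toss (tree r n) \<omega> (coins_used s1) = (\<sigma>, coins_used s2)" and rep: "rep s2 \<sigma>" and d2: "mem s2 ''d'' = ind (picked kv n n)"
    have inp2: "inp s2" by (rule inp_frame[OF inp_frame[OF init(1) fr] fr2]) simp_all
    have \<sigma>d: "\<sigma> \<in> set_pmf (tree_pmf (tree r n))" using toss_in_tree_pmf[of "tree r n" \<omega> 0] \<sigma> c by simp
    have "state_ok vv (picked kv n n) \<sigma>" using state_ok_tree[of n r 0] \<sigma> c by simp
    then have Qn: "snd \<sigma> \<subseteq> {..<n}" using picked_subset[of n n kv] unfolding state_ok_def by auto
    show "wp (Seq (clear ''d'' (var ''n'')) (finish_com ein)) ?R s2"
    proof (rule wp_seqI, rule wp_clear[OF d2 picked_subset])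
      fix s3 assume "frame {''d'', ''j''} s2 s3"
      then show "aval (var ''n'') (mem s3) = of_nat n" using inp_frame[OF inp2, of "{''d'', ''j''}" s3] by (simp add: inp_simps)
    next
      fix s3 assume fr3: "frame {''d'', ''j''} s2 s3" and c3: "coins_used s3 = coins_used s2" and d3: "mem s3 ''d'' = ind {}"
      show "wp (finish_com ein) ?R s3"
      proof (rule wp_finish[where Q = "snd \<sigma>"])
        show "inp s3" by (rule inp_frame[OF inp2 fr3]) simp
        show "mem s3 ''s'' = ind {}" by (simp add: frame_mem[OF fr3] frame_mem[OF fr2] frame_mem[OF fr] zero ind0)
        show "mem s3 ''q'' = ind (snd \<sigma>)" using rep unfolding rep_def by (simp add: frame_mem[OF fr3])
        show "probed s3 = {}" "chosen s3 = {}"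
          using frame_probed[OF fr3] frame_probed[OF fr2] frame_probed[OF fr] frame_chosen[OF fr3] frame_chosen[OF fr2] frame_chosen[OF fr] init by simp_all
        fix s4 assume "coins_used s4 = coins_used s3" "chosen s4 = finish Fs (snd \<sigma>) X (map (ranked wv n) [0..<n])"
        then show "?R s4" using \<sigma> c c3 by simp
      qed (use d3 Qn out[OF \<sigma>d] dc in auto)
    qed (use bounds in auto)
  qed
  have "wp pre (wp (Seq (plan_com key ein eout) (Seq (clear ''d'' (var ''n'')) (finish_com ein))) ?R) ?s"
    using pre
  proof (elim disjE conjE)
    assume "pre = Skip" "r = (\<lambda>_. 0)"
    then have "wp (Seq (plan_com key ein eout) (Seq (clear ''d'' (var ''n'')) (finish_com ein))) ?R ?s"
      using zero ind0 init(4) by (intro main) auto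
    then show ?thesis using \<open>pre = Skip\<close> by (simp del: wp.simps(3))
  next
    assume "pre = classes_com" "r = class_of"
    then show ?thesis
      using zero ind0 init by (intro wp_classes[THEN subst[OF \<open>pre = classes_com\<close>[symmetric], of "\<lambda>c. wp c _ _"]] main) auto
  qed
  then show ?thesis unfolding program_def by (rule wp_seqI)
qed

end

section \<open>Passing to real numbers\<close>

lemma conflicts_of_rat: "conflicts (\<lambda>e. real_of_rat (v e)) n Os Q f = conflicts v n Os Q f"
  by (simp add: conflicts_def rival_def of_rat_less)

lemma admit_of_rat: "admit (\<lambda>e. real_of_rat (v e)) n Os f \<sigma> = admit v n Os f \<sigma>"
proof -
  have "2 * (\<Sum>e\<in>K. real_of_rat (v e)) < real_of_rat (v f) \<longleftrightarrow> 2 * sum v K < v f" for K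
  proof -
    have "2 * (\<Sum>e\<in>K. real_of_rat (v e)) = real_of_rat (2 * sum v K)" by (simp add: of_rat_mult of_rat_sum)
    then show ?thesis by (simp only: of_rat_less)
  qed
  then show ?thesis by (simp add: admit_def admissible_def conflicts_of_rat)
qed

text \<open>Comparisons and sums of values are preserved by \<open>of_rat\<close>, so the analysis
  over \<open>real\<close> applies to the plan that the program computes.\<close>

lemma plan_of_rat: "plan M n Fs Os r p (\<lambda>e. real_of_rat (v e)) ord t = plan M n Fs Os r p v ord t"
proof -
  have "plan_step M n Fs Os r p (\<lambda>e. real_of_rat (v e)) f = plan_step M n Fs Os r p v f" for f
    by (rule ext) (simp add: plan_step_def admit_of_rat cong: if_cong)
  then show ?thesis by (induction t) simp_all
qed

lemma plan_class_of_rat: "plan M n Fs Os (\<lambda>e. real_of_rat (r e)) p v ord t = plan M n Fs Os r p v ord t"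
proof -
  have "block_prob Fs (\<lambda>e. real_of_rat (r e)) p f xs = block_prob Fs r p f xs" for f xs
    by (simp add: block_prob_def blocked_def cand_def)
  then have "plan_step M n Fs Os (\<lambda>e. real_of_rat (r e)) p v f = plan_step M n Fs Os r p v f" for f
    by (intro ext) (simp add: plan_step_def)
  then show ?thesis by (induction t) simp_all
qed

text \<open>Probability 0 is separate because no number of doublings lifts 0 above 1/2.\<close>

definition rounded_prob :: "probing \<Rightarrow> nat \<Rightarrow> real" where
  "rounded_prob I e = (if input_prob I e = 0 then 0 else 1 / 2 ^ doublings (input_prob I e))"

lemma rounded_prob:
  assumes "valid_numbers I" "e < univ_size I"
  shows "real_of_rat (input_prob I e) \<le> rounded_prob I e" "rounded_prob I e \<le> 2 * real_of_rat (input_prob I e)" "rounded_prob I e \<le> 1"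
proof -
  let ?q = "input_prob I e"
  have q: "0 \<le> ?q" "?q \<le> 1" using assms by (auto simp: valid_numbers_def input_prob_def)
  show "rounded_prob I e \<le> 1" by (simp add: rounded_prob_def)
  have "?q \<le> 1 / 2 ^ doublings ?q \<and> 1 / 2 ^ doublings ?q \<le> 2 * ?q" if "0 < ?q"
  proof
    show "?q \<le> 1 / 2 ^ doublings ?q"
    proof (cases "doublings ?q")
      case (Suc k)
      then show ?thesis using doublings(2)[OF that, of k] by (simp add: field_simps)
    qed (use q in simp)
    show "1 / 2 ^ doublings ?q \<le> 2 * ?q" using doublings(1)[OF that] by (simp add: field_simps)
  qed
  then have "0 < ?q \<Longrightarrow> real_of_rat ?q \<le> real_of_rat (1 / 2 ^ doublings ?q) \<and> real_of_rat (1 / 2 ^ doublings ?q) \<le> real_of_rat (2 * ?q)"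
    unfolding of_rat_less_eq .
  then have "0 < ?q \<Longrightarrow> real_of_rat ?q \<le> 1 / 2 ^ doublings ?q \<and> 1 / 2 ^ doublings ?q \<le> 2 * real_of_rat ?q"
    by (simp add: of_rat_divide of_rat_power of_rat_mult)
  then show "real_of_rat ?q \<le> rounded_prob I e" "rounded_prob I e \<le> 2 * real_of_rat ?q"
    using q by (auto simp: rounded_prob_def)
qed

text \<open>In every realisation the chosen elements of \<open>B\<close> form an independent set
  that \<open>Z\<close> blocks, so there are at most \<open>\<kappa> * card Z\<close> of them; then
  take expectations. The outer case is the same with probed elements.\<close>

lemma (in planner) lp_probe_prob:
  assumes v: "valid_numbers I" and n: "n = univ_size I" and fams: "Fs = inner_fams I" "Os = outer_fams I"
    and pI: "\<And>e. e < n \<Longrightarrow> p e = real_of_rat (act_prob I e)" and \<pi>: "feasible I \<pi>"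
  shows "lp (probe_prob I \<pi>)"
  unfolding lp_def
proof (intro conjI ballI allI impI)
  fix F B Z assume F: "F \<in> set Fs" "B \<subseteq> {..<n}" "Z \<in> F" "\<forall>f\<in>B - Z. insert f Z \<notin> F"
  have "card (B \<inter> chosen_by \<pi> X) \<le> \<kappa> * card Z" for X
  proof (rule blocking_boundD[OF inner(3)[OF F(1)] F(3)])
    have "{} \<in> inner_constraint I" using inner(2) fams unfolding inner_constraint_def by auto
    then have "{} \<union> chosen_by \<pi> X \<in> inner_constraint I" using \<pi> unfolding feasible_def by (intro feasible_from_inner)
    then have "chosen_by \<pi> X \<in> F" using F(1) fams unfolding inner_constraint_def by auto
    then show "B \<inter> chosen_by \<pi> X \<in> F" by (rule downward_closedD[OF inner(1)[OF F(1)]]) auto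
  qed (use F(4) in auto)
  then have "(\<Sum>f\<in>B. probe_prob I \<pi> f * real_of_rat (act_prob I f)) \<le> real (\<kappa> * card Z)"
    using F(2) n v by (intro sum_choose_prob_le) (auto intro: finite_subset)
  moreover have "(\<Sum>f\<in>B. probe_prob I \<pi> f * p f) = (\<Sum>f\<in>B. probe_prob I \<pi> f * real_of_rat (act_prob I f))"
    using F(2) pI by (intro sum.cong) auto
  ultimately show "(\<Sum>f\<in>B. probe_prob I \<pi> f * p f) \<le> real (\<kappa> * card Z)" by simp
next
  fix F B Z assume F: "F \<in> set Os" "B \<subseteq> {..<n}" "Z \<in> F" "\<forall>f\<in>B - Z. insert f Z \<notin> F"
  have "card (B \<inter> probed_by \<pi> X) \<le> \<kappa>' * card Z" for X
  proof (rule blocking_boundD[OF outer(3)[OF F(1)] F(3)])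
    have "{} \<in> outer_constraint I" using outer(2) fams unfolding outer_constraint_def by auto
    then have "{} \<union> probed_by \<pi> X \<in> outer_constraint I" using \<pi> unfolding feasible_def by (intro feasible_from_outer)
    then have "probed_by \<pi> X \<in> F" using F(1) fams unfolding outer_constraint_def by auto
    then show "B \<inter> probed_by \<pi> X \<in> F" by (rule downward_closedD[OF outer(1)[OF F(1)]]) auto
  qed (use F(4) in auto)
  then show "(\<Sum>f\<in>B. probe_prob I \<pi> f) \<le> real (\<kappa>' * card Z)"
    using F(2) by (intro sum_probe_prob_le) (auto intro: finite_subset)
qed (auto simp: probe_prob_def)

text \<open>The link between the two halves of the proof: \<open>poly_time_program\<close>
  identifies it with the expected reward of the program, and the analysis bounds it from
  below.\<close>

definition plan_value :: "probing \<Rightarrow> (nat \<Rightarrow> rat) \<Rightarrow> (nat \<Rightarrow> nat) \<Rightarrow> real" where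
  "plan_value I r ord = measure_pmf.expectation
     (plan (trials I) (univ_size I) (inner_fams I) (outer_fams I) r (rounded_prob I) (input_value I) ord (univ_size I))
     (\<lambda>\<sigma>. measure_pmf.expectation (activation I)
        (\<lambda>X. reward I (finish (inner_fams I) (snd \<sigma>) X (map (ranked (input_weight I) (univ_size I)) [0..<univ_size I]))))"

lemma rank_list:
  "distinct (map (ranked \<kappa> n) [0..<n])" "set (map (ranked \<kappa> n) [0..<n]) = {..<n}"
  "sorted_wrt (\<lambda>e f. \<kappa> f \<le> \<kappa> e) (map (ranked \<kappa> n) [0..<n])"
  using bij_rank[of \<kappa> n] rank_desc[of _ _ n \<kappa>]
  by (auto simp: bij_betw_def distinct_map atLeast0LessThan sorted_wrt_map sorted_wrt_upt intro!: sorted_wrt_mono_rel[OF _ sorted_wrt_upt])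

lemma (in planner) reward_of_eq:
  assumes n: "n = univ_size I" and fams: "Fs = inner_fams I" and es: "set es \<subseteq> {..<n}"
    and pI: "\<And>e. e < n \<Longrightarrow> p e = real_of_rat (act_prob I e)" and wI: "\<And>e. e < n \<Longrightarrow> w e = real_of_rat (weight I e)"
  shows "reward_of es Q = measure_pmf.expectation (activation I) (\<lambda>X. reward I (finish (inner_fams I) Q X es))"
proof -
  have "actual = activation I" unfolding activation_def n[symmetric] using pI by (intro Pi_pmf_cong) auto
  moreover have "sum w (finish Fs Q X es) = reward I (finish (inner_fams I) Q X es)" for X
    unfolding reward_def fams[symmetric] using finish_subset[of Fs Q X es] es wI by (intro sum.cong) auto
  ultimately show ?thesis by simp
qed

lemma plan_value_nonneg:
  assumes "valid_numbers I"
  shows "0 \<le> plan_value I r ord"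
proof -
  have "finish Fs Q X (map (ranked (input_weight I) (univ_size I)) [0..<univ_size I]) \<subseteq> ground I" for Fs Q X
    using finish_subset rank_list(2) by (metis Int_subset_iff)
  then show ?thesis
    unfolding plan_value_def reward_def using assms
    by (intro Bochner_Integration.integral_nonneg sum_nonneg) (auto simp: valid_numbers_def subset_iff)
qed

section \<open>Running time\<close>

text \<open>The denominator of \<open>q\<close> is less than \<open>2 ^ bits q\<close>, so
  \<open>bits q\<close> doublings lift \<open>q\<close> above 1. This bounds the doubling loop by
  the input size.\<close>

lemma doublings_le_bits:
  assumes "0 < q"
  shows "doublings q \<le> bits q"
proof -
  obtain a b where ab: "q = of_int a / of_int b" "0 < b" "\<bar>a\<bar> < 2 ^ bits q" "b < 2 ^ bits q"
    using bits_small[of q "bits q"] unfolding small_def by auto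
  have "0 < a" using assms ab by (simp add: zero_less_divide_iff)
  have "(of_int b :: rat) < of_int (2 ^ bits q)" using ab(4) by (simp only: of_int_less_iff)
  then have "1 < (2 ^ bits q :: rat) / of_int b" using ab(2) by simp
  also have "\<dots> \<le> 2 ^ bits q / of_int b * of_int a" using \<open>0 < a\<close> ab(2) by (simp add: field_simps)
  also have "\<dots> = 2 ^ bits q * q" unfolding ab(1) by simp
  finally have "1 < 2 * (2 ^ bits q * q)" by simp
  then show ?thesis unfolding doublings_def by (rule Least_le)
qed

lemma small_of_nat: "small (Suc k) (of_nat k)"
proof -
  have "int k < 2 ^ Suc k" by (simp add: of_nat_less_two_power less_le_trans[OF of_nat_less_two_power])
  moreover have "(1::int) < 2 ^ Suc k" by (rule one_less_power) simp_all
  ultimately show ?thesis unfolding small_def by - (rule exI[of _ "int k"], rule exI[of _ 1], simp)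
qed

lemma small_0: "small (Suc k) 0"
proof -
  have "(1::int) < 2 ^ Suc k" by (rule one_less_power) simp_all
  then show ?thesis unfolding small_def by - (rule exI[of _ 0], rule exI[of _ 1], simp)
qed

lemma input_size_ge:
  "univ_size I + length (inner_fams I) + length (outer_fams I) \<le> input_size kin kout I"
  "bits (of_nat kin) \<le> input_size kin kout I" "bits (of_nat kout) \<le> input_size kin kout I"
  "e < univ_size I \<Longrightarrow> bits (weight I e) \<le> input_size kin kout I"
  "e < univ_size I \<Longrightarrow> bits (act_prob I e) \<le> input_size kin kout I"
proof -
  have "bits (weight I e) + bits (act_prob I e) \<le> (\<Sum>e\<in>ground I. bits (weight I e) + bits (act_prob I e))" if "e < univ_size I"
    using that by (intro member_le_sum) auto
  then show "e < univ_size I \<Longrightarrow> bits (weight I e) \<le> input_size kin kout I"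
    "e < univ_size I \<Longrightarrow> bits (act_prob I e) \<le> input_size kin kout I" by (simp_all add: input_size_def)
qed (simp_all add: input_size_def)

lemma small_initial_state: "small (input_size kin kout I + 2) (mem (initial_state kin kout I) x i)"
proof -
  let ?s = "input_size kin kout I"
  have b: "bits r \<le> ?s \<Longrightarrow> small (?s + 2) r" for r by (intro bits_small) simp
  have "small (?s + 2) (of_nat (univ_size I))"
    using input_size_ge(1)[where I = I and kin = kin and kout = kout] by (intro small_mono[OF small_of_nat]) simp
  then show ?thesis using b input_size_ge[where I = I and kin = kin and kout = kout] small_0[of "Suc ?s"] input_size_ge(4,5)[where I = I and kin = kin and kout = kout]
    by (auto simp: initial_state_def)
qed

text \<open>Unlike \<open>chain_inv\<close> it also covers families that do not contain the empty
  set. Legality of the probes has to be shown for these instances too.\<close>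

lemma plan_outer:
  assumes dc: "\<And>F. F \<in> set Os \<Longrightarrow> downward_closed {..<n} F"
  shows "\<sigma> \<in> set_pmf (plan M n Fs Os r p v ord t) \<Longrightarrow> snd \<sigma> = {} \<or> (\<forall>F\<in>set Os. snd \<sigma> \<in> F)"
proof (induction t arbitrary: \<sigma>)
  case (Suc t)
  then obtain \<sigma>' where s: "\<sigma>' \<in> set_pmf (plan M n Fs Os r p v ord t)" "\<sigma> \<in> set_pmf (plan_step M n Fs Os r p v (ord t) \<sigma>')" by auto
  show ?case
  proof (cases "\<sigma> = \<sigma>'")
    case True
    then show ?thesis using Suc.IH[OF s(1)] by simp
  next
    case False
    let ?K = "conflicts v n Os (snd \<sigma>') (ord t)"
    have "\<sigma> = admit v n Os (ord t) \<sigma>'" using s(2) False by (auto simp: plan_step_def split: if_splits)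
    then have adm: "admissible v n Os (snd \<sigma>') (ord t)" and \<sigma>: "snd \<sigma> = insert (ord t) (snd \<sigma>' - ?K)"
      using False unfolding admit_def by (auto split: if_splits)
    have "snd \<sigma> \<in> F" if F: "F \<in> set Os" for F
    proof (cases "insert (ord t) (snd \<sigma>') \<in> F")
      case True
      then show ?thesis unfolding \<sigma> by (rule downward_closedD[OF dc[OF F]]) auto
    next
      case False
      then have "rival v n F (snd \<sigma>') (ord t) \<in> ?K" using F unfolding conflicts_def by auto
      moreover have "rival v n F (snd \<sigma>') (ord t) \<noteq> n" using calculation adm unfolding admissible_def by auto
      then have "insert (ord t) (snd \<sigma>' - {rival v n F (snd \<sigma>') (ord t)}) \<in> F"
        using rival_cases[of "snd \<sigma>'" n "ord t" F v] by auto
      then show ?thesis unfolding \<sigma> by (rule downward_closedD[OF dc[OF F]]) (use calculation in auto)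
    qed
    then show ?thesis by blast
  qed
qed simp

section \<open>From single runs to polynomial time and expected reward\<close>

lemma expected_reward_toss:
  assumes "\<And>\<omega>. snd (toss t \<omega> 0) \<le> T"
  shows "expected_reward T I (\<lambda>X \<omega>. h (fst (toss t \<omega> 0)) X) =
    measure_pmf.expectation (tree_pmf t) (\<lambda>\<sigma>. measure_pmf.expectation (activation I) (\<lambda>X. reward I (h \<sigma> X)))"
proof -
  have fin: "finite (set_pmf (coin_tape T))"
    unfolding coin_tape_def by (rule finite_subset[OF set_Pi_pmf_subset']) auto
  have "expected_reward T I (\<lambda>X \<omega>. h (fst (toss t \<omega> 0)) X) =
    measure_pmf.expectation (pair_pmf (coin_tape T) (activation I)) (\<lambda>(\<omega>, X). reward I (h (fst (toss t \<omega> 0)) X))"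
    unfolding expected_reward_def by (subst pair_commute_pmf) (simp add: case_prod_beta')
  also have "\<dots> = measure_pmf.expectation (coin_tape T) (\<lambda>\<omega>. measure_pmf.expectation (activation I) (\<lambda>X. reward I (h (fst (toss t \<omega> 0)) X)))"
    unfolding pair_pmf_def using fin by (simp add: expectation_bind_finite)
  also have "\<dots> = measure_pmf.expectation (map_pmf (\<lambda>\<omega>. fst (toss t \<omega> 0)) (coin_tape T))
      (\<lambda>\<sigma>. measure_pmf.expectation (activation I) (\<lambda>X. reward I (h \<sigma> X)))" by simp
  finally show ?thesis unfolding map_toss_coin_tape[OF assms] .
qed

definition interprets :: "aexp \<Rightarrow> aexp \<Rightarrow> (aexp \<Rightarrow> aexp) \<Rightarrow> nat \<Rightarrow> nat \<Rightarrow> probing \<Rightarrow> (nat \<Rightarrow> rat) \<Rightarrow> bool" where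
  "interprets ein eout key kin kout I kv \<longleftrightarrow> (\<forall>m. (\<forall>x\<in>inputs. m x = mem (initial_state kin kout I) x) \<longrightarrow>
     aval ein m = of_nat (length (inner_fams I)) \<and> aval eout m = of_nat (length (outer_fams I)) \<and>
     (\<forall>i. aval (key i) m = kv (to_nat_idx (aval i m))))"

text \<open>Separates the machine model from the analysis: it remains to interpret the expressions
  and to bound \<open>plan_value\<close> from below.\<close>

lemma poly_time_program:
  fixes \<alpha> :: "nat \<Rightarrow> nat \<Rightarrow> real"
  assumes safe: "safe (program pre key ein eout)"
    and spec: "\<And>kin kout I. valid_numbers I \<Longrightarrow> C kin kout I \<Longrightarrow> \<exists>kv r.
      interprets ein eout key kin kout I kv \<and>
      (pre = Skip \<and> r = (\<lambda>_. 0) \<or> pre = classes_com \<and> r = snd (leaders (input_weight I) (univ_size I) (univ_size I))) \<and>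
      (\<forall>F\<in>set (outer_fams I). downward_closed (ground I) F) \<and>
      (\<forall>\<pi>. feasible I \<pi> \<longrightarrow> \<alpha> kin kout * policy_value I \<pi> \<le> plan_value I r (ranked kv (univ_size I)))"
  shows "poly_time_approximation (program pre key ein eout) C \<alpha>"
proof -
  let ?P = "program pre key ein eout"
  \<comment> \<open>\<open>Nf\<close> bounds all loops in terms of the input size: the first summand
    covers the trials, the second the loops over elements, families and doublings, including the
    \<open>n + 1\<close> cells cleared in \<open>conflicts_com\<close>.\<close>
  define Nf where "Nf s = 128 * s * (3 * s + 1) + Suc s" for s :: nat
  define Bf where "Bf s = s + 2" for s :: nat
  define Vf where "Vf s = Bf s + growth (Nf s) (Bf s) ?P" for s
  have polyN: "polynomial Nf" unfolding Nf_def by (auto intro!: polynomial_add polynomial_mult polynomial_Suc)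
  have polyB: "polynomial Bf" unfolding Bf_def by (auto intro!: polynomial_Suc)
  have "polynomial (\<lambda>s. time (Nf s) (Vf s) ?P)"
    unfolding Vf_def by (intro polynomial_time polynomial_add polynomial_growth polyN polyB)
  then obtain q where q: "\<And>s. time (Nf s) (Vf s) ?P = poly q s" unfolding polynomial_def by blast
  show ?thesis
    unfolding poly_time_approximation_def Let_def
  proof (intro exI[of _ q] allI impI, elim conjE)
    fix kin kout I assume valid: "valid_numbers I" and C: "C kin kout I"
    obtain kv r where int: "interprets ein eout key kin kout I kv"
      and pre: "pre = Skip \<and> r = (\<lambda>_. 0) \<or> pre = classes_com \<and> r = snd (leaders (input_weight I) (univ_size I) (univ_size I))"
      and dc: "\<And>F. F \<in> set (outer_fams I) \<Longrightarrow> downward_closed (ground I) F"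
      and val: "\<And>\<pi>. feasible I \<pi> \<Longrightarrow> \<alpha> kin kout * policy_value I \<pi> \<le> plan_value I r (ranked kv (univ_size I))"
      using spec[OF valid C] by blast
    have spec': "aval ein m = of_nat (length (inner_fams I)) \<and> aval eout m = of_nat (length (outer_fams I)) \<and>
        aval (key i) m = kv (to_nat_idx (aval i m))"
      if "\<And>x. x \<in> inputs \<Longrightarrow> m x = mem (initial_state kin kout I) x" for m i
      using int that unfolding interprets_def by simp
    let ?s = "input_size kin kout I"
    let ?n = "univ_size I"
    let ?T = "poly q ?s"
    let ?t = "plan_tree (\<lambda>e. doublings (input_prob I e)) (trials I) ?n (inner_fams I) (outer_fams I) r (input_value I) (ranked kv ?n) ?n"
    let ?es = "map (ranked (input_weight I) ?n) [0..<?n]"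
    have size: "?n + length (inner_fams I) + length (outer_fams I) \<le> ?s" by (rule input_size_ge)
    have tr: "trials I \<le> Nf ?s"
    proof -
      have "trials I \<le> 128 * ?s * (3 * ?s + 1)" unfolding trials_def using size by (intro mult_mono) auto
      then show ?thesis unfolding Nf_def by simp
    qed
    have sN: "Suc ?s \<le> Nf ?s" unfolding Nf_def by simp
    have sampler: "probing_sampler I (Nf ?s) kin kout ein eout key kv"
    proof unfold_locales
      show "Suc ?n \<le> Nf ?s" "length (inner_fams I) \<le> Nf ?s" "length (outer_fams I) \<le> Nf ?s" using size sN by auto
      show "128 * ?n * (length (inner_fams I) + length (outer_fams I) + 3 * ?n + 1) \<le> Nf ?s" using tr unfolding trials_def .
      show "valid_numbers I" by (rule valid)
      fix e assume "e < ?n" "0 < act_prob I e"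
      then have "doublings (act_prob I e) \<le> ?s" using doublings_le_bits input_size_ge(5) order_trans by blast
      then show "doublings (act_prob I e) \<le> Nf ?s" using sN by simp
    qed (use spec' in blast)+
    have inj: "inj_on (ranked kv ?n) {..<?n}" using bij_rank[of kv ?n] unfolding bij_betw_def by simp
    have vpos: "rounded_prob I e = 1 / 2 ^ doublings (input_prob I e)" if "0 < input_value I e" for e
      using that by (auto simp: rounded_prob_def input_value_def)
    have tree_eq: "tree_pmf ?t = plan (trials I) ?n (inner_fams I) (outer_fams I) r (rounded_prob I) (input_value I) (ranked kv ?n) ?n"
      using dist_plan_tree[OF inj, of "input_value I" "rounded_prob I" "\<lambda>e. doublings (input_prob I e)"] vpos by blast
    have run: "\<exists>t s'. exec I X \<omega> ?P (initial_state kin kout I) t s' \<and> t \<le> ?T \<and> coins_used s' = snd (toss ?t \<omega> 0) \<and>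
        chosen s' = finish (inner_fams I) (snd (fst (toss ?t \<omega> 0))) X ?es" for X \<omega>
    proof -
      interpret probing_sampler I X \<omega> "Nf ?s" kin kout ein eout key kv by (rule sampler)
      have J: "J = (\<lambda>e. doublings (input_prob I e))" by (simp add: fun_eq_iff J_def)
      have wp: "wp ?P (\<lambda>s'. coins_used s' = snd (toss ?t \<omega> 0) \<and>
          chosen s' = finish (inner_fams I) (snd (fst (toss ?t \<omega> 0))) X ?es) (initial_state kin kout I)"
      proof (rule wp_program[of pre r, unfolded n_def Fs_def Os_def J])
        show "pre = Skip \<and> r = (\<lambda>_. 0) \<or> pre = classes_com \<and> r = snd (leaders (input_weight I) ?n ?n)" by (rule pre)
        fix \<sigma> F assume "\<sigma> \<in> set_pmf (tree_pmf ?t)" "snd \<sigma> \<noteq> {}" "F \<in> set (outer_fams I)"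
        then show "snd \<sigma> \<in> F" unfolding tree_eq using plan_outer[OF dc] by blast
      qed (rule dc)
      have "\<exists>t s'. exec I X \<omega> ?P (initial_state kin kout I) t s' \<and> t \<le> time (Nf ?s) (Vf ?s) ?P \<and>
        (coins_used s' = snd (toss ?t \<omega> 0) \<and> chosen s' = finish (inner_fams I) (snd (fst (toss ?t \<omega> 0))) X ?es) \<and>
        (\<forall>x i. small (Bf ?s + growth (Nf ?s) (Bf ?s) ?P) (mem s' x i)) \<and> (\<forall>x\<in>inputs. mem s' x = mem (initial_state kin kout I) x)"
        by (rule wp_exec[OF wp]) (use safe small_initial_state size sN in \<open>auto simp: Bf_def Vf_def\<close>)
      then show ?thesis unfolding q by blast
    qed
    have coins: "snd (toss ?t \<omega> 0) \<le> ?T" for \<omega>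
    proof -
      \<comment> \<open>The number of coins read does not depend on the activations, so a run with
        all elements inactive bounds it.\<close>
      obtain t s' where "exec I (\<lambda>_. False) \<omega> ?P (initial_state kin kout I) t s'" "t \<le> ?T" "coins_used s' = snd (toss ?t \<omega> 0)"
        using run by blast
      then show ?thesis using coins_used_le_cost[of I "\<lambda>_. False" \<omega> ?P "initial_state kin kout I" t s'] by (simp add: initial_state_def)
    qed
    let ?out = "\<lambda>X \<omega>. finish (inner_fams I) (snd (fst (toss ?t \<omega> 0))) X ?es"
    have "expected_reward ?T I ?out = plan_value I r (ranked kv ?n)"
      unfolding plan_value_def tree_eq[symmetric]
      by (rule expected_reward_toss[where h = "\<lambda>\<sigma> X. finish (inner_fams I) (snd \<sigma>) X ?es", OF coins])
    then show "\<exists>out. runs_within ?T ?P kin kout I out \<and> (\<forall>\<pi>. feasible I \<pi> \<longrightarrow> \<alpha> kin kout * policy_value I \<pi> \<le> expected_reward ?T I out)"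
      using run val unfolding runs_within_def by (intro exI[of _ ?out]) metis
  qed
qed

section \<open>The two approximation guarantees\<close>

lemma trials_ge:
  fixes C :: real
  assumes "C \<le> 4 * (length (inner_fams I) + length (outer_fams I) + 3 * univ_size I + 1)"
  shows "32 * univ_size I * C \<le> trials I"
proof -
  have "32 * univ_size I * C \<le> 32 * univ_size I * real (4 * (length (inner_fams I) + length (outer_fams I) + 3 * univ_size I + 1))"
    using assms by (intro mult_left_mono) auto
  also have "\<dots> = real (trials I)" by (simp add: trials_def algebra_simps)
  finally show ?thesis .
qed

lemma (in planner) plan_value_eq:
  assumes n: "n = univ_size I" and fams: "Fs = inner_fams I" "Os = outer_fams I" and M: "M = trials I" and r: "\<And>t. chain t = plan M n Fs Os r' p' v ord t"
    and p: "p = (\<lambda>e. real_of_rat (input_prob I e))" "p' = rounded_prob I" and w: "w = (\<lambda>e. real_of_rat (input_weight I e))"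
  shows "plan_value I r' ord = measure_pmf.expectation (chain n) (\<lambda>\<sigma>. reward_of (map (ranked (input_weight I) n) [0..<n]) (snd \<sigma>))"
proof -
  have v: "v = (\<lambda>e. real_of_rat (input_value I e))"
  proof
    fix e
    have "p e = real_of_rat (input_prob I e)" "w e = real_of_rat (input_weight I e)" by (simp_all only: p(1) w)
    then show "v e = real_of_rat (input_value I e)" by (simp add: v_def input_value_def of_rat_mult)
  qed
  have "reward_of (map (ranked (input_weight I) n) [0..<n]) Q =
      measure_pmf.expectation (activation I) (\<lambda>X. reward I (finish (inner_fams I) Q X (map (ranked (input_weight I) n) [0..<n])))" for Q
    by (rule reward_of_eq[OF n fams(1)]) (use rank_list(2)[of "input_weight I" n] n in \<open>auto simp: p w input_prob_def input_weight_def\<close>)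
  moreover have "chain n = plan (trials I) n Fs Os r' (rounded_prob I) (input_value I) ord n"
    unfolding r unfolding v plan_of_rat by (simp only: M p(2))
  ultimately show ?thesis unfolding plan_value_def by (simp add: n fams)
qed

lemma (in planner) policy_value_sum:
  assumes "valid_numbers I" "n = univ_size I" "feasible I \<pi>"
    and "p = (\<lambda>e. real_of_rat (input_prob I e))" "w = (\<lambda>e. real_of_rat (input_weight I e))"
  shows "policy_value I \<pi> = (\<Sum>e<n. probe_prob I \<pi> e * v e)"
  unfolding policy_value_eq[OF assms(1,3)] assms(2)
proof (rule sum.cong)
  fix e assume e: "e \<in> ground I"
  have "p e = real_of_rat (input_prob I e)" "w e = real_of_rat (input_weight I e)" by (simp_all only: assms(4,5))
  then show "probe_prob I \<pi> e * (real_of_rat (act_prob I e) * real_of_rat (weight I e)) = probe_prob I \<pi> e * v e"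
    using e by (simp add: v_def input_prob_def input_weight_def)
qed simp

lemma policy_value_empty: "valid_numbers I \<Longrightarrow> univ_size I = 0 \<Longrightarrow> feasible I \<pi> \<Longrightarrow> policy_value I \<pi> = 0"
  by (simp add: policy_value_eq)

lemma inverse_scale_le:
  fixes c K p V :: real
  assumes "p \<le> c * K * V" "0 < c" "0 < K"
  shows "1 / c / K * p \<le> V"
  using assms by (simp add: field_simps)

text \<open>From \<open>C = 4 * kin + 2 * kout + 1 \<le> 5 * (kin + kout)\<close> the constant is
  \<open>16 * 5 = 80\<close>.\<close>

lemma matroid_plan_value:
  assumes valid: "valid_numbers I" and m: "matroid_intersections kin kout I" and \<pi>: "feasible I \<pi>"
  shows "1 / 80 / real (kin + kout) * policy_value I \<pi> \<le> plan_value I (\<lambda>_. 0) (ranked (input_weight I) (univ_size I))"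
proof (cases "kin + kout = 0 \<or> univ_size I = 0")
  \<comment> \<open>For \<open>kin + kout = 0\<close> the claimed ratio is a division by 0 and hence
    0. For an empty universe there are no trials, and the policy value is 0.\<close>
  case True
  then have zero: "1 / 80 / real (kin + kout) * policy_value I \<pi> = 0" using policy_value_empty[OF valid _ \<pi>] by auto
  show ?thesis unfolding zero by (rule plan_value_nonneg[OF valid])
next
  case False
  let ?n = "univ_size I"
  let ?p = "\<lambda>e. real_of_rat (input_prob I e)" and ?w = "\<lambda>e. real_of_rat (input_weight I e)" and ?ord = "ranked (input_weight I) ?n"
  have len: "length (inner_fams I) = kin" "length (outer_fams I) = kout"
    and mat: "\<And>F. F \<in> set (inner_fams I) \<union> set (outer_fams I) \<Longrightarrow> matroid {..<?n} F"
    using m unfolding matroid_intersections_def by auto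
  interpret matroid_planner "trials I" ?n "inner_fams I" "outer_fams I" "\<lambda>_. 0 :: rat" ?p "rounded_prob I" ?w ?ord 1 1 1
  proof unfold_locales
    show "bij_betw ?ord {..<?n} {..<?n}" by (rule bij_rank)
    show "?w (?ord t) \<le> 1 * ?w (?ord s)" if "s < t" "t < ?n" for s t
      using rank_desc[OF that, of "input_weight I"] by (simp add: of_rat_less_eq)
    show "0 < trials I" using False by (simp add: trials_def)
  qed (use rounded_prob[OF valid] valid mat in \<open>auto simp: input_weight_def input_prob_def valid_numbers_def intro!: matroid_dc(1,3)[OF mat] matroid_blocking_bound[OF mat, simplified]\<close>)
  let ?C = "4 * real kin + 2 * real kout + 1" and ?V = "plan_value I (\<lambda>_. 0) ?ord"
  have V: "?V = measure_pmf.expectation (chain ?n) (\<lambda>\<sigma>. reward_of (map ?ord [0..<?n]) (snd \<sigma>))"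
    by (rule plan_value_eq) simp_all
  have lp: "lp (probe_prob I \<pi>)" by (rule lp_probe_prob[OF valid _ _ _ _ \<pi>]) (simp_all add: input_prob_def)
  have "policy_value I \<pi> = (\<Sum>e<?n. probe_prob I \<pi> e * v e)"
    by (rule policy_value_sum[OF valid _ \<pi>]) simp_all
  also have "\<dots> \<le> 16 * ?C * ?V"
    unfolding V
  proof (rule matroid_guarantee[OF lp])
    show "32 * ?n * ?C \<le> trials I" by (rule trials_ge) (simp add: len)
  qed (simp add: len)
  also have "\<dots> \<le> 80 * real (kin + kout) * ?V"
  proof (rule mult_right_mono)
    have "1 \<le> real (kin + kout)" using False by linarith
    then show "16 * ?C \<le> 80 * real (kin + kout)" by simp
  qed (rule plan_value_nonneg[OF valid])
  finally show ?thesis by (rule inverse_scale_le) (use False in auto)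
qed

text \<open>A downward-closed family without the empty set is empty, so no probe is ever
  allowed.\<close>

lemma infeasible_policy_value:
  assumes F: "F \<in> set (inner_fams I) \<union> set (outer_fams I)" "downward_closed (ground I) F" "{} \<notin> F" and \<pi>: "feasible I \<pi>"
  shows "policy_value I \<pi> = 0"
proof -
  have "insert e S \<notin> F" for e S using downward_closedD[OF F(2), of "insert e S" "{}"] F(3) by auto
  then have "\<not> may_probe I Q S e" for Q S e
    using F(1) unfolding may_probe_def inner_constraint_def outer_constraint_def by blast
  then have "\<pi> = Stop" using \<pi> unfolding feasible_def by (cases \<pi>) auto
  then show ?thesis by (simp add: policy_value_def reward_def)
qed

text \<open>If \<open>Z\<close> is not empty, \<open>card B \<le> n\<close> gives the bound with
  \<open>n\<close>; otherwise the bound with \<open>k\<close> says that \<open>B\<close> is empty.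
  The cut-off keeps the number of trials polynomial, as \<open>k\<close> may be exponential in its
  bit length.\<close>

lemma blocking_bound_min:
  assumes "blocking_bound k F" "downward_closed {..<n} F"
  shows "blocking_bound (min k n) F"
  unfolding blocking_bound_def
proof (intro ballI impI)
  fix Z B assume *: "Z \<in> F" "B \<in> F" "\<forall>f\<in>B - Z. insert f Z \<notin> F"
  then have le: "card B \<le> k * card Z" using assms(1) unfolding blocking_bound_def by blast
  have "Z \<subseteq> {..<n}" "B \<subseteq> {..<n}" using * assms(2) unfolding downward_closed_def by auto
  then have "card B \<le> n" by (metis card_lessThan card_mono finite_lessThan)
  show "card B \<le> min k n * card Z"
  proof (cases "card Z = 0")
    case False
    then have "n \<le> n * card Z" by simp
    with \<open>card B \<le> n\<close> have "card B \<le> n * card Z" by (rule order_trans)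
    then show ?thesis using le by (simp add: min_def)
  qed (use le in simp)
qed

text \<open>The constant is \<open>16 * 9 * 4 = 576\<close>:
  \<open>C \<le> 9 * (kin + kout)\<close>, and comparing the two greedy sets costs
  \<open>4 * \<kappa>\<close>.\<close>

lemma system_plan_value:
  assumes valid: "valid_numbers I" and ks: "k_systems kin kout I" and \<pi>: "feasible I \<pi>"
  shows "1 / 576 / real (kin + kout) ^ 2 * policy_value I \<pi> \<le>
    plan_value I (snd (leaders (input_weight I) (univ_size I) (univ_size I))) (ranked (input_value I) (univ_size I))"
proof -
  obtain Fi Fo where fams: "inner_fams I = [Fi]" "outer_fams I = [Fo]"
    and k: "k_system (ground I) kin Fi" "k_system (ground I) kout Fo" using ks unfolding k_systems_def by blast
  have dc: "downward_closed (ground I) Fi" "downward_closed (ground I) Fo" and kin1: "1 \<le> kin" using k unfolding k_system_def by auto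
  let ?n = "univ_size I"
  let ?p = "\<lambda>e. real_of_rat (input_prob I e)" and ?w = "\<lambda>e. real_of_rat (input_weight I e)" and ?ord = "ranked (input_value I) ?n"
  let ?rq = "snd (leaders (input_weight I) ?n ?n)"
  let ?r = "\<lambda>e. real_of_rat (?rq e)" and ?V = "plan_value I ?rq ?ord"
  show ?thesis
  proof (cases "?n = 0 \<or> {} \<notin> Fi \<or> {} \<notin> Fo")
    \<comment> \<open>These cases are outside the locale, which needs a positive number of trials
      and the empty set in both families.\<close>
    case True
    then have "policy_value I \<pi> = 0"
      using policy_value_empty[OF valid _ \<pi>] infeasible_policy_value[of Fi I \<pi>] infeasible_policy_value[of Fo I \<pi>] dc fams \<pi> by auto
    then show ?thesis using plan_value_nonneg[OF valid] by simp
  next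
    case False
    let ?\<kappa> = "min kin ?n" and ?\<kappa>' = "min kout ?n" and ?es = "map (ranked (input_weight I) ?n) [0..<?n]"
    have wn: "0 \<le> input_weight I e" if "e < ?n" for e using valid that by (auto simp: input_weight_def valid_numbers_def)
    have pk: "picked (input_weight I) ?n ?n = {..<?n}" using bij_rank[of "input_weight I" ?n] by (simp add: picked_eq bij_betw_def)
    have lead: "\<And>e. e < ?n \<Longrightarrow> input_weight I e \<le> ?rq e" "\<And>e. e < ?n \<Longrightarrow> ?rq e \<le> 2 * input_weight I e"
      "\<And>e f. e < ?n \<Longrightarrow> f < ?n \<Longrightarrow> ?rq e < ?rq f \<Longrightarrow> 2 * ?rq e \<le> ?rq f"
      using leaders_props[of ?n "input_weight I" ?n] wn unfolding pk by auto
    have two: "real_of_rat (2 * x) = 2 * real_of_rat x" for x by (simp add: of_rat_mult)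
    have r: "?w e \<le> ?r e" "?r e \<le> 2 * ?w e" if "e < ?n" for e
      using lead(1,2)[OF that] by (simp_all only: two[symmetric] of_rat_less_eq)
    have r3: "2 * ?r e \<le> ?r f" if "e < ?n" "f < ?n" "?r e < ?r f" for e f
      using lead(3)[OF that(1,2)] that(3) by (simp only: two[symmetric] of_rat_less_eq of_rat_less)
    have val: "?p e * ?w e = real_of_rat (input_value I e)" for e by (simp add: input_value_def of_rat_mult)
    have bij: "bij_betw ?ord {..<?n} {..<?n}" by (rule bij_rank)
    interpret system_planner "trials I" ?n Fi Fo ?r ?p "rounded_prob I" ?w ?ord ?\<kappa> ?\<kappa>' ?es
    proof unfold_locales
      show "bij_betw ?ord {..<?n} {..<?n}" by (rule bij)
      show "0 < trials I" using False by (simp add: trials_def)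
      show "?w (?ord t) \<le> 2 * ?w (?ord s)" if "s < t" "t < ?n" "?r (?ord s) = ?r (?ord t)" for s t
      proof -
        have "?ord s < ?n" "?ord t < ?n" using that rank_props(1) by auto
        \<comment> \<open>Both weights lie between half the common class value and that value, hence
          \<open>D = 2\<close>.\<close>
        then show ?thesis using r(1)[of "?ord t"] r(2)[of "?ord s"] that(3) by linarith
      qed
      show "?p (?ord t) * ?w (?ord t) \<le> ?p (?ord s) * ?w (?ord s)" if "s < t" "t < ?n" for s t
        unfolding val of_rat_less_eq using that by (rule rank_desc)
      show "distinct ?es" "set ?es = {..<?n}" by (rule rank_list)+
      show "sorted_wrt (\<lambda>e f. ?w f \<le> ?w e) ?es" using rank_list(3)[of "input_weight I" ?n] by (simp only: of_rat_less_eq)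
      show "?w e \<le> ?r e" "?r e \<le> 2 * ?w e" if "e < ?n" for e using r[OF that] .
      show "2 * ?r e \<le> ?r f" if "e < ?n" "f < ?n" "?r e < ?r f" for e f using r3[OF that] .
      show "blocking_bound ?\<kappa> F" if "F \<in> set [Fi]" for F
        using that dc k_system_blocking_bound[OF k(1)] by (auto intro: blocking_bound_min)
      show "blocking_bound ?\<kappa>' F" if "F \<in> set [Fo]" for F
        using that dc k_system_blocking_bound[OF k(2)] by (auto intro: blocking_bound_min)
    qed (use rounded_prob[OF valid] valid dc False in \<open>auto simp: input_weight_def input_prob_def valid_numbers_def\<close>)
    let ?C = "8 * real ?\<kappa> + real ?\<kappa>' + 1"
    have V: "?V = measure_pmf.expectation (chain ?n) (\<lambda>\<sigma>. reward_of ?es (snd \<sigma>))"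
      by (rule plan_value_eq) (simp_all add: fams plan_class_of_rat)
    have lp: "lp (probe_prob I \<pi>)" by (rule lp_probe_prob[OF valid _ _ _ _ \<pi>]) (simp_all add: input_prob_def fams)
    have "policy_value I \<pi> = (\<Sum>e<?n. probe_prob I \<pi> e * v e)"
      by (rule policy_value_sum[OF valid _ \<pi>]) simp_all
    also have "\<dots> \<le> 16 * ?C * (4 * ?\<kappa>) * ?V"
      unfolding V
    proof (rule system_guarantee[OF lp])
      show "32 * ?n * ?C \<le> trials I" by (rule trials_ge) (auto simp: fams min_def)
    qed simp
    also have "\<dots> \<le> 576 * real (kin + kout) ^ 2 * ?V"
    proof (rule mult_right_mono)
      have k0: "real ?\<kappa> \<le> real (kin + kout)" by simp
      have "?C \<le> 9 * real (kin + kout)" using kin1 by (simp add: min_def)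
      then have "16 * ?C * (4 * ?\<kappa>) \<le> 16 * (9 * real (kin + kout)) * (4 * real (kin + kout))"
        using k0 by (intro mult_mono) auto
      also have "\<dots> = 576 * real (kin + kout) ^ 2" by (simp add: power2_eq_square algebra_simps)
      finally show "16 * ?C * (4 * ?\<kappa>) \<le> 576 * real (kin + kout) ^ 2" .
    qed (rule plan_value_nonneg[OF valid])
    finally show ?thesis by (rule inverse_scale_le) (use kin1 in auto)
  qed
qed

theorem theorem2:
  shows "(\<exists>c::real>0. \<exists>P. poly_time_approximation P matroid_intersections
            (\<lambda>kin kout. c / real (kin + kout))) \<and>
         (\<exists>c::real>0. \<exists>P. poly_time_approximation P k_systems
            (\<lambda>kin kout. c / real (kin + kout) ^ 2))"
proof
  have "poly_time_approximation (program Skip weight_exp (var ''kin'') (var ''kout'')) matroid_intersections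
      (\<lambda>kin kout. 1 / 80 / real (kin + kout))"
  proof (rule poly_time_program)
    show "safe (program Skip weight_exp (var ''kin'') (var ''kout''))" by (simp add: program_defs Let_def)
    fix kin kout I assume valid: "valid_numbers I" and m: "matroid_intersections kin kout I"
    have "interprets (var ''kin'') (var ''kout'') weight_exp kin kout I (input_weight I)"
      using m unfolding interprets_def matroid_intersections_def
      by (auto simp: initial_state_def weight_exp_def input_weight_def)
    moreover have "\<forall>F\<in>set (outer_fams I). downward_closed (ground I) F"
      using m matroid_dc(1) unfolding matroid_intersections_def by blast
    ultimately show "\<exists>kv r. interprets (var ''kin'') (var ''kout'') weight_exp kin kout I kv \<and>
        (Skip = Skip \<and> r = (\<lambda>_. 0) \<or> Skip = classes_com \<and> r = snd (leaders (input_weight I) (univ_size I) (univ_size I))) \<and>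
        (\<forall>F\<in>set (outer_fams I). downward_closed (ground I) F) \<and>
        (\<forall>\<pi>. feasible I \<pi> \<longrightarrow> 1 / 80 / real (kin + kout) * policy_value I \<pi> \<le> plan_value I r (ranked kv (univ_size I)))"
      using matroid_plan_value[OF valid m] by (intro exI[of _ "input_weight I"] exI[of _ "\<lambda>_. 0"]) simp
  qed
  then show "\<exists>c::real>0. \<exists>P. poly_time_approximation P matroid_intersections (\<lambda>kin kout. c / real (kin + kout))"
    by (intro exI[of _ "1 / 80"]) auto
next
  \<comment> \<open>Each side has a single oracle here, so the numbers of families are the constant
    1 and not \<open>kin\<close> and \<open>kout\<close>.\<close>
  have "poly_time_approximation (program classes_com value_exp (Num 1) (Num 1)) k_systems
      (\<lambda>kin kout. 1 / 576 / real (kin + kout) ^ 2)"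
  proof (rule poly_time_program)
    show "safe (program classes_com value_exp (Num 1) (Num 1))" by (simp add: program_defs Let_def)
    fix kin kout I assume valid: "valid_numbers I" and k: "k_systems kin kout I"
    have "interprets (Num 1) (Num 1) value_exp kin kout I (input_value I)"
      using k unfolding interprets_def k_systems_def
      by (auto simp: initial_state_def value_exp_def input_value_def input_weight_def input_prob_def)
    moreover have "\<forall>F\<in>set (outer_fams I). downward_closed (ground I) F"
      using k unfolding k_systems_def k_system_def by auto
    ultimately show "\<exists>kv r. interprets (Num 1) (Num 1) value_exp kin kout I kv \<and>
        (classes_com = Skip \<and> r = (\<lambda>_. 0) \<or> classes_com = classes_com \<and> r = snd (leaders (input_weight I) (univ_size I) (univ_size I))) \<and>
        (\<forall>F\<in>set (outer_fams I). downward_closed (ground I) F) \<and>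
        (\<forall>\<pi>. feasible I \<pi> \<longrightarrow> 1 / 576 / real (kin + kout) ^ 2 * policy_value I \<pi> \<le> plan_value I r (ranked kv (univ_size I)))"
      using system_plan_value[OF valid k]
      by (intro exI[of _ "input_value I"] exI[of _ "snd (leaders (input_weight I) (univ_size I) (univ_size I))"]) simp
  qed
  then show "\<exists>c::real>0. \<exists>P. poly_time_approximation P k_systems (\<lambda>kin kout. c / real (kin + kout) ^ 2)"
    by (intro exI[of _ "1 / 576"]) auto
qed

end
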